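(* Let $\alpha\in(0,2)$ and $a,b\in(0,\infty]$, suppose $X_{12}\in\mathcal S_\alpha(a)$ and $X_{11}\in\mathcal S_\alpha(b)$, and let $X=X(n)$ be the associated Wigner matrices. Let $C=C(n)$ be the $n\times n$ Hermitian matrix $$C_{ij}=\mathbf 1_{\{\varepsilon(n)n^{1/2}<|X_{ij}|<\varepsilon(n)^{-1}n^{1/2}\}}\frac{X_{ij}}{\sqrt n},\qquad \varepsilon(n)=\frac1{\log n}.$$ Then the random probability measures $\mu_{\mathrm{sc}}\boxplus\mu_C$ and $\mu_{X/\sqrt n}$ are exponentially equivalent: for any $\delta>0$, $$\limsup_{n\to\infty}\frac1{n^{1+\alpha/2}}\log\mathbb P\big(d(\mu_{X/\sqrt n},\mu_{\mathrm{sc}}\boxplus\mu_C)\ge\delta\big)=-\infty.$$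
   Context: For a Hermitian $n\times n$ matrix $A$, $\mu_A=\frac1n\sum_k\delta_{\lambda_k(A)}$ is its empirical spectral measure. $\mu_{\mathrm{sc}}$ is the semicircle law with density $\frac1{2\pi}\sqrt{4-x^2}$ on $[-2,2]$; $\boxplus$ is free additive convolution. For $\mu,\nu\in\mathcal P(\mathbb R)$, $d(\mu,\nu)=\sup\{|g_\mu(z)-g_\nu(z)|:\Im z\ge2\}$, where $g_\mu(z)=\int\frac{\mu(dx)}{x-z}$. Class $\mathcal S_\alpha(a)$: for $0<a<\infty$, a complex random variable $Y$ belongs to $\mathcal S_\alpha(a)$ if $\lim_{t\to\infty}-t^{-\alpha}\log\mathbb P(|Y|\ge t)=a$ and there exist $t_0>0$ and a probability measure $\vartheta$ on the unit circle $\mathbb S^1$ such that for all $t\ge t_0$ and measurable $U\subset\mathbb S^1$, $\mathbb P(Y/|Y|\in U,|Y|\ge t)=\vartheta(U)\mathbb P(|Y|\ge t)$. For $a=\infty$, $Y\in\mathcal S_\alpha(\infty)$ means only that $\lim_{t\to\infty}-t^{-\alpha}\log\mathbb P(|Y|\ge t)=\infty$. Wigner matrix: $(X_{ij})_{1\le i<j}$ are i.i.d. complex random variables with $\mathbb E|X_{12}-\mathbb EX_{12}|^2=1$; $(X_{ii})_{i\ge1}$ is an independent family of i.i.d. real random variables; $X_{ij}=\overline{X_{ji}}$ for $j<i$; $X(n)=(X_{ij})_{1\le i,j\le n}$. Convention $\log0=-\infty$. *)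

theory Defs
  imports
    "HOL-Probability.Probability"
    "HOL-Computational_Algebra.Polynomial"
    "Jordan_Normal_Form.Char_Poly"
begin

text \<open>The logarithm of a probability, with the convention \<open>log 0 = - \<infinity>\<close> (whereas \<open>ln 0 = 0\<close>).\<close>

definition elog :: "real \<Rightarrow> ereal" where
  "elog p = (if p = 0 then - \<infinity> else ereal (ln p))"


text \<open>
  The class \<open>S\<^sub>\<alpha>(a)\<close>, for \<open>a \<in> (0, \<infinity>]\<close>. The condition on the argument of \<open>Y\<close> is imposed only if
  \<open>a\<close> is finite.
\<close>

definition tail_class :: "'w measure \<Rightarrow> real \<Rightarrow> ereal \<Rightarrow> ('w \<Rightarrow> complex) \<Rightarrow> bool" where
  "tail_class M \<alpha> a Y \<longleftrightarrow>
     Y \<in> borel_measurable M \<and>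
     ((\<lambda>t. - ereal (t powr (- \<alpha>)) * elog (measure M {\<omega> \<in> space M. t \<le> cmod (Y \<omega>)}))
        \<longlongrightarrow> a) at_top \<and>
     (a \<noteq> \<infinity> \<longrightarrow>
       (\<exists>t\<^sub>0 > 0. \<exists>\<theta> :: complex measure.
          prob_space \<theta> \<and> sets \<theta> = sets (restrict_space borel (sphere 0 1)) \<and>
          (\<forall>t \<ge> t\<^sub>0. \<forall>U \<in> sets \<theta>.
             measure M {\<omega> \<in> space M. Y \<omega> / of_real (cmod (Y \<omega>)) \<in> U \<and> t \<le> cmod (Y \<omega>)} =
             measure \<theta> U * measure M {\<omega> \<in> space M. t \<le> cmod (Y \<omega>)})))"


text \<open>
  The entries are indexed by \<open>i, j \<ge> 1\<close>. The diagonal entries are real random variables, regarded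
  as complex-valued. In \<open>variance\<close>, a non-integrable integrand would have integral \<open>0\<close>, so
  square-integrability of \<open>X 1 2\<close> is implied.
\<close>

locale wigner_entries = prob_space M for M :: "'w measure" +
  fixes X :: "nat \<Rightarrow> nat \<Rightarrow> 'w \<Rightarrow> complex"
  assumes indep: "indep_vars (\<lambda>_. borel) (\<lambda>(i, j). X i j) {(i, j). 1 \<le> i \<and> i \<le> j}"
    and ident_offdiag: "1 \<le> i \<Longrightarrow> i < j \<Longrightarrow> distr M borel (X i j) = distr M borel (X 1 2)"
    and ident_diag: "1 \<le> i \<Longrightarrow> distr M borel (X i i) = distr M borel (X 1 1)"
    and real_diag: "1 \<le> i \<Longrightarrow> \<omega> \<in> space M \<Longrightarrow> X i i \<omega> \<in> \<real>"
    and hermitian: "1 \<le> j \<Longrightarrow> j < i \<Longrightarrow> \<omega> \<in> space M \<Longrightarrow> X i j \<omega> = cnj (X j i \<omega>)"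
    and variance: "expectation (\<lambda>\<omega>. (cmod (X 1 2 \<omega> - expectation (X 1 2)))\<^sup>2) = 1"

text \<open>Rows and columns of \<open>complex mat\<close> are numbered from \<open>0\<close>, hence the shift.\<close>

definition wigner_scaled :: "(nat \<Rightarrow> nat \<Rightarrow> 'w \<Rightarrow> complex) \<Rightarrow> nat \<Rightarrow> 'w \<Rightarrow> complex mat" where
  "wigner_scaled X n \<omega> =
     Matrix.mat n n (\<lambda>(i, j). X (Suc i) (Suc j) \<omega> / of_real (sqrt (real n)))"

definition eps :: "nat \<Rightarrow> real" where
  "eps n = 1 / ln (real n)"

definition wigner_C :: "(nat \<Rightarrow> nat \<Rightarrow> 'w \<Rightarrow> complex) \<Rightarrow> nat \<Rightarrow> 'w \<Rightarrow> complex mat" where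
  "wigner_C X n \<omega> = Matrix.mat n n (\<lambda>(i, j). let x = X (Suc i) (Suc j) \<omega> in
     if eps n * sqrt (real n) < cmod x \<and> cmod x < inverse (eps n) * sqrt (real n)
     then x / of_real (sqrt (real n)) else 0)"


text \<open>
  The complex roots of the characteristic polynomial of an \<open>n \<times> n\<close> matrix form a multiset of
  size \<open>n\<close>, from which we sample uniformly. For Hermitian matrices they are real, so that \<open>Re\<close> only
  changes the type. The value for \<open>n = 0\<close> is arbitrary.
\<close>

definition spectral_measure :: "complex mat \<Rightarrow> real measure" where
  "spectral_measure A =
     distr (measure_pmf (pmf_of_multiset (proots (char_poly A)))) borel Re"

definition semicircle :: "real measure" where
  "semicircle = density lborel
     (\<lambda>x. ennreal (indicator {-2..2} x * (1 / (2 * pi) * sqrt (4 - x\<^sup>2))))"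


text \<open>
  A state on the free algebra \<open>\<complex>\<langle>x, y\<rangle>\<close> is given by its values on words, where \<open>False\<close> stands
  for \<open>x\<close> and \<open>True\<close> for \<open>y\<close>. For a list \<open>[(i\<^sub>1, p\<^sub>1), \<dots>, (i\<^sub>m, p\<^sub>m)]\<close> of letters and univariate
  polynomials, \<open>poly_moment \<tau>\<close> is the value at \<open>p\<^sub>1(i\<^sub>1) \<cdots> p\<^sub>m(i\<^sub>m)\<close> of the linear extension of \<open>\<tau>\<close>.
\<close>

fun poly_moment :: "(bool list \<Rightarrow> complex) \<Rightarrow> (bool \<times> complex poly) list \<Rightarrow> complex" where
  "poly_moment \<tau> [] = \<tau> []"
| "poly_moment \<tau> ((i, p) # ps) =
     (\<Sum>k\<le>degree p. poly.coeff p k * poly_moment (\<lambda>w. \<tau> (replicate k i @ w)) ps)"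

text \<open>
  Free independence of \<open>x\<close> and \<open>y\<close> under a unital functional: alternating products of centred
  elements of the algebras generated by \<open>x\<close> and by \<open>y\<close> are centred.
\<close>

definition free_pair :: "(bool list \<Rightarrow> complex) \<Rightarrow> bool" where
  "free_pair \<tau> \<longleftrightarrow> \<tau> [] = 1 \<and>
     (\<forall>ps. ps \<noteq> [] \<and> distinct_adj (map fst ps) \<and> (\<forall>q \<in> set ps. poly_moment \<tau> [q] = 0)
        \<longrightarrow> poly_moment \<tau> ps = 0)"

text \<open>
  For compactly supported probability measures \<open>\<mu>\<close> and \<open>\<nu>\<close> on the line, \<open>\<mu> \<boxplus> \<nu>\<close> is the
  distribution of \<open>x + y\<close> for free \<open>x\<close> and \<open>y\<close> with distributions \<open>\<mu>\<close> and \<open>\<nu>\<close>: the compactly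
  supported probability measure whose moments are those of \<open>x + y\<close>. Its value is meaningless if
  \<open>\<mu>\<close> or \<open>\<nu>\<close> is not compactly supported.
\<close>

definition free_conv :: "real measure \<Rightarrow> real measure \<Rightarrow> real measure" (infixl "\<boxplus>" 65) where
  "\<mu> \<boxplus> \<nu> = (THE \<rho>. prob_space \<rho> \<and> sets \<rho> = sets borel \<and> (\<exists>r. AE s in \<rho>. \<bar>s\<bar> \<le> r) \<and>
     (\<exists>\<tau>. free_pair \<tau> \<and>
        (\<forall>k. \<tau> (replicate k False) = of_real (\<integral>s. s ^ k \<partial>\<mu>)) \<and>
        (\<forall>k. \<tau> (replicate k True) = of_real (\<integral>s. s ^ k \<partial>\<nu>)) \<and>
        (\<forall>k. of_real (\<integral>s. s ^ k \<partial>\<rho>) = (\<Sum>w | length w = k. \<tau> w))))"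


definition stieltjes :: "real measure \<Rightarrow> complex \<Rightarrow> complex" where
  "stieltjes \<mu> z = (\<integral>x. 1 / (of_real x - z) \<partial>\<mu>)"

definition stieltjes_dist :: "real measure \<Rightarrow> real measure \<Rightarrow> real" where
  "stieltjes_dist \<mu> \<nu> = (SUP z \<in> {z. 2 \<le> Im z}. cmod (stieltjes \<mu> z - stieltjes \<nu> z))"

end

theory Submission
  imports Defs "HOL-Complex_Analysis.Complex_Analysis" "HOL-Real_Asymp.Real_Asymp"
    "Jordan_Normal_Form.Schur_Decomposition"
begin

text \<open>
  Write \<open>g\<^sub>H\<close> for the normalised trace of the resolvent \<open>(H - z)\<inverse>\<close>. Freeness of the semicircle law from
  \<open>\<mu>\<^sub>C\<close> says that \<open>s = g\<close> of \<open>\<mu>\<^sub>s\<^sub>c \<boxplus> \<mu>\<^sub>C\<close> solves Pastur's fixed point equation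
  \<open>s(z) = g\<^sub>C(z + s(z))\<close>, a contraction for \<open>Im z \<ge> 2\<close>. It therefore suffices to bound the defect
  \<open>g\<^sub>C(z + g) - g\<close> of \<open>g = g\<^bsub>A + C\<^esub>(z)\<close>, where \<open>A\<close> consists of the recentred entries of modulus at most
  \<open>(log n)\<^bsup>2/\<alpha>\<^esup>\<close>. Resampling one entry of \<open>A\<close> at a time (the method of exchangeable pairs) gives an
  exponential moment of the defect at the parameter \<open>n\<^bsup>1 + \<alpha>/2\<^esup> log n\<close>, which is admissible because the
  entries of \<open>A\<close> are tiny; this is uniform in \<open>C\<close>. A net in \<open>z\<close> of polynomial size makes the bound uniform.
  The remaining entries, their mean, and the diagonal change \<open>g\<close> by a Hilbert-Schmidt or rank estimate
  which is controlled by the sum of \<open>|X\<^sub>i\<^sub>j|\<^sup>\<alpha>\<close> over the entries above the truncation level, and the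
  exponential moments of \<open>|X\<^sub>i\<^sub>j|\<^sup>\<alpha>\<close> turn this into Chernoff's bound.
\<close>



section \<open>Resolvents of Hermitian matrices\<close>

text \<open>All parameters follow from the speed \<open>n^(1 + \<alpha>/2)\<close>. The truncation
  level \<open>K\<close> satisfies \<open>K^\<alpha> = (log n)^2\<close>, so
  \<open>n^2 exp(- c K^\<alpha>)\<close> tends to 0 and the exponential moment of the large entries
  costs nothing, although there are about \<open>n^2\<close> entries. Powers of \<open>K\<close> are
  still only powers of \<open>log n\<close>, so concentration tolerates parameters up to
  \<open>n^2\<close> over a power of \<open>log n\<close>, beyond the speed because \<alpha> < 2.
  The budget \<open>W = n^(1 + \<alpha>/2) (log n)^\<beta>\<close> for the large entries exceeds
  every multiple of the speed, while \<beta> < min(\<alpha>, 2 - \<alpha>) lets the rank and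
  Hilbert-Schmidt errors vanish. Exchangeable pairs bound the defect itself and not its deviation
  from a mean, so no expectation has to be computed. An entry is resampled only between two small
  values; this leaves \<open>C\<close> fixed and takes the place of conditioning on
  \<open>C\<close>. Free convolution is a definite description, so the measure must be shown to
  exist and to be unique. Existence comes from a Fock model and Hausdorff's moment problem,
  uniqueness from the fact that freeness determines all mixed moments.\<close>

text \<open>An \<open>n \<times> n\<close> matrix is a function on pairs of naturals of which only the indices below \<open>n\<close> matter.\<close>

definition herm :: "nat \<Rightarrow> (nat \<Rightarrow> nat \<Rightarrow> complex) \<Rightarrow> bool" where
  "herm n H \<longleftrightarrow> (\<forall>i<n. \<forall>j<n. H j i = cnj (H i j))"

definition shift :: "(nat \<Rightarrow> nat \<Rightarrow> complex) \<Rightarrow> complex \<Rightarrow> nat \<Rightarrow> nat \<Rightarrow> complex" where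
  "shift H z i j = H i j - (if i = j then z else 0)"

text \<open>Cramer's rule makes the resolvent a total function of the entries and a quotient of
  determinants, from which measurability is read off.\<close>

definition res :: "nat \<Rightarrow> (nat \<Rightarrow> nat \<Rightarrow> complex) \<Rightarrow> complex \<Rightarrow> nat \<Rightarrow> nat \<Rightarrow> complex" where
  "res n H z i j = (let A = Matrix.mat n n (\<lambda>(i, j). shift H z i j) in cofactor A j i / Determinant.det A)"

definition gres :: "nat \<Rightarrow> (nat \<Rightarrow> nat \<Rightarrow> complex) \<Rightarrow> complex \<Rightarrow> complex" where
  "gres n H z = (\<Sum>i<n. res n H z i i) / of_nat n"

definition mv :: "nat \<Rightarrow> (nat \<Rightarrow> nat \<Rightarrow> complex) \<Rightarrow> (nat \<Rightarrow> complex) \<Rightarrow> nat \<Rightarrow> complex" where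
  "mv n A v i = (\<Sum>k<n. A i k * v k)"

definition mm :: "nat \<Rightarrow> (nat \<Rightarrow> nat \<Rightarrow> complex) \<Rightarrow> (nat \<Rightarrow> nat \<Rightarrow> complex) \<Rightarrow> nat \<Rightarrow> nat \<Rightarrow> complex" where
  "mm n A B i j = (\<Sum>k<n. A i k * B k j)"

abbreviation vn :: "nat \<Rightarrow> (nat \<Rightarrow> complex) \<Rightarrow> real" where
  "vn n v \<equiv> L2_set (\<lambda>i. cmod (v i)) {..<n}"

text \<open>The operator norm is at most \<open>c\<close>, in a form that needs no supremum and
  composes directly.\<close>

definition opb :: "nat \<Rightarrow> real \<Rightarrow> (nat \<Rightarrow> nat \<Rightarrow> complex) \<Rightarrow> bool" where
  "opb n c M \<longleftrightarrow> (\<forall>v. vn n (mv n M v) \<le> c * vn n v)"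

lemma hermD: "herm n H \<Longrightarrow> i < n \<Longrightarrow> j < n \<Longrightarrow> cnj (H i j) = H j i"
  unfolding herm_def by metis

lemma hermI: "(\<And>i j. i < n \<Longrightarrow> j < n \<Longrightarrow> H j i = cnj (H i j)) \<Longrightarrow> herm n H"
  unfolding herm_def by blast

lemma vn_sq: "(vn n v)\<^sup>2 = (\<Sum>i<n. (cmod (v i))\<^sup>2)"
  by (simp add: L2_set_def sum_nonneg)

lemma inner_vn: "cmod (\<Sum>i<n. u i * v i) \<le> vn n u * vn n v"
proof -
  have "cmod (\<Sum>i<n. u i * v i) \<le> (\<Sum>i<n. \<bar>cmod (u i)\<bar> * \<bar>cmod (v i)\<bar>)"
    by (rule order_trans[OF norm_sum]) (simp add: norm_mult)
  also have "\<dots> \<le> vn n u * vn n v" by (rule L2_set_mult_ineq)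
  finally show ?thesis .
qed

lemma vn_self_inner: "(\<Sum>i<n. cnj (v i) * v i) = of_real ((vn n v)\<^sup>2)"
proof -
  have "cnj x * x = of_real ((cmod x)\<^sup>2)" for x by (metis complex_norm_square mult.commute)
  thus ?thesis unfolding vn_sq by simp
qed

lemma herm_form_real:
  assumes "herm n H"
  shows "Im (\<Sum>i<n. cnj (u i) * mv n H u i) = 0"
proof -
  let ?S = "\<Sum>i<n. \<Sum>k<n. cnj (u i) * H i k * u k"
  have S: "(\<Sum>i<n. cnj (u i) * mv n H u i) = ?S"
    by (simp add: mv_def sum_distrib_left mult.assoc)
  have "cnj ?S = (\<Sum>i<n. \<Sum>k<n. u i * cnj (H i k) * cnj (u k))" by simp
  also have "\<dots> = (\<Sum>i<n. \<Sum>k<n. u i * H k i * cnj (u k))"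
    by (intro sum.cong refl) (simp add: hermD[OF assms])
  also have "\<dots> = (\<Sum>k<n. \<Sum>i<n. u i * H k i * cnj (u k))" by (rule sum.swap)
  also have "\<dots> = ?S" by (intro sum.cong refl) (simp add: mult_ac)
  finally have "cnj ?S = ?S" .
  moreover have "Im x = 0" if "cnj x = x" for x using that by (simp add: complex_eq_iff)
  ultimately have "Im ?S = 0" by blast
  thus ?thesis using S by simp
qed

text \<open>The quadratic form of \<open>H\<close> is real, so only \<open>z\<close> contributes an
  imaginary part. All resolvent bounds, the reality of eigenvalues and the sign of \<open>Im\<close>
  on the diagonal of the resolvent come from this identity.\<close>

lemma herm_coercive:
  assumes "herm n H" "\<And>i. i < n \<Longrightarrow> v i = mv n H u i - z * u i"
  shows "Im (\<Sum>i<n. cnj (u i) * v i) = - Im z * (vn n u)\<^sup>2"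
proof -
  have "(\<Sum>i<n. cnj (u i) * v i) = (\<Sum>i<n. cnj (u i) * mv n H u i - z * (cnj (u i) * u i))"
    by (intro sum.cong refl) (simp add: assms(2) algebra_simps)
  also have "\<dots> = (\<Sum>i<n. cnj (u i) * mv n H u i) - z * of_real ((vn n u)\<^sup>2)"
    unfolding sum_subtractf sum_distrib_left[symmetric] vn_self_inner by simp
  finally show ?thesis using herm_form_real[OF assms(1), of u] by simp
qed

text \<open>Cauchy-Schwarz against \<open>herm_coercive\<close>. With \<open>v = 0\<close> it gives
  injectivity of \<open>H - z\<close> off the real axis, and hence real eigenvalues; in general it
  gives the norm bound \<open>1 / |Im z|\<close> for the resolvent.\<close>

lemma herm_vn_bound:
  assumes "herm n H" "\<And>i. i < n \<Longrightarrow> v i = mv n H u i - z * u i"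
  shows "\<bar>Im z\<bar> * vn n u \<le> vn n v"
proof (cases "vn n u = 0")
  case False
  hence pos: "vn n u > 0" using L2_set_nonneg[of "\<lambda>i. cmod (u i)" "{..<n}"] by linarith
  have "\<bar>Im z\<bar> * (vn n u)\<^sup>2 = \<bar>- Im z * (vn n u)\<^sup>2\<bar>" by (simp add: abs_mult)
  also have "\<dots> = \<bar>Im (\<Sum>i<n. cnj (u i) * v i)\<bar>" by (simp only: herm_coercive[OF assms])
  also have "\<dots> \<le> cmod (\<Sum>i<n. cnj (u i) * v i)" by (rule abs_Im_le_cmod)
  also have "\<dots> \<le> vn n u * vn n v" using inner_vn[of "\<lambda>i. cnj (u i)" v n] by simp
  finally have "vn n u * (\<bar>Im z\<bar> * vn n u) \<le> vn n u * vn n v" by (simp add: power2_eq_square mult_ac)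
  thus ?thesis using pos by simp
qed (simp add: L2_set_nonneg)

lemma mm_assoc: "mm n (mm n A B) C i j = mm n A (mm n B C) i j"
proof -
  have "mm n (mm n A B) C i j = (\<Sum>k<n. \<Sum>l<n. A i l * B l k * C k j)"
    by (simp add: mm_def sum_distrib_right)
  also have "\<dots> = (\<Sum>l<n. \<Sum>k<n. A i l * B l k * C k j)" by (rule sum.swap)
  finally show ?thesis by (simp add: mm_def sum_distrib_left mult.assoc)
qed

lemma mv_mm: "mv n (mm n A B) v i = mv n A (mv n B v) i"
proof -
  have "mv n (mm n A B) v i = (\<Sum>k<n. \<Sum>l<n. A i l * B l k * v k)"
    by (simp add: mm_def mv_def sum_distrib_right)
  also have "\<dots> = (\<Sum>l<n. \<Sum>k<n. A i l * B l k * v k)" by (rule sum.swap)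
  finally show ?thesis by (simp add: mv_def sum_distrib_left mult.assoc)
qed

lemma mv_shift: "i < n \<Longrightarrow> mv n (shift H z) u i = mv n H u i - z * u i"
proof -
  assume i: "i < n"
  have "mv n (shift H z) u i = (\<Sum>k<n. H i k * u k - (if k = i then z * u k else 0))"
    unfolding mv_def shift_def by (intro sum.cong refl) (auto simp: algebra_simps)
  also have "\<dots> = mv n H u i - z * u i"
    unfolding sum_subtractf using i by (simp add: mv_def)
  finally show ?thesis .
qed

lemma det_shift_nonzero:
  assumes "herm n H" "Im z \<noteq> 0"
  shows "Determinant.det (Matrix.mat n n (\<lambda>(i, j). shift H z i j)) \<noteq> 0"
proof
  let ?A = "Matrix.mat n n (\<lambda>(i, j). shift H z i j)"
  assume "Determinant.det ?A = 0"
  then obtain v where v: "v \<in> carrier_vec n" "v \<noteq> 0\<^sub>v n" "?A *\<^sub>v v = 0\<^sub>v n"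
    using det_0_iff_vec_prod_zero[of ?A n] by auto
  have "mv n H (vec_index v) i - z * vec_index v i = 0" if i: "i < n" for i
  proof -
    have "0 = vec_index (?A *\<^sub>v v) i" using v(3) i by simp
    also have "\<dots> = mv n (shift H z) (vec_index v) i"
      using i v(1) by (simp add: scalar_prod_def mv_def atLeast0LessThan)
    finally show ?thesis using mv_shift[OF i] by simp
  qed
  hence "\<bar>Im z\<bar> * vn n (vec_index v) \<le> vn n (\<lambda>i. 0)"
    by (intro herm_vn_bound[OF assms(1)]) auto
  hence "vn n (vec_index v) \<le> 0" using assms(2) by (simp add: mult_le_0_iff L2_set_def)
  hence "\<forall>i<n. vec_index v i = 0"
    using L2_set_nonneg[of "\<lambda>i. cmod (vec_index v i)" "{..<n}"]
      L2_set_eq_0_iff[of "{..<n}" "\<lambda>i. cmod (vec_index v i)"] by auto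
  hence "v = 0\<^sub>v n" using v(1) by (intro eq_vecI) auto
  with v(2) show False by simp
qed

lemma res_right_inverse:
  assumes "herm n H" "Im z \<noteq> 0" "i < n" "j < n"
  shows "mm n (shift H z) (res n H z) i j = (if i = j then 1 else 0)"
proof -
  let ?A = "Matrix.mat n n (\<lambda>(i, j). shift H z i j)"
  have d: "Determinant.det ?A \<noteq> 0" by (rule det_shift_nonzero[OF assms(1,2)])
  have "(?A * adj_mat ?A) $$ (i, j) = (Determinant.det ?A \<cdot>\<^sub>m 1\<^sub>m n) $$ (i, j)"
    by (subst adj_mat(2)[of ?A n]) auto
  hence "(\<Sum>k<n. shift H z i k * cofactor ?A j k) = Determinant.det ?A * (if i = j then 1 else 0)"
    using assms by (simp add: times_mat_def scalar_prod_def adj_mat_def atLeast0LessThan)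
  thus ?thesis using d
    by (simp add: mm_def res_def Let_def sum_divide_distrib[symmetric])
qed

lemma res_left_inverse:
  assumes "herm n H" "Im z \<noteq> 0" "i < n" "j < n"
  shows "mm n (res n H z) (shift H z) i j = (if i = j then 1 else 0)"
proof -
  let ?A = "Matrix.mat n n (\<lambda>(i, j). shift H z i j)"
  have d: "Determinant.det ?A \<noteq> 0" by (rule det_shift_nonzero[OF assms(1,2)])
  have "(adj_mat ?A * ?A) $$ (i, j) = (Determinant.det ?A \<cdot>\<^sub>m 1\<^sub>m n) $$ (i, j)"
    by (subst adj_mat(3)[of ?A n]) auto
  hence "(\<Sum>k<n. cofactor ?A k i * shift H z k j) = Determinant.det ?A * (if i = j then 1 else 0)"
    using assms by (simp add: times_mat_def scalar_prod_def adj_mat_def atLeast0LessThan)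
  thus ?thesis using d
    by (simp add: mm_def res_def Let_def sum_divide_distrib[symmetric])
qed

lemma mm_id_left: "(\<And>k. k < n \<Longrightarrow> A i k = (if i = k then 1 else 0)) \<Longrightarrow> i < n \<Longrightarrow> mm n A B i j = B i j"
proof -
  assume a: "\<And>k. k < n \<Longrightarrow> A i k = (if i = k then 1 else 0)" and i: "i < n"
  have "mm n A B i j = (\<Sum>k<n. if k = i then B k j else 0)"
    unfolding mm_def by (intro sum.cong refl) (use a in auto)
  thus ?thesis using i by simp
qed

lemma mm_id_right: "(\<And>k. k < n \<Longrightarrow> B k j = (if k = j then 1 else 0)) \<Longrightarrow> j < n \<Longrightarrow> mm n A B i j = A i j"
proof -
  assume a: "\<And>k. k < n \<Longrightarrow> B k j = (if k = j then 1 else 0)" and i: "j < n"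
  have "mm n A B i j = (\<Sum>k<n. if k = j then A i k else 0)"
    unfolding mm_def by (intro sum.cong refl) (use a in auto)
  thus ?thesis using i by simp
qed

lemma mm_cong: "(\<And>k. k < n \<Longrightarrow> A i k = A' i k) \<Longrightarrow> (\<And>k. k < n \<Longrightarrow> B k j = B' k j) \<Longrightarrow> mm n A B i j = mm n A' B' i j"
  unfolding mm_def by (intro sum.cong) auto

text \<open>The resolvent identity. Matrix and spectral parameter change at the same time because
  the defect compares \<open>A + C\<close> at \<open>z\<close> with \<open>C\<close> at
  \<open>z + g\<close>.\<close>

lemma res_diff:
  assumes "herm n H" "Im z \<noteq> 0" "herm n H'" "Im w \<noteq> 0" and ij: "i < n" "j < n"
  shows "res n H z i j - res n H' w i j =
    (\<Sum>k<n. \<Sum>l<n. res n H z i k * (shift H' w k l - shift H z k l) * res n H' w l j)"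
proof -
  let ?G = "res n H z" and ?G' = "res n H' w"
  have 1: "mm n ?G (mm n (shift H' w) ?G') i j = ?G i j"
    by (rule mm_id_right) (use assms res_right_inverse[of n H' w] in auto)
  have "mm n (mm n ?G (shift H z)) ?G' i j = ?G' i j"
    by (rule mm_id_left) (use assms res_left_inverse[of n H z] in auto)
  hence 2: "mm n ?G (mm n (shift H z) ?G') i j = ?G' i j" by (simp add: mm_assoc)
  have "?G i j - ?G' i j = mm n ?G (mm n (shift H' w) ?G') i j - mm n ?G (mm n (shift H z) ?G') i j"
    using 1 2 by simp
  thus ?thesis
    by (simp add: mm_def sum_subtractf[symmetric] sum_distrib_left algebra_simps)
qed

text \<open>Cyclicity of the trace gathers the two resolvents into one matrix, of which only the
  operator norm has to be known.\<close>

lemma res_trace_diff: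
  assumes "herm n H" "Im z \<noteq> 0" "herm n H'" "Im w \<noteq> 0"
  shows "(\<Sum>i<n. res n H z i i) - (\<Sum>i<n. res n H' w i i) =
    (\<Sum>k<n. \<Sum>l<n. (shift H' w k l - shift H z k l) * mm n (res n H' w) (res n H z) l k)"
proof -
  let ?G = "res n H z" and ?G' = "res n H' w"
  have "(\<Sum>i<n. ?G i i) - (\<Sum>i<n. ?G' i i) =
    (\<Sum>i<n. \<Sum>k<n. \<Sum>l<n. ?G i k * (shift H' w k l - shift H z k l) * ?G' l i)"
    unfolding sum_subtractf[symmetric] by (intro sum.cong refl res_diff) (use assms in auto)
  also have "\<dots> = (\<Sum>k<n. \<Sum>i<n. \<Sum>l<n. ?G i k * (shift H' w k l - shift H z k l) * ?G' l i)"
    by (rule sum.swap)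
  also have "\<dots> = (\<Sum>k<n. \<Sum>l<n. \<Sum>i<n. ?G i k * (shift H' w k l - shift H z k l) * ?G' l i)"
    by (intro sum.cong refl sum.swap)
  finally show ?thesis by (simp add: mm_def sum_distrib_left mult_ac)
qed

lemma opb_res:
  assumes "herm n H" "c > 0" "c \<le> \<bar>Im z\<bar>"
  shows "opb n (1 / c) (res n H z)"
  unfolding opb_def
proof
  fix v
  let ?u = "mv n (res n H z) v"
  have "v i = mv n H ?u i - z * ?u i" if i: "i < n" for i
  proof -
    have "mv n (shift H z) ?u i = mv n (mm n (shift H z) (res n H z)) v i" by (simp add: mv_mm)
    also have "\<dots> = (\<Sum>k<n. if k = i then v k else 0)"
      unfolding mv_def by (intro sum.cong refl) (use assms i in \<open>auto simp: res_right_inverse\<close>)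
    finally show ?thesis using i by (simp add: mv_shift)
  qed
  from herm_vn_bound[OF assms(1) this] have "\<bar>Im z\<bar> * vn n ?u \<le> vn n v" by simp
  moreover have "c * vn n ?u \<le> \<bar>Im z\<bar> * vn n ?u" using assms by (intro mult_right_mono) auto
  ultimately show "vn n ?u \<le> 1 / c * vn n v" using assms(2) by (simp add: field_simps)
qed

lemma opb_mm: "opb n c A \<Longrightarrow> opb n d B \<Longrightarrow> c \<ge> 0 \<Longrightarrow> opb n (c * d) (mm n A B)"
  unfolding opb_def
proof
  fix v assume A: "\<forall>v. vn n (mv n A v) \<le> c * vn n v" and B: "\<forall>v. vn n (mv n B v) \<le> d * vn n v" and c: "c \<ge> 0"
  have "vn n (mv n (mm n A B) v) = vn n (mv n A (mv n B v))" by (simp add: mv_mm)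
  also have "\<dots> \<le> c * vn n (mv n B v)" using A by blast
  also have "\<dots> \<le> c * (d * vn n v)" using B c by (intro mult_left_mono) auto
  finally show "vn n (mv n (mm n A B) v) \<le> c * d * vn n v" by (simp add: mult.assoc)
qed

lemma opb_bilinear:
  assumes "opb n c M"
  shows "cmod (\<Sum>i<n. \<Sum>j<n. x i * M i j * y j) \<le> c * vn n x * vn n y"
proof -
  have "(\<Sum>i<n. \<Sum>j<n. x i * M i j * y j) = (\<Sum>i<n. x i * mv n M y i)"
    by (simp add: mv_def sum_distrib_left mult.assoc)
  hence "cmod (\<Sum>i<n. \<Sum>j<n. x i * M i j * y j) \<le> vn n x * vn n (mv n M y)"
    using inner_vn[of x "mv n M y" n] by simp
  also have "\<dots> \<le> vn n x * (c * vn n y)"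
    using assms by (intro mult_left_mono) (auto simp: opb_def)
  finally show ?thesis by (simp add: mult_ac)
qed

lemma vn_unit: "j < n \<Longrightarrow> vn n (\<lambda>k. if k = j then 1 else 0) = 1"
proof -
  assume "j < n"
  moreover have "(vn n (\<lambda>k. if k = j then 1 else 0))\<^sup>2 = (\<Sum>k<n. if k = j then 1 else 0)"
    unfolding vn_sq by (intro sum.cong) auto
  ultimately have "(vn n (\<lambda>k. if k = j then 1 else 0))\<^sup>2 = 1" by simp
  thus ?thesis using L2_set_nonneg[of "\<lambda>k. cmod (if k = j then 1 else 0)" "{..<n}"]
    by (auto simp: power2_eq_1_iff)
qed

lemma opb_column:
  assumes "opb n c M" "j < n"
  shows "vn n (\<lambda>i. M i j) \<le> c"
proof -
  have "mv n M (\<lambda>k. if k = j then 1 else 0) i = M i j" for i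
  proof -
    have "mv n M (\<lambda>k. if k = j then 1 else 0) i = (\<Sum>k<n. if k = j then M i k else 0)"
      unfolding mv_def by (intro sum.cong) auto
    thus ?thesis using assms(2) by simp
  qed
  hence "(\<lambda>i. M i j) = mv n M (\<lambda>k. if k = j then 1 else 0)" by auto
  thus ?thesis using assms vn_unit[OF assms(2)] unfolding opb_def by (metis mult.right_neutral)
qed

lemma opb_entry: "opb n c M \<Longrightarrow> i < n \<Longrightarrow> j < n \<Longrightarrow> cmod (M i j) \<le> c"
  using opb_column[of n c M j] member_le_L2_set[of "{..<n}" i "\<lambda>i. cmod (M i j)"] by fastforce

text \<open>By duality: pairing the image under the transpose with its own conjugate gives a value
  of the bilinear form of \<open>M\<close>.\<close>

lemma opb_transpose:
  assumes "opb n c M" "c \<ge> 0"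
  shows "opb n c (\<lambda>i j. M j i)"
  unfolding opb_def
proof
  fix v
  let ?w = "mv n (\<lambda>i j. M j i) v"
  have "of_real ((vn n ?w)\<^sup>2) = (\<Sum>i<n. cnj (?w i) * ?w i)" by (simp add: vn_self_inner)
  also have "\<dots> = (\<Sum>i<n. \<Sum>j<n. v j * M j i * cnj (?w i))"
    by (subst (2) mv_def) (simp add: sum_distrib_left mult_ac)
  also have "\<dots> = (\<Sum>j<n. \<Sum>i<n. v j * M j i * cnj (?w i))" by (rule sum.swap)
  finally have "cmod (of_real ((vn n ?w)\<^sup>2)) = cmod (\<Sum>j<n. \<Sum>i<n. v j * M j i * cnj (?w i))" by simp
  also have "\<dots> \<le> c * vn n v * vn n ?w" using opb_bilinear[OF assms(1), of v "\<lambda>i. cnj (?w i)"] by simp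
  finally have "vn n ?w * vn n ?w \<le> vn n ?w * (c * vn n v)" 
    by (simp add: power2_eq_square mult_ac norm_mult L2_set_nonneg)
  thus "vn n ?w \<le> c * vn n v"
    by (cases "vn n ?w = 0") (use assms(2) in \<open>auto simp: mult_le_cancel_left L2_set_nonneg less_le\<close>)
qed

text \<open>Each of the \<open>n\<close> columns is the image of a unit vector.\<close>

lemma opb_hs:
  assumes "opb n c M"
  shows "(\<Sum>i<n. \<Sum>j<n. (cmod (M i j))\<^sup>2) \<le> real n * c\<^sup>2"
proof -
  have "(\<Sum>i<n. \<Sum>j<n. (cmod (M i j))\<^sup>2) = (\<Sum>j<n. (vn n (\<lambda>i. M i j))\<^sup>2)"
    unfolding vn_sq by (rule sum.swap)
  also have "\<dots> \<le> (\<Sum>j<n. c\<^sup>2)"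
    by (intro sum_mono power_mono opb_column) (use assms in \<open>auto simp: L2_set_nonneg\<close>)
  finally show ?thesis by simp
qed

lemma double_sum_cauchy_schwarz:
  fixes f g :: "nat \<Rightarrow> nat \<Rightarrow> real"
  shows "(\<Sum>i<n. \<Sum>j<n. \<bar>f i j\<bar> * \<bar>g i j\<bar>) \<le> sqrt (\<Sum>i<n. \<Sum>j<n. (f i j)\<^sup>2) * sqrt (\<Sum>i<n. \<Sum>j<n. (g i j)\<^sup>2)"
  using L2_set_mult_ineq[of "\<lambda>(i, j). f i j" "\<lambda>(i, j). g i j" "{..<n} \<times> {..<n}"]
  by (simp add: L2_set_def sum.cartesian_product case_prod_beta')

text \<open>Cauchy-Schwarz in \<open>res_trace_diff\<close>: the product of two resolvents has
  operator norm at most \<open>1/4\<close>, hence Hilbert-Schmidt norm at most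
  \<open>sqrt n / 4\<close>.\<close>

lemma gres_hs:
  assumes "herm n H" "herm n H'" "Im z \<ge> 2" "n > 0"
  shows "cmod (gres n H z - gres n H' z) \<le> sqrt ((\<Sum>i<n. \<Sum>j<n. (cmod (H i j - H' i j))\<^sup>2) / n) / 4"
proof -
  let ?N = "mm n (res n H' z) (res n H z)" and ?S = "\<Sum>i<n. \<Sum>j<n. (cmod (H i j - H' i j))\<^sup>2"
  have op: "opb n (1/2 * (1/2)) ?N"
    by (intro opb_mm opb_res) (use assms in auto)
  have "cmod (\<Sum>k<n. \<Sum>l<n. (shift H' z k l - shift H z k l) * ?N l k)
    \<le> (\<Sum>k<n. \<Sum>l<n. \<bar>cmod (H k l - H' k l)\<bar> * \<bar>cmod (?N l k)\<bar>)"
    by (intro order_trans[OF norm_sum] sum_mono order_trans[OF norm_sum])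
       (simp add: norm_mult shift_def norm_minus_commute)
  also have "\<dots> \<le> sqrt ?S * sqrt (\<Sum>k<n. \<Sum>l<n. (cmod (?N l k))\<^sup>2)"
    by (rule double_sum_cauchy_schwarz)
  also have "\<dots> \<le> sqrt ?S * sqrt (n * (1/4)\<^sup>2)"
  proof (intro mult_left_mono real_sqrt_le_mono)
    have "(\<Sum>k<n. \<Sum>l<n. (cmod (?N l k))\<^sup>2) = (\<Sum>l<n. \<Sum>k<n. (cmod (?N l k))\<^sup>2)" by (rule sum.swap)
    thus "(\<Sum>k<n. \<Sum>l<n. (cmod (?N l k))\<^sup>2) \<le> n * (1/4)\<^sup>2" using opb_hs[OF op] by simp
  qed (simp add: sum_nonneg)
  also have "\<dots> = sqrt ?S * sqrt n / 4" by (simp add: real_sqrt_mult real_sqrt_divide)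
  finally have *: "cmod ((\<Sum>i<n. res n H z i i) - (\<Sum>i<n. res n H' z i i)) \<le> sqrt ?S * sqrt n / 4"
    using assms by (subst res_trace_diff) auto
  have "cmod (gres n H z - gres n H' z) \<le> (sqrt ?S * sqrt n / 4) / n"
    unfolding gres_def diff_divide_distrib[symmetric] norm_divide norm_of_nat
    by (rule divide_right_mono[OF *]) simp
  also have "\<dots> = sqrt (?S / n) / 4"
    using assms(4) by (simp add: real_sqrt_divide field_simps)
  finally show ?thesis .
qed

text \<open>Column \<open>j\<close> of the resolvent solves \<open>(H - z) u = e_j\<close>, so
  \<open>herm_coercive\<close> computes the imaginary part of its \<open>j\<close>-th entry.\<close>

lemma res_diag_im:
  assumes "herm n H" "Im z > 0" "j < n"
  shows "Im (res n H z j j) \<ge> 0"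
proof -
  let ?u = "\<lambda>i. res n H z i j"
  have "Im (\<Sum>i<n. cnj (?u i) * (if i = j then 1 else 0)) = - Im z * (vn n ?u)\<^sup>2"
  proof (rule herm_coercive[OF assms(1)])
    fix i assume i: "i < n"
    have "mm n (shift H z) (res n H z) i j = mv n (shift H z) ?u i" by (simp add: mm_def mv_def)
    thus "(if i = j then 1 else 0) = mv n H ?u i - z * ?u i"
      using assms i by (simp add: res_right_inverse mv_shift)
  qed
  moreover have "(\<Sum>i<n. cnj (?u i) * (if i = j then 1 else 0)) = cnj (?u j)"
    using assms(3) by (simp add: if_distrib[of "\<lambda>x. _ * x"] cong: if_cong)
  ultimately have "- Im (?u j) = - Im z * (vn n ?u)\<^sup>2" by simp
  thus ?thesis using assms(2) by simp
qed

lemma gres_im: "herm n H \<Longrightarrow> Im z > 0 \<Longrightarrow> Im (gres n H z) \<ge> 0"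
  unfolding gres_def by (auto intro!: divide_nonneg_nonneg sum_nonneg res_diag_im)

lemma gres_bound:
  assumes "herm n H" "Im z \<ge> 2"
  shows "cmod (gres n H z) \<le> 1/2"
proof (cases "n = 0")
  case False
  have "cmod (\<Sum>i<n. res n H z i i) \<le> (\<Sum>i<n. 1/2)"
    by (intro sum_norm_le opb_entry[OF opb_res]) (use assms in auto)
  thus ?thesis using False by (simp add: gres_def norm_divide field_simps)
qed (simp add: gres_def)

text \<open>With equal matrices, \<open>res_trace_diff\<close> leaves \<open>z - w\<close> times the
  trace of a product of two resolvents. The constant \<open>1/4\<close> is what makes Pastur's
  equation a contraction.\<close>

lemma gres_lipschitz:
  assumes "herm n H" "Im z \<ge> 2" "Im w \<ge> 2"
  shows "cmod (gres n H z - gres n H w) \<le> cmod (z - w) / 4"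
proof (cases "n = 0")
  case False
  let ?N = "mm n (res n H w) (res n H z)"
  have op: "opb n (1/2 * (1/2)) ?N"
    by (intro opb_mm opb_res) (use assms in auto)
  have "(\<Sum>i<n. res n H z i i) - (\<Sum>i<n. res n H w i i) =
    (\<Sum>k<n. \<Sum>l<n. (shift H w k l - shift H z k l) * ?N l k)"
    by (rule res_trace_diff) (use assms in auto)
  also have "\<dots> = (\<Sum>k<n. \<Sum>l<n. (if l = k then (z - w) * ?N k k else 0))"
    by (intro sum.cong refl) (simp add: shift_def)
  also have "\<dots> = (\<Sum>k<n. (z - w) * ?N k k)" by simp
  also have "cmod \<dots> \<le> (\<Sum>k<n. cmod (z - w) * (1/4))"
  proof (intro sum_norm_le)
    fix k assume "k \<in> {..<n}"
    hence "cmod (?N k k) \<le> 1/4" using opb_entry[OF op, of k k] by simp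
    thus "cmod ((z - w) * ?N k k) \<le> cmod (z - w) * (1/4)" unfolding norm_mult by (intro mult_left_mono) auto
  qed
  finally show ?thesis using False 
    by (simp add: gres_def diff_divide_distrib[symmetric] norm_divide field_simps)
qed (simp add: gres_def)


section \<open>Perturbations of small rank and of few entries\<close>

text \<open>The bound does not depend on the size of \<rho>. Let \<open>u = G v\<close>, let
  \<open>y\<close> be the conjugate of \<open>v\<close> applied to \<open>G\<close> from the left,
  and \<open>q\<close> the quadratic form of \<open>G\<close> at \<open>v\<close>. Eliminating the
  perturbed resolvent gives \<open>t (1 + \<rho> q) = \<rho> \<Sum> u_i y_i\<close> for the
  difference \<open>t\<close> of the traces. Both \<open>u\<close> and \<open>y\<close> have squared
  norm \<open>Im q / Im z\<close>, and \<open>|1 + \<rho> q| \<ge> |\<rho>| Im q\<close>, so \<rho>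
  cancels.\<close>

lemma rank_one_trace:
  assumes H: "herm n H" and H': "herm n H'" and z: "Im z > 0"
    and r1: "\<And>i j. i < n \<Longrightarrow> j < n \<Longrightarrow> H' i j = H i j + of_real \<rho> * (v i * cnj (v j))"
  shows "cmod ((\<Sum>i<n. res n H z i i) - (\<Sum>i<n. res n H' z i i)) \<le> 1 / Im z"
proof -
  let ?G = "res n H z" and ?G' = "res n H' z"
  define u where "u = mv n ?G v"
  define u' where "u' = mv n ?G' v"
  define y where "y j = (\<Sum>i<n. cnj (v i) * ?G i j)" for j
  define y' where "y' j = (\<Sum>i<n. cnj (v i) * ?G' i j)" for j
  define q where "q = (\<Sum>i<n. cnj (v i) * u i)"
  have zn: "Im z \<noteq> 0" using z by simp
  have d1: "?G i j - ?G' i j = of_real \<rho> * u i * y' j" if "i < n" "j < n" for i j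
  proof -
    have "?G i j - ?G' i j = (\<Sum>k<n. \<Sum>l<n. ?G i k * (of_real \<rho> * (v k * cnj (v l))) * ?G' l j)"
      using that zn H H' by (subst res_diff) (auto simp: shift_def r1 intro!: sum.cong)
    thus ?thesis by (simp add: u_def mv_def y'_def sum_distrib_left sum_distrib_right sum_product mult_ac)
  qed
  have d2: "?G i j - ?G' i j = of_real \<rho> * u' i * y j" if "i < n" "j < n" for i j
  proof -
    have "?G' i j - ?G i j = (\<Sum>k<n. \<Sum>l<n. ?G' i k * (- of_real \<rho> * (v k * cnj (v l))) * ?G l j)"
      using that zn H H' by (subst res_diff) (auto simp: shift_def r1 intro!: sum.cong)
    also have "\<dots> = - (of_real \<rho> * u' i * y j)"
      by (simp add: u'_def mv_def y_def sum_distrib_left sum_distrib_right sum_product sum_negf mult_ac)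
    finally show ?thesis by (metis minus_diff_eq minus_equation_iff)
  qed
  have q2: "q = (\<Sum>j<n. y j * v j)"
  proof -
    have "q = (\<Sum>i<n. \<Sum>j<n. cnj (v i) * ?G i j * v j)"
      by (simp add: q_def u_def mv_def sum_distrib_left mult.assoc)
    also have "\<dots> = (\<Sum>j<n. \<Sum>i<n. cnj (v i) * ?G i j * v j)" by (rule sum.swap)
    finally show ?thesis by (simp add: y_def sum_distrib_right)
  qed
  have uu': "u i = u' i * (1 + of_real \<rho> * q)" if "i < n" for i
  proof -
    have "u i - u' i = (\<Sum>j<n. (?G i j - ?G' i j) * v j)"
      by (simp add: u_def u'_def mv_def sum_subtractf algebra_simps)
    also have "\<dots> = (\<Sum>j<n. of_real \<rho> * u' i * y j * v j)"
      using that by (intro sum.cong) (auto simp: d2)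
    also have "\<dots> = of_real \<rho> * u' i * q" by (simp add: q2 sum_distrib_left mult.assoc)
    finally show ?thesis by (simp add: algebra_simps)
  qed
  define t where "t = (\<Sum>i<n. ?G i i) - (\<Sum>i<n. ?G' i i)"
  have t: "t = of_real \<rho> * (\<Sum>i<n. u' i * y i)"
    unfolding t_def sum_subtractf[symmetric] by (simp add: d2 sum_distrib_left mult.assoc)
  have tq: "t * (1 + of_real \<rho> * q) = of_real \<rho> * (\<Sum>i<n. u i * y i)"
  proof -
    have "(\<Sum>i<n. u i * y i) = (\<Sum>i<n. u' i * y i) * (1 + of_real \<rho> * q)"
      unfolding sum_distrib_right by (intro sum.cong) (auto simp: uu')
    thus ?thesis using t by simp
  qed
  have vu: "v i = mv n H u i - z * u i" if i: "i < n" for i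
  proof -
    have "mv n H u i - z * u i = mv n (mm n (shift H z) ?G) v i"
      using i by (simp add: mv_mm mv_shift u_def)
    also have "\<dots> = (\<Sum>k<n. if k = i then v k else 0)"
      unfolding mv_def by (intro sum.cong refl) (use H zn i in \<open>auto simp: res_right_inverse\<close>)
    finally show ?thesis using i by simp
  qed
  have qu: "Im q = Im z * (vn n u)\<^sup>2"
  proof -
    have "Im (\<Sum>i<n. cnj (u i) * v i) = - Im z * (vn n u)\<^sup>2"
      by (rule herm_coercive[OF H]) (use vu in auto)
    moreover have "cnj q = (\<Sum>i<n. cnj (u i) * v i)" by (simp add: q_def mult.commute)
    ultimately show ?thesis by (metis cnj.simps(2) minus_equation_iff mult_minus_left)
  qed
  \<comment> \<open>The conjugate of \<open>y\<close> solves the adjoint equation, with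
    \<open>cnj z\<close> in place of \<open>z\<close>; this is where the left inverse
    enters.\<close>
  have vy: "v j = mv n H (\<lambda>j. cnj (y j)) j - cnj z * cnj (y j)" if j: "j < n" for j
  proof -
    have "cnj (v j) = (\<Sum>i<n. if i = j then cnj (v i) else 0)" using j by simp
    also have "\<dots> = (\<Sum>i<n. cnj (v i) * mm n ?G (shift H z) i j)"
      by (intro sum.cong refl) (use H zn j in \<open>auto simp: res_left_inverse\<close>)
    also have "\<dots> = (\<Sum>i<n. \<Sum>k<n. cnj (v i) * ?G i k * shift H z k j)"
      by (simp add: mm_def sum_distrib_left mult.assoc)
    also have "\<dots> = (\<Sum>k<n. \<Sum>i<n. cnj (v i) * ?G i k * shift H z k j)" by (rule sum.swap)
    also have "\<dots> = (\<Sum>k<n. shift H z k j * y k)"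
      by (simp add: y_def sum_distrib_left mult_ac)
    also have "\<dots> = (\<Sum>k<n. cnj (shift H (cnj z) j k) * y k)"
      by (intro sum.cong refl) (use j in \<open>auto simp: shift_def hermD[OF H]\<close>)
    finally have "v j = cnj (\<Sum>k<n. cnj (shift H (cnj z) j k) * y k)" by (metis complex_cnj_cnj)
    also have "\<dots> = mv n (shift H (cnj z)) (\<lambda>j. cnj (y j)) j" by (simp add: mv_def)
    finally show ?thesis using j by (simp add: mv_shift)
  qed
  have qy: "Im q = Im z * (vn n y)\<^sup>2"
  proof -
    have "Im (\<Sum>i<n. cnj (cnj (y i)) * v i) = - Im (cnj z) * (vn n (\<lambda>j. cnj (y j)))\<^sup>2"
      by (rule herm_coercive[OF H]) (use vy in auto)
    thus ?thesis by (simp add: q2)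
  qed
  have q0: "Im q \<ge> 0" using qu z by simp
  \<comment> \<open>If \<open>Im q = 0\<close> then \<open>y\<close> vanishes and with it the
    difference of traces; otherwise one may divide by \<open>|\<rho>| Im q\<close>.\<close>
  show ?thesis
  proof (cases "\<rho> = 0 \<or> Im q = 0")
    case True
    have "of_real \<rho> * (\<Sum>i<n. u' i * y i) = 0"
    proof (cases "\<rho> = 0")
      case False
      hence "vn n y = 0" using True qy z by auto
      hence "\<forall>i<n. y i = 0" by (auto simp: L2_set_eq_0_iff)
      thus ?thesis by simp
    qed simp
    hence "t = 0" using t by simp
    hence "cmod t \<le> 1 / Im z" using z by simp
    thus ?thesis by (simp only: t_def)
  next
    case False
    hence pos: "\<bar>\<rho>\<bar> * Im q > 0" using q0 by simp
    have "cmod t * (\<bar>\<rho>\<bar> * Im q) \<le> cmod t * cmod (1 + of_real \<rho> * q)"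
    proof (intro mult_left_mono)
      have "\<bar>\<rho>\<bar> * Im q = \<bar>Im (1 + of_real \<rho> * q)\<bar>" using q0 by (simp add: abs_mult)
      thus "\<bar>\<rho>\<bar> * Im q \<le> cmod (1 + of_real \<rho> * q)" using abs_Im_le_cmod by metis
    qed simp
    also have "\<dots> = \<bar>\<rho>\<bar> * cmod (\<Sum>i<n. u i * y i)"
      by (metis norm_mult norm_of_real tq)
    also have "\<dots> \<le> \<bar>\<rho>\<bar> * (vn n u * vn n y)" by (intro mult_left_mono inner_vn) auto
    also have "vn n u * vn n y = Im q / Im z"
    proof -
      have "(vn n u)\<^sup>2 = (vn n y)\<^sup>2" using qu qy z by auto
      hence "vn n u = vn n y" by (simp add: power2_eq_iff_nonneg)
      thus ?thesis using qy z by (simp add: power2_eq_square)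
    qed
    finally have "cmod t * (\<bar>\<rho>\<bar> * Im q) \<le> 1 / Im z * (\<bar>\<rho>\<bar> * Im q)" by (simp add: mult_ac)
    hence "cmod t \<le> 1 / Im z" using pos by (rule mult_right_le_imp_le)
    thus ?thesis by (simp only: t_def)
  qed
qed

text \<open>Changing an off-diagonal pair by \<open>d\<close> adds \<open>d e_i e_j^H\<close> and
  its adjoint. With \<open>p = d e_i + e_j\<close> and \<open>m = d e_i - e_j\<close> this is half
  the difference of \<open>p p^H\<close> and \<open>m m^H\<close>, hence two rank one steps,
  whatever the size of \<open>d\<close>.\<close>

lemma entry_change_trace:
  assumes H: "herm n H" and H': "herm n H'" and z: "Im z > 0" and ij: "i < n" "j < n"
    and eq: "\<And>k l. k < n \<Longrightarrow> l < n \<Longrightarrow> (k, l) \<noteq> (i, j) \<Longrightarrow> (k, l) \<noteq> (j, i) \<Longrightarrow> H k l = H' k l"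
  shows "cmod ((\<Sum>k<n. res n H z k k) - (\<Sum>k<n. res n H' z k k)) \<le> 2 / Im z"
proof (cases "i = j")
  case True
  define d where "d = Re (H' i i - H i i)"
  have "H i i = cnj (H i i)" "H' i i = cnj (H' i i)" using ij by (simp_all add: hermD[OF H] hermD[OF H'])
  hence d: "H' i i = H i i + of_real d"
    by (simp add: d_def complex_eq_iff)
  have "cmod ((\<Sum>k<n. res n H z k k) - (\<Sum>k<n. res n H' z k k)) \<le> 1 / Im z"
  proof (rule rank_one_trace[OF H H' z, of d "\<lambda>k. if k = i then 1 else 0"])
    fix k l assume "k < n" "l < n"
    thus "H' k l = H k l + of_real d * ((if k = i then 1 else 0) * cnj (if l = i then 1 else 0))"
      using d eq[of k l] True by auto
  qed
  also have "\<dots> \<le> 2 / Im z" using z by (simp add: divide_right_mono)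
  finally show ?thesis .
next
  case False
  define d where "d = H' i j - H i j"
  have d': "H' j i - H j i = cnj d" using ij by (simp add: d_def hermD[OF H] hermD[OF H'])
  define p where "p k = (if k = i then d else if k = j then 1 else 0)" for k
  define m where "m k = (if k = i then d else if k = j then - 1 else 0)" for k
  define F where "F k l = H k l + of_real (1/2) * (p k * cnj (p l))" for k l
  have F: "herm n F" by (rule hermI) (simp add: F_def hermD[OF H] mult.commute)
  have 1: "cmod ((\<Sum>k<n. res n H z k k) - (\<Sum>k<n. res n F z k k)) \<le> 1 / Im z"
    by (rule rank_one_trace[OF H F z, of "1/2" p]) (simp add: F_def)
  have 2: "cmod ((\<Sum>k<n. res n F z k k) - (\<Sum>k<n. res n H' z k k)) \<le> 1 / Im z"
  proof (rule rank_one_trace[OF F H' z, of "-1/2" m])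
    fix k l assume kl: "k < n" "l < n"
    have "H' k l - H k l = (1/2) * (p k * cnj (p l)) - (1/2) * (m k * cnj (m l))"
      using eq[OF kl] d' False by (auto simp: p_def m_def d_def) (simp_all add: field_simps)
    hence "H' k l = H k l + ((1/2) * (p k * cnj (p l)) - (1/2) * (m k * cnj (m l)))"
      by (metis add.commute diff_add_cancel)
    thus "H' k l = F k l + of_real (-1/2) * (m k * cnj (m l))"
      by (simp add: F_def)
  qed
  have "cmod ((\<Sum>k<n. res n H z k k) - (\<Sum>k<n. res n H' z k k)) \<le> 1 / Im z + 1 / Im z"
    by (rule norm_diff_triangle_le[OF 1 2])
  thus ?thesis by simp
qed

lemma entries_change_trace:
  assumes "finite P" "P \<subseteq> {(i, j). i \<le> j \<and> j < n}" "herm n H" "herm n H'" "Im z > 0"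
    and "\<And>i j. i \<le> j \<Longrightarrow> j < n \<Longrightarrow> (i, j) \<notin> P \<Longrightarrow> H i j = H' i j"
  shows "cmod ((\<Sum>k<n. res n H z k k) - (\<Sum>k<n. res n H' z k k)) \<le> real (card P) * (2 / Im z)"
  using assms
proof (induction P arbitrary: H' rule: finite_induct)
  case empty
  have e: "H i j = H' i j" if "i < n" "j < n" for i j
  proof (cases "i \<le> j")
    case False
    thus ?thesis using empty.prems(5)[of j i] hermD[OF empty.prems(2), of j i] hermD[OF empty.prems(3), of j i] that by simp
  qed (use empty that in auto)
  have "(\<Sum>k<n. res n H z k k) - (\<Sum>k<n. res n H' z k k) = 0"
    using empty.prems e by (subst res_trace_diff) (auto simp: shift_def)
  thus ?case by simp
next
  case (insert e P)
  obtain i j where ij: "e = (i, j)" "i \<le> j" "j < n" using insert.prems(1) by auto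
  define F where "F k l = (if (k, l) = (i, j) \<or> (k, l) = (j, i) then H k l else H' k l)" for k l
  have F: "herm n F"
    by (rule hermI) (auto simp: F_def hermD[OF insert.prems(2)] hermD[OF insert.prems(3)])
  have 1: "cmod ((\<Sum>k<n. res n H z k k) - (\<Sum>k<n. res n F z k k)) \<le> real (card P) * (2 / Im z)"
  proof (rule insert.IH[OF _ _ F])
    fix k l assume "k \<le> l" "l < n" "(k, l) \<notin> P"
    thus "H k l = F k l" using insert.prems(5)[of k l] ij by (auto simp: F_def)
  qed (use insert.prems in auto)
  have 2: "cmod ((\<Sum>k<n. res n F z k k) - (\<Sum>k<n. res n H' z k k)) \<le> 2 / Im z"
    by (rule entry_change_trace[OF F, of _ _ i j]) (use insert.prems ij in \<open>auto simp: F_def\<close>)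
  have "cmod ((\<Sum>k<n. res n H z k k) - (\<Sum>k<n. res n H' z k k)) \<le> real (card P) * (2 / Im z) + 2 / Im z"
    by (rule norm_diff_triangle_le[OF 1 2])
  thus ?case using insert.hyps by (simp add: algebra_simps add_divide_distrib)
qed

text \<open>
  The triangular truncation of a matrix is not bounded in norm, but cutting the index set into
  blocks of length \<open>q\<close> shows that the sum of the entries above the diagonal is \<open>o(n powr (3/2))\<close>.
\<close>

lemma upper_triangle_sum:
  assumes op: "opb n c N" and c: "c \<ge> 0" and q: "q > 0" and n: "n > 0"
  shows "cmod (\<Sum>i<n. \<Sum>j<n. if i < j then N i j else 0) \<le>
    c * (real n * sqrt q + (real n / q + 1) * sqrt (real q * real n))"
proof -
  let ?B = "\<lambda>k. {i. i < n \<and> i div q = k}"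
  have fB: "finite (?B k)" for k by simp
  have cB: "card (?B k) \<le> q" for k
  proof -
    have "?B k \<subseteq> {k * q..<k * q + q}"
    proof
      fix i assume "i \<in> ?B k"
      hence "i div q = k" by simp
      thus "i \<in> {k * q..<k * q + q}"
        using q div_mult_mod_eq[of i q] mod_less_divisor[OF q, of i] by auto
    qed
    from card_mono[OF _ this] show ?thesis by simp
  qed
  define m where "m = n div q + 1"
  \<comment> \<open>Pairs within one block are few and are handled by Cauchy-Schwarz. Pairs in
    different blocks form, for every block \<open>k\<close> of rows, a full rectangle, to which the
    operator norm bound applies through indicator vectors.\<close>
  have split: "(if i < j then N i j else 0) = (if i < j \<and> i div q = j div q then N i j else 0)
     + (\<Sum>k<m. (if i div q = k then 1 else 0) * N i j * (if j div q > k then 1 else 0))"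
    if "i < n" "j < n" for i j
  proof -
    have im: "i div q < m" using that(1) by (simp add: m_def div_le_mono le_imp_less_Suc less_imp_le)
    have "(\<Sum>k<m. (if i div q = k then 1 else 0) * N i j * (if j div q > k then 1 else 0))
      = (\<Sum>k<m. if k = i div q then (if j div q > i div q then N i j else 0) else 0)"
      by (intro sum.cong) auto
    also have "\<dots> = (if j div q > i div q then N i j else 0)" using im by simp
    moreover have "j \<le> i \<Longrightarrow> \<not> j div q > i div q" using div_le_mono[of j i q] by simp
    moreover have "i < j \<Longrightarrow> i div q \<le> j div q" using div_le_mono[of i j q] by simp
    ultimately show ?thesis by (cases "i < j"; cases "i div q = j div q") auto
  qed
  let ?S1 = "\<Sum>i<n. \<Sum>j<n. if i < j \<and> i div q = j div q then N i j else 0"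
  let ?S2 = "\<lambda>k. \<Sum>i<n. \<Sum>j<n. (if i div q = k then 1 else 0) * N i j * (if j div q > k then 1 else 0)"
  have "(\<Sum>i<n. \<Sum>j<n. if i < j then N i j else 0)
     = ?S1 + (\<Sum>i<n. \<Sum>j<n. \<Sum>k<m. (if i div q = k then 1 else 0) * N i j * (if j div q > k then 1 else 0))"
    unfolding sum.distrib[symmetric] by (intro sum.cong refl) (use split in auto)
  also have "(\<Sum>i<n. \<Sum>j<n. \<Sum>k<m. (if i div q = k then 1 else 0) * N i j * (if j div q > k then 1 else 0))
      = (\<Sum>i<n. \<Sum>k<m. \<Sum>j<n. (if i div q = k then 1 else 0) * N i j * (if j div q > k then 1 else 0))"
    by (intro sum.cong refl sum.swap)
  also have "\<dots> = (\<Sum>k<m. ?S2 k)" by (rule sum.swap)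
  finally have eq: "(\<Sum>i<n. \<Sum>j<n. if i < j then N i j else 0) = ?S1 + (\<Sum>k<m. ?S2 k)" .
  have "cmod (\<Sum>i<n. \<Sum>j<n. if i < j then N i j else 0) \<le> cmod ?S1 + cmod (\<Sum>k<m. ?S2 k)"
    unfolding eq by (rule norm_triangle_ineq)
  also have "cmod ?S1 \<le> (\<Sum>i<n. \<Sum>j<n. \<bar>if i div q = j div q then 1 else 0\<bar> * \<bar>cmod (N i j)\<bar>)"
    by (intro order_trans[OF norm_sum] sum_mono order_trans[OF norm_sum]) auto
  also have "\<dots> \<le> sqrt (\<Sum>i<n. \<Sum>j<n. (if i div q = j div q then 1 else 0)\<^sup>2) * sqrt (\<Sum>i<n. \<Sum>j<n. (cmod (N i j))\<^sup>2)"
    by (rule double_sum_cauchy_schwarz)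
  also have "\<dots> \<le> sqrt (real n * q) * sqrt (real n * c\<^sup>2)"
  proof (intro mult_mono real_sqrt_le_mono opb_hs op)
    have "(\<Sum>i<n. \<Sum>j<n. (if i div q = j div q then 1 else 0 :: real)\<^sup>2) = (\<Sum>i<n. real (card (?B (i div q))))"
    proof (intro sum.cong refl)
      fix i
      have "(\<Sum>j<n. (if i div q = j div q then 1 else 0 :: real)\<^sup>2) = (\<Sum>j\<in>{..<n}. if j div q = i div q then 1 else 0)"
        by (intro sum.cong) auto
      also have "\<dots> = (\<Sum>j\<in>{j\<in>{..<n}. j div q = i div q}. 1)" by (subst sum.inter_filter[symmetric]) auto
      finally show "(\<Sum>j<n. (if i div q = j div q then 1 else 0 :: real)\<^sup>2) = real (card (?B (i div q)))" by simp
    qed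
    also have "\<dots> \<le> (\<Sum>i<n. real q)" using cB by (intro sum_mono) auto
    finally show "(\<Sum>i<n. \<Sum>j<n. (if i div q = j div q then 1 else 0 :: real)\<^sup>2) \<le> real n * q" by simp
  qed (auto simp: sum_nonneg)
  also have "\<dots> = c * (real n * sqrt q)" using c by (simp add: real_sqrt_mult)
  also have "cmod (\<Sum>k<m. ?S2 k) \<le> (\<Sum>k<m. c * sqrt (real q * real n))"
  proof (rule sum_norm_le)
    fix k
    have "cmod (?S2 k) \<le> c * vn n (\<lambda>i. if i div q = k then 1 else 0) * vn n (\<lambda>j. if j div q > k then 1 else 0)"
      by (rule opb_bilinear[OF op])
    also have "\<dots> \<le> c * sqrt q * sqrt n"
    proof (intro mult_mono)
      have "(\<Sum>i<n. (cmod (if i div q = k then 1 else 0))\<^sup>2) = (\<Sum>i\<in>{i\<in>{..<n}. i div q = k}. 1)"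
        by (subst sum.inter_filter) (auto intro!: sum.cong)
      also have "\<dots> \<le> real q" using cB[of k] by simp
      finally show "vn n (\<lambda>i. if i div q = k then 1 else 0) \<le> sqrt q"
        unfolding L2_set_def by (rule real_sqrt_le_mono)
      have "(\<Sum>i<n. (cmod (if i div q > k then 1 else 0))\<^sup>2) \<le> (\<Sum>i<n. 1)" by (intro sum_mono) auto
      thus "vn n (\<lambda>i. if i div q > k then 1 else 0) \<le> sqrt n"
        unfolding L2_set_def by (intro real_sqrt_le_mono) auto
    qed (use c in \<open>auto simp: L2_set_nonneg\<close>)
    finally show "cmod (?S2 k) \<le> c * sqrt (real q * real n)" by (simp add: real_sqrt_mult)
  qed
  also have "(\<Sum>k<m. c * sqrt (real q * real n)) = real m * (c * sqrt (real q * real n))" by simp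
  also have "\<dots> \<le> (real n / q + 1) * (c * sqrt (real q * real n))"
  proof (intro mult_right_mono)
    have "real (n div q) * real q \<le> real n" by (metis div_times_less_eq_dividend of_nat_le_iff of_nat_mult)
    thus "real m \<le> real n / q + 1" using q by (simp add: m_def field_simps)
  qed (use c in auto)
  finally show ?thesis by (simp add: algebra_simps)
qed


section \<open>The defect of the self-consistent equation\<close>

definition hadd :: "(nat \<Rightarrow> nat \<Rightarrow> complex) \<Rightarrow> (nat \<Rightarrow> nat \<Rightarrow> complex) \<Rightarrow> nat \<Rightarrow> nat \<Rightarrow> complex" where
  "hadd A C i j = A i j + C i j"

definition perr :: "nat \<Rightarrow> (nat \<Rightarrow> nat \<Rightarrow> complex) \<Rightarrow> (nat \<Rightarrow> nat \<Rightarrow> complex) \<Rightarrow> complex \<Rightarrow> complex" where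
  "perr n A C z = gres n C (z + gres n (hadd A C) z) - gres n (hadd A C) z"

text \<open>The product of resolvents that \<open>res_trace_diff\<close> produces between
  \<open>A + C\<close> at \<open>z\<close> and \<open>C\<close> at \<open>z + g\<close>.\<close>

definition pmat :: "nat \<Rightarrow> (nat \<Rightarrow> nat \<Rightarrow> complex) \<Rightarrow> (nat \<Rightarrow> nat \<Rightarrow> complex) \<Rightarrow> complex \<Rightarrow> nat \<Rightarrow> nat \<Rightarrow> complex" where
  "pmat n A C z = mm n (res n (hadd A C) z) (res n C (z + gres n (hadd A C) z))"

lemma herm_hadd: "herm n A \<Longrightarrow> herm n C \<Longrightarrow> herm n (hadd A C)"
  by (rule hermI) (simp add: hadd_def hermD)

lemma shifted_im:
  assumes "herm n A" "herm n C" "Im z \<ge> 2"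
  shows "Im (z + gres n (hadd A C) z) \<ge> 2"
  using gres_im[OF herm_hadd[OF assms(1,2)], of z] assms(3) by simp

lemma opb_pmat:
  assumes "herm n A" "herm n C" "Im z \<ge> 2"
  shows "opb n (1/4) (pmat n A C z)"
proof -
  have "opb n (1/2 * (1/2)) (pmat n A C z)"
    unfolding pmat_def using shifted_im[OF assms] assms
    by (intro opb_mm opb_res herm_hadd) auto
  thus ?thesis by simp
qed

text \<open>The second summand stems from the shift of \<open>z\<close> by \<open>g\<close>. To
  leading order the sum over \<open>A\<close> contains its negative, because
  \<open>|A k l|^2\<close> is about \<open>1 / n\<close> on average; the shift is made for this
  cancellation.\<close>

lemma perr_formula:
  assumes "herm n A" "herm n C" "Im z \<ge> 2"
  shows "perr n A C z = ((\<Sum>k<n. \<Sum>l<n. A k l * pmat n A C z l k)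
    + gres n (hadd A C) z * (\<Sum>k<n. pmat n A C z k k)) / of_nat n"
proof -
  let ?g = "gres n (hadd A C) z" and ?M = "pmat n A C z"
  have "(\<Sum>i<n. res n C (z + ?g) i i) - (\<Sum>i<n. res n (hadd A C) z i i) =
    (\<Sum>k<n. \<Sum>l<n. (shift (hadd A C) z k l - shift C (z + ?g) k l) * ?M l k)"
    unfolding pmat_def by (rule res_trace_diff) (use assms shifted_im[OF assms] herm_hadd[OF assms(1,2)] in auto)
  also have "\<dots> = (\<Sum>k<n. \<Sum>l<n. A k l * ?M l k + (if l = k then ?g * ?M k k else 0))"
    by (intro sum.cong refl) (simp add: shift_def hadd_def algebra_simps)
  also have "\<dots> = (\<Sum>k<n. \<Sum>l<n. A k l * ?M l k) + ?g * (\<Sum>k<n. ?M k k)"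
    by (simp add: sum.distrib sum_distrib_left)
  finally show ?thesis unfolding perr_def gres_def[of n C] 
    by (subst (2) gres_def) (simp add: diff_divide_distrib[symmetric])
qed

text \<open>Perturbation theory for one symmetric pair of entries. The sharper estimates keep
  off-diagonal entries of \<open>G\<close> and \<open>G G\<close> instead of bounding them by
  constants, since in quadratic mean these are only of order \<open>n^(-1/2)\<close>.\<close>

locale entry_change =
  fixes n :: nat and A A' C :: "nat \<Rightarrow> nat \<Rightarrow> complex" and z :: complex and i j :: nat and \<kappa> :: real
  assumes n: "n > 0" and A: "herm n A" and A': "herm n A'" and C: "herm n C" and z: "Im z \<ge> 2"
    and ij: "i < n" "j < n" "i \<noteq> j"
    and outside: "\<And>k l. k < n \<Longrightarrow> l < n \<Longrightarrow> (k, l) \<noteq> (i, j) \<Longrightarrow> (k, l) \<noteq> (j, i) \<Longrightarrow> A k l = A' k l"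
    and small: "cmod (A' i j - A i j) \<le> \<kappa>"
begin

abbreviation "G \<equiv> res n (hadd A C) z"
abbreviation "G' \<equiv> res n (hadd A' C) z"
abbreviation "g \<equiv> gres n (hadd A C) z"
abbreviation "g' \<equiv> gres n (hadd A' C) z"
abbreviation "R \<equiv> res n C (z + g)"
abbreviation "R' \<equiv> res n C (z + g')"
abbreviation "NR \<equiv> mm n G' R"
abbreviation "d \<equiv> A' i j - A i j"

lemma kappa: "\<kappa> \<ge> 0" using small norm_ge_zero order_trans by blast

lemma d_cnj: "A' j i - A j i = cnj d"
  using ij hermD[OF A, of i j] hermD[OF A', of i j] by simp

lemma herms: "herm n (hadd A C)" "herm n (hadd A' C)"
  using A A' C by (auto intro: herm_hadd)

lemma zn: "Im z \<noteq> 0" using z by simp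

lemma w: "Im (z + g) \<ge> 2" "Im (z + g') \<ge> 2"
  using shifted_im[OF A C z] shifted_im[OF A' C z] by auto

lemma ops: "opb n (1/2) G" "opb n (1/2) G'" "opb n (1/2) R" "opb n (1/2) R'"
  using herms C w z by (auto intro!: opb_res)

lemma opm: "opb n (1/2) X \<Longrightarrow> opb n (1/2) Y \<Longrightarrow> opb n (1/4) (mm n X Y)"
  using opb_mm[of n "1/2" X "1/2" Y] by simp

lemma e2: "opb n (1/2) X \<Longrightarrow> k < n \<Longrightarrow> l < n \<Longrightarrow> cmod (X k l) \<le> 1/2"
  by (rule opb_entry)

lemma two_entries:
  "(\<Sum>k<n. \<Sum>l<n. x k * (shift (hadd A' C) z k l - shift (hadd A C) z k l) * y l) = d * (x i * y j) + cnj d * (x j * y i)"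
proof -
  have "(\<Sum>k<n. \<Sum>l<n. x k * (shift (hadd A' C) z k l - shift (hadd A C) z k l) * y l)
      = (\<Sum>k<n. \<Sum>l<n. (if k = i then if l = j then x i * d * y j else 0 else 0) + (if k = j then if l = i then x j * cnj d * y i else 0 else 0))"
  proof (intro sum.cong refl)
    fix k l assume kl: "k \<in> {..<n}" "l \<in> {..<n}"
    have s: "shift (hadd A' C) z k l - shift (hadd A C) z k l = A' k l - A k l"
      by (simp add: shift_def hadd_def)
    show "x k * (shift (hadd A' C) z k l - shift (hadd A C) z k l) * y l = 
      (if k = i then if l = j then x i * d * y j else 0 else 0) + (if k = j then if l = i then x j * cnj d * y i else 0 else 0)"
      unfolding s using outside[of k l] kl d_cnj ij(3) by auto
  qed
  also have "\<dots> = (\<Sum>k<n. (if k = i then x i * d * y j else 0) + (if k = j then x j * cnj d * y i else 0))"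
    using ij by (intro sum.cong refl) (auto simp: sum.distrib)
  also have "\<dots> = d * (x i * y j) + cnj d * (x j * y i)"
    using ij by (simp add: sum.distrib mult_ac)
  finally show ?thesis .
qed

lemma two_terms_bound: "cmod p \<le> a \<Longrightarrow> cmod q \<le> b \<Longrightarrow> cmod (d * p + cnj d * q) \<le> \<kappa> * (a + b)"
proof -
  assume a: "cmod p \<le> a" "cmod q \<le> b"
  have "cmod (d * p + cnj d * q) \<le> cmod d * cmod p + cmod d * cmod q"
    by (metis norm_triangle_ineq norm_mult complex_mod_cnj)
  also have "\<dots> \<le> \<kappa> * a + \<kappa> * b"
    by (intro add_mono mult_mono) (use small a kappa in auto)
  finally show ?thesis by (simp add: algebra_simps)
qed

lemma G_diff:
  assumes "k < n" "l < n"
  shows "G k l - G' k l = d * (G k i * G' j l) + cnj d * (G k j * G' i l)"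
proof -
  have "G k l - G' k l =
    (\<Sum>p<n. \<Sum>q<n. G k p * (shift (hadd A' C) z p q - shift (hadd A C) z p q) * G' q l)"
    by (rule res_diff) (use herms zn assms in auto)
  thus ?thesis unfolding two_entries .
qed

lemma mm_diff_left:
  assumes "k < n" "l < n"
  shows "mm n G Y k l - mm n G' Y k l = d * (G k i * mm n G' Y j l) + cnj d * (G k j * mm n G' Y i l)"
proof -
  have "mm n G Y k l - mm n G' Y k l = (\<Sum>m<n. (G k m - G' k m) * Y m l)"
    by (simp add: mm_def sum_subtractf algebra_simps)
  also have "\<dots> = (\<Sum>m<n. d * (G k i * (G' j m * Y m l)) + cnj d * (G k j * (G' i m * Y m l)))"
    using assms by (intro sum.cong refl) (auto simp: G_diff algebra_simps)
  also have "\<dots> = d * (G k i * mm n G' Y j l) + cnj d * (G k j * mm n G' Y i l)"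
    by (simp add: mm_def sum.distrib sum_distrib_left)
  finally show ?thesis .
qed

lemma mm_diff_left_bound:
  assumes "opb n (1/2) Y" "k < n" "l < n"
  shows "cmod (mm n G Y k l - mm n G' Y k l) \<le> \<kappa> / 4"
proof -
  have b: "cmod (G k p * mm n G' Y q l) \<le> 1/8" if "p < n" "q < n" for p q
  proof -
    have "cmod (G k p) * cmod (mm n G' Y q l) \<le> 1/2 * (1/4)"
      using opb_entry[OF ops(1), of k p] opb_entry[OF opm[OF ops(2) assms(1)], of q l] assms(2,3) that
      by (intro mult_mono) auto
    thus ?thesis by (simp add: norm_mult)
  qed
  have "cmod (mm n G Y k l - mm n G' Y k l) \<le> \<kappa> * (1/8 + 1/8)"
    unfolding mm_diff_left[OF assms(2,3)] by (intro two_terms_bound b) (use ij in auto)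
  thus ?thesis by simp
qed

lemma g_diff: "of_nat n * (g - g') = d * mm n G' G j i + cnj d * mm n G' G i j"
proof -
  have "of_nat n * (g - g') = (\<Sum>k<n. G k k) - (\<Sum>k<n. G' k k)"
    using n by (simp add: gres_def right_diff_distrib)
  also have "\<dots> = (\<Sum>m<n. G m m - G' m m)" by (simp add: sum_subtractf)
  also have "\<dots> = (\<Sum>m<n. d * (G' j m * G m i) + cnj d * (G' i m * G m j))"
    by (intro sum.cong refl) (simp add: G_diff mult_ac)
  also have "\<dots> = d * mm n G' G j i + cnj d * mm n G' G i j"
    by (simp add: mm_def sum.distrib sum_distrib_left)
  finally show ?thesis .
qed

lemma g_diff_crude: "cmod (g - g') \<le> \<kappa> / (2 * n)"
proof -
  have "real n * cmod (g - g') = cmod (of_nat n * (g - g'))" by (simp add: norm_mult)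
  also have "\<dots> \<le> \<kappa> * (1/4 + 1/4)"
    unfolding g_diff by (intro two_terms_bound opb_entry[OF opm[OF ops(2) ops(1)]]) (use ij in auto)
  finally show ?thesis using n by (simp add: field_simps)
qed

text \<open>Replacing \<open>G'\<close> by \<open>G\<close> costs \<kappa>, and the entries of
  \<open>G G\<close> are kept. Their squares sum to order \<open>n\<close>, so on average this gains
  a factor of order \<open>n^(-1/2)\<close>, up to \<kappa>, over \<open>g_diff_crude\<close>; the
  gain is collected in \<open>BE_sum\<close>.\<close>

lemma g_diff_fine: "cmod (g - g') \<le> \<kappa> / n * (cmod (mm n G G i j) + cmod (mm n G G j i) + \<kappa>)"
proof -
  have b: "cmod (mm n G' G k l) \<le> cmod (mm n G G k l) + \<kappa> / 4" if "k < n" "l < n" for k l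
    using mm_diff_left_bound[OF ops(1) that] norm_triangle_sub[of "mm n G' G k l" "mm n G G k l"]
    by (simp add: norm_minus_commute)
  have "real n * cmod (g - g') = cmod (of_nat n * (g - g'))" by (simp add: norm_mult)
  also have "\<dots> \<le> \<kappa> * ((cmod (mm n G G j i) + \<kappa> / 4) + (cmod (mm n G G i j) + \<kappa> / 4))"
    unfolding g_diff by (intro two_terms_bound b) (use ij in auto)
  also have "\<dots> \<le> \<kappa> * (cmod (mm n G G i j) + cmod (mm n G G j i) + \<kappa>)"
    using kappa by (intro mult_left_mono) auto
  finally show ?thesis using n by (simp add: field_simps)
qed

text \<open>The defect depends on \<open>A\<close> only through \<open>g\<close>. The constant is 1
  for \<open>g\<close> itself plus the Lipschitz constant \<open>1/4\<close> of
  \<open>gres n C\<close>.\<close>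

lemma perr_diff: "cmod (perr n A C z - perr n A' C z) \<le> 5/4 * cmod (g - g')"
proof -
  have "cmod (gres n C (z + g) - gres n C (z + g')) \<le> cmod ((z + g) - (z + g')) / 4"
    by (rule gres_lipschitz[OF C w])
  moreover have "perr n A C z - perr n A' C z = (gres n C (z + g) - gres n C (z + g')) - (g - g')"
    by (simp add: perr_def)
  ultimately show ?thesis
    using norm_triangle_ineq4[of "gres n C (z + g) - gres n C (z + g')" "g - g'"] by simp
qed

lemma R_diff: "k < n \<Longrightarrow> l < n \<Longrightarrow> R k l - R' k l = (g - g') * mm n R R' k l"
proof -
  assume kl: "k < n" "l < n"
  have "R k l - R' k l = (\<Sum>p<n. \<Sum>q<n. R k p * (shift C (z + g') p q - shift C (z + g) p q) * R' q l)"
    by (rule res_diff) (use C w kl in auto)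
  also have "\<dots> = (\<Sum>p<n. \<Sum>q<n. if q = p then (g - g') * (R k p * R' p l) else 0)"
    by (intro sum.cong refl) (simp add: shift_def)
  finally show ?thesis by (simp add: mm_def sum_distrib_left)
qed

text \<open>First order expansion in the changed pair. The second resolvent \<open>R\<close> sees
  the change only through \<open>g\<close>, which moves by \<open>\<kappa> / (2 n)\<close> at
  most.\<close>

lemma M_diff:
  assumes "k < n" "l < n"
  shows "cmod ((pmat n A C z k l - pmat n A' C z k l) - (d * (G k i * NR j l) + cnj d * (G k j * NR i l)))
    \<le> \<kappa> / (16 * n)"
proof -
  have "mm n G' R k l - mm n G' R' k l = (\<Sum>m<n. G' k m * (R m l - R' m l))"
    by (simp add: mm_def sum_subtractf algebra_simps)
  also have "\<dots> = (g - g') * mm n G' (mm n R R') k l"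
    using assms by (simp add: R_diff mm_def[of n G'] sum_distrib_left mult_ac)
  finally have h: "mm n G' R k l - mm n G' R' k l = (g - g') * mm n G' (mm n R R') k l" .
  have "pmat n A C z k l - pmat n A' C z k l = (mm n G R k l - mm n G' R k l) + (mm n G' R k l - mm n G' R' k l)"
    by (simp add: pmat_def)
  hence eq: "(pmat n A C z k l - pmat n A' C z k l) - (d * (G k i * NR j l) + cnj d * (G k j * NR i l))
    = (g - g') * mm n G' (mm n R R') k l"
    unfolding mm_diff_left[OF assms] h by simp
  have "cmod ((pmat n A C z k l - pmat n A' C z k l) - (d * (G k i * NR j l) + cnj d * (G k j * NR i l)))
    = cmod (g - g') * cmod (mm n G' (mm n R R') k l)" unfolding eq by (rule norm_mult)
  also have "\<dots> \<le> \<kappa> / (2 * n) * (1/2 * (1/4))"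
    by (intro mult_mono g_diff_crude opb_entry[OF opb_mm[OF ops(2) opm[OF ops(3) ops(4)]]])
       (use assms kappa in auto)
  finally show ?thesis by simp
qed

lemma M_diff_crude:
  assumes "k < n" "l < n"
  shows "cmod (pmat n A C z k l - pmat n A' C z k l) \<le> \<kappa> / 2"
proof -
  have "cmod (d * (G k i * NR j l) + cnj d * (G k j * NR i l)) \<le> \<kappa> / 4"
    using mm_diff_left_bound[OF ops(3) assms] unfolding mm_diff_left[OF assms] .
  moreover have "\<kappa> / (16 * n) \<le> \<kappa> / 4" using n kappa by (intro divide_left_mono) auto
  ultimately show ?thesis
    using M_diff[OF assms] norm_triangle_sub[of "pmat n A C z k l - pmat n A' C z k l" "d * (G k i * NR j l) + cnj d * (G k j * NR i l)"]
    by linarith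
qed

text \<open>Multiplied by \<open>A i j\<close>, the conjugate term of the expansion becomes
  \<open>|A i j|^2 G_jj M_ii\<close>, which does not average out. The other term carries the
  off-diagonal entry \<open>G_ji\<close> and counts as an error.\<close>

lemma M_expand:
  assumes "A' i j = 0"
  shows "cmod (A i j * pmat n A' C z j i - A i j * pmat n A C z j i - (cmod (A i j))\<^sup>2 * (G j j * pmat n A C z i i))
     \<le> \<kappa>\<^sup>2 * (\<kappa> + cmod (G j i) + 1 / n)"
proof -
  define a where "a = A i j"
  let ?M = "pmat n A C z" and ?M' = "pmat n A' C z"
  have d: "d = - a" using assms by (simp add: a_def)
  have ak: "cmod a \<le> \<kappa>" using small d by simp
  define E where "E = (?M j i - ?M' j i) - (d * (G j i * NR j i) + cnj d * (G j j * NR i i))"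
  have E: "cmod E \<le> \<kappa> / (16 * n)" unfolding E_def by (rule M_diff) (use ij in auto)
  have NM: "cmod (?M i i - NR i i) \<le> \<kappa> / 4"
    unfolding pmat_def by (rule mm_diff_left_bound[OF ops(3)]) (use ij in auto)
  have aa: "a * cnj a = of_real ((cmod a)\<^sup>2)" by (metis complex_norm_square)
  have "a * ?M' j i - a * ?M j i = - a * (E + (d * (G j i * NR j i) + cnj d * (G j j * NR i i)))"
    by (simp add: E_def algebra_simps)
  also have "\<dots> = - a * E + a\<^sup>2 * (G j i * NR j i) + (a * cnj a) * (G j j * NR i i)"
    unfolding d by (simp add: algebra_simps power2_eq_square)
  finally have "a * ?M' j i - a * ?M j i - (cmod a)\<^sup>2 * (G j j * ?M i i)
    = - a * E + a\<^sup>2 * (G j i * NR j i) - (cmod a)\<^sup>2 * (G j j * (?M i i - NR i i))"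
    unfolding aa by (simp add: algebra_simps)
  hence tri: "cmod (a * ?M' j i - a * ?M j i - (cmod a)\<^sup>2 * (G j j * ?M i i)) \<le> cmod (a * E) + cmod (a\<^sup>2 * (G j i * NR j i)) + cmod ((cmod a)\<^sup>2 * (G j j * (?M i i - NR i i)))"
    using norm_triangle_ineq4[of "- a * E + a\<^sup>2 * (G j i * NR j i)" "(cmod a)\<^sup>2 * (G j j * (?M i i - NR i i))"]
      norm_triangle_ineq[of "- a * E" "a\<^sup>2 * (G j i * NR j i)"] by simp
  have b1: "cmod (a * E) \<le> \<kappa> * (\<kappa> / (16 * n))"
    unfolding norm_mult by (intro mult_mono ak E) (use kappa in auto)
  have b2: "cmod (a\<^sup>2 * (G j i * NR j i)) \<le> \<kappa>\<^sup>2 * (cmod (G j i) * (1/4))"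
    unfolding norm_mult norm_power
    by (intro mult_mono power_mono ak opb_entry[OF opm[OF ops(2,3)]]) (use ij kappa ak in auto)
  have b3: "cmod ((cmod a)\<^sup>2 * (G j j * (?M i i - NR i i))) \<le> \<kappa>\<^sup>2 * (1/2 * (\<kappa> / 4))"
    unfolding norm_mult norm_power norm_of_real abs_norm_cancel
    by (intro mult_mono power_mono ak opb_entry[OF ops(1)] NM) (use ij kappa ak in auto)
  have "\<kappa> * (\<kappa> / (16 * n)) + \<kappa>\<^sup>2 * (cmod (G j i) * (1/4)) + \<kappa>\<^sup>2 * (1/2 * (\<kappa> / 4))
     = \<kappa>\<^sup>2 * (\<kappa> / 8 + cmod (G j i) / 4 + 1 / (16 * n))"
    using n by (simp add: power2_eq_square field_simps)
  also have "\<dots> \<le> \<kappa>\<^sup>2 * (\<kappa> + cmod (G j i) + 1 / n)"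
    using kappa n by (intro mult_left_mono add_mono) (auto simp: field_simps)
  finally have "\<kappa> * (\<kappa> / (16 * n)) + \<kappa>\<^sup>2 * (cmod (G j i) * (1/4)) + \<kappa>\<^sup>2 * (1/2 * (\<kappa> / 4))
    \<le> \<kappa>\<^sup>2 * (\<kappa> + cmod (G j i) + 1 / n)" .
  hence "cmod (a * ?M' j i - a * ?M j i - (cmod a)\<^sup>2 * (G j j * ?M i i)) \<le> \<kappa>\<^sup>2 * (\<kappa> + cmod (G j i) + 1 / n)"
    using tri b1 b2 b3 by linarith
  thus ?thesis by (simp add: a_def)
qed

end

definition zero_entry :: "(nat \<Rightarrow> nat \<Rightarrow> complex) \<Rightarrow> nat \<Rightarrow> nat \<Rightarrow> nat \<Rightarrow> nat \<Rightarrow> complex" where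
  "zero_entry A i j k l = (if (k, l) = (i, j) \<or> (k, l) = (j, i) then 0 else A k l)"

lemma herm_zero_entry: "herm n A \<Longrightarrow> herm n (zero_entry A i j)"
  by (rule hermI) (auto simp: zero_entry_def hermD)

lemma entry_change_zero_entry:
  assumes "n > 0" "herm n A" "herm n C" "Im z \<ge> 2" "i < n" "j < n" "i \<noteq> j" "cmod (A i j) \<le> \<kappa>"
  shows "entry_change n A (zero_entry A i j) C z i j \<kappa>"
  by unfold_locales (use assms herm_zero_entry[OF assms(2)] in \<open>auto simp: zero_entry_def\<close>)

text \<open>The linear part of the defect, in which the matrix multiplying an entry does not depend on that entry.\<close>

definition plin :: "nat \<Rightarrow> (nat \<Rightarrow> nat \<Rightarrow> complex) \<Rightarrow> (nat \<Rightarrow> nat \<Rightarrow> complex) \<Rightarrow> complex \<Rightarrow> complex" where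
  "plin n A C z = (\<Sum>i<n. \<Sum>j<n. A i j * pmat n (zero_entry A i j) C z j i) / of_nat n"

text \<open>Cauchy-Schwarz gives \<open>n^(3/2)\<close> where bounding every entry by
  \<open>c\<close> would give \<open>n^2\<close>.\<close>

lemma sum_opb_entries:
  assumes "opb n c M" "c \<ge> 0"
  shows "(\<Sum>i<n. \<Sum>j<n. cmod (M i j)) \<le> c * (real n * sqrt n)"
proof -
  have "(\<Sum>i<n. \<Sum>j<n. cmod (M i j)) = (\<Sum>i<n. \<Sum>j<n. \<bar>1\<bar> * \<bar>cmod (M i j)\<bar>)" by simp
  also have "\<dots> \<le> sqrt (\<Sum>i<n. \<Sum>j<n. 1\<^sup>2) * sqrt (\<Sum>i<n. \<Sum>j<n. (cmod (M i j))\<^sup>2)"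
    by (rule double_sum_cauchy_schwarz)
  also have "\<dots> \<le> sqrt (real n * real n) * sqrt (real n * c\<^sup>2)"
    by (intro mult_mono real_sqrt_le_mono opb_hs assms) (auto simp: sum_nonneg)
  also have "\<dots> = c * (real n * sqrt n)" using assms(2) by (simp add: real_sqrt_mult)
  finally show ?thesis .
qed

text \<open>Each \<open>pmat\<close> is replaced by the one with its own entry removed, which by
  \<open>M_expand\<close> costs \<open>|A i j|^2 G_jj M_ii\<close>. Writing \<open>1 / n\<close> for
  \<open>|A i j|^2\<close> reproduces the product of traces in \<open>perr_formula\<close> up to the
  diagonal, so only the centred squares stay explicit; they are left to a probabilistic
  estimate.\<close>

lemma perr_plin:
  assumes n: "n > 0" and A: "herm n A" and C: "herm n C" and z: "Im z \<ge> 2"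
    and diag: "\<And>i. i < n \<Longrightarrow> A i i = 0"
    and small: "\<And>i j. i < n \<Longrightarrow> j < n \<Longrightarrow> cmod (A i j) \<le> \<kappa>" and k: "\<kappa> \<ge> 0"
  shows "cmod (perr n A C z - plin n A C z + (\<Sum>i<n. \<Sum>j<n. (if i = j then 0 else of_real ((cmod (A i j))\<^sup>2 - 1 / n))
     * (res n (hadd A C) z j j * pmat n A C z i i)) / of_nat n)
    \<le> \<kappa> ^ 3 * n + \<kappa>\<^sup>2 * sqrt n + \<kappa>\<^sup>2 + 1 / n"
proof -
  let ?M = "pmat n A C z" and ?G = "res n (hadd A C) z" and ?Z = "\<lambda>i j. pmat n (zero_entry A i j) C z"
  let ?g = "gres n (hadd A C) z"
  define r where "r i j = A i j * ?Z i j j i - A i j * ?M j i - of_real ((cmod (A i j))\<^sup>2) * (?G j j * ?M i i)" for i j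
  define s where "s i j = (if i = j then 0 else of_real ((cmod (A i j))\<^sup>2 - 1 / n) * (?G j j * ?M i i))" for i j
  have op: "opb n (1/2) ?G" using z herm_hadd[OF A C] by (intro opb_res) auto
  have opM: "opb n (1/4) ?M" by (rule opb_pmat[OF A C z])
  have rb: "cmod (r i j) \<le> \<kappa>\<^sup>2 * (\<kappa> + cmod (?G j i) + 1 / n)" if ij: "i < n" "j < n" for i j
  proof (cases "i = j")
    case True
    thus ?thesis using diag[OF ij(1)] k by (simp add: r_def)
  next
    case False
    interpret entry_change n A "zero_entry A i j" C z i j \<kappa>
      by (rule entry_change_zero_entry) (use assms ij False in auto)
    show ?thesis unfolding r_def by (rule M_expand) (simp add: zero_entry_def)
  qed
  \<comment> \<open>As a double sum the product of traces includes \<open>i = j\<close>. These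
    \<open>n\<close> terms have no counterpart among the entries of \<open>A\<close> and cause the
    error \<open>1 / n\<close>.\<close>
  have gM: "?g * (\<Sum>k<n. ?M k k) = (\<Sum>i<n. \<Sum>j<n. of_real (1 / n) * (?G j j * ?M i i))"
    unfolding gres_def sum_divide_distrib
    by (subst mult.commute, subst sum_product, intro sum.cong refl) simp
  have Aij: "A i j * ?M j i = A i j * ?Z i j j i - s i j - (if i = j then 0 else of_real (1 / n) * (?G j j * ?M i i)) - r i j"
    if "i < n" "j < n" for i j
    using diag[of i] that by (auto simp: s_def r_def algebra_simps)
  have "of_nat n * perr n A C z = (\<Sum>i<n. \<Sum>j<n. A i j * ?M j i) + (\<Sum>i<n. \<Sum>j<n. of_real (1 / n) * (?G j j * ?M i i))"
    using n unfolding perr_formula[OF A C z] gM by simp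
  also have "\<dots> = (\<Sum>i<n. \<Sum>j<n. A i j * ?Z i j j i - s i j - r i j + (if j = i then of_real (1 / n) * (?G i i * ?M i i) else 0))"
    unfolding sum.distrib[symmetric] by (intro sum.cong refl) (auto simp: Aij)
  also have "\<dots> = of_nat n * plin n A C z - (\<Sum>i<n. \<Sum>j<n. s i j) - (\<Sum>i<n. \<Sum>j<n. r i j) + (\<Sum>i<n. of_real (1 / n) * (?G i i * ?M i i))"
    using n by (simp add: sum.distrib sum_subtractf plin_def)
  finally have eq: "of_nat n * (perr n A C z - plin n A C z + (\<Sum>i<n. \<Sum>j<n. s i j) / of_nat n)
     = (\<Sum>i<n. of_real (1 / n) * (?G i i * ?M i i)) - (\<Sum>i<n. \<Sum>j<n. r i j)"
    using n by (simp add: algebra_simps)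
  have "cmod (\<Sum>i<n. of_real (1 / n) * (?G i i * ?M i i)) \<le> (\<Sum>i<n. 1 / n * (1/2 * (1/4)))"
    by (intro sum_norm_le, unfold norm_mult, intro mult_mono opb_entry[OF op] opb_entry[OF opM])
       (auto simp: norm_divide)
  also have "\<dots> \<le> 1" using n by simp
  finally have 1: "cmod (\<Sum>i<n. of_real (1 / n) * (?G i i * ?M i i)) \<le> 1" .
  have "cmod (\<Sum>i<n. \<Sum>j<n. r i j) \<le> (\<Sum>i<n. \<Sum>j<n. \<kappa>\<^sup>2 * (\<kappa> + cmod (?G j i) + 1 / n))"
    by (intro sum_norm_le rb) auto
  also have "\<dots> = \<kappa>\<^sup>2 * (real n * real n * \<kappa> + (\<Sum>i<n. \<Sum>j<n. cmod (?G j i)) + real n)"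
    using n by (simp add: sum.distrib sum_distrib_left[symmetric] algebra_simps)
  also have "(\<Sum>i<n. \<Sum>j<n. cmod (?G j i)) = (\<Sum>i<n. \<Sum>j<n. cmod (?G i j))" by (rule sum.swap)
  also have "\<kappa>\<^sup>2 * (real n * real n * \<kappa> + (\<Sum>i<n. \<Sum>j<n. cmod (?G i j)) + real n)
      \<le> \<kappa>\<^sup>2 * (real n * real n * \<kappa> + 1/2 * (real n * sqrt n) + real n)"
    by (intro mult_left_mono add_mono sum_opb_entries op) auto
  finally have 2: "cmod (\<Sum>i<n. \<Sum>j<n. r i j) \<le> \<kappa>\<^sup>2 * (real n * real n * \<kappa> + 1/2 * (real n * sqrt n) + real n)" .
  have "real n * cmod (perr n A C z - plin n A C z + (\<Sum>i<n. \<Sum>j<n. s i j) / of_nat n)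
     = cmod (of_nat n * (perr n A C z - plin n A C z + (\<Sum>i<n. \<Sum>j<n. s i j) / of_nat n))"
    unfolding norm_mult by simp
  also have "\<dots> \<le> 1 + \<kappa>\<^sup>2 * (real n * real n * \<kappa> + 1/2 * (real n * sqrt n) + real n)"
    unfolding eq by (rule order_trans[OF norm_triangle_ineq4 add_mono[OF 1 2]])
  also have "\<dots> \<le> 1 + \<kappa>\<^sup>2 * (real n * real n * \<kappa> + (real n * sqrt n) + real n)"
    by (intro add_left_mono mult_left_mono) auto
  also have "\<dots> = real n * (\<kappa> ^ 3 * n + \<kappa>\<^sup>2 * sqrt n + \<kappa>\<^sup>2 + 1 / n)"
    using n by (simp add: field_simps power3_eq_cube power2_eq_square)
  finally have "cmod (perr n A C z - plin n A C z + (\<Sum>i<n. \<Sum>j<n. s i j) / of_nat n)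
    \<le> \<kappa> ^ 3 * n + \<kappa>\<^sup>2 * sqrt n + \<kappa>\<^sup>2 + 1 / n" using n by simp
  moreover have "s i j = (if i = j then 0 else of_real ((cmod (A i j))\<^sup>2 - 1 / n)) * (?G j j * ?M i i)" for i j
    by (simp add: s_def)
  ultimately show ?thesis by simp
qed


section \<open>Concentration by resampling one coordinate\<close>

text \<open>The bound is symmetric in \<open>a\<close> and \<open>b\<close> on purpose: when a
  coordinate is exchanged with its copy, both summands get the same integral.\<close>

lemma exp_diff_abs_le: "\<bar>exp a - exp b\<bar> \<le> \<bar>a - b\<bar> * (exp a + exp b)" for a b :: real
proof -
  have *: "exp a - exp b \<le> (a - b) * exp a" for a b :: real
  proof -
    have "exp a * (1 + (b - a)) \<le> exp a * exp (b - a)" by (intro mult_left_mono exp_ge_add_one_self) auto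
    also have "exp a * exp (b - a) = exp b" by (simp add: exp_add[symmetric])
    finally show ?thesis by (simp add: algebra_simps)
  qed
  show ?thesis
  proof (cases "a \<ge> b")
    case True
    have "(a - b) * exp a \<le> (a - b) * (exp a + exp b)" using True by (intro mult_left_mono) auto
    moreover have "exp b \<le> exp a" using True by simp
    moreover have "\<bar>a - b\<bar> = a - b" "\<bar>exp a - exp b\<bar> = exp a - exp b" using True by simp_all
    ultimately show ?thesis using *[of a b] by ((simp only:), linarith?)
  next
    case False
    have "(b - a) * exp b \<le> (b - a) * (exp a + exp b)" using False by (intro mult_left_mono) auto
    moreover have "exp a \<le> exp b" using False by simp
    moreover have "\<bar>a - b\<bar> = b - a" "\<bar>exp a - exp b\<bar> = exp b - exp a" using False by simp_all
    ultimately show ?thesis using *[of b a] by ((simp only:), linarith?)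
  qed
qed

locale resample =
  fixes E :: "'i set" and \<mu> :: "'i \<Rightarrow> 'a measure"
  assumes finE: "finite E" and prob_mu: "\<And>e. prob_space (\<mu> e)"
begin

abbreviation "N \<equiv> Pi\<^sub>M E \<mu>"

sublocale product_prob_space \<mu> E
  by (intro product_prob_spaceI prob_mu)



lemma upd_measurable: "e \<in> E \<Longrightarrow> (\<lambda>p. (fst p)(e := snd p)) \<in> measurable (N \<Otimes>\<^sub>M \<mu> e) N"
  by (rule measurable_fun_upd[where J = E]) auto

lemma swap_measurable: "e \<in> E \<Longrightarrow> (\<lambda>p. ((fst p)(e := snd p), fst p e)) \<in> measurable (N \<Otimes>\<^sub>M \<mu> e) (N \<Otimes>\<^sub>M \<mu> e)"
  by (intro measurable_Pair upd_measurable) (auto intro!: measurable_compose[OF measurable_fst] measurable_component_singleton)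

text \<open>Splitting off coordinate \<open>e\<close> leaves two independent variables of law
  \<open>\<mu> e\<close>, the old and the new value, which Fubini's theorem exchanges. The bound
  \<open>B\<close> provides integrability.\<close>

lemma integral_swap:
  fixes h :: "('i \<Rightarrow> 'a) \<times> 'a \<Rightarrow> real"
  assumes e: "e \<in> E" and h[measurable]: "h \<in> borel_measurable (N \<Otimes>\<^sub>M \<mu> e)"
    and b: "\<And>p. p \<in> space (N \<Otimes>\<^sub>M \<mu> e) \<Longrightarrow> \<bar>h p\<bar> \<le> B"
  shows "(\<integral>x. (\<integral>y. h (x, y) \<partial>\<mu> e) \<partial>N) = (\<integral>x. (\<integral>y. h (x(e := y), x e) \<partial>\<mu> e) \<partial>N)"
proof -
  interpret Q: pair_prob_space N "\<mu> e" ..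
  interpret R: pair_prob_space "\<mu> e" "\<mu> e" ..
  define I where "I = E - {e}"
  have EI: "E = insert e I" "finite I" "e \<notin> I" using e finE by (auto simp: I_def)
  have NI: "N = Pi\<^sub>M (insert e I) \<mu>" using EI by simp
  define h' where "h' p = h ((fst p)(e := snd p), fst p e)" for p
  have h'm[measurable]: "h' \<in> borel_measurable (N \<Otimes>\<^sub>M \<mu> e)"
    unfolding h'_def using measurable_compose[OF swap_measurable[OF e] h] .
  have b': "\<bar>h' p\<bar> \<le> B" if "p \<in> space (N \<Otimes>\<^sub>M \<mu> e)" for p
    unfolding h'_def using measurable_space[OF swap_measurable[OF e] that] by (rule b)
  have int: "integrable N (\<lambda>x. \<integral>y. k (x, y) \<partial>\<mu> e)"
    if k: "k \<in> borel_measurable (N \<Otimes>\<^sub>M \<mu> e)" "\<And>p. p \<in> space (N \<Otimes>\<^sub>M \<mu> e) \<Longrightarrow> \<bar>k p\<bar> \<le> B" for k :: "_ \<Rightarrow> real"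
  proof -
    have "integrable (N \<Otimes>\<^sub>M \<mu> e) k"
      by (rule Q.P.integrable_const_bound[where B = B]) (use k in \<open>auto intro!: AE_I2\<close>)
    from Q.integrable_fst'[OF this] show ?thesis by simp
  qed
  have spN: "x(e := u) \<in> space N" if "x \<in> space (Pi\<^sub>M I \<mu>)" "u \<in> space (\<mu> e)" for x u
    using that EI by (auto simp: space_PiM PiE_def extensional_def)
  have upd2: "(\<lambda>p. (x(e := fst p), snd p)) \<in> measurable (\<mu> e \<Otimes>\<^sub>M \<mu> e) (N \<Otimes>\<^sub>M \<mu> e)"
    if x: "x \<in> space (Pi\<^sub>M I \<mu>)" for x
  proof (intro measurable_Pair)
    have "(\<lambda>p. (x)(e := fst p)) \<in> measurable (\<mu> e \<Otimes>\<^sub>M \<mu> e) (Pi\<^sub>M (insert e I) \<mu>)"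
      by (rule measurable_fun_upd[where J = I]) (use x in auto)
    thus "(\<lambda>p. x(e := fst p)) \<in> measurable (\<mu> e \<Otimes>\<^sub>M \<mu> e) N" using NI by simp
  qed auto
  have "(\<integral>x. (\<integral>y. h (x, y) \<partial>\<mu> e) \<partial>N) = (\<integral>x. (\<integral>u. (\<integral>y. h (x(e := u), y) \<partial>\<mu> e) \<partial>\<mu> e) \<partial>Pi\<^sub>M I \<mu>)"
    unfolding NI by (rule product_integral_insert) (use EI int[OF h b] NI in auto)
  also have "\<dots> = (\<integral>x. (\<integral>u. (\<integral>y. h (x(e := y), u) \<partial>\<mu> e) \<partial>\<mu> e) \<partial>Pi\<^sub>M I \<mu>)"
  proof (rule Bochner_Integration.integral_cong[OF refl])
    fix x assume x: "x \<in> space (Pi\<^sub>M I \<mu>)"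
    have "integrable (\<mu> e \<Otimes>\<^sub>M \<mu> e) (\<lambda>p. h (x(e := fst p), snd p))"
    proof (rule R.P.integrable_const_bound[where B = B])
      show "(\<lambda>p. h (x(e := fst p), snd p)) \<in> borel_measurable (\<mu> e \<Otimes>\<^sub>M \<mu> e)"
        by (rule measurable_compose[OF upd2[OF x] h])
      show "AE p in \<mu> e \<Otimes>\<^sub>M \<mu> e. norm (h (x(e := fst p), snd p)) \<le> B"
        using measurable_space[OF upd2[OF x]] by (intro AE_I2) (auto intro!: b)
    qed
    hence "integrable (\<mu> e \<Otimes>\<^sub>M \<mu> e) (\<lambda>(u, y). h (x(e := u), y))" by (simp add: case_prod_beta')
    from R.Fubini_integral[OF this]
    show "(\<integral>u. (\<integral>y. h (x(e := u), y) \<partial>\<mu> e) \<partial>\<mu> e) = (\<integral>u. (\<integral>y. h (x(e := y), u) \<partial>\<mu> e) \<partial>\<mu> e)" by simp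
  qed
  also have "\<dots> = (\<integral>x. (\<integral>u. (\<integral>y. h' (x(e := u), y) \<partial>\<mu> e) \<partial>\<mu> e) \<partial>Pi\<^sub>M I \<mu>)"
    by (simp add: h'_def)
  also have "\<dots> = (\<integral>x. (\<integral>y. h' (x, y) \<partial>\<mu> e) \<partial>N)"
    unfolding NI by (rule product_integral_insert[symmetric]) (use EI int[OF h'm b'] NI in auto)
  finally show ?thesis by (simp add: h'_def)
qed

text \<open>
  Since \<open>F e\<close> is antisymmetric under the exchange of the coordinate \<open>e\<close> with an independent copy,
  the integral of \<open>F e * exp (\<theta> \<phi>)\<close> involves only the increment of \<open>exp (\<theta> \<phi>)\<close> (Stein's method of
  exchangeable pairs, after Chatterjee).
\<close>

lemma exchangeable_integral:
  fixes \<phi> :: "('i \<Rightarrow> 'a) \<Rightarrow> real" and F :: "'i \<Rightarrow> ('i \<Rightarrow> 'a) \<times> 'a \<Rightarrow> real"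
  assumes \<phi>[measurable]: "\<phi> \<in> borel_measurable N" and \<phi>b: "\<And>x. x \<in> space N \<Longrightarrow> \<bar>\<phi> x\<bar> \<le> c"
    and F: "\<And>e. e \<in> E \<Longrightarrow> F e \<in> borel_measurable (N \<Otimes>\<^sub>M \<mu> e)"
    and Fb: "\<And>e p. e \<in> E \<Longrightarrow> p \<in> space (N \<Otimes>\<^sub>M \<mu> e) \<Longrightarrow> \<bar>F e p\<bar> \<le> c'"
    and anti: "\<And>e x y. e \<in> E \<Longrightarrow> x \<in> space N \<Longrightarrow> y \<in> space (\<mu> e) \<Longrightarrow> F e (x(e := y), x e) = - F e (x, y)"
    and b: "\<And>e x y. e \<in> E \<Longrightarrow> x \<in> space N \<Longrightarrow> y \<in> space (\<mu> e) \<Longrightarrow> \<bar>F e (x, y)\<bar> * \<bar>\<phi> x - \<phi> (x(e := y))\<bar> \<le> b e x"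
    and bB: "\<And>x. x \<in> space N \<Longrightarrow> (\<Sum>e\<in>E. b e x) \<le> B" and \<theta>: "\<theta> > 0"
  shows "integrable N (\<lambda>x. (\<Sum>e\<in>E. \<integral>y. F e (x, y) \<partial>\<mu> e) * exp (\<theta> * \<phi> x))"
    "(\<integral>x. (\<Sum>e\<in>E. \<integral>y. F e (x, y) \<partial>\<mu> e) * exp (\<theta> * \<phi> x) \<partial>N) \<le> \<theta> * B * (\<integral>x. exp (\<theta> * \<phi> x) \<partial>N)"
proof -
  let ?u = "\<lambda>x. exp (\<theta> * \<phi> x)"
  have ub: "\<bar>?u x\<bar> \<le> exp (\<theta> * c)" if "x \<in> space N" for x
    using \<phi>b[OF that] \<theta> by (simp add: mult_left_mono abs_le_iff)
  have uI: "integrable N ?u"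
    by (rule P.integrable_const_bound[where B = "exp (\<theta> * c)"]) (use \<theta> abs_le_D1[OF \<phi>b] in \<open>auto intro!: AE_I2\<close>)
  define D where "D e p = \<bar>F e p\<bar> * \<bar>\<phi> (fst p) - \<phi> ((fst p)(e := snd p))\<bar>" for e p
  have Eb: "integrable N (\<lambda>x. (\<integral>y. F e (x, y) \<partial>\<mu> e) * ?u x) \<and>
      integrable N (\<lambda>x. (\<integral>y. D e (x, y) \<partial>\<mu> e) * ?u x) \<and>
      (\<integral>x. (\<integral>y. F e (x, y) \<partial>\<mu> e) * ?u x \<partial>N) \<le> \<theta> * (\<integral>x. (\<integral>y. D e (x, y) \<partial>\<mu> e) * ?u x \<partial>N)" if e: "e \<in> E" for e
  proof -
    interpret Q: pair_prob_space N "\<mu> e" ..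
    note [measurable] = F[OF e] upd_measurable[OF e]
    have sp: "fst p \<in> space N" "snd p \<in> space (\<mu> e)" "(fst p)(e := snd p) \<in> space N"
      if "p \<in> space (N \<Otimes>\<^sub>M \<mu> e)" for p
      using that measurable_space[OF upd_measurable[OF e] that] by (auto simp: space_pair_measure)
    have Dm[measurable]: "D e \<in> borel_measurable (N \<Otimes>\<^sub>M \<mu> e)" unfolding D_def by measurable
    have Db: "\<bar>D e p\<bar> \<le> c' * (2 * c)" if "p \<in> space (N \<Otimes>\<^sub>M \<mu> e)" for p
    proof -
      have "\<bar>\<phi> (fst p) - \<phi> ((fst p)(e := snd p))\<bar> \<le> 2 * c"
        using \<phi>b[OF sp(1)[OF that]] \<phi>b[OF sp(3)[OF that]] by linarith
      thus ?thesis unfolding D_def abs_mult abs_abs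
        by (intro mult_mono Fb[OF e that]) (use Fb[OF e that] in auto)
    qed
    have bint: "integrable (N \<Otimes>\<^sub>M \<mu> e) k" if "k \<in> borel_measurable (N \<Otimes>\<^sub>M \<mu> e)" "\<And>p. p \<in> space (N \<Otimes>\<^sub>M \<mu> e) \<Longrightarrow> \<bar>k p\<bar> \<le> K" for k :: "_ \<Rightarrow> real" and K
      by (rule Q.P.integrable_const_bound[where B = K]) (use that in \<open>auto intro!: AE_I2\<close>)
    have prodb: "\<bar>k * w\<bar> \<le> K * exp (\<theta> * c)" if "\<bar>k\<bar> \<le> K" "\<bar>w\<bar> \<le> exp (\<theta> * c)" for k w K :: real
      unfolding abs_mult by (intro mult_mono that) (use that(1) in auto)
    define f1 where "f1 p = F e p * ?u (fst p)" for p
    define f2 where "f2 p = F e p * ?u ((fst p)(e := snd p))" for p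
    define d1 where "d1 p = D e p * ?u (fst p)" for p
    define d2 where "d2 p = D e p * ?u ((fst p)(e := snd p))" for p
    have m[measurable]: "f1 \<in> borel_measurable (N \<Otimes>\<^sub>M \<mu> e)" "f2 \<in> borel_measurable (N \<Otimes>\<^sub>M \<mu> e)"
      "d1 \<in> borel_measurable (N \<Otimes>\<^sub>M \<mu> e)" "d2 \<in> borel_measurable (N \<Otimes>\<^sub>M \<mu> e)"
      unfolding f1_def f2_def d1_def d2_def by measurable
    have bds: "\<bar>f1 p\<bar> \<le> c' * exp (\<theta> * c)" "\<bar>f2 p\<bar> \<le> c' * exp (\<theta> * c)"
      "\<bar>d1 p\<bar> \<le> c' * (2 * c) * exp (\<theta> * c)" "\<bar>d2 p\<bar> \<le> c' * (2 * c) * exp (\<theta> * c)"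
      if "p \<in> space (N \<Otimes>\<^sub>M \<mu> e)" for p
      unfolding f1_def f2_def d1_def d2_def
      by (rule prodb[OF Fb[OF e that] ub[OF sp(1)[OF that]]] prodb[OF Fb[OF e that] ub[OF sp(3)[OF that]]]
          prodb[OF Db[OF that] ub[OF sp(1)[OF that]]] prodb[OF Db[OF that] ub[OF sp(3)[OF that]]])+
    have ints: "integrable (N \<Otimes>\<^sub>M \<mu> e) f1" "integrable (N \<Otimes>\<^sub>M \<mu> e) f2" "integrable (N \<Otimes>\<^sub>M \<mu> e) d1" "integrable (N \<Otimes>\<^sub>M \<mu> e) d2"
      by (rule bint, measurable, erule bds)+
    have pull: "(\<lambda>x. (\<integral>y. F e (x, y) \<partial>\<mu> e) * ?u x) = (\<lambda>x. \<integral>y. f1 (x, y) \<partial>\<mu> e)"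
      "(\<lambda>x. (\<integral>y. D e (x, y) \<partial>\<mu> e) * ?u x) = (\<lambda>x. \<integral>y. d1 (x, y) \<partial>\<mu> e)"
      by (simp_all add: f1_def d1_def)
    have it: "(\<integral>x. (\<integral>y. k (x, y) \<partial>\<mu> e) \<partial>N) = (\<integral>p. k p \<partial>(N \<Otimes>\<^sub>M \<mu> e))" if "integrable (N \<Otimes>\<^sub>M \<mu> e) k" for k :: "_ \<Rightarrow> real"
      using Q.integral_fst'[OF that] .
    have s1: "(\<integral>x. (\<integral>y. f1 (x, y) \<partial>\<mu> e) \<partial>N) = - (\<integral>x. (\<integral>y. f2 (x, y) \<partial>\<mu> e) \<partial>N)"
    proof -
      have "(\<integral>x. (\<integral>y. f1 (x, y) \<partial>\<mu> e) \<partial>N) = (\<integral>x. (\<integral>y. f1 (x(e := y), x e) \<partial>\<mu> e) \<partial>N)"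
        by (rule integral_swap[OF e]) (auto intro: bds)
      also have "\<dots> = (\<integral>x. (\<integral>y. - f2 (x, y) \<partial>\<mu> e) \<partial>N)"
        by (intro Bochner_Integration.integral_cong refl) (simp add: f1_def f2_def anti[OF e])
      finally show ?thesis by simp
    qed
    have s2: "(\<integral>x. (\<integral>y. d2 (x, y) \<partial>\<mu> e) \<partial>N) = (\<integral>x. (\<integral>y. d1 (x, y) \<partial>\<mu> e) \<partial>N)"
    proof -
      have "(\<integral>x. (\<integral>y. d2 (x, y) \<partial>\<mu> e) \<partial>N) = (\<integral>x. (\<integral>y. d2 (x(e := y), x e) \<partial>\<mu> e) \<partial>N)"
        by (rule integral_swap[OF e]) (auto intro: bds)
      also have "\<dots> = (\<integral>x. (\<integral>y. d1 (x, y) \<partial>\<mu> e) \<partial>N)"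
        by (intro Bochner_Integration.integral_cong refl) (simp add: d1_def d2_def D_def anti[OF e] abs_minus_commute)
      finally show ?thesis .
    qed
    \<comment> \<open>The same integral is written before and after the exchange; by antisymmetry
      the average of the two contains only the increment of the exponential.\<close>
    have "2 * (\<integral>x. (\<integral>y. f1 (x, y) \<partial>\<mu> e) \<partial>N) = (\<integral>p. f1 p - f2 p \<partial>(N \<Otimes>\<^sub>M \<mu> e))"
      using s1 it ints by simp
    also have "\<dots> \<le> (\<integral>p. \<theta> * (d1 p + d2 p) \<partial>(N \<Otimes>\<^sub>M \<mu> e))"
    proof (rule integral_mono)
      fix p
      have "f1 p - f2 p = F e p * (?u (fst p) - ?u ((fst p)(e := snd p)))"
        by (simp add: f1_def f2_def algebra_simps)
      also have "\<dots> \<le> \<bar>F e p\<bar> * \<bar>?u (fst p) - ?u ((fst p)(e := snd p))\<bar>"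
        by (metis abs_ge_self abs_mult)
      also have "\<dots> \<le> \<bar>F e p\<bar> * (\<bar>\<theta> * \<phi> (fst p) - \<theta> * \<phi> ((fst p)(e := snd p))\<bar> * (?u (fst p) + ?u ((fst p)(e := snd p))))"
        by (intro mult_left_mono exp_diff_abs_le) auto
      also have "\<bar>\<theta> * \<phi> (fst p) - \<theta> * \<phi> ((fst p)(e := snd p))\<bar> = \<theta> * \<bar>\<phi> (fst p) - \<phi> ((fst p)(e := snd p))\<bar>"
        using \<theta> by (simp add: abs_mult flip: right_diff_distrib)
      finally show "f1 p - f2 p \<le> \<theta> * (d1 p + d2 p)"
        unfolding d1_def d2_def D_def by (simp only: distrib_left mult_ac)
    qed (use ints in auto)
    also have "\<dots> = \<theta> * ((\<integral>x. (\<integral>y. d1 (x, y) \<partial>\<mu> e) \<partial>N) + (\<integral>x. (\<integral>y. d2 (x, y) \<partial>\<mu> e) \<partial>N))"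
      using it ints by simp
    finally have le: "(\<integral>x. (\<integral>y. f1 (x, y) \<partial>\<mu> e) \<partial>N) \<le> \<theta> * (\<integral>x. (\<integral>y. d1 (x, y) \<partial>\<mu> e) \<partial>N)" using s2 by simp
    show ?thesis unfolding pull using le Q.integrable_fst'[OF ints(1)] Q.integrable_fst'[OF ints(3)] by simp
  qed
  show I1: "integrable N (\<lambda>x. (\<Sum>e\<in>E. \<integral>y. F e (x, y) \<partial>\<mu> e) * ?u x)"
    unfolding sum_distrib_right by (intro Bochner_Integration.integrable_sum) (use Eb in auto)
  have I2: "integrable N (\<lambda>x. (\<Sum>e\<in>E. \<integral>y. D e (x, y) \<partial>\<mu> e) * ?u x)"
    unfolding sum_distrib_right by (intro Bochner_Integration.integrable_sum) (use Eb in auto)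
  have "(\<integral>x. (\<Sum>e\<in>E. \<integral>y. F e (x, y) \<partial>\<mu> e) * ?u x \<partial>N) = (\<Sum>e\<in>E. \<integral>x. (\<integral>y. F e (x, y) \<partial>\<mu> e) * ?u x \<partial>N)"
    unfolding sum_distrib_right by (intro Bochner_Integration.integral_sum) (use Eb in auto)
  also have "\<dots> \<le> (\<Sum>e\<in>E. \<theta> * (\<integral>x. (\<integral>y. D e (x, y) \<partial>\<mu> e) * ?u x \<partial>N))"
    by (intro sum_mono) (use Eb in auto)
  also have "\<dots> = \<theta> * (\<integral>x. (\<Sum>e\<in>E. \<integral>y. D e (x, y) \<partial>\<mu> e) * ?u x \<partial>N)"
    unfolding sum_distrib_right sum_distrib_left[symmetric]
    by (subst Bochner_Integration.integral_sum) (use Eb in auto)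
  also have "\<dots> \<le> \<theta> * (\<integral>x. B * ?u x \<partial>N)"
  proof (intro mult_left_mono integral_mono)
    fix x assume x: "x \<in> space N"
    have "(\<Sum>e\<in>E. \<integral>y. D e (x, y) \<partial>\<mu> e) \<le> (\<Sum>e\<in>E. b e x)"
    proof (rule sum_mono)
      fix e assume e: "e \<in> E"
      have bd: "D e (x, y) \<le> b e x" if "y \<in> space (\<mu> e)" for y
        using b[OF e x that] by (simp add: D_def)
      have "b e x \<ge> 0"
        using b[OF e x] prob_space.not_empty[OF prob_mu] by (metis abs_ge_zero equals0I mult_nonneg_nonneg order_trans)
      thus "(\<integral>y. D e (x, y) \<partial>\<mu> e) \<le> b e x"
        using bd prob_space.integral_le_const[OF prob_mu, of e "\<lambda>y. D e (x, y)" "b e x"]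
        by (cases "integrable (\<mu> e) (\<lambda>y. D e (x, y))") (auto simp: not_integrable_integral_eq intro!: AE_I2)
    qed
    also have "\<dots> \<le> B" by (rule bB[OF x])
    finally show "(\<Sum>e\<in>E. \<integral>y. D e (x, y) \<partial>\<mu> e) * ?u x \<le> B * ?u x" by (intro mult_right_mono) auto
  qed (use \<theta> I2 uI in auto)
  finally show "(\<integral>x. (\<Sum>e\<in>E. \<integral>y. F e (x, y) \<partial>\<mu> e) * ?u x \<partial>N) \<le> \<theta> * B * (\<integral>x. ?u x \<partial>N)" by simp
qed

text \<open>Integrates \<open>(\<phi> - s) exp(\<theta> \<phi>)\<close>. Off \<open>bad\<close>,
  \<phi> exceeds the sum of integrals by at most \<eta>, and that sum contributes at most
  \<open>\<theta> B\<close> times the exponential moment by \<open>exchangeable_integral\<close>.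
  The integrand is at least \<open>t exp(\<theta> (s + t))\<close> on the event and at least
  \<open>- exp(\<theta> s) / \<theta>\<close> elsewhere. On \<open>bad\<close> the crude bounds
  \<open>C\<close> and \<open>c\<close> enter, multiplied by its probability.\<close>

lemma exchangeable_tail:
  fixes \<phi> :: "('i \<Rightarrow> 'a) \<Rightarrow> real" and F :: "'i \<Rightarrow> ('i \<Rightarrow> 'a) \<times> 'a \<Rightarrow> real"
  assumes \<phi>[measurable]: "\<phi> \<in> borel_measurable N" and \<phi>b: "\<And>x. x \<in> space N \<Longrightarrow> \<bar>\<phi> x\<bar> \<le> c"
    and F: "\<And>e. e \<in> E \<Longrightarrow> F e \<in> borel_measurable (N \<Otimes>\<^sub>M \<mu> e)"
    and Fb: "\<And>e p. e \<in> E \<Longrightarrow> p \<in> space (N \<Otimes>\<^sub>M \<mu> e) \<Longrightarrow> \<bar>F e p\<bar> \<le> c'"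
    and anti: "\<And>e x y. e \<in> E \<Longrightarrow> x \<in> space N \<Longrightarrow> y \<in> space (\<mu> e) \<Longrightarrow> F e (x(e := y), x e) = - F e (x, y)"
    and b: "\<And>e x y. e \<in> E \<Longrightarrow> x \<in> space N \<Longrightarrow> y \<in> space (\<mu> e) \<Longrightarrow> \<bar>F e (x, y)\<bar> * \<bar>\<phi> x - \<phi> (x(e := y))\<bar> \<le> b e x"
    and bB: "\<And>x. x \<in> space N \<Longrightarrow> (\<Sum>e\<in>E. b e x) \<le> B" and \<theta>: "\<theta> > 0" and t: "t > 0" and s: "s \<ge> 0" "s \<ge> \<theta> * B + \<eta>"
    and bad: "bad \<in> sets N" and C: "\<And>x. x \<in> space N \<Longrightarrow> \<phi> x - (\<Sum>e\<in>E. \<integral>y. F e (x, y) \<partial>\<mu> e) \<le> C"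
    and C0: "C \<ge> 0" and \<eta>: "\<eta> \<ge> 0" and good: "\<And>x. x \<in> space N \<Longrightarrow> x \<notin> bad \<Longrightarrow> \<phi> x - (\<Sum>e\<in>E. \<integral>y. F e (x, y) \<partial>\<mu> e) \<le> \<eta>"
  shows "measure N {x \<in> space N. \<phi> x \<ge> s + t} \<le> exp (- \<theta> * t) / (\<theta> * t) + C * exp (\<theta> * c) / t * measure N bad"
proof -
  let ?u = "\<lambda>x. exp (\<theta> * \<phi> x)" and ?S = "\<lambda>x. \<Sum>e\<in>E. \<integral>y. F e (x, y) \<partial>\<mu> e"
  let ?A = "{x \<in> space N. \<phi> x \<ge> s + t}"
  have A[measurable]: "?A \<in> sets N" by measurable
  note [measurable] = bad
  have ub: "?u x \<le> exp (\<theta> * c)" if "x \<in> space N" for x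
    using \<phi>b[OF that] \<theta> by (simp add: mult_left_mono abs_le_iff)
  have uI[simp]: "integrable N ?u"
    by (rule P.integrable_const_bound[where B = "exp (\<theta> * c)"]) (use \<theta> abs_le_D1[OF \<phi>b] in \<open>auto intro!: AE_I2\<close>)
  have SI[simp]: "integrable N (\<lambda>x. ?S x * ?u x)" and Sle: "(\<integral>x. ?S x * ?u x \<partial>N) \<le> \<theta> * B * (\<integral>x. ?u x \<partial>N)"
    using exchangeable_integral[OF \<phi> \<phi>b F Fb anti b bB \<theta>] by blast+
  have iI[simp]: "integrable N (indicator bad :: _ \<Rightarrow> real)" "integrable N (indicator ?A :: _ \<Rightarrow> real)"
    by (auto intro!: integrable_real_indicator simp: P.emeasure_eq_measure)
  have pt: "t * exp (\<theta> * (s + t)) * indicator ?A x - exp (\<theta> * s) / \<theta>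
      \<le> ?S x * ?u x + \<eta> * ?u x + C * exp (\<theta> * c) * indicator bad x - s * ?u x" if x: "x \<in> space N" for x
  proof -
    have 1: "(\<phi> x - s) * ?u x \<ge> t * exp (\<theta> * (s + t)) * indicator ?A x - exp (\<theta> * s) / \<theta>"
    proof (cases "\<phi> x \<ge> s + t")
      case True
      have "t * exp (\<theta> * (s + t)) \<le> (\<phi> x - s) * ?u x"
        using True t \<theta> by (intro mult_mono) auto
      moreover have "exp (\<theta> * s) / \<theta> \<ge> 0" using \<theta> by simp
      ultimately show ?thesis using True x by simp
    next
      case False
      have "(\<phi> x - s) * ?u x \<ge> - (exp (\<theta> * s) / \<theta>)"
      proof -
        \<comment> \<open>The negative part of the integrand is \<open>- v exp(- v)\<close> in this
          variable, up to \<open>exp(\<theta> s) / \<theta>\<close>.\<close>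
        define v where "v = \<theta> * (s - \<phi> x)"
        have "v \<le> exp v" using exp_ge_add_one_self[of v] by linarith
        hence "v * exp (- v) \<le> 1" by (simp add: exp_minus field_simps)
        hence "exp (\<theta> * s) * (v * exp (- v)) \<le> exp (\<theta> * s) * 1" by (intro mult_left_mono) auto
        moreover have "?u x = exp (\<theta> * s) * exp (- v)" by (simp add: v_def exp_add[symmetric] algebra_simps)
        ultimately have "v * ?u x \<le> exp (\<theta> * s)" by (simp only: mult_ac mult_1_right)
        thus ?thesis using \<theta> by (simp add: v_def field_simps)
      qed
      thus ?thesis using False by simp
    qed
    have 2: "(\<phi> x - ?S x) * ?u x \<le> \<eta> * ?u x + C * exp (\<theta> * c) * indicator bad x"
    proof (cases "x \<in> bad")
      case True
      have "(\<phi> x - ?S x) * ?u x \<le> C * ?u x" by (intro mult_right_mono C x) auto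
      also have "\<dots> \<le> C * exp (\<theta> * c)" by (intro mult_left_mono ub x C0)
      also have "\<dots> \<le> \<eta> * ?u x + C * exp (\<theta> * c) * indicator bad x" using True \<eta> by simp
      finally show ?thesis .
    next
      case False
      have "(\<phi> x - ?S x) * ?u x \<le> \<eta> * ?u x" by (intro mult_right_mono good x False) auto
      thus ?thesis using False by simp
    qed
    show ?thesis using 1 2 by (simp add: algebra_simps)
  qed
  have "(\<integral>x. t * exp (\<theta> * (s + t)) * indicator ?A x - exp (\<theta> * s) / \<theta> \<partial>N)
      \<le> (\<integral>x. ?S x * ?u x + \<eta> * ?u x + C * exp (\<theta> * c) * indicator bad x - s * ?u x \<partial>N)"
    by (intro integral_mono pt) auto
  hence "t * exp (\<theta> * (s + t)) * measure N ?A - exp (\<theta> * s) / \<theta>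
      \<le> (\<integral>x. ?S x * ?u x \<partial>N) + \<eta> * (\<integral>x. ?u x \<partial>N) + C * exp (\<theta> * c) * measure N bad - s * (\<integral>x. ?u x \<partial>N)"
    by (simp add: P.prob_space)
  also have "\<dots> \<le> \<theta> * B * (\<integral>x. ?u x \<partial>N) + \<eta> * (\<integral>x. ?u x \<partial>N) + C * exp (\<theta> * c) * measure N bad - s * (\<integral>x. ?u x \<partial>N)"
    using Sle by simp
  \<comment> \<open>By the choice of \<open>s\<close> the coefficient of the exponential moment is
    not positive, so this unknown moment drops out and is never estimated.\<close>
  also have "\<dots> = (\<theta> * B + \<eta> - s) * (\<integral>x. ?u x \<partial>N) + C * exp (\<theta> * c) * measure N bad" by (simp add: algebra_simps)
  also have "\<dots> \<le> C * exp (\<theta> * c) * measure N bad"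
    using s(2) by (simp add: mult_nonpos_nonneg)
  finally have "t * exp (\<theta> * (s + t)) * measure N ?A \<le> exp (\<theta> * s) / \<theta> + C * exp (\<theta> * c) * measure N bad" by simp
  hence "measure N ?A \<le> (exp (\<theta> * s) / \<theta> + C * exp (\<theta> * c) * measure N bad) / (t * exp (\<theta> * (s + t)))"
    using t by (simp add: pos_le_divide_eq mult.commute)
  also have "\<dots> = exp (\<theta> * s) / \<theta> / (t * exp (\<theta> * (s + t))) + C * exp (\<theta> * c) / t * measure N bad / exp (\<theta> * (s + t))"
    by (simp add: add_divide_distrib)
  also have "exp (\<theta> * s) / \<theta> / (t * exp (\<theta> * (s + t))) = exp (- \<theta> * t) / (\<theta> * t)"
    by (simp add: exp_add exp_minus distrib_left divide_simps)
  also have "C * exp (\<theta> * c) / t * measure N bad / exp (\<theta> * (s + t)) \<le> C * exp (\<theta> * c) / t * measure N bad / 1"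
    using s(1) t \<theta> C0 by (intro divide_left_mono) auto
  finally show ?thesis by simp
qed

end


section \<open>The defect for a random matrix with truncated entries\<close>

lemma det_measurable:
  fixes f :: "'x \<Rightarrow> nat \<Rightarrow> nat \<Rightarrow> complex"
  assumes "\<And>i j. i < m \<Longrightarrow> j < m \<Longrightarrow> (\<lambda>x. f x i j) \<in> borel_measurable M"
  shows "(\<lambda>x. Determinant.det (Matrix.mat m m (\<lambda>(i, j). f x i j))) \<in> borel_measurable M"
proof -
  have "Determinant.det (Matrix.mat m m (\<lambda>(i, j). f x i j))
     = (\<Sum>p \<in> {p. p permutes {0..<m}}. signof p * (\<Prod>i = 0..<m. f x i (p i)))" for x
    unfolding Determinant.det_def
    by (auto intro!: sum.cong prod.cong simp: permutes_in_image dest: permutes_in_image)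
  moreover have "(\<lambda>x. \<Sum>p \<in> {p. p permutes {0..<m}}. signof p * (\<Prod>i = 0..<m. f x i (p i))) \<in> borel_measurable M"
    by (intro borel_measurable_sum borel_measurable_times borel_measurable_const borel_measurable_prod assms)
       (auto dest: permutes_in_image)
  ultimately show ?thesis by simp
qed

lemma res_measurable:
  assumes H: "\<And>i j. i < n \<Longrightarrow> j < n \<Longrightarrow> (\<lambda>x. H x i j) \<in> borel_measurable M"
    and w: "w \<in> borel_measurable M" and ij: "i < n" "j < n"
  shows "(\<lambda>x. res n (H x) (w x) i j) \<in> borel_measurable M"
proof -
  have sh: "(\<lambda>x. shift (H x) (w x) k l) \<in> borel_measurable M" if "k < n" "l < n" for k l
    unfolding shift_def using H[OF that] w by auto
  let ?A = "\<lambda>x. Matrix.mat n n (\<lambda>(i, j). shift (H x) (w x) i j)"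
  define q where "q k r = (if r < k then r else Suc r)" for k r :: nat
  have "mat_delete (?A x) j i = Matrix.mat (n - 1) (n - 1) (\<lambda>(k, l). shift (H x) (w x) (q j k) (q i l))" for x
    using ij by (intro eq_matI) (auto simp: mat_delete_def q_def)
  hence c: "cofactor (?A x) j i = (-1) ^ (j + i) * Determinant.det (Matrix.mat (n - 1) (n - 1) (\<lambda>(k, l). shift (H x) (w x) (q j k) (q i l)))" for x
    by (simp add: cofactor_def)
  show ?thesis unfolding res_def Let_def c
    by (intro borel_measurable_divide borel_measurable_times borel_measurable_const det_measurable sh)
       (auto simp: q_def)
qed

lemma gres_measurable:
  assumes "\<And>i j. i < n \<Longrightarrow> j < n \<Longrightarrow> (\<lambda>x. H x i j) \<in> borel_measurable M" "w \<in> borel_measurable M"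
  shows "(\<lambda>x. gres n (H x) (w x)) \<in> borel_measurable M"
  unfolding gres_def
  by (intro borel_measurable_divide borel_measurable_sum borel_measurable_const res_measurable assms) auto

lemma gres_hadd_measurable:
  assumes "\<And>i j. i < n \<Longrightarrow> j < n \<Longrightarrow> (\<lambda>x. A x i j) \<in> borel_measurable M"
    "\<And>i j. i < n \<Longrightarrow> j < n \<Longrightarrow> (\<lambda>x. C x i j) \<in> borel_measurable M"
  shows "(\<lambda>x. gres n (hadd (A x) (C x)) z) \<in> borel_measurable M"
  using assms by (intro gres_measurable) (auto simp: hadd_def)

lemma perr_measurable:
  assumes "\<And>i j. i < n \<Longrightarrow> j < n \<Longrightarrow> (\<lambda>x. A x i j) \<in> borel_measurable M"
    "\<And>i j. i < n \<Longrightarrow> j < n \<Longrightarrow> (\<lambda>x. C x i j) \<in> borel_measurable M"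
  shows "(\<lambda>x. perr n (A x) (C x) z) \<in> borel_measurable M"
  unfolding perr_def
  by (intro borel_measurable_diff gres_measurable borel_measurable_add borel_measurable_const gres_hadd_measurable assms)

lemma pmat_measurable:
  assumes "\<And>i j. i < n \<Longrightarrow> j < n \<Longrightarrow> (\<lambda>x. A x i j) \<in> borel_measurable M"
    "\<And>i j. i < n \<Longrightarrow> j < n \<Longrightarrow> (\<lambda>x. C x i j) \<in> borel_measurable M" and ij: "i < n" "j < n"
  shows "(\<lambda>x. pmat n (A x) (C x) z i j) \<in> borel_measurable M"
  unfolding pmat_def mm_def using assms
  by (intro borel_measurable_sum borel_measurable_times res_measurable borel_measurable_add borel_measurable_const gres_hadd_measurable)
     (auto simp: hadd_def)

lemma perr_bound:
  assumes "herm n A" "herm n C" "Im z \<ge> 2"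
  shows "cmod (perr n A C z) \<le> 1"
  using gres_bound[OF assms(2) shifted_im[OF assms]] gres_bound[OF herm_hadd[OF assms(1,2)] assms(3)]
    norm_triangle_ineq4[of "gres n C (z + gres n (hadd A C) z)" "gres n (hadd A C) z"]
  by (simp add: perr_def)

definition edges :: "nat \<Rightarrow> (nat \<times> nat) set" where
  "edges n = {(i, j). i \<le> j \<and> j < n}"

lemma edgeI: "i \<le> j \<Longrightarrow> j < n \<Longrightarrow> (i, j) \<in> edges n" by (simp add: edges_def)

lemma cnj_measurable: "f \<in> borel_measurable M \<Longrightarrow> (\<lambda>x. cnj (f x)) \<in> borel_measurable M"
  by (erule measurable_compose) (intro borel_measurable_continuous_onI continuous_intros)

lemma edges_subset: "edges n \<subseteq> {..<n} \<times> {..<n}" by (auto simp: edges_def)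

lemma finite_edges[simp]: "finite (edges n)"
  by (rule finite_subset[OF edges_subset]) auto

lemma card_edges: "card (edges n) \<le> n * n"
  using card_mono[OF _ edges_subset, of n] by simp

lemma sum_edges:
  fixes f :: "nat \<Rightarrow> nat \<Rightarrow> 'b::comm_monoid_add"
  shows "(\<Sum>i<n. \<Sum>j<n. f i j) = (\<Sum>(i, j)\<in>edges n. if i < j then f i j + f j i else f i j)"
proof -
  have d: "{..<n} \<times> {..<n} = edges n \<union> {(i, j). j < i \<and> i < n}" by (auto simp: edges_def)
  have fin: "finite {(i, j). j < i \<and> i < n}"
    by (rule finite_subset[of _ "{..<n} \<times> {..<n}"]) auto
  have "(\<Sum>i<n. \<Sum>j<n. f i j) = (\<Sum>(i, j)\<in>{..<n} \<times> {..<n}. f i j)" by (simp add: sum.cartesian_product)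
  also have "\<dots> = (\<Sum>(i, j)\<in>edges n. f i j) + (\<Sum>(i, j)\<in>{(i, j). j < i \<and> i < n}. f i j)"
    unfolding d by (rule sum.union_disjoint[OF finite_edges fin]) (auto simp: edges_def)
  also have "(\<Sum>(i, j)\<in>{(i, j). j < i \<and> i < n}. f i j) = (\<Sum>(i, j)\<in>{(i, j). i < j \<and> j < n}. f j i)"
    by (rule sum.reindex_bij_witness[where i = "\<lambda>(i, j). (j, i)" and j = "\<lambda>(i, j). (j, i)"]) auto
  also have "\<dots> = (\<Sum>(i, j)\<in>edges n. if i < j then f j i else 0)"
    by (rule sum.mono_neutral_cong_left[OF finite_edges]) (auto simp: edges_def split: if_splits)
  finally show ?thesis unfolding sum.distrib[symmetric] by (simp add: case_prod_beta' if_distrib cong: if_cong)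
qed

text \<open>The functions \<open>a\<close> and \<open>c\<close> give the small recentred part and
  the large part of an entry. They live on complementary sets, so exchanging two values in
  \<open>S\<close> moves \<open>A\<close> and leaves \<open>C\<close> alone. Here \<open>p\<close>
  is the probability of \<open>S\<close> off the diagonal, and \<epsilon> measures how far the
  variance of the small part is from \<open>1 / n\<close>.\<close>

locale trunc_law = resample "edges n" \<mu> for n :: nat and \<mu> :: "nat \<times> nat \<Rightarrow> complex measure" +
  fixes S :: "complex set" and a c :: "complex \<Rightarrow> complex" and \<kappa> p m2 \<epsilon> :: real
  assumes n: "n > 0" and sets_mu: "\<And>e. sets (\<mu> e) = sets borel"
    and S: "S \<in> sets borel" and a[measurable]: "a \<in> borel_measurable borel" and c[measurable]: "c \<in> borel_measurable borel"
    and aS: "\<And>u. u \<notin> S \<Longrightarrow> a u = 0" and a\<kappa>: "\<And>u. cmod (a u) \<le> \<kappa>" and cS: "\<And>u. u \<in> S \<Longrightarrow> c u = 0"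
    and \<kappa>: "\<kappa> > 0" and p: "p > 0"
    and pS: "\<And>i j. i < j \<Longrightarrow> j < n \<Longrightarrow> measure (\<mu> (i, j)) S = p"
    and a0: "\<And>i j. i < j \<Longrightarrow> j < n \<Longrightarrow> (\<integral>u. a u \<partial>\<mu> (i, j)) = 0"
    and m2: "\<And>i j. i < j \<Longrightarrow> j < n \<Longrightarrow> (\<integral>u. (cmod (a u))\<^sup>2 \<partial>\<mu> (i, j)) = m2"
    and \<epsilon>: "\<bar>m2 - 1 / n\<bar> \<le> \<epsilon> / n"
begin

lemma measurable_mu: "measurable (\<mu> e) M = measurable borel M" "measurable M (\<mu> e) = measurable M borel"
  by (rule measurable_cong_sets; simp add: sets_mu)+

definition Amat :: "(nat \<times> nat \<Rightarrow> complex) \<Rightarrow> nat \<Rightarrow> nat \<Rightarrow> complex" where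
  "Amat x i j = (if i < j then a (x (i, j)) else if j < i then cnj (a (x (j, i))) else 0)"

text \<open>Taking \<open>Re\<close> on the diagonal makes the matrix Hermitian at every sample
  point, not just where the diagonal entries are real.\<close>

definition Cmat :: "(nat \<times> nat \<Rightarrow> complex) \<Rightarrow> nat \<Rightarrow> nat \<Rightarrow> complex" where
  "Cmat x i j = (if i < j then c (x (i, j)) else if j < i then cnj (c (x (j, i))) else of_real (Re (c (x (i, i)))))"

lemma herm_Amat: "herm n (Amat x)" by (rule hermI) (auto simp: Amat_def)
lemma herm_Cmat: "herm n (Cmat x)" by (rule hermI) (auto simp: Cmat_def)

lemma Amat_bound: "cmod (Amat x i j) \<le> \<kappa>"
  using a\<kappa> \<kappa> by (auto simp: Amat_def)

lemma coordinate_measurable: "e \<in> edges n \<Longrightarrow> (\<lambda>x. x e) \<in> borel_measurable N"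
  using measurable_component_singleton[of e "edges n" \<mu>] by (simp add: measurable_mu)

lemma Amat_measurable: "i < n \<Longrightarrow> j < n \<Longrightarrow> (\<lambda>x. Amat x i j) \<in> borel_measurable N"
  using measurable_compose[OF coordinate_measurable a, of "(i, j)"] measurable_compose[OF coordinate_measurable a, of "(j, i)"]
  by (cases i j rule: linorder_cases) (auto simp: Amat_def edgeI cnj_measurable)

lemma Cmat_measurable: "i < n \<Longrightarrow> j < n \<Longrightarrow> (\<lambda>x. Cmat x i j) \<in> borel_measurable N"
  using measurable_compose[OF coordinate_measurable c, of "(i, j)"] measurable_compose[OF coordinate_measurable c, of "(j, i)"]
  by (cases i j rule: linorder_cases) (auto simp: Cmat_def edgeI cnj_measurable)

lemma zero_entry_measurable: "i < n \<Longrightarrow> j < n \<Longrightarrow> (\<lambda>x. zero_entry (Amat x) k l i j) \<in> borel_measurable N"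
  unfolding zero_entry_def using Amat_measurable by auto

lemma Cmat_upd: "x (i, j) \<in> S \<Longrightarrow> y \<in> S \<Longrightarrow> i < j \<Longrightarrow> Cmat (x((i, j) := y)) = Cmat x"
  by (intro ext) (auto simp: Cmat_def cS)

lemma zero_entry_upd: "i < j \<Longrightarrow> zero_entry (Amat (x((i, j) := y))) i j = zero_entry (Amat x) i j"
  by (intro ext) (auto simp: zero_entry_def Amat_def)

lemma zero_entry_commute: "zero_entry A j i = zero_entry A i j"
  by (intro ext) (auto simp: zero_entry_def)

text \<open>The bad event controls the quadratic form of the centred \<open>|a|\<^sup>2\<close> over all pairs of sign vectors.\<close>

definition signs :: "(nat \<Rightarrow> real) set" where "signs = {..<n} \<rightarrow>\<^sub>E {-1, 1}"

definition W :: "(nat \<times> nat \<Rightarrow> complex) \<Rightarrow> nat \<Rightarrow> nat \<Rightarrow> real" where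
  "W x i j = (if i = j then 0 else (cmod (Amat x i j))\<^sup>2 - m2)"

definition bad :: "real \<Rightarrow> (nat \<times> nat \<Rightarrow> complex) set" where
  "bad \<eta> = (\<Union>s\<in>signs. \<Union>t\<in>signs. {x \<in> space N. (\<Sum>i<n. \<Sum>j<n. W x i j * (s i * t j)) \<ge> \<eta> * n})"

lemma finite_signs: "finite signs" and card_signs: "card signs = 2 ^ n"
  unfolding signs_def by (auto intro: finite_PiE simp: card_PiE numeral_2_eq_2)

lemma W_measurable[measurable]: "i < n \<Longrightarrow> j < n \<Longrightarrow> (\<lambda>x. W x i j) \<in> borel_measurable N"
  unfolding W_def using Amat_measurable[of i j] by auto

lemma bad_sets: "bad \<eta> \<in> sets N"
  unfolding bad_def using finite_signs by (intro sets.finite_UN) (auto intro!: borel_measurable_le)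

text \<open>Hoeffding's inequality for one pair of sign vectors and a union bound over the
  \<open>4 ^ n\<close> pairs. For \<kappa> of order \<open>n^(-1/2)\<close> up to logarithms the
  exponent is \<open>n^2\<close> up to logarithms, far above both \<open>n\<close> and the
  speed.\<close>

lemma measure_bad: 
  assumes \<eta>: "\<eta> > 0"
  shows "measure N (bad \<eta>) \<le> 4 ^ n * exp (- \<eta>\<^sup>2 / (8 * \<kappa> ^ 4))"
proof -
  have one: "measure N {x \<in> space N. (\<Sum>i<n. \<Sum>j<n. W x i j * (s i * t j)) \<ge> \<eta> * n} \<le> exp (- \<eta>\<^sup>2 / (8 * \<kappa> ^ 4))"
    if st: "s \<in> signs" "t \<in> signs" for s t
  proof -
    have s1: "\<bar>s i\<bar> = 1" "\<bar>t i\<bar> = 1" if "i < n" for i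
      using PiE_mem[OF st(1)[unfolded signs_def], of i] PiE_mem[OF st(2)[unfolded signs_def], of i] that by auto
    \<comment> \<open>The coefficient of one independent entry, which occurs in the quadratic form
      at \<open>(i, j)\<close> and at \<open>(j, i)\<close>.\<close>
    define ce where "ce e = (case e of (i, j) \<Rightarrow> if i < j then s i * t j + s j * t i else 0)" for e
    have ce: "\<bar>ce e\<bar> \<le> 2" if "e \<in> edges n" for e
    proof (cases e)
      case (Pair i j)
      have "\<bar>s i * t j + s j * t i\<bar> \<le> \<bar>s i\<bar> * \<bar>t j\<bar> + \<bar>s j\<bar> * \<bar>t i\<bar>" unfolding abs_mult[symmetric] by (rule abs_triangle_ineq)
      thus ?thesis using that Pair s1 by (auto simp: ce_def edges_def)
    qed
    define Z where "Z e u = ce e * (cmod (a u))\<^sup>2" for e u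
    have Zm: "Z e \<in> borel_measurable borel" for e unfolding Z_def by measurable
    have a2: "(cmod (a u))\<^sup>2 \<le> \<kappa>\<^sup>2" for u by (intro power_mono a\<kappa>) auto
    have Zb: "\<bar>Z e u\<bar> \<le> 2 * \<kappa>\<^sup>2" if "e \<in> edges n" for e u
      unfolding Z_def abs_mult using a2[of u] ce[OF that] by (intro mult_mono) auto
    have ind: "P.indep_vars (\<lambda>_. borel) (\<lambda>e x. Z e (x e)) (edges n)"
    proof -
      have "P.indep_vars (\<lambda>e. \<mu> e) (\<lambda>e x. x e) (edges n)"
      proof (subst P.indep_vars_iff_distr_eq_PiM')
        have "distr N (Pi\<^sub>M (edges n) \<mu>) (\<lambda>x. \<lambda>e\<in>edges n. x e) = distr N N (\<lambda>x. x)"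
          by (rule distr_cong) (auto simp: space_PiM)
        also have "\<dots> = N" by simp
        also have "\<dots> = Pi\<^sub>M (edges n) (\<lambda>e. distr N (\<mu> e) (\<lambda>x. x e))"
          by (rule PiM_cong) (auto simp: PiM_component)
        finally show "distr N (Pi\<^sub>M (edges n) \<mu>) (\<lambda>x. \<lambda>e\<in>edges n. x e) = Pi\<^sub>M (edges n) (\<lambda>e. distr N (\<mu> e) (\<lambda>x. x e))" .
      qed (use n in \<open>auto simp: edges_def\<close>)
      hence "P.indep_vars (\<lambda>_. borel) (\<lambda>e. Z e \<circ> (\<lambda>x. x e)) (edges n)"
        by (rule P.indep_vars_compose) (use Zm in \<open>simp add: measurable_mu\<close>)
      thus ?thesis by (simp add: comp_def)
    qed
    interpret HI: Hoeffding_ineq N "edges n" "\<lambda>e x. Z e (x e)" "\<lambda>_. - 2 * \<kappa>\<^sup>2" "\<lambda>_. 2 * \<kappa>\<^sup>2" "\<Sum>e\<in>edges n. P.expectation (\<lambda>x. Z e (x e))"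
      by unfold_locales (use ind Zb in \<open>auto intro!: AE_I2 simp: abs_le_iff minus_le_iff\<close>)
    have ex: "P.expectation (\<lambda>x. Z e (x e)) = ce e * m2" if e: "e \<in> edges n" for e
    proof -
      have "P.expectation (\<lambda>x. Z e (x e)) = (\<integral>u. Z e u \<partial>distr N (\<mu> e) (\<lambda>x. x e))"
        by (rule integral_distr[symmetric]) (use e Zm in \<open>auto simp: measurable_mu coordinate_measurable\<close>)
      also have "distr N (\<mu> e) (\<lambda>x. x e) = \<mu> e" by (rule PiM_component[OF e])
      also have "(\<integral>u. Z e u \<partial>\<mu> e) = ce e * m2"
        using e m2[of "fst e" "snd e"] by (cases e) (auto simp: Z_def ce_def edges_def)
      finally show ?thesis .
    qed
    have sum_eq: "(\<Sum>i<n. \<Sum>j<n. W x i j * (s i * t j)) = (\<Sum>e\<in>edges n. Z e (x e)) - (\<Sum>e\<in>edges n. P.expectation (\<lambda>x. Z e (x e)))" for x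
    proof -
      have "(\<Sum>i<n. \<Sum>j<n. W x i j * (s i * t j)) = (\<Sum>e\<in>edges n. Z e (x e) - ce e * m2)"
        unfolding sum_edges
        by (intro sum.cong refl) (auto simp: W_def Z_def ce_def Amat_def edges_def algebra_simps)
      thus ?thesis by (simp add: sum_subtractf ex)
    qed
    have ne: "edges n \<noteq> {}" using n by (auto simp: edges_def)
    have S: "(\<Sum>e\<in>edges n. (2 * \<kappa>\<^sup>2 - (- 2 * \<kappa>\<^sup>2))\<^sup>2) = real (card (edges n)) * (16 * \<kappa> ^ 4)"
      by (simp add: power_mult_distrib)
    have Spos: "(\<Sum>e\<in>edges n. (2 * \<kappa>\<^sup>2 - (- 2 * \<kappa>\<^sup>2))\<^sup>2) > 0"
      unfolding S using ne \<kappa> by (simp add: card_gt_0_iff)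
    have "measure N {x \<in> space N. (\<Sum>e\<in>edges n. Z e (x e)) \<ge> (\<Sum>e\<in>edges n. P.expectation (\<lambda>x. Z e (x e))) + \<eta> * n}
       \<le> exp (- 2 * (\<eta> * n)\<^sup>2 / (\<Sum>e\<in>edges n. (2 * \<kappa>\<^sup>2 - (- 2 * \<kappa>\<^sup>2))\<^sup>2))"
      by (rule HI.Hoeffding_ineq_ge) (use \<eta> Spos in auto)
    also have "{x \<in> space N. (\<Sum>e\<in>edges n. Z e (x e)) \<ge> (\<Sum>e\<in>edges n. P.expectation (\<lambda>x. Z e (x e))) + \<eta> * n}
      = {x \<in> space N. (\<Sum>i<n. \<Sum>j<n. W x i j * (s i * t j)) \<ge> \<eta> * n}"
      unfolding sum_eq by (intro Collect_cong) auto
    also have "exp (- 2 * (\<eta> * n)\<^sup>2 / (\<Sum>e\<in>edges n. (2 * \<kappa>\<^sup>2 - (- 2 * \<kappa>\<^sup>2))\<^sup>2)) \<le> exp (- \<eta>\<^sup>2 / (8 * \<kappa> ^ 4))"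
    proof -
      have "real (card (edges n)) \<le> real n * real n" using card_edges[of n] by (metis of_nat_le_iff of_nat_mult)
      hence le: "(\<Sum>e\<in>edges n. (2 * \<kappa>\<^sup>2 - (- 2 * \<kappa>\<^sup>2))\<^sup>2) \<le> real n * real n * (16 * \<kappa> ^ 4)"
        unfolding S by (intro mult_right_mono) auto
      have "\<eta>\<^sup>2 / (8 * \<kappa> ^ 4) = 2 * (\<eta> * n)\<^sup>2 / (real n * real n * (16 * \<kappa> ^ 4))"
        using n \<kappa> by (simp add: power_mult_distrib power2_eq_square)
      also have "\<dots> \<le> 2 * (\<eta> * n)\<^sup>2 / (\<Sum>e\<in>edges n. (2 * \<kappa>\<^sup>2 - (- 2 * \<kappa>\<^sup>2))\<^sup>2)"
        by (intro divide_left_mono le mult_pos_pos Spos) (use n \<kappa> in auto)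
      finally show ?thesis by simp
    qed
    finally show ?thesis .
  qed
  have "measure N (bad \<eta>) \<le> (\<Sum>s\<in>signs. \<Sum>t\<in>signs. exp (- \<eta>\<^sup>2 / (8 * \<kappa> ^ 4)))"
    unfolding bad_def
    by (intro order_trans[OF P.finite_measure_subadditive_finite] finite_signs sum_mono one)
       (auto intro!: sets.finite_UN finite_signs borel_measurable_le)
  also have "\<dots> = 4 ^ n * exp (- \<eta>\<^sup>2 / (8 * \<kappa> ^ 4))"
    by (simp add: card_signs) (simp add: power_mult_distrib[symmetric])
  finally show ?thesis .
qed

lemma sign_vector:
  fixes y :: "nat \<Rightarrow> real"
  obtains s where "s \<in> signs" "\<And>i. i < n \<Longrightarrow> s i * y i = \<bar>y i\<bar>"
proof
  show "(\<lambda>i\<in>{..<n}. if y i \<ge> 0 then 1 else -1) \<in> signs" by (auto simp: signs_def)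
qed auto

text \<open>A bilinear form on a cube is largest at vertices. The signs \<open>s\<close> of the rows
  remove the outer absolute values; then the signs \<open>t\<close> of the columns take over from
  \<open>r\<close>.\<close>

lemma cut_norm_real:
  assumes x: "x \<in> space N" "x \<notin> bad \<eta>" and r: "\<And>j. j < n \<Longrightarrow> \<bar>r j\<bar> \<le> 1"
  shows "(\<Sum>i<n. \<bar>\<Sum>j<n. W x i j * r j\<bar>) \<le> \<eta> * n"
proof -
  obtain s where s: "s \<in> signs" "\<And>i. i < n \<Longrightarrow> s i * (\<Sum>j<n. W x i j * r j) = \<bar>\<Sum>j<n. W x i j * r j\<bar>"
    using sign_vector[of "\<lambda>i. \<Sum>j<n. W x i j * r j"] by blast
  obtain t where t: "t \<in> signs" "\<And>j. j < n \<Longrightarrow> t j * (\<Sum>i<n. s i * W x i j) = \<bar>\<Sum>i<n. s i * W x i j\<bar>"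
    using sign_vector[of "\<lambda>j. \<Sum>i<n. s i * W x i j"] by blast
  have "(\<Sum>i<n. \<bar>\<Sum>j<n. W x i j * r j\<bar>) = (\<Sum>i<n. \<Sum>j<n. s i * (W x i j * r j))"
    using s(2) by (simp add: sum_distrib_left)
  also have "\<dots> = (\<Sum>j<n. \<Sum>i<n. s i * (W x i j * r j))" by (rule sum.swap)
  also have "\<dots> = (\<Sum>j<n. r j * (\<Sum>i<n. s i * W x i j))" by (simp add: sum_distrib_left mult_ac)
  also have "\<dots> \<le> (\<Sum>j<n. \<bar>\<Sum>i<n. s i * W x i j\<bar>)"
  proof (rule sum_mono)
    fix j assume "j \<in> {..<n}"
    hence "\<bar>r j\<bar> * \<bar>\<Sum>i<n. s i * W x i j\<bar> \<le> 1 * \<bar>\<Sum>i<n. s i * W x i j\<bar>" using r by (intro mult_right_mono) auto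
    moreover have "r j * (\<Sum>i<n. s i * W x i j) \<le> \<bar>r j\<bar> * \<bar>\<Sum>i<n. s i * W x i j\<bar>"
      unfolding abs_mult[symmetric] by (rule abs_ge_self)
    ultimately show "r j * (\<Sum>i<n. s i * W x i j) \<le> \<bar>\<Sum>i<n. s i * W x i j\<bar>" by linarith
  qed
  also have "\<dots> = (\<Sum>j<n. t j * (\<Sum>i<n. s i * W x i j))" using t(2) by simp
  also have "\<dots> = (\<Sum>j<n. \<Sum>i<n. W x i j * (s i * t j))" by (simp add: sum_distrib_left mult_ac)
  also have "\<dots> = (\<Sum>i<n. \<Sum>j<n. W x i j * (s i * t j))" by (rule sum.swap)
  also have "\<dots> \<le> \<eta> * n"
  proof -
    have "x \<notin> {x \<in> space N. (\<Sum>i<n. \<Sum>j<n. W x i j * (s i * t j)) \<ge> \<eta> * n}"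
      using x(2) s(1) t(1) unfolding bad_def by blast
    thus ?thesis using x(1) by simp
  qed
  finally show ?thesis .
qed

text \<open>The vector \<open>v\<close> is removed by taking moduli, and \<open>u\<close> is split
  into real and imaginary part, whence the factor 2.\<close>

lemma cut_norm:
  assumes x: "x \<in> space N" "x \<notin> bad \<eta>" and u: "\<And>j. j < n \<Longrightarrow> cmod (u j) \<le> 1" and v: "\<And>j. j < n \<Longrightarrow> cmod (v j) \<le> 1"
  shows "cmod (\<Sum>i<n. \<Sum>j<n. of_real (W x i j) * (u j * v i)) \<le> 2 * \<eta> * n"
proof -
  have "cmod (\<Sum>i<n. \<Sum>j<n. of_real (W x i j) * (u j * v i)) \<le> (\<Sum>i<n. cmod (\<Sum>j<n. of_real (W x i j) * u j))"
  proof (rule sum_norm_le)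
    fix i assume "i \<in> {..<n}"
    have "cmod (\<Sum>j<n. of_real (W x i j) * (u j * v i)) = cmod (\<Sum>j<n. of_real (W x i j) * u j) * cmod (v i)"
      unfolding norm_mult[symmetric] sum_distrib_right by (simp add: mult_ac)
    also have "\<dots> \<le> cmod (\<Sum>j<n. of_real (W x i j) * u j) * 1"
      using v \<open>i \<in> {..<n}\<close> by (intro mult_left_mono) auto
    finally show "cmod (\<Sum>j<n. of_real (W x i j) * (u j * v i)) \<le> cmod (\<Sum>j<n. of_real (W x i j) * u j)" by simp
  qed
  also have "\<dots> \<le> (\<Sum>i<n. \<bar>\<Sum>j<n. W x i j * Re (u j)\<bar> + \<bar>\<Sum>j<n. W x i j * Im (u j)\<bar>)"
    by (intro sum_mono order_trans[OF cmod_le]) simp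
  also have "\<dots> = (\<Sum>i<n. \<bar>\<Sum>j<n. W x i j * Re (u j)\<bar>) + (\<Sum>i<n. \<bar>\<Sum>j<n. W x i j * Im (u j)\<bar>)"
    by (rule sum.distrib)
  also have "\<dots> \<le> \<eta> * n + \<eta> * n"
    by (intro add_mono cut_norm_real[OF x]; rule order_trans[OF abs_Re_le_cmod u] order_trans[OF abs_Im_le_cmod u])
  finally show ?thesis by simp
qed

end


lemma sum_three_squares: "(x + y + z)\<^sup>2 \<le> 3 * (x\<^sup>2 + y\<^sup>2 + z\<^sup>2)" for x y z :: real
  using sum_squares_bound[of x y] sum_squares_bound[of y z] sum_squares_bound[of x z]
  by (simp add: power2_eq_square algebra_simps)

lemma opb_symmetrized_sum:
  assumes "opb n (1/4) M" "\<kappa> \<ge> 0"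
  shows "(\<Sum>i<n. \<Sum>j<n. (cmod (M i j) + cmod (M j i) + \<kappa>)\<^sup>2) \<le> 3 * (real n + (real n)\<^sup>2 * \<kappa>\<^sup>2)"
proof -
  have hs: "(\<Sum>i<n. \<Sum>j<n. (cmod (M i j))\<^sup>2) \<le> real n / 16"
    using opb_hs[OF assms(1)] by (simp add: power2_eq_square)
  have "(\<Sum>i<n. \<Sum>j<n. (cmod (M i j) + cmod (M j i) + \<kappa>)\<^sup>2)
    \<le> (\<Sum>i<n. \<Sum>j<n. 3 * ((cmod (M i j))\<^sup>2 + (cmod (M j i))\<^sup>2 + \<kappa>\<^sup>2))"
    by (intro sum_mono sum_three_squares)
  also have "\<dots> = 3 * ((\<Sum>i<n. \<Sum>j<n. (cmod (M i j))\<^sup>2) + (\<Sum>i<n. \<Sum>j<n. (cmod (M j i))\<^sup>2) + (real n)\<^sup>2 * \<kappa>\<^sup>2)"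
    by (simp add: sum_distrib_left[symmetric] sum.distrib power2_eq_square)
  also have "(\<Sum>i<n. \<Sum>j<n. (cmod (M j i))\<^sup>2) = (\<Sum>i<n. \<Sum>j<n. (cmod (M i j))\<^sup>2)" by (rule sum.swap)
  finally show ?thesis using hs by simp
qed

context trunc_law
begin

definition fX :: "complex \<Rightarrow> (nat \<times> nat \<Rightarrow> complex) \<Rightarrow> complex" where
  "fX z x = perr n (Amat x) (Cmat x) z"

definition MZ :: "complex \<Rightarrow> nat \<Rightarrow> nat \<Rightarrow> (nat \<times> nat \<Rightarrow> complex) \<Rightarrow> nat \<Rightarrow> nat \<Rightarrow> complex" where
  "MZ z i j x = pmat n (zero_entry (Amat x) i j) (Cmat x) z"

text \<open>The antisymmetric function for the exchangeable pair. \<open>MZ\<close> does not see the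
  entry \<open>e\<close>, and for two values in \<open>S\<close> neither does \<open>Cmat\<close>,
  so the exchange only flips the sign of the difference of \<open>a\<close>. Dividing by
  \<open>p\<close> compensates the probability that the new value lies in \<open>S\<close>; the
  number \<open>w\<close> selects a direction in the complex plane.\<close>

definition FE :: "complex \<Rightarrow> complex \<Rightarrow> nat \<times> nat \<Rightarrow> (nat \<times> nat \<Rightarrow> complex) \<times> complex \<Rightarrow> real" where
  "FE z w e q = (case e of (i, j) \<Rightarrow> if i < j \<and> fst q e \<in> S \<and> snd q \<in> S then
     Re (w * ((a (fst q e) - a (snd q)) * MZ z i j (fst q) j i + cnj (a (fst q e) - a (snd q)) * MZ z i j (fst q) i j)) / (p * n)
     else 0)"

text \<open>The product of the bounds for \<open>FE\<close> and for the increment of the defect, the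
  latter from \<open>entry_change\<close> with step \<open>2 * \<kappa>\<close>; the constant 5 is
  \<open>2 \<cdot> 5/4 \<cdot> 2\<close>. The matrix entries are kept for Cauchy-Schwarz in
  \<open>BE_sum\<close>.\<close>

definition BE :: "complex \<Rightarrow> nat \<times> nat \<Rightarrow> (nat \<times> nat \<Rightarrow> complex) \<Rightarrow> real" where
  "BE z e x = (case e of (i, j) \<Rightarrow> if i < j then
     5 * \<kappa>\<^sup>2 / (p * n\<^sup>2) * ((cmod (pmat n (Amat x) (Cmat x) z i j) + cmod (pmat n (Amat x) (Cmat x) z j i) + 2 * \<kappa>)
       * (cmod (mm n (res n (hadd (Amat x) (Cmat x)) z) (res n (hadd (Amat x) (Cmat x)) z) i j)
        + cmod (mm n (res n (hadd (Amat x) (Cmat x)) z) (res n (hadd (Amat x) (Cmat x)) z) j i) + 2 * \<kappa>)) else 0)"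

lemma MZ_measurable: "k < n \<Longrightarrow> l < n \<Longrightarrow> (\<lambda>x. MZ z i j x k l) \<in> borel_measurable N"
  unfolding MZ_def by (intro pmat_measurable zero_entry_measurable Cmat_measurable)

lemma fX_measurable: "fX z \<in> borel_measurable N"
  unfolding fX_def by (intro perr_measurable Amat_measurable Cmat_measurable)

lemma FE_measurable:
  assumes "e \<in> edges n"
  shows "FE z w e \<in> borel_measurable (N \<Otimes>\<^sub>M \<mu> e)"
proof (cases e)
  case (Pair i j)
  have ij: "i < n" "j < n" using assms Pair by (auto simp: edges_def)
  have [measurable]: "(\<lambda>q. fst q e) \<in> borel_measurable (N \<Otimes>\<^sub>M \<mu> e)" "(\<lambda>q. snd q) \<in> borel_measurable (N \<Otimes>\<^sub>M \<mu> e)"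
    using measurable_compose[OF measurable_fst coordinate_measurable[OF assms]] measurable_snd[of N "\<mu> e"]
    by (auto simp: measurable_mu)
  have [measurable]: "(\<lambda>q. MZ z i j (fst q) k l) \<in> borel_measurable (N \<Otimes>\<^sub>M \<mu> e)" if "k < n" "l < n" for k l
    using measurable_compose[OF measurable_fst MZ_measurable[OF that]] .
  note [measurable] = S
  have [measurable]: "(\<lambda>q. cnj (a (fst q e) - a (snd q))) \<in> borel_measurable (N \<Otimes>\<^sub>M \<mu> e)"
    by (rule cnj_measurable) measurable
  have "FE z w e = (\<lambda>q. if i < j \<and> fst q e \<in> S \<and> snd q \<in> S then
     Re (w * ((a (fst q e) - a (snd q)) * MZ z i j (fst q) j i + cnj (a (fst q e) - a (snd q)) * MZ z i j (fst q) i j)) / (p * n)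
     else 0)" by (simp add: fun_eq_iff FE_def Pair)
  also have "\<dots> \<in> borel_measurable (N \<Otimes>\<^sub>M \<mu> e)" using ij by measurable
  finally show ?thesis .
qed

lemma MZ_bound:
  assumes z: "Im z \<ge> 2" and ij: "i < j" "j < n" and kl: "k < n" "l < n"
  shows "cmod (MZ z i j x k l) \<le> cmod (pmat n (Amat x) (Cmat x) z k l) + \<kappa> / 2"
    "cmod (MZ z i j x k l) \<le> 1 / 4"
proof -
  interpret entry_change n "Amat x" "zero_entry (Amat x) i j" "Cmat x" z i j \<kappa>
    by (rule entry_change_zero_entry) (use n z ij Amat_bound herm_Amat herm_Cmat in auto)
  show "cmod (MZ z i j x k l) \<le> cmod (pmat n (Amat x) (Cmat x) z k l) + \<kappa> / 2"
    using M_diff_crude[OF kl] norm_triangle_sub[of "MZ z i j x k l" "pmat n (Amat x) (Cmat x) z k l"]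
    by (simp add: MZ_def norm_minus_commute)
  show "cmod (MZ z i j x k l) \<le> 1 / 4"
    unfolding MZ_def by (rule opb_entry[OF opb_pmat[OF A' C z] kl])
qed

lemma FE_bound:
  assumes w: "cmod w = 1" and e: "e = (i, j)" "i < j" "j < n"
  shows "\<bar>FE z w e (x, y)\<bar> \<le> 2 * \<kappa> / (p * n) * (cmod (MZ z i j x j i) + cmod (MZ z i j x i j))"
proof -
  let ?d = "a (x e) - a y" and ?m = "cmod (MZ z i j x j i) + cmod (MZ z i j x i j)"
  have pn: "p * n > 0" using p n by simp
  have d: "cmod ?d \<le> 2 * \<kappa>" using norm_triangle_ineq4[of "a (x e)" "a y"] a\<kappa>[of "x e"] a\<kappa>[of y] by linarith
  have "\<bar>Re (w * (?d * MZ z i j x j i + cnj ?d * MZ z i j x i j))\<bar> \<le> cmod (w * (?d * MZ z i j x j i + cnj ?d * MZ z i j x i j))"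
    by (rule abs_Re_le_cmod)
  also have "\<dots> \<le> cmod (?d * MZ z i j x j i) + cmod (cnj ?d * MZ z i j x i j)"
    unfolding norm_mult w by (simp only: mult_1) (metis norm_triangle_ineq norm_mult)
  also have "\<dots> = cmod ?d * ?m" unfolding norm_mult complex_mod_cnj by (simp add: distrib_left)
  also have "\<dots> \<le> 2 * \<kappa> * ?m" by (intro mult_right_mono d) auto
  finally have "\<bar>Re (w * (?d * MZ z i j x j i + cnj ?d * MZ z i j x i j)) / (p * n)\<bar> \<le> 2 * \<kappa> * ?m / (p * n)"
    using pn by (simp add: divide_right_mono)
  moreover have "0 \<le> 2 * \<kappa> * ?m / (p * n)" using \<kappa> pn by simp
  ultimately show ?thesis using e by (simp add: FE_def)
qed

lemma FE_increment:
  assumes z1: "Im z \<ge> 2" and w1: "cmod w = 1" and e: "e \<in> edges n"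
  shows "\<bar>FE z w e (x, y)\<bar> * \<bar>Re (w * fX z x) - Re (w * fX z (x(e := y)))\<bar> \<le> BE z e x"
proof -
  obtain i j where ij0: "e = (i, j)" "i \<le> j" "j < n" using e by (auto simp: edges_def)
  let ?M = "pmat n (Amat x) (Cmat x) z"
  let ?Q = "mm n (res n (hadd (Amat x) (Cmat x)) z) (res n (hadd (Amat x) (Cmat x)) z)"
  have B0: "BE z e x \<ge> 0" using p \<kappa> n unfolding BE_def by (auto split: prod.splits)
  show ?thesis
  proof (cases "i < j \<and> x e \<in> S \<and> y \<in> S")
    case False
    hence "FE z w e (x, y) = 0" using ij0 by (auto simp: FE_def)
    thus ?thesis using B0 by simp
  next
    case True
    let ?A' = "Amat (x(e := y))"
    have Cu: "Cmat (x(e := y)) = Cmat x" using Cmat_upd True ij0 by simp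
    interpret entry_change n "Amat x" ?A' "Cmat x" z i j "2 * \<kappa>"
    proof unfold_locales
      show "cmod (?A' i j - Amat x i j) \<le> 2 * \<kappa>"
        using norm_triangle_ineq4[of "?A' i j" "Amat x i j"] Amat_bound[of "x(e := y)" i j] Amat_bound[of x i j] by linarith
    qed (use n z1 True ij0 herm_Amat herm_Cmat in \<open>auto simp: Amat_def\<close>)
    have F: "\<bar>FE z w e (x, y)\<bar> \<le> 2 * \<kappa> / (p * n) * (cmod (?M i j) + cmod (?M j i) + 2 * \<kappa>)"
    proof -
      have "\<bar>FE z w e (x, y)\<bar> \<le> 2 * \<kappa> / (p * n) * (cmod (MZ z i j x j i) + cmod (MZ z i j x i j))"
        using FE_bound[OF w1 ij0(1) _ ij0(3)] True by simp
      also have "\<dots> \<le> 2 * \<kappa> / (p * n) * (cmod (?M i j) + cmod (?M j i) + 2 * \<kappa>)"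
        using MZ_bound(1)[OF z1 _ ij0(3), of i j i x] MZ_bound(1)[OF z1 _ ij0(3), of i i j x] True \<kappa> p ij0
        by (intro mult_left_mono) auto
      finally show ?thesis .
    qed
    have "\<bar>Re (w * fX z x) - Re (w * fX z (x(e := y)))\<bar> \<le> cmod (w * (fX z x - fX z (x(e := y))))"
      by (metis abs_Re_le_cmod minus_complex.simps(1) right_diff_distrib)
    also have "\<dots> \<le> 5/4 * cmod (g - g')"
      unfolding norm_mult w1 using perr_diff by (simp add: fX_def Cu)
    also have "\<dots> \<le> 5/4 * (2 * \<kappa> / n * (cmod (?Q i j) + cmod (?Q j i) + 2 * \<kappa>))"
      by (intro mult_left_mono g_diff_fine) auto
    finally have D: "\<bar>Re (w * fX z x) - Re (w * fX z (x(e := y)))\<bar> \<le> 5/4 * (2 * \<kappa> / n * (cmod (?Q i j) + cmod (?Q j i) + 2 * \<kappa>))" .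
    have "\<bar>FE z w e (x, y)\<bar> * \<bar>Re (w * fX z x) - Re (w * fX z (x(e := y)))\<bar>
      \<le> (2 * \<kappa> / (p * n) * (cmod (?M i j) + cmod (?M j i) + 2 * \<kappa>)) * (5/4 * (2 * \<kappa> / n * (cmod (?Q i j) + cmod (?Q j i) + 2 * \<kappa>)))"
      by (intro mult_mono F D) (use p \<kappa> n in auto)
    also have "\<dots> = 5 * \<kappa>\<^sup>2 / (p * n\<^sup>2) * ((cmod (?M i j) + cmod (?M j i) + 2 * \<kappa>) * (cmod (?Q i j) + cmod (?Q j i) + 2 * \<kappa>))"
      by (simp add: power2_eq_square)
    also have "\<dots> = BE z e x" using True ij0 by (simp add: BE_def)
    finally show ?thesis .
  qed
qed

text \<open>Cauchy-Schwarz over all pairs: both factors are symmetrised entries of matrices of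
  operator norm at most \<open>1/4\<close>, plus \<open>2 * \<kappa>\<close>, with square sums of
  order \<open>n + n^2 \<kappa>^2\<close>. In the regime of use the result is \<open>n^(-2)\<close>
  up to logarithms, which admits \<theta> well beyond the speed.\<close>

lemma BE_sum:
  assumes z: "Im z \<ge> 2"
  shows "(\<Sum>e\<in>edges n. BE z e x) \<le> 15 * \<kappa>\<^sup>2 / p * (1 / n + 4 * \<kappa>\<^sup>2)"
proof -
  let ?M = "pmat n (Amat x) (Cmat x) z"
  let ?Q = "mm n (res n (hadd (Amat x) (Cmat x)) z) (res n (hadd (Amat x) (Cmat x)) z)"
  define f where "f i j = cmod (?M i j) + cmod (?M j i) + 2 * \<kappa>" for i j
  define h where "h i j = cmod (?Q i j) + cmod (?Q j i) + 2 * \<kappa>" for i j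
  define K where "K = 5 * \<kappa>\<^sup>2 / (p * n\<^sup>2)"
  have K0: "K \<ge> 0" using p by (simp add: K_def)
  have fh0: "f i j * h i j \<ge> 0" for i j using \<kappa> by (simp add: f_def h_def)
  have opG: "opb n (1/2) (res n (hadd (Amat x) (Cmat x)) z)"
    using z by (intro opb_res herm_hadd herm_Amat herm_Cmat) auto
  have opQ: "opb n (1/4) ?Q" using opb_mm[OF opG opG] by simp
  have opM: "opb n (1/4) ?M" by (rule opb_pmat[OF herm_Amat herm_Cmat z])
  have "(\<Sum>e\<in>edges n. BE z e x) \<le> (\<Sum>e\<in>edges n. case e of (i, j) \<Rightarrow> K * (f i j * h i j))"
  proof (rule sum_mono)
    fix e :: "nat \<times> nat"
    obtain i j where e: "e = (i, j)" by (cases e)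
    have "BE z e x = (if i < j then K * (f i j * h i j) else 0)" by (simp add: e BE_def K_def f_def h_def)
    thus "BE z e x \<le> (case e of (i, j) \<Rightarrow> K * (f i j * h i j))" using K0 fh0 by (simp add: e)
  qed
  also have "\<dots> \<le> (\<Sum>e\<in>{..<n} \<times> {..<n}. case e of (i, j) \<Rightarrow> K * (f i j * h i j))"
    by (intro sum_mono2 edges_subset) (use K0 fh0 in auto)
  also have "\<dots> = K * (\<Sum>i<n. \<Sum>j<n. f i j * h i j)"
    by (simp add: sum.cartesian_product sum_distrib_left case_prod_beta')
  also have "(\<Sum>i<n. \<Sum>j<n. f i j * h i j) = (\<Sum>i<n. \<Sum>j<n. \<bar>f i j\<bar> * \<bar>h i j\<bar>)"
    using fh0 by (simp add: abs_mult[symmetric])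
  also have "\<dots> \<le> sqrt (\<Sum>i<n. \<Sum>j<n. (f i j)\<^sup>2) * sqrt (\<Sum>i<n. \<Sum>j<n. (h i j)\<^sup>2)"
    by (rule double_sum_cauchy_schwarz)
  also have "\<dots> \<le> sqrt (3 * (real n + (real n)\<^sup>2 * (2 * \<kappa>)\<^sup>2)) * sqrt (3 * (real n + (real n)\<^sup>2 * (2 * \<kappa>)\<^sup>2))"
    unfolding f_def h_def using \<kappa>
    by (intro mult_mono real_sqrt_le_mono opb_symmetrized_sum opM opQ) (auto simp: sum_nonneg)
  also have "\<dots> = 3 * (real n + (real n)\<^sup>2 * (2 * \<kappa>)\<^sup>2)"
    by (rule real_sqrt_mult_self[THEN trans]) simp
  finally have "(\<Sum>e\<in>edges n. BE z e x) \<le> K * (3 * (real n + (real n)\<^sup>2 * (2 * \<kappa>)\<^sup>2))" using K0 by (simp add: mult_left_mono)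
  also have "\<dots> = 15 * \<kappa>\<^sup>2 / p * (1 / n + 4 * \<kappa>\<^sup>2)"
    using n p by (simp add: K_def power2_eq_square field_simps)
  finally show ?thesis .
qed

text \<open>When the new value is integrated over \<open>S\<close>, the term with \<open>a y\<close>
  vanishes by centring and the term with the old value gains the factor \<open>p\<close>. If the old
  value is outside \<open>S\<close>, both sides are 0 since \<open>a\<close> vanishes there.\<close>

lemma FE_integral_sum:
  "(\<Sum>e\<in>edges n. \<integral>y. FE z w e (x, y) \<partial>\<mu> e) = Re (w * plin n (Amat x) (Cmat x) z)"
proof -
  have e: "(\<integral>y. FE z w (i, j) (x, y) \<partial>\<mu> (i, j)) = (if i < j then
      Re (w * (Amat x i j * MZ z i j x j i + Amat x j i * MZ z i j x i j)) / n else 0)"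
    if ij: "i \<le> j" "j < n" for i j
  proof (cases "i < j \<and> x (i, j) \<in> S")
    case False
    hence "FE z w (i, j) (x, y) = 0" for y by (auto simp: FE_def)
    thus ?thesis using False aS by (auto simp: Amat_def)
  next
    case True
    have fm: "finite_measure (\<mu> (i, j))" by (rule prob_space.finite_measure[OF prob_mu])
    let ?m1 = "MZ z i j x j i" and ?m2 = "MZ z i j x i j" and ?al = "a (x (i, j))"
    have am: "a \<in> borel_measurable (\<mu> (i, j))" by (simp add: measurable_mu)
    have ai: "integrable (\<mu> (i, j)) a"
      by (rule finite_measure.integrable_const_bound[OF fm _ am, of \<kappa>]) (use a\<kappa> in auto)
    have Si: "integrable (\<mu> (i, j)) (indicator S :: _ \<Rightarrow> real)"
      using S by (intro integrable_real_indicator) (auto simp: sets_mu finite_measure.emeasure_eq_measure[OF fm])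
    have F: "FE z w (i, j) (x, y) = (indicator S y * Re (w * (?al * ?m1 + cnj ?al * ?m2)) - Re (w * (a y * ?m1 + cnj (a y) * ?m2))) / (p * n)" for y
    proof (cases "y \<in> S")
      case False
      thus ?thesis using aS[OF False] by (simp add: FE_def)
    next
      case y: True
      thus ?thesis using True by (simp add: FE_def algebra_simps)
    qed
    have i1: "integrable (\<mu> (i, j)) (\<lambda>y. a y * ?m1 + cnj (a y) * ?m2)"
      using ai by (intro Bochner_Integration.integrable_add integrable_mult_left integrable_cnj)
    have "(\<integral>y. Re (w * (a y * ?m1 + cnj (a y) * ?m2)) \<partial>\<mu> (i, j)) = Re (\<integral>y. w * (a y * ?m1 + cnj (a y) * ?m2) \<partial>\<mu> (i, j))"
      using i1 by (intro integral_Re) simp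
    also have "(\<integral>y. w * (a y * ?m1 + cnj (a y) * ?m2) \<partial>\<mu> (i, j)) = 0"
      using ai integrable_cnj[OF ai] a0[of i j] True ij by (simp add: integral_cnj)
    finally have "(\<integral>y. Re (w * (a y * ?m1 + cnj (a y) * ?m2)) \<partial>\<mu> (i, j)) = 0" by simp
    moreover have "integrable (\<mu> (i, j)) (\<lambda>y. Re (w * (a y * ?m1 + cnj (a y) * ?m2)))"
      using i1 by (intro integrable_Re) simp
    moreover have "(\<integral>y. indicator S y \<partial>\<mu> (i, j)) = p"
      using S pS[of i j] True ij by (simp add: sets_mu)
    ultimately have "(\<integral>y. FE z w (i, j) (x, y) \<partial>\<mu> (i, j)) = (p * Re (w * (?al * ?m1 + cnj ?al * ?m2))) / (p * n)"
      unfolding F using Si by simp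
    thus ?thesis using True p by (simp add: Amat_def)
  qed
  have "(\<Sum>e\<in>edges n. \<integral>y. FE z w e (x, y) \<partial>\<mu> e) = (\<Sum>(i, j)\<in>edges n. if i < j then
      Re (w * (Amat x i j * MZ z i j x j i + Amat x j i * MZ z i j x i j)) / n else 0)"
    by (intro sum.cong refl) (auto simp: e edges_def)
  also have "\<dots> = Re (\<Sum>(i, j)\<in>edges n. if i < j then w * (Amat x i j * MZ z i j x j i + Amat x j i * MZ z i j x i j) / n else 0)"
    by (auto simp: case_prod_beta' intro!: sum.cong)
  also have "(\<Sum>(i, j)\<in>edges n. if i < j then w * (Amat x i j * MZ z i j x j i + Amat x j i * MZ z i j x i j) / n else 0)
     = (\<Sum>(i, j)\<in>edges n. if i < j then w * (Amat x i j * MZ z i j x j i) / n + w * (Amat x j i * MZ z j i x i j) / n else w * (Amat x i j * MZ z i j x j i) / n)"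
    by (intro sum.cong refl) (auto simp: edges_def MZ_def zero_entry_commute[of _ _ "fst _"] Amat_def zero_entry_commute add_divide_distrib distrib_left)
  also have "\<dots> = (\<Sum>i<n. \<Sum>j<n. w * (Amat x i j * MZ z i j x j i) / n)" by (rule sum_edges[symmetric])
  also have "\<dots> = w * plin n (Amat x) (Cmat x) z"
    by (simp add: plin_def MZ_def sum_distrib_left sum_divide_distrib)
  finally show ?thesis .
qed

text \<open>Off \<open>bad\<close>, the sum left over by \<open>perr_plin\<close> is a bilinear form
  of \<open>W\<close> in the diagonals of \<open>G\<close> and \<open>M\<close>, plus the effect of
  \<open>m2\<close> differing from \<open>1 / n\<close>.\<close>

lemma fX_plin_good:
  assumes z: "Im z \<ge> 2" and x: "x \<in> space N" "x \<notin> bad \<eta>" and \<eta>: "\<eta> > 0"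
  shows "cmod (fX z x - plin n (Amat x) (Cmat x) z) \<le> \<kappa> ^ 3 * n + \<kappa>\<^sup>2 * sqrt n + \<kappa>\<^sup>2 + 1 / n + \<epsilon> + \<eta>"
proof -
  let ?G = "res n (hadd (Amat x) (Cmat x)) z" and ?M = "pmat n (Amat x) (Cmat x) z"
  define T where "T = (\<Sum>i<n. \<Sum>j<n. (if i = j then 0 else of_real ((cmod (Amat x i j))\<^sup>2 - 1 / n)) * (?G j j * ?M i i))"
  have opG: "opb n (1/2) ?G" using z by (intro opb_res herm_hadd herm_Amat herm_Cmat) auto
  have opM: "opb n (1/4) ?M" by (rule opb_pmat[OF herm_Amat herm_Cmat z])
  have Gb: "cmod (?G j j) \<le> 1/2" if "j < n" for j by (rule opb_entry[OF opG that that])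
  have Mb: "cmod (?M j j) \<le> 1/4" if "j < n" for j by (rule opb_entry[OF opM that that])
  have "T = (\<Sum>i<n. \<Sum>j<n. of_real (W x i j) * (?G j j * ?M i i) + of_real (if i = j then 0 else m2 - 1 / n) * (?G j j * ?M i i))"
    unfolding T_def by (intro sum.cong refl) (auto simp: W_def algebra_simps)
  hence T: "T = (\<Sum>i<n. \<Sum>j<n. of_real (W x i j) * (?G j j * ?M i i)) + (\<Sum>i<n. \<Sum>j<n. of_real (if i = j then 0 else m2 - 1 / n) * (?G j j * ?M i i))"
    by (simp add: sum.distrib)
  have 1: "cmod (\<Sum>i<n. \<Sum>j<n. of_real (W x i j) * (?G j j * ?M i i)) \<le> \<eta> * n"
  proof -
    \<comment> \<open>The doubling is allowed because the diagonal of \<open>G\<close> is at most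
      \<open>1/2\<close>, and it cancels the factor 2 of \<open>cut_norm\<close>.\<close>
    have "cmod (\<Sum>i<n. \<Sum>j<n. of_real (W x i j) * ((2 * ?G j j) * ?M i i)) \<le> 2 * \<eta> * n"
    proof (rule cut_norm[OF x])
      fix j assume j: "j < n"
      show "cmod (2 * ?G j j) \<le> 1" using Gb[OF j] by (simp add: norm_mult)
      show "cmod (?M j j) \<le> 1" using Mb[OF j] by simp
    qed
    moreover have "(\<Sum>i<n. \<Sum>j<n. of_real (W x i j) * ((2 * ?G j j) * ?M i i)) = 2 * (\<Sum>i<n. \<Sum>j<n. of_real (W x i j) * (?G j j * ?M i i))"
      by (simp add: sum_distrib_left mult_ac)
    ultimately show ?thesis by (simp add: norm_mult)
  qed
  have \<epsilon>0: "\<epsilon> \<ge> 0" using \<epsilon> n by (metis abs_ge_zero divide_nonneg_nonneg mult_nonneg_nonneg nonzero_mult_div_cancel_right of_nat_0_le_iff of_nat_0_less_iff order_trans times_divide_eq_left less_irrefl)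
  have 2: "cmod (\<Sum>i<n. \<Sum>j<n. of_real (if i = j then 0 else m2 - 1 / n) * (?G j j * ?M i i)) \<le> (\<Sum>i<n. \<Sum>j<n. \<epsilon> / n)"
  proof (intro sum_norm_le)
    fix i j assume ij: "i \<in> {..<n}" "j \<in> {..<n}"
    have "cmod (of_real (if i = j then 0 else m2 - 1 / n) * (?G j j * ?M i i)) = \<bar>if i = j then 0 else m2 - 1 / n\<bar> * (cmod (?G j j) * cmod (?M i i))"
      unfolding norm_mult norm_of_real ..
    also have "\<dots> \<le> (\<epsilon> / n) * (1/2 * (1/4))"
      by (intro mult_mono Gb Mb) (use ij \<epsilon> \<epsilon>0 in auto)
    also have "\<dots> \<le> \<epsilon> / n" using \<epsilon>0 n by (simp add: field_simps)
    finally show "cmod (of_real (if i = j then 0 else m2 - 1 / n) * (?G j j * ?M i i)) \<le> \<epsilon> / n" .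
  qed
  have "(\<Sum>i<n. \<Sum>j<n. \<epsilon> / n) = \<epsilon> * n" using n by simp
  hence "cmod T \<le> \<eta> * n + \<epsilon> * n"
    using 1 2 norm_triangle_ineq[of "\<Sum>i<n. \<Sum>j<n. of_real (W x i j) * (?G j j * ?M i i)" "\<Sum>i<n. \<Sum>j<n. of_real (if i = j then 0 else m2 - 1 / n) * (?G j j * ?M i i)"]
    unfolding T by linarith
  hence T2: "cmod (T / n) \<le> \<eta> + \<epsilon>" using n by (simp add: norm_divide field_simps)
  have "cmod (fX z x - plin n (Amat x) (Cmat x) z + T / n) \<le> \<kappa> ^ 3 * n + \<kappa>\<^sup>2 * sqrt n + \<kappa>\<^sup>2 + 1 / n"
    unfolding fX_def T_def by (rule perr_plin) (use n z herm_Amat herm_Cmat Amat_bound \<kappa> in \<open>auto simp: Amat_def\<close>)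
  thus ?thesis using T2 norm_triangle_ineq4[of "fX z x - plin n (Amat x) (Cmat x) z + T / n" "T / n"] by simp
qed

lemma plin_bound:
  assumes z: "Im z \<ge> 2"
  shows "cmod (plin n (Amat x) (Cmat x) z) \<le> n * \<kappa>"
proof -
  have "cmod (\<Sum>i<n. \<Sum>j<n. Amat x i j * pmat n (zero_entry (Amat x) i j) (Cmat x) z j i) \<le> (\<Sum>i<n. \<Sum>j<n. \<kappa> * (1/4))"
    by (intro sum_norm_le, unfold norm_mult, intro mult_mono Amat_bound opb_entry[OF opb_pmat])
       (use z herm_zero_entry[OF herm_Amat] herm_Cmat \<kappa> in auto)
  also have "\<dots> \<le> real n * (n * \<kappa>)" using \<kappa> by (simp add: mult_left_mono)
  finally show ?thesis using n by (simp add: plin_def norm_divide field_simps)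
qed

text \<open>An instance of \<open>exchangeable_tail\<close> with the defect bounded by 1 and the
  linear part by \<open>n * \<kappa>\<close>. The threshold \<open>s\<close> absorbs
  \<open>\<theta> B\<close> and the error of \<open>fX_plin_good\<close>.\<close>

lemma fX_tail_directional:
  assumes z: "Im z \<ge> 2" and w: "cmod w = 1" and \<theta>: "\<theta> > 0" and t: "t > 0" and \<eta>: "\<eta> > 0"
    and s: "s \<ge> \<theta> * (15 * \<kappa>\<^sup>2 / p * (1 / n + 4 * \<kappa>\<^sup>2)) + (\<kappa> ^ 3 * n + \<kappa>\<^sup>2 * sqrt n + \<kappa>\<^sup>2 + 1 / n + \<epsilon> + \<eta>)"
    and r: "\<kappa> ^ 3 * n + \<kappa>\<^sup>2 * sqrt n + \<kappa>\<^sup>2 + 1 / n + \<epsilon> + \<eta> \<ge> 0"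
  shows "measure N {x \<in> space N. Re (w * fX z x) \<ge> s + t} \<le>
    exp (- \<theta> * t) / (\<theta> * t) + (1 + n * \<kappa>) * exp (\<theta> * 1) / t * (4 ^ n * exp (- \<eta>\<^sup>2 / (8 * \<kappa> ^ 4)))"
proof -
  have "measure N {x \<in> space N. Re (w * fX z x) \<ge> s + t} \<le> exp (- \<theta> * t) / (\<theta> * t) + (1 + n * \<kappa>) * exp (\<theta> * 1) / t * measure N (bad \<eta>)"
  proof (rule exchangeable_tail[where F = "FE z w" and b = "BE z" and c' = "2 * \<kappa> / (p * n) * (1 / 4 + 1 / 4)"
      and B = "15 * \<kappa>\<^sup>2 / p * (1 / n + 4 * \<kappa>\<^sup>2)" and \<eta> = "\<kappa> ^ 3 * n + \<kappa>\<^sup>2 * sqrt n + \<kappa>\<^sup>2 + 1 / n + \<epsilon> + \<eta>"])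
    show "(\<lambda>x. Re (w * fX z x)) \<in> borel_measurable N" using fX_measurable by measurable
    have le: "Re (w * u) \<le> cmod u" "\<bar>Re (w * u)\<bar> \<le> cmod u" for u
      using complex_Re_le_cmod[of "w * u"] abs_Re_le_cmod[of "w * u"] w by (simp_all only: norm_mult mult_1)
    have f1: "cmod (fX z x) \<le> 1" for x
      unfolding fX_def by (rule perr_bound[OF herm_Amat herm_Cmat z])
    show "\<bar>Re (w * fX z x)\<bar> \<le> 1" for x using le(2)[of "fX z x"] f1[of x] by linarith
    show "FE z w e \<in> borel_measurable (N \<Otimes>\<^sub>M \<mu> e)" if "e \<in> edges n" for e by (rule FE_measurable[OF that])
    show "\<bar>FE z w e q\<bar> \<le> 2 * \<kappa> / (p * n) * (1 / 4 + 1 / 4)" if e: "e \<in> edges n" for e q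
    proof -
      obtain i j x y where ij: "e = (i, j)" "i \<le> j" "j < n" "q = (x, y)" using e by (cases q) (auto simp: edges_def)
      show ?thesis
      proof (cases "i < j")
        case True
        have "\<bar>FE z w e (x, y)\<bar> \<le> 2 * \<kappa> / (p * n) * (cmod (MZ z i j x j i) + cmod (MZ z i j x i j))"
          by (rule FE_bound[OF w ij(1) True ij(3)])
        also have "\<dots> \<le> 2 * \<kappa> / (p * n) * (1 / 4 + 1 / 4)"
          using \<kappa> p True ij by (intro mult_left_mono add_mono MZ_bound(2)[OF z]) auto
        finally show ?thesis using ij by simp
      next
        case False
        thus ?thesis using ij \<kappa> p by (simp add: FE_def)
      qed
    qed
    show "FE z w e (x(e := y), x e) = - FE z w e (x, y)" if "e \<in> edges n" for e x y
    proof -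
      obtain i j where ij: "e = (i, j)" using that by (cases e)
      show ?thesis
      proof (cases "i < j \<and> x e \<in> S \<and> y \<in> S")
        case True
        hence "MZ z i j (x(e := y)) = MZ z i j x"
          using ij Cmat_upd[of x i j y] zero_entry_upd[of i j x y] by (simp add: MZ_def)
        thus ?thesis using True ij by (simp add: FE_def algebra_simps minus_divide_left add_divide_distrib diff_divide_distrib)
      next
        case False
        thus ?thesis using ij by (auto simp: FE_def)
      qed
    qed
    show "\<bar>FE z w e (x, y)\<bar> * \<bar>Re (w * fX z x) - Re (w * fX z (x(e := y)))\<bar> \<le> BE z e x" if "e \<in> edges n" for e x y
      by (rule FE_increment[OF z w that])
    show "(\<Sum>e\<in>edges n. BE z e x) \<le> 15 * \<kappa>\<^sup>2 / p * (1 / n + 4 * \<kappa>\<^sup>2)" for x by (rule BE_sum[OF z])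
    show "bad \<eta> \<in> sets N" by (rule bad_sets)
    have dif: "Re (w * fX z x) - (\<Sum>e\<in>edges n. \<integral>y. FE z w e (x, y) \<partial>\<mu> e) \<le> cmod (fX z x - plin n (Amat x) (Cmat x) z)" for x
      unfolding FE_integral_sum using le(1)[of "fX z x - plin n (Amat x) (Cmat x) z"] by (simp only: right_diff_distrib minus_complex.simps)
    show "Re (w * fX z x) - (\<Sum>e\<in>edges n. \<integral>y. FE z w e (x, y) \<partial>\<mu> e) \<le> 1 + n * \<kappa>" for x
      using dif[of x] f1[of x] plin_bound[OF z, of x] norm_triangle_ineq4[of "fX z x" "plin n (Amat x) (Cmat x) z"] by linarith
    show "Re (w * fX z x) - (\<Sum>e\<in>edges n. \<integral>y. FE z w e (x, y) \<partial>\<mu> e) \<le> \<kappa> ^ 3 * n + \<kappa>\<^sup>2 * sqrt n + \<kappa>\<^sup>2 + 1 / n + \<epsilon> + \<eta>"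
      if "x \<in> space N" "x \<notin> bad \<eta>" for x
      using dif[of x] fX_plin_good[OF z that \<eta>] by linarith
    have B0: "15 * \<kappa>\<^sup>2 / p * (1 / n + 4 * \<kappa>\<^sup>2) \<ge> 0" using p by simp
    show "s \<ge> 0" using s r \<theta> B0 by (smt (verit) mult_nonneg_nonneg)
  qed (use s r \<theta> t \<kappa> in auto)
  also have "\<dots> \<le> exp (- \<theta> * t) / (\<theta> * t) + (1 + n * \<kappa>) * exp (\<theta> * 1) / t * (4 ^ n * exp (- \<eta>\<^sup>2 / (8 * \<kappa> ^ 4)))"
    using \<kappa> t by (intro add_left_mono mult_left_mono measure_bad \<eta>) auto
  finally show ?thesis .
qed

text \<open>If the modulus is at least \<open>2 * (s + t)\<close>, then in one of the four
  directions \<open>1\<close>, \<open>-1\<close>, \<open>\<i>\<close>, \<open>-\<i>\<close> the real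
  part reaches \<open>s + t\<close>.\<close>

lemma fX_tail:
  assumes z: "Im z \<ge> 2" and \<theta>: "\<theta> > 0" and t: "t > 0" and \<eta>: "\<eta> > 0"
    and s: "s \<ge> \<theta> * (15 * \<kappa>\<^sup>2 / p * (1 / n + 4 * \<kappa>\<^sup>2)) + (\<kappa> ^ 3 * n + \<kappa>\<^sup>2 * sqrt n + \<kappa>\<^sup>2 + 1 / n + \<epsilon> + \<eta>)"
    and r: "\<epsilon> \<ge> 0"
  shows "measure N {x \<in> space N. cmod (fX z x) \<ge> 2 * (s + t)} \<le>
    4 * (exp (- \<theta> * t) / (\<theta> * t) + (1 + n * \<kappa>) * exp (\<theta> * 1) / t * (4 ^ n * exp (- \<eta>\<^sup>2 / (8 * \<kappa> ^ 4))))"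
proof -
  let ?D = "\<lambda>w. {x \<in> space N. Re (w * fX z x) \<ge> s + t}"
  have D[measurable]: "?D w \<in> sets N" for w using fX_measurable by measurable
  have sub: "{x \<in> space N. cmod (fX z x) \<ge> 2 * (s + t)} \<subseteq> (\<Union>w\<in>{1, -1, \<i>, -\<i>}. ?D w)"
  proof
    fix x assume "x \<in> {x \<in> space N. cmod (fX z x) \<ge> 2 * (s + t)}"
    hence x: "x \<in> space N" "cmod (fX z x) \<ge> 2 * (s + t)" by auto
    have "2 * (s + t) \<le> \<bar>Re (fX z x)\<bar> + \<bar>Im (fX z x)\<bar>" using x(2) cmod_le[of "fX z x"] by linarith
    hence "s + t \<le> Re (fX z x) \<or> s + t \<le> - Re (fX z x) \<or> s + t \<le> Im (fX z x) \<or> s + t \<le> - Im (fX z x)"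
      by (cases "Re (fX z x) \<ge> 0"; cases "Im (fX z x) \<ge> 0"; simp; linarith)
    moreover have "Re (1 * fX z x) = Re (fX z x)" "Re (- 1 * fX z x) = - Re (fX z x)"
      "Re (- \<i> * fX z x) = Im (fX z x)" "Re (\<i> * fX z x) = - Im (fX z x)" by simp_all
    ultimately have "s + t \<le> Re (1 * fX z x) \<or> s + t \<le> Re (- 1 * fX z x) \<or> s + t \<le> Re (- \<i> * fX z x) \<or> s + t \<le> Re (\<i> * fX z x)"
      by presburger
    thus "x \<in> (\<Union>w\<in>{1, -1, \<i>, -\<i>}. ?D w)" using x(1) by blast
  qed
  define V where "V = {1, -1, \<i>, -\<i>}"
  have V: "finite V" "card V = 4" by (auto simp: V_def complex_eq_iff)
  have V1: "cmod w = 1" if "w \<in> V" for w using that by (auto simp: V_def)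
  have "measure N {x \<in> space N. cmod (fX z x) \<ge> 2 * (s + t)} \<le> measure N (\<Union>w\<in>V. ?D w)"
    unfolding V_def by (rule P.finite_measure_mono[OF sub]) (intro sets.finite_UN D finite.intros)
  also have "\<dots> \<le> (\<Sum>w\<in>V. measure N (?D w))"
    by (intro P.finite_measure_subadditive_finite V) (use D in blast)
  also have "\<dots> \<le> (\<Sum>w\<in>V. exp (- \<theta> * t) / (\<theta> * t) + (1 + n * \<kappa>) * exp (\<theta> * 1) / t * (4 ^ n * exp (- \<eta>\<^sup>2 / (8 * \<kappa> ^ 4))))"
    by (intro sum_mono fX_tail_directional z \<theta> t \<eta> s V1) (use \<kappa> r \<eta> in auto)
  also have "\<dots> = 4 * (exp (- \<theta> * t) / (\<theta> * t) + (1 + n * \<kappa>) * exp (\<theta> * 1) / t * (4 ^ n * exp (- \<eta>\<^sup>2 / (8 * \<kappa> ^ 4))))"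
    by (simp add: V(2))
  finally show ?thesis .
qed

end


section \<open>Free pairs\<close>

text \<open>The linear functional on polynomials that sends the \<open>k\<close>-th power of the
  variable to \<open>F k\<close>.\<close>

definition pfun :: "(nat \<Rightarrow> 'a) \<Rightarrow> 'a::comm_ring_1 poly \<Rightarrow> 'a" where
  "pfun F p = (\<Sum>k\<le>degree p. poly.coeff p k * F k)"

lemma pfun_bound: "degree p \<le> n \<Longrightarrow> pfun F p = (\<Sum>k\<le>n. poly.coeff p k * F k)"
  unfolding pfun_def by (rule sum.mono_neutral_left) (auto simp: coeff_eq_0)

lemma pfun_add: "pfun F (p + q) = pfun F p + pfun F q"
proof -
  define n where "n = max (degree p) (degree q)"
  have "degree p \<le> n" "degree q \<le> n" "degree (p + q) \<le> n" by (auto simp: n_def degree_add_le_max)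
  thus ?thesis by (simp add: pfun_bound[of _ n] sum.distrib algebra_simps)
qed

lemma pfun_smult: "pfun F (Polynomial.smult c p) = c * pfun F p"
  by (subst pfun_bound[of _ "degree p"]) (auto simp: pfun_def sum_distrib_left mult_ac degree_smult_le)

lemma pfun_pCons: "pfun F (pCons a p) = a * F 0 + pfun (\<lambda>k. F (Suc k)) p"
  by (subst pfun_bound[of _ "Suc (degree p)"])
     (auto simp: pfun_def degree_pCons_le sum.atMost_Suc_shift simp del: sum.atMost_Suc)

lemma pfun_0[simp]: "pfun F 0 = 0" by (simp add: pfun_def)

lemma pfun_add_fun: "pfun (\<lambda>k. F k + G k) p = pfun F p + pfun G p"
  by (simp add: pfun_def sum.distrib algebra_simps)

lemma pfun_scale_fun: "pfun (\<lambda>k. c * F k) p = c * pfun F p"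
  by (simp add: pfun_def sum_distrib_left mult_ac)

lemma poly_moment_Cons: "poly_moment \<tau> ((i, p) # ps) = pfun (\<lambda>k. poly_moment (\<lambda>w. \<tau> (replicate k i @ w)) ps) p"
  by (simp add: pfun_def)

declare poly_moment.simps(2)[simp del]

lemma poly_moment_add:
  "poly_moment \<tau> (qs @ (i, p + q) # rs) = poly_moment \<tau> (qs @ (i, p) # rs) + poly_moment \<tau> (qs @ (i, q) # rs)"
  by (induction qs arbitrary: \<tau>) (auto simp: poly_moment_Cons pfun_add pfun_add_fun)

lemma poly_moment_const: "poly_moment \<tau> (qs @ (i, [:c:]) # rs) = c * poly_moment \<tau> (qs @ rs)"
  by (induction qs arbitrary: \<tau>) (auto simp: poly_moment_Cons pfun_pCons pfun_scale_fun)

text \<open>Applying two polynomials to the same variable one after the other is applying their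
  product. This merges equal neighbours in a word and later turns inner products into
  moments.\<close>

lemma pfun_mult: "pfun (\<lambda>k. pfun (\<lambda>l. F (k + l)) q) p = pfun F (p * q)"
proof (induction p arbitrary: F)
  case (pCons a p)
  have "pfun (\<lambda>k. pfun (\<lambda>l. F (k + l)) q) (pCons a p) = a * pfun F q + pfun (\<lambda>k. pfun (\<lambda>l. F (Suc k + l)) q) p"
    by (simp add: pfun_pCons)
  also have "pfun (\<lambda>k. pfun (\<lambda>l. F (Suc k + l)) q) p = pfun (\<lambda>k. F (Suc k)) (p * q)"
    using pCons.IH[of "\<lambda>k. F (Suc k)"] by simp
  also have "a * pfun F q + \<dots> = pfun F (pCons a p * q)"
    by (simp add: mult_pCons_left pfun_add pfun_smult pfun_pCons)
  finally show ?case .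
qed simp

lemma poly_moment_merge: "poly_moment \<tau> (qs @ (i, p) # (i, q) # rs) = poly_moment \<tau> (qs @ (i, p * q) # rs)"
proof (induction qs arbitrary: \<tau>)
  case Nil
  have "poly_moment \<tau> ((i, p) # (i, q) # rs) = pfun (\<lambda>k. pfun (\<lambda>l. poly_moment (\<lambda>w. \<tau> (replicate (k + l) i @ w)) rs) q) p"
    by (simp add: poly_moment_Cons replicate_add)
  thus ?case using pfun_mult[of "\<lambda>m. poly_moment (\<lambda>w. \<tau> (replicate m i @ w)) rs" q p]
    by (simp add: poly_moment_Cons)
qed (auto simp: poly_moment_Cons)

lemma poly_moment_word: "poly_moment \<tau> (map (\<lambda>b. (b, [:0, 1:])) w) = \<tau> w"
  by (induction w arbitrary: \<tau>) (auto simp: poly_moment_Cons pfun_pCons)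

lemma poly_moment_single: "poly_moment \<tau> [(i, p)] = pfun (\<lambda>k. \<tau> (replicate k i)) p"
  by (simp add: poly_moment_Cons)

lemma not_distinct_adj_split:
  "\<not> distinct_adj (map f xs) \<Longrightarrow> \<exists>us x y vs. xs = us @ x # y # vs \<and> f x = f y"
proof (induction xs)
  case (Cons a xs)
  show ?case
  proof (cases xs)
    case (Cons b zs)
    show ?thesis
    proof (cases "f a = f b")
      case True
      thus ?thesis using Cons by (intro exI[of _ "[]"]) auto
    next
      case False
      hence "\<not> distinct_adj (map f xs)" using Cons.prems Cons by auto
      from Cons.IH[OF this] obtain us x y vs where "xs = us @ x # y # vs" "f x = f y" by blast
      thus ?thesis by (intro exI[of _ "a # us"]) auto
    qed
  qed (use Cons in auto)
qed auto

lemma free_pairD: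
  "free_pair \<tau> \<Longrightarrow> ps \<noteq> [] \<Longrightarrow> distinct_adj (map fst ps) \<Longrightarrow> (\<And>q. q \<in> set ps \<Longrightarrow> poly_moment \<tau> [q] = 0)
    \<Longrightarrow> poly_moment \<tau> ps = 0"
  unfolding free_pair_def by blast

text \<open>
  Centring the factors of an alternating product one by one leaves products with fewer factors, so
  the moments of a free pair are determined by the marginals.
\<close>

lemma free_pair_unique:
  assumes f1: "free_pair \<tau>" and f2: "free_pair \<tau>'" and eq: "\<And>i k. \<tau> (replicate k i) = \<tau>' (replicate k i)"
  shows "\<tau> = \<tau>'"
proof -
  have main: "poly_moment \<tau> ps = poly_moment \<tau>' ps" for ps
  proof (induction "length ps" arbitrary: ps rule: less_induct)
    case less
    show ?case
    proof (cases "distinct_adj (map fst ps)")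
      case False
      then obtain us x y vs where s: "ps = us @ x # y # vs" "fst x = fst y"
        using not_distinct_adj_split by blast
      obtain i p where x: "x = (i, p)" by (cases x)
      obtain q where y: "y = (i, q)" using s(2) x by (cases y) auto
      have "length (us @ (i, p * q) # vs) < length ps" by (simp add: s(1))
      from less[OF this] show ?thesis unfolding s(1) x y poly_moment_merge .
    next
      case True
      \<comment> \<open>The suffix \<open>rs\<close> is already centred under \<open>\<tau>\<close>,
        hence under \<open>\<tau>'\<close>. The last factor of \<open>qs\<close> is split into a
        centred one, which joins \<open>rs\<close>, and a constant, which leaves a shorter product;
        the outer induction covers that one whether or not it is still alternating.\<close>
      have "poly_moment \<tau> (qs @ rs) = poly_moment \<tau>' (qs @ rs)"
        if "length (qs @ rs) = length ps" "distinct_adj (map fst (qs @ rs))" "\<forall>q\<in>set rs. poly_moment \<tau> [q] = 0" for qs rs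
        using that
      proof (induction qs arbitrary: rs rule: rev_induct)
        case Nil
        show ?case
        proof (cases "rs = []")
          case False
          have s: "poly_moment \<tau> [q] = poly_moment \<tau>' [q]" for q
            by (cases q) (simp add: poly_moment_single eq)
          have "distinct_adj (map fst rs)" using Nil.prems(2) by simp
          hence "poly_moment \<tau> rs = 0" "poly_moment \<tau>' rs = 0"
            using Nil.prems(3) by (auto intro!: free_pairD[OF f1 False] free_pairD[OF f2 False] simp: s[symmetric])
          thus ?thesis by simp
        next
          case True
          thus ?thesis using eq[of 0 False] by simp
        qed
      next
        case (snoc a qs)
        obtain i p where a: "a = (i, p)" by (cases a)
        define c where "c = poly_moment \<tau> [(i, p)]"
        define p' where "p' = p - [:c:]"
        have pp: "p' + [:c:] = p" by (simp add: p'_def)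
        have c0: "poly_moment \<tau> [(i, p)] = c" by (simp add: c_def)
        have t0: "\<tau> [] = 1" using f1 by (simp add: free_pair_def)
        have cen: "poly_moment \<tau> [(i, p')] = 0"
          using poly_moment_add[of \<tau> "[]" i p' "[:c:]" "[]", unfolded pp] poly_moment_const[of \<tau> "[]" i c "[]"] t0
          by (simp add: c0)
        have e: "poly_moment \<sigma> ((qs @ [a]) @ rs) = poly_moment \<sigma> (qs @ (i, p') # rs) + c * poly_moment \<sigma> (qs @ rs)" for \<sigma>
          using poly_moment_add[of \<sigma> qs i p' "[:c:]" rs, unfolded pp] poly_moment_const[of \<sigma> qs i c rs] by (simp add: a)
        have "poly_moment \<tau> (qs @ (i, p') # rs) = poly_moment \<tau>' (qs @ (i, p') # rs)"
          by (rule snoc.IH) (use snoc.prems cen a in auto)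
        moreover have "poly_moment \<tau> (qs @ rs) = poly_moment \<tau>' (qs @ rs)"
          by (rule less) (use snoc.prems in auto)
        ultimately show ?case unfolding e by simp
      qed
      from this[of ps "[]"] True show ?thesis by simp
    qed
  qed
  show ?thesis
  proof
    fix w
    show "\<tau> w = \<tau>' w" using main[of "map (\<lambda>b. (b, [:0, 1:])) w"] by (simp only: poly_moment_word)
  qed
qed

text \<open>For a measure on \<open>[-r, r]\<close> the characteristic function is the limit of its
  Taylor sums, since \<open>(|t| r)^n / n!\<close> tends to 0, and these sums involve nothing but
  moments.\<close>

lemma moments_determine_bounded_measure:
  assumes \<mu>: "prob_space \<mu>" "sets \<mu> = sets borel" "AE x in \<mu>. \<bar>x\<bar> \<le> r"
    and \<nu>: "prob_space \<nu>" "sets \<nu> = sets borel" "AE x in \<nu>. \<bar>x\<bar> \<le> r"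
    and eq: "\<And>k. (\<integral>x. x ^ k \<partial>\<mu>) = (\<integral>x. x ^ k \<partial>\<nu>)"
  shows "\<mu> = (\<nu> :: real measure)"
proof -
  have rd: "real_distribution \<mu>" "real_distribution \<nu>"
    using \<mu> \<nu> by (auto intro!: real_distribution.intro simp: real_distribution_axioms_def dest: sets_eq_imp_space_eq)
  have r0: "r \<ge> 0"
  proof -
    interpret prob_space \<mu> by fact
    from \<mu>(3) have "AE x in \<mu>. r \<ge> 0" by eventually_elim auto
    thus ?thesis by simp
  qed
  define s where "s n t = (\<Sum>k\<le>n. ((\<i> * t) ^ k / fact k) * of_real (\<integral>x. x ^ k \<partial>\<mu>))" for n and t :: real
  have conv: "(\<lambda>n. s n t) \<longlonglongrightarrow> char M t"
    if M: "real_distribution M" "AE x in M. \<bar>x\<bar> \<le> r" "\<And>k. (\<integral>x. x ^ k \<partial>M) = (\<integral>x. x ^ k \<partial>\<mu>)" for M t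
  proof -
    interpret real_distribution M by (rule M(1))
    have int: "integrable M (\<lambda>x. x ^ k)" for k
      by (rule integrable_const_bound[where B = "r ^ k"]) 
         (use M(2) in \<open>auto simp: power_abs elim!: eventually_mono intro!: power_mono\<close>)
    have bound: "cmod (char M t - s n t) \<le> 2 * ((\<bar>t\<bar> * r) ^ n / fact n)" for n
    proof -
      have e: "expectation (\<lambda>x. \<bar>x\<bar> ^ n) \<le> r ^ n"
      proof (rule integral_le_const)
        show "integrable M (\<lambda>x. \<bar>x\<bar> ^ n)" using integrable_abs[OF int[of n]] by (simp add: power_abs)
        show "AE x in M. \<bar>x\<bar> ^ n \<le> r ^ n" using M(2) by eventually_elim (intro power_mono, auto)
      qed
      have "cmod (char M t - s n t) \<le> (2*\<bar>t\<bar>^n / fact n) * expectation (\<lambda>x. \<bar>x\<bar>^n)"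
        using char_approx1[of n t] int M(3) by (simp add: s_def)
      also have "\<dots> \<le> (2*\<bar>t\<bar>^n / fact n) * r ^ n" by (intro mult_left_mono e) auto
      finally show ?thesis by (simp add: power_mult_distrib)
    qed
    have "(\<lambda>n. (\<bar>t\<bar> * r) ^ n / fact n) \<longlonglongrightarrow> 0"
      using summable_LIMSEQ_zero[OF summable_exp[of "\<bar>t\<bar> * r"]] by (simp add: field_simps)
    hence "(\<lambda>n. 2 * ((\<bar>t\<bar> * r) ^ n / fact n)) \<longlonglongrightarrow> 0" using tendsto_mult_right_zero by blast
    hence "(\<lambda>n. char M t - s n t) \<longlonglongrightarrow> 0"
      by (rule Lim_null_comparison[rotated]) (use bound in auto)
    hence "(\<lambda>n. char M t - (char M t - s n t)) \<longlonglongrightarrow> char M t - 0" by (intro tendsto_diff tendsto_const)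
    thus ?thesis by simp
  qed
  have "char \<mu> = char \<nu>"
    by (rule ext) (rule LIMSEQ_unique[OF conv[OF rd(1) \<mu>(3) refl] conv[OF rd(2) \<nu>(3) eq[symmetric]]])
  thus ?thesis using Levy_uniqueness[OF rd] by simp
qed


section \<open>A Fock model for a semicircular element free from a diagonal matrix\<close>

text \<open>
  A vector assigns to every \<open>i\<close> and every word of letters a number. The creation operator \<open>fl\<close>
  appends the current index to the word, the annihilation operator \<open>fs\<close> averages over it, and
  \<open>fl + fs\<close> is semicircular and free from the multiplication by \<open>\<lambda> i\<close>.
\<close>

type_synonym fvec = "nat \<Rightarrow> nat list \<Rightarrow> complex"

definition fl :: "fvec \<Rightarrow> fvec" where
  "fl v i w = (case w of [] \<Rightarrow> 0 | j # w' \<Rightarrow> v j w')"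

definition fom :: fvec where "fom i w = (if w = [] then 1 else 0)"

text \<open>Linearity is stated for finite combinations because this is the form in which a
  polynomial of an operator appears.\<close>

definition flin :: "(fvec \<Rightarrow> fvec) \<Rightarrow> bool" where
  "flin T \<longleftrightarrow> (\<forall>n c v. T (\<lambda>i w. \<Sum>k\<le>(n::nat). c k * v k i w) = (\<lambda>i w. \<Sum>k\<le>n. c k * T (v k) i w))"

definition flinf :: "(fvec \<Rightarrow> complex) \<Rightarrow> bool" where
  "flinf T \<longleftrightarrow> (\<forall>n c v. T (\<lambda>i w. \<Sum>k\<le>(n::nat). c k * v k i w) = (\<Sum>k\<le>n. c k * T (v k)))"

lemma flinD: "flin T \<Longrightarrow> T (\<lambda>i w. \<Sum>k\<le>(n::nat). c k * v k i w) = (\<lambda>i w. \<Sum>k\<le>n. c k * T (v k) i w)"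
  by (simp add: flin_def)

lemma flinfD: "flinf T \<Longrightarrow> T (\<lambda>i w. \<Sum>k\<le>(n::nat). c k * v k i w) = (\<Sum>k\<le>n. c k * T (v k))"
  by (simp add: flinf_def)

lemma flin_pow: "flin T \<Longrightarrow> flin (T ^^ k)"
  by (induction k) (auto simp: flin_def)

lemma flinf_comp: "flinf \<Phi> \<Longrightarrow> flin T \<Longrightarrow> flinf (\<lambda>v. \<Phi> (T v))"
  by (simp add: flin_def flinf_def)

lemma flinf_add: assumes "flinf T" shows "T (\<lambda>i w. u i w + v i w) = T u + T v"
proof -
  have "T (\<lambda>i w. \<Sum>k\<le>(1::nat). 1 * (if k = 0 then u else v) i w) = (\<Sum>k\<le>(1::nat). 1 * T (if k = 0 then u else v))"
    by (rule flinfD[OF assms])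
  thus ?thesis by simp
qed

lemma flin_fl: "flin fl"
  by (auto simp: flin_def fl_def fun_eq_iff split: list.split)

locale fock =
  fixes n :: nat and lam :: "nat \<Rightarrow> real"
  assumes n: "n > 0"
begin

definition fy :: "fvec \<Rightarrow> fvec" where "fy v i w = of_real (lam i) * v i w"
text \<open>Takes the normalised trace over the current index and makes the first letter of the word
  the new index. Hence \<open>fs (d (fl v))\<close> is \<open>v\<close> times the normalised trace
  of \<open>d\<close> for a diagonal matrix \<open>d\<close>; this relation makes
  \<open>fl + fs\<close> semicircular and free from the diagonal.\<close>

definition fs :: "fvec \<Rightarrow> fvec" where "fs v i w = (\<Sum>k<n. v k (i # w)) / of_nat n"
definition fx :: "fvec \<Rightarrow> fvec" where "fx v i w = fl v i w + fs v i w"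
definition fT :: "fvec \<Rightarrow> fvec" where "fT v i w = fx v i w + fy v i w"
definition phi :: "fvec \<Rightarrow> complex" where "phi v = (\<Sum>i<n. v i []) / of_nat n"
definition fop :: "bool \<Rightarrow> fvec \<Rightarrow> fvec" where "fop b = (if b then fy else fx)"
definition act :: "bool list \<Rightarrow> fvec \<Rightarrow> fvec" where "act w v = foldr fop w v"
definition ftau :: "bool list \<Rightarrow> complex" where "ftau w = phi (act w fom)"
definition fm :: "nat \<Rightarrow> complex" where "fm k = (\<Sum>i<n. of_real (lam i) ^ k) / of_nat n"
text \<open>The conditional expectation of the \<open>k\<close>-th power of \<open>x + y\<close>
  onto the diagonal matrices. Its average over \<open>i\<close> is the moment
  \<open>fR k\<close>.\<close>

definition fM :: "nat \<Rightarrow> nat \<Rightarrow> complex" where "fM i k = (fT ^^ k) fom i []"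
definition fR :: "nat \<Rightarrow> complex" where "fR k = phi ((fT ^^ k) fom)"

lemma flin_fy: "flin fy" by (auto simp: flin_def fy_def fun_eq_iff sum_distrib_left mult_ac)

lemma flin_fs: "flin fs"
  unfolding flin_def
proof (intro allI ext)
  fix m :: nat and c :: "nat \<Rightarrow> complex" and v :: "nat \<Rightarrow> fvec" and i w
  have "(\<Sum>k<n. \<Sum>l\<le>m. c l * v l k (i # w)) = (\<Sum>l\<le>m. c l * (\<Sum>k<n. v l k (i # w)))"
    unfolding sum_distrib_left by (rule sum.swap)
  thus "fs (\<lambda>i w. \<Sum>k\<le>m. c k * v k i w) i w = (\<Sum>k\<le>m. c k * fs (v k) i w)"
    by (simp add: fs_def sum_divide_distrib[symmetric])
qed

lemma flin_fx: "flin fx"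
  using flin_fl flin_fs by (simp add: flin_def fx_def fun_eq_iff sum.distrib distrib_left)

lemma flin_fT: "flin fT"
  using flin_fx flin_fy by (simp add: flin_def fT_def fun_eq_iff sum.distrib distrib_left)

lemma flinf_phi: "flinf phi"
  unfolding flinf_def
proof (intro allI)
  fix m :: nat and c :: "nat \<Rightarrow> complex" and v :: "nat \<Rightarrow> fvec"
  have "(\<Sum>i<n. \<Sum>l\<le>m. c l * v l i []) = (\<Sum>l\<le>m. c l * (\<Sum>i<n. v l i []))"
    unfolding sum_distrib_left by (rule sum.swap)
  thus "phi (\<lambda>i w. \<Sum>k\<le>m. c k * v k i w) = (\<Sum>k\<le>m. c k * phi (v k))"
    by (simp add: phi_def sum_divide_distrib[symmetric])
qed

lemma flin_fop: "flin (fop b)" by (simp add: fop_def flin_fx flin_fy)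

lemma act_append: "act (u @ w) v = act u (act w v)" by (simp add: act_def)
lemma act_replicate: "act (replicate k b) v = (fop b ^^ k) v"
  by (induction k) (auto simp: act_def)
lemma act_Cons: "act (b # w) v = fop b (act w v)" by (simp add: act_def)
lemma act_Nil[simp]: "act [] v = v" by (simp add: act_def)

definition fpoly :: "bool \<Rightarrow> complex poly \<Rightarrow> fvec \<Rightarrow> fvec" where
  "fpoly b p v = (\<lambda>i w. \<Sum>k\<le>degree p. poly.coeff p k * (fop b ^^ k) v i w)"

fun pact :: "(bool \<times> complex poly) list \<Rightarrow> fvec \<Rightarrow> fvec" where
  "pact [] v = v"
| "pact ((b, p) # ps) v = fpoly b p (pact ps v)"

text \<open>Stated for every linear \<Phi> so that the induction can absorb the leading powers into
  \<Phi>.\<close>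

lemma poly_moment_act: "flinf \<Phi> \<Longrightarrow> poly_moment (\<lambda>w. \<Phi> (act w v)) ps = \<Phi> (pact ps v)"
proof (induction ps arbitrary: \<Phi>)
  case (Cons a ps)
  obtain b p where a: "a = (b, p)" by (cases a)
  have "poly_moment (\<lambda>w. \<Phi> (act w v)) (a # ps)
     = pfun (\<lambda>k. poly_moment (\<lambda>w. \<Phi> ((fop b ^^ k) (act w v))) ps) p"
    by (simp add: a poly_moment_Cons act_append act_replicate)
  also have "\<dots> = pfun (\<lambda>k. \<Phi> ((fop b ^^ k) (pact ps v))) p"
    by (simp add: Cons.IH[OF flinf_comp[OF Cons.prems flin_pow[OF flin_fop]]])
  also have "\<dots> = \<Phi> (pact (a # ps) v)"
    by (simp add: a fpoly_def flinfD[OF Cons.prems] pfun_def)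
  finally show ?case .
qed simp

lemma fs_fl: "fs (fl v) = v"
  using n by (auto simp: fs_def fl_def fun_eq_iff)

text \<open>The coefficients of \<open>(fl + fs) ^ k\<close> on the kernel of \<open>fs\<close>, expanded in powers of \<open>fl\<close>.\<close>

fun fc :: "nat \<Rightarrow> nat \<Rightarrow> complex" where
  "fc 0 m = (if m = 0 then 1 else 0)"
| "fc (Suc k) m = (case m of 0 \<Rightarrow> 0 | Suc m' \<Rightarrow> fc k m') + fc k (Suc m)"

lemma fc_zero: "m > k \<Longrightarrow> fc k m = 0"
  by (induction k arbitrary: m) (auto split: nat.split)

lemma fx_pow_kernel:
  assumes v: "fs v = (\<lambda>i w. 0)"
  shows "(fx ^^ k) v = (\<lambda>i w. \<Sum>m\<le>k. fc k m * (fl ^^ m) v i w)"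
proof (induction k)
  case (Suc k)
  have lp: "fs ((fl ^^ m) v) i w = (case m of 0 \<Rightarrow> 0 | Suc m' \<Rightarrow> (fl ^^ m') v i w)" for m i w
    using v by (cases m) (auto simp: fs_fl)
  show ?case
  proof (intro ext)
    fix i w
    have "(fx ^^ Suc k) v i w = (\<Sum>m\<le>k. fc k m * fx ((fl ^^ m) v) i w)"
      by (simp add: Suc flinD[OF flin_fx])
    also have "\<dots> = (\<Sum>m\<le>k. fc k m * (fl ^^ Suc m) v i w) + (\<Sum>m\<le>k. fc k m * (case m of 0 \<Rightarrow> 0 | Suc m' \<Rightarrow> (fl ^^ m') v i w))"
      by (simp add: fx_def lp distrib_left sum.distrib)
    also have "(\<Sum>m\<le>k. fc k m * (fl ^^ Suc m) v i w) = (\<Sum>m\<le>Suc k. (case m of 0 \<Rightarrow> 0 | Suc m' \<Rightarrow> fc k m') * (fl ^^ m) v i w)"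
      by (simp add: sum.atMost_Suc_shift del: sum.atMost_Suc)
    also have "(\<Sum>m\<le>k. fc k m * (case m of 0 \<Rightarrow> 0 | Suc m' \<Rightarrow> (fl ^^ m') v i w))
       = (\<Sum>m\<le>Suc (Suc k). fc k m * (case m of 0 \<Rightarrow> 0 | Suc m' \<Rightarrow> (fl ^^ m') v i w))"
      by (simp add: fc_zero)
    also have "\<dots> = (\<Sum>m\<le>Suc k. fc k (Suc m) * (fl ^^ m) v i w)"
      by (subst sum.atMost_Suc_shift) simp
    finally show "(fx ^^ Suc k) v i w = (\<Sum>m\<le>Suc k. fc (Suc k) m * (fl ^^ m) v i w)"
      by (simp only: sum.distrib[symmetric] distrib_right[symmetric] fc.simps)
  qed
qed simp

lemma fs_fom: "fs fom = (\<lambda>i w. 0)" by (auto simp: fs_def fom_def fun_eq_iff)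

lemma phi_fl: "phi (fl v) = 0" by (simp add: phi_def fl_def)

lemma phi_fom: "phi fom = 1" using n by (simp add: phi_def fom_def)

lemma phi_fx_pow: "phi ((fx ^^ k) fom) = fc k 0"
proof -
  have "phi ((fx ^^ k) fom) = (\<Sum>m\<le>k. fc k m * phi ((fl ^^ m) fom))"
    by (simp add: fx_pow_kernel[OF fs_fom] flinfD[OF flinf_phi])
  also have "\<dots> = (\<Sum>m\<le>k. if m = 0 then fc k 0 else 0)"
  proof (intro sum.cong refl)
    fix m show "fc k m * phi ((fl ^^ m) fom) = (if m = 0 then fc k 0 else 0)"
      by (cases m) (auto simp: phi_fom phi_fl)
  qed
  finally show ?thesis by simp
qed

lemma ftau_x: "ftau (replicate k False) = fc k 0"
  by (simp add: ftau_def act_replicate fop_def phi_fx_pow)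

lemma fy_pow: "(fy ^^ k) v i w = of_real (lam i) ^ k * v i w"
  by (induction k arbitrary: i w) (auto simp: fy_def)

lemma ftau_y: "ftau (replicate k True) = fm k"
  using n by (simp add: ftau_def act_replicate fop_def phi_def fy_pow fm_def fom_def)

text \<open>On the kernel of \<open>fs\<close>, the powers of \<open>x\<close> expand in powers of
  \<open>fl\<close>. The coefficient of the zeroth power in \<open>p\<close> of \<open>x\<close> is
  the moment of \<open>p\<close>, which centring makes 0; all else lies in the range of
  \<open>fl\<close>.\<close>

lemma centered_x:
  assumes "pfun (\<lambda>k. ftau (replicate k False)) p = 0" "fs v = (\<lambda>i w. 0)"
  shows "\<exists>u. fpoly False p v = fl u"
proof -
  define u where "u = (\<lambda>i w. \<Sum>k\<le>degree p. poly.coeff p k * (\<Sum>m<k. fc k (Suc m) * (fl ^^ m) v i w))"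
  have "fpoly False p v i w = fl u i w" for i w
  proof -
    have s: "(fx ^^ k) v i w = fc k 0 * v i w + (\<Sum>m<k. fc k (Suc m) * fl ((fl ^^ m) v) i w)" for k
      unfolding fx_pow_kernel[OF assms(2)] lessThan_Suc_atMost[symmetric] sum.lessThan_Suc_shift by simp
    have "fpoly False p v i w = (\<Sum>k\<le>degree p. poly.coeff p k * fc k 0) * v i w
        + (\<Sum>k\<le>degree p. poly.coeff p k * (\<Sum>m<k. fc k (Suc m) * fl ((fl ^^ m) v) i w))"
      by (simp add: fpoly_def fop_def s distrib_left sum.distrib sum_distrib_right mult.assoc)
    also have "(\<Sum>k\<le>degree p. poly.coeff p k * fc k 0) = 0"
      using assms(1) by (simp add: pfun_def ftau_x)
    also have "(\<Sum>k\<le>degree p. poly.coeff p k * (\<Sum>m<k. fc k (Suc m) * fl ((fl ^^ m) v) i w)) = fl u i w"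
      by (cases w) (auto simp: u_def fl_def)
    finally show ?thesis by simp
  qed
  thus ?thesis by blast
qed

text \<open>Neither \<open>fl u\<close> nor \<open>fom\<close> depends on the current index, so
  \<open>fs\<close> and \<open>phi\<close> see the polynomial only through its average over the
  \<open>lam i\<close>, which is 0.\<close>

lemma centered_y:
  assumes "pfun (\<lambda>k. ftau (replicate k True)) p = 0"
  shows "fs (fpoly True p (fl u)) = (\<lambda>i w. 0)" "phi (fpoly True p (fl u)) = 0"
    "fs (fpoly True p fom) = (\<lambda>i w. 0)" "phi (fpoly True p fom) = 0"
proof -
  have 0: "(\<Sum>k\<le>degree p. poly.coeff p k * (\<Sum>l<n. of_real (lam l) ^ k)) = 0"
  proof -
    have "(\<Sum>k\<le>degree p. poly.coeff p k * (\<Sum>l<n. of_real (lam l) ^ k)) / of_nat n = pfun (\<lambda>k. ftau (replicate k True)) p"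
      unfolding pfun_def ftau_y fm_def sum_divide_distrib times_divide_eq_right[symmetric] ..
    thus ?thesis using assms n by simp
  qed
  have "(\<Sum>l<n. \<Sum>k\<le>degree p. poly.coeff p k * (of_real (lam l) ^ k * c))
      = (\<Sum>k\<le>degree p. poly.coeff p k * (\<Sum>l<n. of_real (lam l) ^ k)) * c" for c
    by (subst sum.swap) (simp add: sum_distrib_left sum_distrib_right mult_ac)
  hence 1: "(\<Sum>l<n. \<Sum>k\<le>degree p. poly.coeff p k * (of_real (lam l) ^ k * c)) = 0" for c using 0 by simp
  show "fs (fpoly True p (fl u)) = (\<lambda>i w. 0)"
    by (simp add: fun_eq_iff fs_def fpoly_def fop_def fy_pow fl_def 1)
  show "phi (fpoly True p (fl u)) = 0" by (simp add: phi_def fpoly_def fop_def fy_pow fl_def)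
  show "fs (fpoly True p fom) = (\<lambda>i w. 0)" by (simp add: fun_eq_iff fs_def fpoly_def fop_def fy_pow fom_def)
  show "phi (fpoly True p fom) = 0" using 1[of 1] by (simp add: phi_def fpoly_def fop_def fy_pow fom_def)
qed

text \<open>Read from the right, an alternating product of centred elements applied to
  \<open>fom\<close> oscillates: after a factor in \<open>x\<close> the vector lies in the range of
  \<open>fl\<close>, after one in \<open>y\<close> it lies in the kernels of \<open>fs\<close> and
  \<open>phi\<close>. Either way \<open>phi\<close> vanishes.\<close>

lemma ftau_free: "free_pair ftau"
proof -
  have pm: "poly_moment ftau ps = phi (pact ps fom)" for ps
    using poly_moment_act[OF flinf_phi, of fom ps] by (simp add: ftau_def[abs_def])
  have key: "(fst (hd ps) = False \<longrightarrow> (\<exists>u. pact ps fom = fl u)) \<and>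
      (fst (hd ps) = True \<longrightarrow> fs (pact ps fom) = (\<lambda>i w. 0) \<and> phi (pact ps fom) = 0)"
    if "ps \<noteq> []" "distinct_adj (map fst ps)" "\<forall>q\<in>set ps. poly_moment ftau [q] = 0" for ps
    using that
  proof (induction ps)
    case (Cons a ps)
    obtain b p where a: "a = (b, p)" by (cases a)
    have cen: "pfun (\<lambda>k. ftau (replicate k b)) p = 0"
      using Cons.prems(3) by (simp add: a poly_moment_single)
    show ?case
    proof (cases ps)
      case Nil
      show ?thesis
      proof (cases b)
        case True
        thus ?thesis using centered_y(3,4)[of p] cen Nil by (simp add: a)
      next
        case False
        thus ?thesis using centered_x[of p fom] fs_fom cen Nil by (simp add: a)
      qed
    next
      case (Cons c qs)
      have IH: "(fst c = False \<longrightarrow> (\<exists>u. pact ps fom = fl u)) \<and>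
        (fst c = True \<longrightarrow> fs (pact ps fom) = (\<lambda>i w. 0) \<and> phi (pact ps fom) = 0)"
        using Cons.IH Cons.prems Cons by auto
      have "b \<noteq> fst c" using Cons.prems(2) Cons by (simp add: a)
      show ?thesis
      proof (cases b)
        case True
        then obtain u where "pact ps fom = fl u" using IH \<open>b \<noteq> fst c\<close> by auto
        thus ?thesis using centered_y(1,2)[of p u] cen True by (simp add: a)
      next
        case False
        hence "fs (pact ps fom) = (\<lambda>i w. 0)" using IH \<open>b \<noteq> fst c\<close> by simp
        thus ?thesis using centered_x[of p "pact ps fom"] cen False by (simp add: a)
      qed
    qed
  qed simp
  have "phi (pact ps fom) = 0"
    if "ps \<noteq> []" "distinct_adj (map fst ps)" "\<forall>q\<in>set ps. poly_moment ftau [q] = 0" for ps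
    using key[OF that] phi_fl by (cases "fst (hd ps)") auto
  moreover have "ftau [] = 1" by (simp add: ftau_def phi_fom)
  ultimately show ?thesis unfolding free_pair_def pm[symmetric] by blast
qed

lemma words_sum: "flinf \<Phi> \<Longrightarrow> (\<Sum>w | length w = k. \<Phi> (act w v)) = \<Phi> ((fT ^^ k) v)"
proof (induction k arbitrary: \<Phi>)
  case (Suc k)
  have fin: "finite {w :: bool list. length w = k}"
    using finite_lists_length_eq[of "UNIV :: bool set" k] by simp
  have "{w :: bool list. length w = Suc k} = (#) False ` {w. length w = k} \<union> (#) True ` {w. length w = k}"
    by (auto simp: length_Suc_conv image_iff)
  hence "(\<Sum>w | length w = Suc k. \<Phi> (act w v)) = (\<Sum>w\<in>(#) False ` {w. length w = k}. \<Phi> (act w v)) + (\<Sum>w\<in>(#) True ` {w. length w = k}. \<Phi> (act w v))"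
    using fin by (simp only:) (subst sum.union_disjoint, auto)
  also have "\<dots> = (\<Sum>w | length w = k. \<Phi> (fx (act w v))) + (\<Sum>w | length w = k. \<Phi> (fy (act w v)))"
    by (simp add: sum.reindex act_Cons fop_def comp_def)
  also have "\<dots> = \<Phi> (fx ((fT ^^ k) v)) + \<Phi> (fy ((fT ^^ k) v))"
    using Suc.IH[OF flinf_comp[OF Suc.prems flin_fx]] Suc.IH[OF flinf_comp[OF Suc.prems flin_fy]] by simp
  also have "\<dots> = \<Phi> ((fT ^^ Suc k) v)"
    by (simp add: fT_def[abs_def] flinf_add[OF Suc.prems])
  finally show ?case .
qed simp

lemma ftau_sum: "(\<Sum>w | length w = k. ftau w) = fR k"
  using words_sum[OF flinf_phi] by (simp add: ftau_def fR_def)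

text \<open>Decomposition by the time at which the last letter was created for good. Up to step
  \<open>b\<close> the path returns to the empty word at index \<open>j\<close>, which gives
  \<open>fM j b\<close>; the next step creates the letter, and from then on it is never touched, so
  the evolution restarts from \<open>fom\<close>.\<close>

lemma fT_append:
  "(fT ^^ k) fom i (w @ [j]) = (\<Sum>b<k. (fT ^^ (k - 1 - b)) fom i w * fM j b)"
proof (induction k arbitrary: i w)
  case 0
  show ?case by (simp add: fom_def)
next
  case (Suc k)
  let ?v = "\<lambda>b. (fT ^^ (k - 1 - b)) fom"
  define F where "F u = (\<Sum>b<k. u b * fM j b)" for u :: "nat \<Rightarrow> complex"
  have Fadd: "F u1 + F u2 = F (\<lambda>b. u1 b + u2 b)" for u1 u2 by (simp add: F_def sum.distrib distrib_right)
  have Fmul: "c * F u = F (\<lambda>b. c * u b)" for c u by (simp add: F_def sum_distrib_left mult_ac)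
  have Fsum: "(\<Sum>k'<n. F (\<lambda>b. u b k')) / of_nat n = F (\<lambda>b. (\<Sum>k'<n. u b k') / of_nat n)" for u :: "nat \<Rightarrow> nat \<Rightarrow> complex"
    unfolding F_def by (subst sum.swap) (simp add: sum_distrib_right sum_divide_distrib)
  have IH: "(fT ^^ k) fom i (w @ [j]) = F (\<lambda>b. ?v b i w)" for i w unfolding F_def by (rule Suc)
  have "(fT ^^ Suc k) fom i (w @ [j]) = fl ((fT ^^ k) fom) i (w @ [j]) + fs ((fT ^^ k) fom) i (w @ [j]) + of_real (lam i) * (fT ^^ k) fom i (w @ [j])"
    by (simp add: fT_def fx_def fy_def)
  also have "fs ((fT ^^ k) fom) i (w @ [j]) = F (\<lambda>b. fs (?v b) i w)"
    using IH[of _ "i # w"] by (simp add: fs_def Fsum)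
  also have "of_real (lam i) * (fT ^^ k) fom i (w @ [j]) = F (\<lambda>b. fy (?v b) i w)"
    by (simp add: IH Fmul fy_def)
  also have "fl ((fT ^^ k) fom) i (w @ [j]) = F (\<lambda>b. fl (?v b) i w) + fom i w * fM j k"
  proof (cases w)
    case Nil
    thus ?thesis by (simp add: fl_def fM_def fom_def F_def)
  next
    case (Cons j' w')
    thus ?thesis using IH[of j' w'] by (simp add: fl_def fom_def)
  qed
  also have "F (\<lambda>b. fl (?v b) i w) + fom i w * fM j k + F (\<lambda>b. fs (?v b) i w) + F (\<lambda>b. fy (?v b) i w)
     = F (\<lambda>b. fT (?v b) i w) + fom i w * fM j k"
    by (simp add: Fadd fT_def fx_def add.assoc)
  also have "F (\<lambda>b. fT (?v b) i w) = (\<Sum>b<k. (fT ^^ (Suc k - 1 - b)) fom i w * fM j b)"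
    unfolding F_def
  proof (intro sum.cong refl)
    fix b assume "b \<in> {..<k}"
    hence "Suc k - 1 - b = Suc (k - 1 - b)" by auto
    thus "fT (?v b) i w * fM j b = (fT ^^ (Suc k - 1 - b)) fom i w * fM j b" by simp
  qed
  finally show ?case by simp
qed

lemma fR_fM: "fR k = (\<Sum>i<n. fM i k) / of_nat n"
  by (simp add: fR_def phi_def fM_def)

lemma fM_0: "fM i 0 = 1" by (simp add: fM_def fom_def)

text \<open>The moment form of Pastur's equation. At the empty word \<open>fl\<close> contributes
  nothing, and \<open>fs\<close> reads words of length one, which \<open>fT_append\<close> resolves
  into a convolution.\<close>

lemma fM_Suc: "fM i (Suc k) = of_real (lam i) * fM i k + (\<Sum>b<k. fR (k - 1 - b) * fM i b)"
proof -
  have "fM i (Suc k) = fs ((fT ^^ k) fom) i [] + of_real (lam i) * fM i k"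
    by (simp add: fM_def fT_def fx_def fy_def fl_def)
  also have "fs ((fT ^^ k) fom) i [] = (\<Sum>l<n. \<Sum>b<k. fM l (k - 1 - b) * fM i b) / of_nat n"
    using fT_append[of k _ "[]" i] by (simp add: fs_def fM_def)
  also have "(\<Sum>l<n. \<Sum>b<k. fM l (k - 1 - b) * fM i b) = (\<Sum>b<k. (\<Sum>l<n. fM l (k - 1 - b)) * fM i b)"
    by (subst sum.swap) (simp add: sum_distrib_right)
  also have "\<dots> / of_nat n = (\<Sum>b<k. fR (k - 1 - b) * fM i b)"
    by (simp add: fR_fM sum_divide_distrib[of _ "{..<k}"])
  finally show ?thesis by simp
qed

end

text \<open>With all eigenvalues 0 the sum \<open>x + y\<close> is \<open>x\<close> alone, so
  averaging \<open>fM_Suc\<close> over \<open>i\<close> yields the recursion of the semicircular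
  moments.\<close>

lemma (in fock) fc_recursion: "fc (Suc k) 0 = (\<Sum>b<k. fc (k - 1 - b) 0 * fc b 0)"
proof -
  interpret Z: fock n "\<lambda>_. 0" by unfold_locales (rule n)
  have T: "Z.fT = fx"
    by (auto simp: Z.fT_def Z.fx_def fx_def Z.fy_def Z.fs_def fs_def fun_eq_iff)
  have R: "Z.fR k = fc k 0" for k
    unfolding Z.fR_def T using phi_fx_pow[of k] by (simp add: Z.phi_def phi_def)
  have "Z.fR (Suc k) = (\<Sum>b<k. Z.fR (k - 1 - b) * Z.fR b)"
    unfolding Z.fR_fM[of "Suc k"] Z.fM_Suc
    by (simp add: sum_divide_distrib[symmetric] sum.swap[of _ "{..<k}"] sum_distrib_left[symmetric] Z.fR_fM[of "_ :: nat"])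
  thus ?thesis by (simp only: R)
qed


section \<open>Measures from positive moment functionals\<close>

text \<open>Bernstein sums reproduce \<open>x^j\<close> exactly if the node values are the quotients
  \<open>(k choose j) / (N choose j)\<close>. A commutative ring is allowed because \<open>x\<close>
  will be the polynomial variable itself.\<close>

lemma bernstein_choose_sum:
  fixes x :: "'a::comm_ring_1"
  assumes "j \<le> N"
  shows "(\<Sum>k\<le>N. of_nat ((N choose k) * (k choose j)) * (x ^ k * (1 - x) ^ (N - k))) = of_nat (N choose j) * x ^ j"
proof -
  have "(\<Sum>k\<le>N. of_nat ((N choose k) * (k choose j)) * (x ^ k * (1 - x) ^ (N - k)))
      = (\<Sum>k\<in>{j..N}. of_nat ((N choose k) * (k choose j)) * (x ^ k * (1 - x) ^ (N - k)))"
    by (rule sum.mono_neutral_right) (auto simp: not_le binomial_eq_0)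
  also have "\<dots> = (\<Sum>k\<in>{j..N}. of_nat (N choose j) * x ^ j * (of_nat ((N - j) choose (k - j)) * x ^ (k - j) * (1 - x) ^ (N - k)))"
  proof (intro sum.cong refl)
    fix k assume k: "k \<in> {j..N}"
    hence "(N choose k) * (k choose j) = (N choose j) * ((N - j) choose (k - j))" by (intro choose_mult) auto
    moreover have "x ^ k = x ^ j * x ^ (k - j)" using k by (simp flip: power_add)
    ultimately show "of_nat ((N choose k) * (k choose j)) * (x ^ k * (1 - x) ^ (N - k))
      = of_nat (N choose j) * x ^ j * (of_nat ((N - j) choose (k - j)) * x ^ (k - j) * (1 - x) ^ (N - k))"
      by (simp add: mult_ac)
  qed
  also have "\<dots> = of_nat (N choose j) * x ^ j * (\<Sum>k\<in>{j..N}. of_nat ((N - j) choose (k - j)) * x ^ (k - j) * (1 - x) ^ (N - k))"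
    by (simp add: sum_distrib_left)
  also have "(\<Sum>k\<in>{j..N}. of_nat ((N - j) choose (k - j)) * x ^ (k - j) * (1 - x) ^ (N - k))
      = (\<Sum>l\<le>N - j. of_nat ((N - j) choose l) * x ^ l * (1 - x) ^ (N - j - l))"
    by (rule sum.reindex_bij_witness[of _ "\<lambda>l. l + j" "\<lambda>k. k - j"]) (use assms in auto)
  also have "\<dots> = (x + (1 - x)) ^ (N - j)" by (subst binomial_ring) simp
  finally show ?thesis by simp
qed

text \<open>Induction on \<open>j\<close> through \<open>k b_j = (N - j) b_(j+1) + j b_j\<close> for
  the quotients \<open>b_j\<close>: each step adds an error of at most \<open>j / N\<close>.\<close>

lemma choose_quotient_approx:
  assumes "k \<le> N" "j \<le> N" "N > 0"
  shows "\<bar>(real k / N) ^ j - real (k choose j) / real (N choose j)\<bar> \<le> 2 * real j * real j / N"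
  using assms(2)
proof (induction j)
  case (Suc j)
  let ?b = "\<lambda>j. real (k choose j) / real (N choose j)"
  have pos: "real (N choose j) > 0" "real (N choose Suc j) > 0" using Suc.prems by (simp_all add: zero_less_binomial)
  have kN: "real k / N \<le> 1" "real k / N \<ge> 0" using assms by auto
  have b01: "0 \<le> ?b j" "?b j \<le> 1" "0 \<le> ?b (Suc j)" "?b (Suc j) \<le> 1"
    using pos binomial_right_mono[OF assms(1), of j] binomial_right_mono[OF assms(1), of "Suc j"] by auto
  have absorb: "real m * real (m choose j) = real (Suc j) * real (m choose Suc j) + real j * real (m choose j)" for m
  proof (cases "j \<le> m")
    case True
    have "(m - j) * (m choose j) = Suc j * (m choose Suc j)"
      by (simp only: binomial_absorb_comp binomial_absorption)
    hence "real (m - j) * real (m choose j) = real (Suc j) * real (m choose Suc j)" by (metis of_nat_mult)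
    thus ?thesis using True by (simp add: of_nat_diff algebra_simps)
  qed (simp add: binomial_eq_0)
  have NS: "real (Suc j) * real (N choose Suc j) = (real N - real j) * real (N choose j)"
    using absorb[of N] by (simp add: algebra_simps)
  have alg: "u * x - y = v * (x - y)" if "u * x = c * y + v * x" "c = 1 - v" for u x y v c :: real
    using that by (simp add: algebra_simps)
  have "real k / N * ?b j = ((N - real j) / N) * ?b (Suc j) + (real j / N) * ?b j"
  proof -
    have "real N - real j = real (Suc j) * real (N choose Suc j) / real (N choose j)"
      using NS pos by (simp add: field_simps)
    hence "(real N - real j) * ?b (Suc j) = (real (Suc j) * real (N choose Suc j) / real (N choose j)) * ?b (Suc j)"
      by (simp only:)
    hence "(real N - real j) * ?b (Suc j) = real (Suc j) * real (k choose Suc j) / real (N choose j)"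
      using pos by (simp del: of_nat_Suc)
    hence "(real N - real j) * ?b (Suc j) + real j * ?b j = (real (Suc j) * real (k choose Suc j) + real j * real (k choose j)) / real (N choose j)"
      by (simp add: add_divide_distrib)
    also have "\<dots> = real k * ?b j" using absorb[of k] by simp
    finally have "real k * ?b j / N = ((real N - real j) * ?b (Suc j) + real j * ?b j) / N" by simp
    thus ?thesis by (simp add: add_divide_distrib mult_ac)
  qed
  hence eq: "real k / N * ?b j - ?b (Suc j) = (real j / N) * (?b j - ?b (Suc j))"
    by (rule alg) (use assms(3) in \<open>simp add: field_simps\<close>)
  have "\<bar>(real j / N) * (?b j - ?b (Suc j))\<bar> \<le> real j / N * 1"
  proof -
    have "\<bar>?b j - ?b (Suc j)\<bar> \<le> 1" unfolding abs_le_iff using b01 by linarith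
    thus ?thesis unfolding abs_mult by (intro mult_mono) auto
  qed
  hence 1: "\<bar>real k / N * ?b j - ?b (Suc j)\<bar> \<le> real j / N" unfolding eq by simp
  have "\<bar>real k / N * ((real k / N) ^ j - ?b j)\<bar> \<le> 1 * (2 * real j * real j / N)"
    unfolding abs_mult using Suc kN by (intro mult_mono) auto
  hence "\<bar>(real k / N) ^ Suc j - ?b (Suc j)\<bar> \<le> 2 * real j * real j / N + real j / N"
    using 1 unfolding right_diff_distrib power_Suc mult_1 by linarith
  also have "\<dots> \<le> 2 * real (Suc j) * real (Suc j) / N"
    unfolding add_divide_distrib[symmetric] by (intro divide_right_mono) (auto simp: algebra_simps)
  finally show ?case .
qed simp

text \<open>Hausdorff's construction: the values of \<open>L\<close> on the Bernstein basis are
  nonnegative weights at the nodes \<open>k / N\<close> with total mass 1. A weak limit along a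
  subsequence has the right moments, since \<open>(k / N)^j\<close> differs by
  \<open>O(1 / N)\<close> from the node values for which the sums are exact.\<close>

lemma hausdorff_moment:
  fixes L :: "real poly \<Rightarrow> real"
  assumes add: "\<And>p q. L (p + q) = L p + L q" and scale: "\<And>c p. L (Polynomial.smult c p) = c * L p" and one: "L 1 = 1"
    and pos: "\<And>a b. L ([:0, 1:] ^ a * [:1, -1:] ^ b) \<ge> 0"
  shows "\<exists>\<rho>. prob_space \<rho> \<and> sets \<rho> = sets borel \<and> (AE x in \<rho>. 0 \<le> x \<and> x \<le> 1) \<and> (\<forall>p. (\<integral>x. poly p x \<partial>\<rho>) = L p)"
proof -
  have L0: "L 0 = 0" using scale[of 0 0] by simp
  have Lsum: "L (\<Sum>k\<in>A. f k) = (\<Sum>k\<in>A. L (f k))" if "finite A" for A :: "nat set" and f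
    using that by induction (auto simp: add L0)
  define X where "X = [:0, 1 :: real:]"
  define w where "w N k = real (N choose k) * L (X ^ k * (1 - X) ^ (N - k))" for N k
  have X1: "1 - X = [:1, -1:]" by (simp add: X_def one_pCons)
  have w0: "w N k \<ge> 0" for N k unfolding w_def X1 unfolding X_def using pos by simp
  have wsum: "(\<Sum>k\<le>N. w N k * real (k choose j)) = real (N choose j) * L (X ^ j)" if "j \<le> N" for N j
  proof -
    have "(\<Sum>k\<le>N. w N k * real (k choose j)) = L (\<Sum>k\<le>N. Polynomial.smult (real ((N choose k) * (k choose j))) (X ^ k * (1 - X) ^ (N - k)))"
      by (simp add: Lsum scale w_def mult_ac)
    also have "(\<Sum>k\<le>N. Polynomial.smult (real ((N choose k) * (k choose j))) (X ^ k * (1 - X) ^ (N - k))) = Polynomial.smult (real (N choose j)) (X ^ j)"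
      using bernstein_choose_sum[OF that, of X] by (simp add: of_nat_poly)
    finally show ?thesis by (simp add: scale)
  qed
  have w1: "(\<Sum>k\<le>N. w N k) = 1" for N using wsum[of 0 N] one by simp
  define P where "P N = point_measure {..N} (\<lambda>k. ennreal (w N k))" for N
  define \<mu> where "\<mu> N = distr (P (Suc N)) borel (\<lambda>k. real k / real (Suc N))" for N
  have spP: "space (P N) = {..N}" "sets (P N) = Pow {..N}" for N by (simp_all add: P_def space_point_measure sets_point_measure)
  have mP[measurable]: "f \<in> measurable (P N) borel" for f :: "nat \<Rightarrow> real" and N
    by (auto simp: measurable_def spP)
  have prP: "prob_space (P N)" for N
  proof (rule prob_spaceI)
    have "emeasure (P N) {..N} = (\<Sum>k\<le>N. ennreal (w N k))"
      unfolding P_def by (rule emeasure_point_measure_finite) auto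
    also have "\<dots> = ennreal (\<Sum>k\<le>N. w N k)" by (rule sum_ennreal) (rule w0)
    finally show "emeasure (P N) (space (P N)) = 1" by (simp add: spP w1)
  qed
  have rd: "real_distribution (\<mu> N)" for N
    unfolding \<mu>_def by (intro prob_space.real_distribution_distr prP) simp
  have int\<mu>: "(\<integral>x. f x \<partial>\<mu> N) = (\<Sum>k\<le>Suc N. w (Suc N) k * f (real k / real (Suc N)))"
    if [measurable]: "f \<in> borel_measurable borel" for f :: "real \<Rightarrow> real" and N
  proof -
    have "(\<integral>x. f x \<partial>\<mu> N) = (\<integral>k. f (real k / real (Suc N)) \<partial>P (Suc N))"
      unfolding \<mu>_def by (rule integral_distr) auto
    also have "\<dots> = (\<Sum>k\<le>Suc N. w (Suc N) k * f (real k / real (Suc N)))"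
      unfolding P_def by (subst lebesgue_integral_point_measure_finite) (auto simp: w0)
    finally show ?thesis .
  qed
  \<comment> \<open>Clamping makes the powers bounded and continuous, as weak convergence requires,
    and does not change them at the nodes.\<close>
  define cl where "cl x = max 0 (min 1 x)" for x :: real
  have cl_eq: "cl (real k / real (Suc N)) = real k / real (Suc N)" if "k \<le> Suc N" for k N
    using that by (auto simp: cl_def)
  have [measurable]: "cl \<in> borel_measurable borel" unfolding cl_def by measurable
  have "tight \<mu>"
    unfolding tight_def
  proof (intro conjI allI impI)
    fix \<epsilon> :: real assume \<epsilon>: "\<epsilon> > 0"
    show "\<exists>a b. a < b \<and> (\<forall>n. measure (\<mu> n) {a<..b} > 1 - \<epsilon>)"
    proof (rule exI[of _ "-1"], rule exI[of _ 1], intro conjI allI)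
      fix N
      have "measure (\<mu> N) {-1<..1} = measure (P (Suc N)) ((\<lambda>k. real k / real (Suc N)) -` {-1<..1} \<inter> space (P (Suc N)))"
        unfolding \<mu>_def by (rule measure_distr) auto
      also have "(\<lambda>k. real k / real (Suc N)) -` {-1<..1} \<inter> space (P (Suc N)) = space (P (Suc N))"
      proof -
        have "- 1 < real k / real (Suc N)" for k by (rule less_le_trans[of _ 0]) auto
        thus ?thesis by (auto simp: spP)
      qed
      finally show "measure (\<mu> N) {-1<..1} > 1 - \<epsilon>" using \<epsilon> prob_space.prob_space[OF prP] by simp
    qed simp
  qed (rule rd)
  from tight_imp_convergent_subsubsequence[OF this strict_mono_id]
  obtain r M where r: "strict_mono (r :: nat \<Rightarrow> nat)" and M: "real_distribution M" and conv: "weak_conv_m (\<mu> \<circ> r) M"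
    by auto
  interpret M: real_distribution M by (rule M)
  have lim: "(\<lambda>N. \<integral>x. f x \<partial>\<mu> (r N)) \<longlonglongrightarrow> (\<integral>x. f x \<partial>M)"
    if "\<And>x. isCont f x" "\<And>x. \<bar>f x\<bar> \<le> B" for f :: "real \<Rightarrow> real" and B
    using weak_conv_imp_integral_bdd_continuous_conv[of "\<mu> \<circ> r" M f B] rd M conv that by (simp add: comp_def)
  have clc: "isCont cl x" for x unfolding cl_def by (intro continuous_intros)
  have cl01: "0 \<le> cl x" "cl x \<le> 1" for x by (auto simp: cl_def)
  have mom: "(\<integral>x. cl x ^ j \<partial>M) = L (X ^ j)" for j
  proof -
    have "(\<lambda>N. \<integral>x. cl x ^ j \<partial>\<mu> (r N)) \<longlonglongrightarrow> (\<integral>x. cl x ^ j \<partial>M)"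
      by (rule lim[of "\<lambda>x. cl x ^ j" 1]) (auto intro!: continuous_intros clc power_le_one simp: cl01)
    moreover have "(\<lambda>N. \<integral>x. cl x ^ j \<partial>\<mu> N) \<longlonglongrightarrow> L (X ^ j)"
    proof -
      have b: "\<bar>(\<integral>x. cl x ^ j \<partial>\<mu> N) - L (X ^ j)\<bar> \<le> 2 * real j * real j / real (Suc N)" if jN: "j \<le> N" for N
      proof -
        have e: "(\<integral>x. cl x ^ j \<partial>\<mu> N) = (\<Sum>k\<le>Suc N. w (Suc N) k * (real k / real (Suc N)) ^ j)"
          by (subst int\<mu>) (auto simp: cl_eq simp del: of_nat_Suc sum.atMost_Suc)
        have "L (X ^ j) = (\<Sum>k\<le>Suc N. w (Suc N) k * real (k choose j)) / real (Suc N choose j)"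
          using jN by (subst wsum) auto
        hence "(\<integral>x. cl x ^ j \<partial>\<mu> N) - L (X ^ j) = (\<Sum>k\<le>Suc N. w (Suc N) k * ((real k / real (Suc N)) ^ j - real (k choose j) / real (Suc N choose j)))"
          unfolding e sum_divide_distrib by (simp only: sum_subtractf[symmetric] right_diff_distrib times_divide_eq_right)
        hence "\<bar>(\<integral>x. cl x ^ j \<partial>\<mu> N) - L (X ^ j)\<bar> \<le> (\<Sum>k\<le>Suc N. \<bar>w (Suc N) k * ((real k / real (Suc N)) ^ j - real (k choose j) / real (Suc N choose j))\<bar>)"
          by (simp only: sum_abs)
        also have "\<dots> \<le> (\<Sum>k\<le>Suc N. w (Suc N) k * (2 * real j * real j / real (Suc N)))"
          unfolding abs_mult abs_of_nonneg[OF w0]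
          by (intro sum_mono mult_left_mono choose_quotient_approx w0) (use jN in auto)
        also have "\<dots> = 2 * real j * real j / real (Suc N)" by (simp only: sum_distrib_right[symmetric] w1 mult_1)
        finally show ?thesis .
      qed
      have "(\<lambda>N. 2 * real j * real j / real (Suc N)) \<longlonglongrightarrow> 0" by real_asymp
      hence "(\<lambda>N. (\<integral>x. cl x ^ j \<partial>\<mu> N) - L (X ^ j)) \<longlonglongrightarrow> 0"
        by (rule Lim_null_comparison[rotated]) (use b in \<open>auto intro!: eventually_sequentiallyI[of j]\<close>)
      thus ?thesis by (simp add: LIM_zero_iff)
    qed
    hence "((\<lambda>N. \<integral>x. cl x ^ j \<partial>\<mu> N) \<circ> r) \<longlonglongrightarrow> L (X ^ j)" using r by (rule LIMSEQ_subseq_LIMSEQ)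
    ultimately show ?thesis by (auto simp: comp_def intro: LIMSEQ_unique)
  qed
  have AE: "AE x in M. cl x = x"
  proof -
    \<comment> \<open>A bounded continuous function that vanishes exactly where
      \<open>cl x = x\<close>. Its integral is 0 under every approximation, hence under the limit,
      which therefore lives on \<open>[0, 1]\<close>.\<close>
    define h where "h x = min 1 \<bar>x - cl x\<bar>" for x
    have [measurable]: "h \<in> borel_measurable borel" unfolding h_def by measurable
    have hc: "isCont h x" for x unfolding h_def by (intro continuous_intros clc)
    have hb: "0 \<le> h x" "h x \<le> 1" for x by (auto simp: h_def)
    have "(\<integral>x. h x \<partial>\<mu> N) = 0" for N
      by (subst int\<mu>) (auto simp: h_def cl_eq simp del: of_nat_Suc sum.atMost_Suc intro!: sum.neutral)
    hence "(\<lambda>N. 0) \<longlonglongrightarrow> (\<integral>x. h x \<partial>M)" using lim[of h 1, OF hc] hb by simp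
    hence "(\<integral>x. h x \<partial>M) = 0" by (simp add: LIMSEQ_const_iff)
    moreover have "integrable M h" by (rule M.integrable_const_bound[where B = 1]) (use hb in auto)
    ultimately have "AE x in M. h x = 0" using hb by (simp add: integral_nonneg_eq_0_iff_AE)
    thus ?thesis by eventually_elim (auto simp: h_def min_def split: if_splits)
  qed
  have AE01: "AE x in M. 0 \<le> x \<and> x \<le> 1" using AE by eventually_elim (metis cl01)
  have ip: "integrable M (\<lambda>x. x ^ k)" for k
  proof (rule M.integrable_const_bound[where B = 1])
    show "AE x in M. norm (x ^ k) \<le> 1" using AE01 by eventually_elim (simp add: power_le_one)
  qed simp
  have mk: "(\<integral>x. x ^ k \<partial>M) = L (X ^ k)" for k
  proof -
    have "(\<integral>x. x ^ k \<partial>M) = (\<integral>x. cl x ^ k \<partial>M)" by (rule integral_cong_AE) (use AE in \<open>auto elim: eventually_mono\<close>)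
    thus ?thesis by (simp add: mom)
  qed
  have "(\<integral>x. poly p x \<partial>M) = L p" for p
  proof -
    have "p = (\<Sum>k\<le>degree p. monom (coeff p k) k)" by (simp add: poly_as_sum_of_monoms)
    also have "\<dots> = (\<Sum>k\<le>degree p. Polynomial.smult (coeff p k) (X ^ k))" by (simp add: monom_altdef X_def)
    finally have p: "p = (\<Sum>k\<le>degree p. Polynomial.smult (coeff p k) (X ^ k))" .
    have "L p = (\<Sum>k\<le>degree p. coeff p k * L (X ^ k))" by (subst p) (simp add: Lsum scale)
    also have "\<dots> = (\<integral>x. poly p x \<partial>M)" using ip by (simp add: poly_altdef mk)
    finally show ?thesis by simp
  qed
  thus ?thesis using AE01 M.prob_space_axioms M.events_eq_borel by blast
qed

text \<open>An affine map of \<open>[-r, r]\<close> onto \<open>[0, 1]\<close> reduces this to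
  \<open>hausdorff_moment\<close>. A product of powers of \<open>r + x\<close> and
  \<open>r - x\<close> is a square times one of the four products with exponents 0 or 1, which are
  the four positivity assumptions.\<close>

lemma bounded_moment_measure:
  fixes L :: "real poly \<Rightarrow> real"
  assumes add: "\<And>p q. L (p + q) = L p + L q" and scale: "\<And>c p. L (Polynomial.smult c p) = c * L p" and one: "L 1 = 1" and r: "r > 0"
    and p1: "\<And>p. L (p * p) \<ge> 0" and p2: "\<And>p. L ([:r, 1:] * (p * p)) \<ge> 0" and p3: "\<And>p. L ([:r, -1:] * (p * p)) \<ge> 0"
    and p4: "\<And>p. L ([:r, 1:] * [:r, -1:] * (p * p)) \<ge> 0"
  shows "\<exists>\<rho>. prob_space \<rho> \<and> sets \<rho> = sets borel \<and> (AE x in \<rho>. \<bar>x\<bar> \<le> r) \<and> (\<forall>k. (\<integral>x. x ^ k \<partial>\<rho>) = L ([:0, 1:] ^ k))"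
proof -
  let ?q = "[:r, 1:]" and ?q' = "[:r, -1:]"
  define c where "c = 1 / (2 * r)"
  have c: "c > 0" using r by (simp add: c_def)
  define Q where "Q = Polynomial.smult c ?q"
  have Qc: "pcompose [:0, 1:] Q = Q" "pcompose [:1, -1:] Q = Polynomial.smult c ?q'"
    using r by (simp_all add: Q_def c_def pcompose_pCons)
  have pw: "pcompose (p ^ k) R = pcompose p R ^ k" for p R :: "real poly" and k
    by (induction k) (auto simp: pcompose_mult pcompose_1)
  have pos: "L (pcompose ([:0, 1:] ^ a * [:1, -1:] ^ b) Q) \<ge> 0" for a b
  proof -
    define P where "P = ?q ^ (a div 2) * ?q' ^ (b div 2)"
    have sm: "Polynomial.smult c x ^ a * Polynomial.smult c y ^ b = Polynomial.smult (c ^ a * c ^ b) (x ^ a * y ^ b)" for x y :: "real poly"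
      by (simp add: smult_power mult_ac)
    have half: "x ^ k = x ^ (k mod 2) * (x ^ (k div 2) * x ^ (k div 2))" for x :: "real poly" and k
      by (simp flip: power_add add: mult_2[symmetric])
    have "pcompose ([:0, 1:] ^ a * [:1, -1:] ^ b) Q = Polynomial.smult (c ^ a * c ^ b) (?q ^ a * ?q' ^ b)"
      unfolding pcompose_mult pw Qc unfolding Q_def by (rule sm)
    also have "?q ^ a * ?q' ^ b = ?q ^ (a mod 2) * ?q' ^ (b mod 2) * (P * P)"
      by (subst half[of ?q a], subst half[of ?q' b]) (simp add: P_def mult_ac)
    finally have e: "L (pcompose ([:0, 1:] ^ a * [:1, -1:] ^ b) Q) = (c ^ a * c ^ b) * L (?q ^ (a mod 2) * ?q' ^ (b mod 2) * (P * P))"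
      by (simp only: scale)
    have "a mod 2 = 0 \<or> a mod 2 = 1" "b mod 2 = 0 \<or> b mod 2 = 1" by auto
    hence "L (?q ^ (a mod 2) * ?q' ^ (b mod 2) * (P * P)) \<ge> 0"
      using p1[of P] p2[of P] p3[of P] p4[of P] by (elim disjE) (simp_all only: power_0 power_one_right mult_1 mult_1_right)
    thus ?thesis unfolding e using c by simp
  qed
  have "\<exists>\<rho>. prob_space \<rho> \<and> sets \<rho> = sets borel \<and> (AE x in \<rho>. 0 \<le> x \<and> x \<le> 1) \<and> (\<forall>p. (\<integral>x. poly p x \<partial>\<rho>) = L (pcompose p Q))"
    by (rule hausdorff_moment) (use pos in \<open>auto simp: pcompose_add pcompose_smult add scale one pcompose_1\<close>)
  then obtain \<rho> where \<rho>: "prob_space \<rho>" "sets \<rho> = sets borel" "AE x in \<rho>. 0 \<le> x \<and> x \<le> 1" "\<And>p. (\<integral>x. poly p x \<partial>\<rho>) = L (pcompose p Q)"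
    by blast
  let ?f = "\<lambda>x. 2 * r * x - r"
  have [measurable]: "?f \<in> measurable \<rho> borel" by (subst measurable_cong_sets[OF \<rho>(2) refl]) measurable
  have "(\<integral>x. x ^ k \<partial>distr \<rho> borel ?f) = L ([:0, 1:] ^ k)" for k
  proof -
    have "(\<integral>x. x ^ k \<partial>distr \<rho> borel ?f) = (\<integral>x. ?f x ^ k \<partial>\<rho>)" by (rule integral_distr) auto
    also have "\<dots> = (\<integral>x. poly ([:- r, 2 * r:] ^ k) x \<partial>\<rho>)"
      by (intro Bochner_Integration.integral_cong refl) (simp add: mult.commute)
    also have "\<dots> = L (pcompose [:- r, 2 * r:] Q ^ k)" by (simp only: \<rho>(4) pw)
    also have "pcompose [:- r, 2 * r:] Q = [:0, 1:]" using r by (simp add: Q_def c_def pcompose_pCons)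
    finally show ?thesis .
  qed
  moreover have "AE x in distr \<rho> borel ?f. \<bar>x\<bar> \<le> r"
  proof (subst AE_distr_iff)
    show "AE x in \<rho>. \<bar>?f x\<bar> \<le> r" using \<rho>(3)
    proof eventually_elim
      case (elim x)
      hence "r * x \<le> r * 1" "r * 0 \<le> r * x" using r by (intro mult_left_mono; simp)+
      thus ?case by (simp add: abs_le_iff)
    qed
  qed auto
  moreover have "prob_space (distr \<rho> borel ?f)" by (rule prob_space.prob_space_distr[OF \<rho>(1)]) simp
  ultimately show ?thesis by (intro exI[of _ "distr \<rho> borel ?f"]) auto
qed


section \<open>The free convolution with the semicircle law\<close>

context fock
begin

definition wds :: "nat \<Rightarrow> nat list set" where
  "wds L = {w. length w \<le> L \<and> set w \<subseteq> {..<n}}"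

text \<open>The real part of the inner product of the Fock space, cut off at word length
  \<open>L\<close> so that all sums are finite. The weights make the index and every letter
  uniformly distributed, for which \<open>fs\<close> is the adjoint of \<open>fl\<close>.\<close>

definition ip :: "nat \<Rightarrow> fvec \<Rightarrow> fvec \<Rightarrow> real" where
  "ip L u v = (\<Sum>w\<in>wds L. (1 / real n) ^ Suc (length w) * (\<Sum>i<n. Re (cnj (u i w) * v i w)))"

definition supp :: "nat \<Rightarrow> fvec \<Rightarrow> bool" where
  "supp L v \<longleftrightarrow> (\<forall>i w. length w > L \<longrightarrow> v i w = 0)"

lemma finite_wds: "finite (wds L)"
  unfolding wds_def using finite_lists_length_le[of "{..<n}" L] by (simp add: conj_commute)

lemma wds_Suc: "wds (Suc L) = {[]} \<union> (\<lambda>(j, w). j # w) ` ({..<n} \<times> wds L)"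
proof -
  have "w \<in> wds (Suc L) \<longleftrightarrow> w \<in> {[]} \<union> (\<lambda>(j, w). j # w) ` ({..<n} \<times> wds L)" for w
    by (cases w) (auto simp: wds_def image_iff)
  thus ?thesis by blast
qed

lemma sum_wds_Suc:
  fixes f :: "nat list \<Rightarrow> real"
  shows "(\<Sum>w\<in>wds (Suc L). f w) = f [] + (\<Sum>w\<in>wds L. \<Sum>j<n. f (j # w))"
proof -
  have "(\<Sum>w\<in>wds (Suc L). f w) = (\<Sum>w\<in>{[]}. f w) + (\<Sum>w\<in>(\<lambda>(j, w). j # w) ` ({..<n} \<times> wds L). f w)"
    unfolding wds_Suc by (rule sum.union_disjoint) (auto simp: finite_wds)
  also have "(\<Sum>w\<in>(\<lambda>(j, w). j # w) ` ({..<n} \<times> wds L). f w) = (\<Sum>(j, w)\<in>{..<n} \<times> wds L. f (j # w))"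
    by (subst sum.reindex) (auto simp: inj_on_def case_prod_beta')
  also have "\<dots> = (\<Sum>j<n. \<Sum>w\<in>wds L. f (j # w))" by (simp add: sum.cartesian_product)
  also have "\<dots> = (\<Sum>w\<in>wds L. \<Sum>j<n. f (j # w))" by (rule sum.swap)
  finally show ?thesis by simp
qed

lemma ip_sym: "ip L u v = ip L v u"
  unfolding ip_def by (intro sum.cong refl arg_cong[of _ _ "\<lambda>x. _ * x"]) (auto simp: mult.commute)

lemma ip_add: "ip L u (\<lambda>i w. v i w + v' i w) = ip L u v + ip L u v'"
  by (simp add: ip_def distrib_left sum.distrib)

lemma ip_scale: "ip L u (\<lambda>i w. of_real c * v i w) = c * ip L u v"
  by (simp add: ip_def sum_distrib_left algebra_simps)

lemma ip_sum: "ip L u (\<lambda>i w. \<Sum>k\<le>(m::nat). of_real (c k) * v k i w) = (\<Sum>k\<le>m. c k * ip L u (v k))"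
proof (induction m)
  case (Suc m)
  have "ip L u (\<lambda>i w. \<Sum>k\<le>Suc m. of_real (c k) * v k i w)
      = ip L u (\<lambda>i w. \<Sum>k\<le>m. of_real (c k) * v k i w) + ip L u (\<lambda>i w. of_real (c (Suc m)) * v (Suc m) i w)"
    using ip_add[of L u "\<lambda>i w. \<Sum>k\<le>m. of_real (c k) * v k i w" "\<lambda>i w. of_real (c (Suc m)) * v (Suc m) i w"] by simp
  thus ?case by (simp add: Suc ip_scale)
qed (simp add: ip_scale)

lemma ip_self: "ip L u u = (\<Sum>w\<in>wds L. (1 / real n) ^ Suc (length w) * (\<Sum>i<n. (cmod (u i w))\<^sup>2))"
proof -
  have "Re (cnj x * x) = (cmod x)\<^sup>2" for x unfolding cmod_power2 by (simp add: power2_eq_square)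
  thus ?thesis by (simp add: ip_def)
qed

lemma ip_nonneg: "ip L u u \<ge> 0"
  unfolding ip_self by (intro sum_nonneg mult_nonneg_nonneg) auto

lemma ip_mono_L: "L \<le> L' \<Longrightarrow> ip L u u \<le> ip L' u u"
  unfolding ip_self by (intro sum_mono2 finite_wds) (auto simp: wds_def intro!: divide_nonneg_nonneg mult_nonneg_nonneg sum_nonneg)

lemma ip_supp: assumes "supp L v" "L \<le> L'" shows "ip L' u v = ip L u v"
  unfolding ip_def
  by (rule sum.mono_neutral_right) (use assms finite_wds in \<open>auto simp: wds_def supp_def not_le\<close>)

text \<open>Stands in for Cauchy-Schwarz; the parameter \<open>s\<close> will be 1 or
  \<open>Rad\<close>.\<close>

lemma ip_am_gm: assumes "s > 0" shows "2 * \<bar>ip L u v\<bar> \<le> s * ip L u u + ip L v v / s"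
proof -
  have pt: "2 * \<bar>Re (cnj x * y)\<bar> \<le> s * (cmod x)\<^sup>2 + (cmod y)\<^sup>2 / s" for x y
  proof -
    have "\<bar>Re (cnj x * y)\<bar> \<le> cmod x * cmod y" using abs_Re_le_cmod[of "cnj x * y"] by (simp add: norm_mult)
    moreover have "0 \<le> (s * cmod x - cmod y)\<^sup>2 / s" using assms by simp
    hence "2 * (cmod x * cmod y) \<le> s * (cmod x)\<^sup>2 + (cmod y)\<^sup>2 / s"
      using assms by (simp add: power2_eq_square field_simps)
    ultimately show ?thesis by linarith
  qed
  have "2 * \<bar>ip L u v\<bar> \<le> 2 * (\<Sum>w\<in>wds L. \<bar>(1 / real n) ^ Suc (length w) * (\<Sum>i<n. Re (cnj (u i w) * v i w))\<bar>)"
    unfolding ip_def by (intro mult_left_mono sum_abs) auto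
  also have "\<dots> \<le> 2 * (\<Sum>w\<in>wds L. (1 / real n) ^ Suc (length w) * (\<Sum>i<n. \<bar>Re (cnj (u i w) * v i w)\<bar>))"
    unfolding abs_mult by (intro mult_left_mono sum_mono mult_mono sum_abs) auto
  also have "\<dots> = (\<Sum>w\<in>wds L. (1 / real n) ^ Suc (length w) * (\<Sum>i<n. 2 * \<bar>Re (cnj (u i w) * v i w)\<bar>))"
    by (simp add: sum_distrib_left mult_ac)
  also have "\<dots> \<le> (\<Sum>w\<in>wds L. (1 / real n) ^ Suc (length w) * (\<Sum>i<n. s * (cmod (u i w))\<^sup>2 + (cmod (v i w))\<^sup>2 / s))"
    by (intro sum_mono mult_left_mono pt) auto
  also have "\<dots> = s * ip L u u + ip L v v / s"
    unfolding ip_self by (simp add: sum.distrib distrib_left sum_distrib_left sum_divide_distrib mult_ac)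
  finally show ?thesis .
qed

text \<open>Creation and annihilation are adjoint; the cutoff rises by one because \<open>fl\<close>
  lengthens words.\<close>

lemma ip_fl: "ip (Suc L) (fl v) u = ip L v (fs u)"
proof -
  have "ip (Suc L) (fl v) u = (\<Sum>w\<in>wds L. \<Sum>j<n. (1 / real n) ^ Suc (Suc (length w)) * (\<Sum>i<n. Re (cnj (v j w) * u i (j # w))))"
    unfolding ip_def sum_wds_Suc by (simp add: fl_def)
  also have "\<dots> = (\<Sum>w\<in>wds L. (1 / real n) ^ Suc (length w) * (\<Sum>j<n. Re (cnj (v j w) * fs u j w)))"
  proof (intro sum.cong refl)
    fix w
    have "Re (cnj (v j w) * fs u j w) = (1 / real n) * (\<Sum>i<n. Re (cnj (v j w) * u i (j # w)))" for j
    proof -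
      have "cnj (v j w) * fs u j w = (\<Sum>i<n. cnj (v j w) * u i (j # w)) / of_real (real n)"
        by (simp add: fs_def sum_distrib_left)
      hence "Re (cnj (v j w) * fs u j w) = Re (\<Sum>i<n. cnj (v j w) * u i (j # w)) / real n"
        by (simp only: Re_divide_of_real)
      thus ?thesis by simp
    qed
    thus "(\<Sum>j<n. (1 / real n) ^ Suc (Suc (length w)) * (\<Sum>i<n. Re (cnj (v j w) * u i (j # w))))
      = (1 / real n) ^ Suc (length w) * (\<Sum>j<n. Re (cnj (v j w) * fs u j w))"
      by (simp only: sum_distrib_left[symmetric] power_Suc mult_ac)
  qed
  finally show ?thesis by (simp add: ip_def)
qed

lemma supp_mono: "supp L v \<Longrightarrow> L \<le> L' \<Longrightarrow> supp L' v" by (auto simp: supp_def)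
lemma supp_fl: "supp L v \<Longrightarrow> supp (Suc L) (fl v)" by (auto simp: supp_def fl_def split: list.split)
lemma supp_fs: "supp L v \<Longrightarrow> supp L (fs v)" by (auto simp: supp_def fs_def)
lemma supp_fy: "supp L v \<Longrightarrow> supp L (fy v)" by (auto simp: supp_def fy_def)
lemma supp_fT: assumes "supp L v" shows "supp (Suc L) (fT v)"
  using supp_fl[OF assms] supp_mono[OF supp_fs[OF assms], of "Suc L"] supp_mono[OF supp_fy[OF assms], of "Suc L"]
  by (simp add: supp_def fT_def fx_def)
lemma supp_pow: "supp k ((fT ^^ k) fom)"
  by (induction k) (auto simp: supp_fT, simp add: supp_def fom_def)

lemma fT_split: "fT v = (\<lambda>i w. (fl v i w + fs v i w) + fy v i w)" by (simp add: fT_def[abs_def] fx_def)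

lemma ip_fl_right: assumes "supp L v" shows "ip (Suc L) u (fl v) = ip (Suc L) (fs u) v"
proof -
  have "ip (Suc L) u (fl v) = ip L v (fs u)" by (subst ip_sym) (rule ip_fl)
  also have "\<dots> = ip L (fs u) v" by (rule ip_sym)
  also have "\<dots> = ip (Suc L) (fs u) v" using ip_supp[OF assms, of "Suc L"] by simp
  finally show ?thesis .
qed

lemma ip_fT: assumes "supp L u" "supp L v" shows "ip (Suc L) u (fT v) = ip (Suc L) (fT u) v"
proof -
  have y: "ip (Suc L) u (fy v) = ip (Suc L) (fy u) v"
    unfolding ip_def fy_def by (intro sum.cong refl arg_cong[of _ _ "\<lambda>x. _ * x"]) (simp add: algebra_simps)
  have l: "ip (Suc L) u (fl v) = ip (Suc L) (fs u) v" "ip (Suc L) v (fl u) = ip (Suc L) (fs v) u"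
    by (rule ip_fl_right; fact)+
  have "ip (Suc L) u (fT v) = ip (Suc L) u (fl v) + ip (Suc L) u (fs v) + ip (Suc L) u (fy v)"
    unfolding fT_split ip_add by simp
  also have "\<dots> = ip (Suc L) v (fs u) + ip (Suc L) v (fl u) + ip (Suc L) v (fy u)"
    using l y by (simp add: ip_sym[of _ v] ip_sym[of _ u])
  also have "\<dots> = ip (Suc L) v (fT u)" unfolding fT_split ip_add by simp
  also have "\<dots> = ip (Suc L) (fT u) v" by (rule ip_sym)
  finally show ?thesis .
qed

text \<open>A bound for the norm of \<open>fT\<close>: the square of a sum of three terms is at most
  three times the sum of squares, \<open>fl\<close> and \<open>fs\<close> are contractions, and
  \<open>fy\<close> is bounded by the sum of the \<open>|lam i|\<close>.\<close>

definition Rad :: real where "Rad = sqrt (3 * (2 + (\<Sum>i<n. \<bar>lam i\<bar>)\<^sup>2))"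

lemma Rad_pos: "Rad > 0" by (simp add: Rad_def add_pos_nonneg)

lemma ip_fT_bound: assumes "supp L u" shows "ip (Suc L) (fT u) (fT u) \<le> Rad\<^sup>2 * ip (Suc L) u u"
proof -
  let ?I = "ip (Suc L)"
  have l: "?I (fl u) (fl u) \<le> ?I u u"
    using ip_fl[of L u "fl u"] ip_mono_L[of L "Suc L" u] by (simp add: fs_fl)
  \<comment> \<open>The square of \<open>fs u\<close> is the inner product of
    \<open>fl (fs u)\<close> with \<open>u\<close>, at most half the sum of their squares; since
    \<open>fl\<close> is a contraction, half of the left side can be absorbed.\<close>
  have s: "?I (fs u) (fs u) \<le> ?I u u"
  proof -
    have "?I (fs u) (fs u) = ip (Suc (Suc L)) (fl (fs u)) u" by (simp only: ip_fl)
    also have "\<dots> = ?I (fl (fs u)) u" using ip_supp[OF supp_mono[OF assms, of "Suc L"], of "Suc (Suc L)"] by simp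
    finally have 1: "?I (fs u) (fs u) = ?I (fl (fs u)) u" .
    have "?I (fl (fs u)) (fl (fs u)) = ip L (fs u) (fs u)" by (simp add: ip_fl fs_fl)
    hence 2: "?I (fl (fs u)) (fl (fs u)) \<le> ?I (fs u) (fs u)" using ip_mono_L[of L "Suc L" "fs u"] by simp
    show ?thesis using 1 2 ip_am_gm[of 1 "Suc L" "fl (fs u)" u] by simp
  qed
  have y: "?I (fy u) (fy u) \<le> (\<Sum>i<n. \<bar>lam i\<bar>)\<^sup>2 * ?I u u"
  proof -
    have "(cmod (fy u i w))\<^sup>2 \<le> (\<Sum>i<n. \<bar>lam i\<bar>)\<^sup>2 * (cmod (u i w))\<^sup>2" if "i < n" for i w
    proof -
      have "\<bar>lam i\<bar> \<le> (\<Sum>i<n. \<bar>lam i\<bar>)" using that by (intro member_le_sum) auto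
      hence "\<bar>lam i\<bar>\<^sup>2 \<le> (\<Sum>i<n. \<bar>lam i\<bar>)\<^sup>2" by (intro power_mono) auto
      thus ?thesis by (simp add: fy_def norm_mult power_mult_distrib mult_right_mono)
    qed
    hence "?I (fy u) (fy u) \<le> (\<Sum>w\<in>wds (Suc L). (1 / real n) ^ Suc (length w) * (\<Sum>i<n. (\<Sum>i<n. \<bar>lam i\<bar>)\<^sup>2 * (cmod (u i w))\<^sup>2))"
      unfolding ip_self by (intro sum_mono mult_left_mono) auto
    also have "\<dots> = (\<Sum>i<n. \<bar>lam i\<bar>)\<^sup>2 * ?I u u"
      unfolding ip_self by (simp add: sum_distrib_left mult_ac)
    finally show ?thesis .
  qed
  have pt: "(cmod (fT u i w))\<^sup>2 \<le> 3 * ((cmod (fl u i w))\<^sup>2 + (cmod (fs u i w))\<^sup>2 + (cmod (fy u i w))\<^sup>2)" for i w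
  proof -
    have "cmod (fT u i w) \<le> cmod (fl u i w) + cmod (fs u i w) + cmod (fy u i w)"
      unfolding fT_split by (rule order_trans[OF norm_triangle_ineq]) (simp add: norm_triangle_ineq)
    hence "(cmod (fT u i w))\<^sup>2 \<le> (cmod (fl u i w) + cmod (fs u i w) + cmod (fy u i w))\<^sup>2" by (intro power_mono) auto
    thus ?thesis using sum_three_squares[of "cmod (fl u i w)" "cmod (fs u i w)" "cmod (fy u i w)"] by linarith
  qed
  have "?I (fT u) (fT u) \<le> (\<Sum>w\<in>wds (Suc L). (1 / real n) ^ Suc (length w) * (\<Sum>i<n. 3 * ((cmod (fl u i w))\<^sup>2 + (cmod (fs u i w))\<^sup>2 + (cmod (fy u i w))\<^sup>2)))"
    unfolding ip_self by (intro sum_mono mult_left_mono pt) auto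
  also have "\<dots> = 3 * (?I (fl u) (fl u) + ?I (fs u) (fs u) + ?I (fy u) (fy u))"
    unfolding ip_self by (simp add: sum.distrib distrib_left sum_distrib_left mult_ac)
  also have "\<dots> \<le> 3 * (?I u u + ?I u u + (\<Sum>i<n. \<bar>lam i\<bar>)\<^sup>2 * ?I u u)"
    using l s y by (intro mult_left_mono add_mono) auto
  also have "\<dots> = Rad\<^sup>2 * ?I u u" by (simp add: Rad_def algebra_simps)
  finally show ?thesis .
qed

lemma ip_fom: "ip L fom v = Re (phi v)"
proof -
  have "ip L fom v = (\<Sum>w\<in>{[]}. (1 / real n) ^ Suc (length w) * (\<Sum>i<n. Re (cnj (fom i w) * v i w)))"
    unfolding ip_def
    by (rule sum.mono_neutral_right[OF finite_wds]) (auto simp: wds_def fom_def)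
  also have "\<dots> = Re ((\<Sum>i<n. v i []) / of_real (real n))" unfolding Re_divide_of_real by (simp add: fom_def)
  finally show ?thesis by (simp add: phi_def)
qed

lemma ip_pow: "k + l < L \<Longrightarrow> ip L ((fT ^^ k) fom) ((fT ^^ l) fom) = Re (fR (k + l))"
proof (induction k arbitrary: l)
  case 0
  show ?case by (simp add: ip_fom fR_def)
next
  case (Suc k)
  obtain L' where L': "L = Suc L'" using Suc.prems by (cases L) auto
  have "ip L ((fT ^^ Suc k) fom) ((fT ^^ l) fom) = ip L ((fT ^^ k) fom) ((fT ^^ Suc l) fom)"
    unfolding L' using ip_fT[OF supp_mono[OF supp_pow[of k]] supp_mono[OF supp_pow[of l]], of L'] Suc.prems L' by simp
  thus ?case using Suc.IH[of "Suc l"] Suc.prems by simp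
qed

definition rmom :: "nat \<Rightarrow> real" where "rmom k = Re (fR k)"

definition pvec :: "real poly \<Rightarrow> fvec" where
  "pvec p = (\<lambda>i w. \<Sum>k\<le>degree p. of_real (poly.coeff p k) * (fT ^^ k) fom i w)"

lemma supp_pvec: "supp (degree p) (pvec p)"
  unfolding supp_def pvec_def using supp_pow by (auto simp: supp_def intro!: sum.neutral)

lemma ip_pvec: assumes "degree p + degree q < L" shows "ip L (pvec p) (pvec q) = pfun rmom (p * q)"
proof -
  have A: "ip L (pvec p) v = (\<Sum>k\<le>degree p. coeff p k * ip L v ((fT ^^ k) fom))" for v
    by (subst ip_sym) (simp only: pvec_def ip_sum)
  have "ip L (pvec p) (pvec q) = (\<Sum>l\<le>degree q. coeff q l * (\<Sum>k\<le>degree p. coeff p k * ip L ((fT ^^ l) fom) ((fT ^^ k) fom)))"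
    by (subst pvec_def[of q]) (simp only: ip_sum A)
  also have "\<dots> = (\<Sum>l\<le>degree q. coeff q l * (\<Sum>k\<le>degree p. coeff p k * rmom (l + k)))"
    by (intro sum.cong refl arg_cong[of _ _ "\<lambda>x. _ * x"]) (use assms in \<open>auto simp: ip_pow rmom_def\<close>)
  also have "\<dots> = pfun rmom (q * p)" unfolding pfun_mult[symmetric] by (simp add: pfun_def)
  finally show ?thesis by (simp add: mult.commute)
qed

lemma fT_pvec: "fT (pvec p) = pvec (pCons 0 p)"
proof -
  have "pvec (pCons 0 p) = (\<lambda>i w. \<Sum>k\<le>Suc (degree p). of_real (poly.coeff (pCons 0 p) k) * (fT ^^ k) fom i w)"
  proof (intro ext)
    fix i w
    show "pvec (pCons 0 p) i w = (\<Sum>k\<le>Suc (degree p). of_real (poly.coeff (pCons 0 p) k) * (fT ^^ k) fom i w)"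
      unfolding pvec_def by (rule sum.mono_neutral_left) (auto simp: coeff_eq_0 degree_pCons_le split: if_splits)
  qed
  also have "\<dots> = fT (pvec p)"
    unfolding pvec_def flinD[OF flin_fT] by (simp add: sum.atMost_Suc_shift del: sum.atMost_Suc)
  finally show ?thesis by simp
qed

lemma fT_real: "(\<And>i w. v i w \<in> \<real>) \<Longrightarrow> fT v i w \<in> \<real>"
  by (auto simp: fT_def fx_def fy_def fs_def fl_def intro!: Reals_add Reals_divide sum_in_Reals Reals_mult split: list.split)

lemma fR_real: "fR k = of_real (rmom k)"
proof -
  have "(fT ^^ k) fom i w \<in> \<real>" for i w
    by (induction k arbitrary: i w) (auto simp: fom_def intro: fT_real)
  hence "fR k \<in> \<real>" unfolding fR_def phi_def by (intro Reals_divide sum_in_Reals) auto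
  thus ?thesis unfolding rmom_def by simp
qed

text \<open>The spectral measure of \<open>fT\<close> at \<open>fom\<close>, obtained from moments.
  For the vector \<open>v\<close> that \<open>p\<close> of \<open>fT\<close> produces from
  \<open>fom\<close>, the four positivity conditions say that \<open>ip L v v\<close> is
  nonnegative, that \<open>|ip L v (fT v)|\<close> is at most \<open>Rad\<close> times it, and that
  \<open>fT\<close> is bounded by \<open>Rad\<close>. The cutoff is chosen beyond all degrees
  involved.\<close>

lemma fock_measure:
  "\<exists>\<rho>. prob_space \<rho> \<and> sets \<rho> = sets borel \<and> (AE x in \<rho>. \<bar>x\<bar> \<le> Rad) \<and> (\<forall>k. of_real (\<integral>x. x ^ k \<partial>\<rho>) = fR k)"
proof -
  let ?r = Rad
  have 1: "pfun rmom ([:?r, 1:] * (p * p)) = ?r * ip L (pvec p) (pvec p) + ip L (pvec p) (fT (pvec p))" 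
    "pfun rmom ([:?r, -1:] * (p * p)) = ?r * ip L (pvec p) (pvec p) - ip L (pvec p) (fT (pvec p))"
    "pfun rmom ([:?r, 1:] * [:?r, -1:] * (p * p)) = ?r\<^sup>2 * ip L (pvec p) (pvec p) - ip L (fT (pvec p)) (fT (pvec p))"
    "pfun rmom (p * p) = ip L (pvec p) (pvec p)"
    if L: "2 * degree p + 2 < L" for p L
  proof -
    have d: "degree (pCons 0 p) \<le> Suc (degree p)" by (rule degree_pCons_le)
    have a: "pfun rmom (p * p) = ip L (pvec p) (pvec p)" using L by (subst ip_pvec) auto
    have b: "pfun rmom (p * pCons 0 p) = ip L (pvec p) (fT (pvec p))"
      unfolding fT_pvec using L d by (subst ip_pvec) auto
    have c: "pfun rmom (pCons 0 p * pCons 0 p) = ip L (fT (pvec p)) (fT (pvec p))"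
      unfolding fT_pvec using L d by (subst ip_pvec) auto
    have neg: "pfun rmom (- q) = - pfun rmom q" for q using pfun_smult[of rmom "-1" q] by simp
    have "[:?r, 1:] * (p * p) = Polynomial.smult ?r (p * p) + p * pCons 0 p" by (simp add: mult_pCons_left mult_pCons_right)
    thus "pfun rmom ([:?r, 1:] * (p * p)) = ?r * ip L (pvec p) (pvec p) + ip L (pvec p) (fT (pvec p))"
      by (simp only: pfun_add pfun_smult a b)
    have "[:?r, -1:] * (p * p) = Polynomial.smult ?r (p * p) + - (p * pCons 0 p)" by (simp add: mult_pCons_left mult_pCons_right)
    thus "pfun rmom ([:?r, -1:] * (p * p)) = ?r * ip L (pvec p) (pvec p) - ip L (pvec p) (fT (pvec p))"
      by ((simp only: pfun_add pfun_smult a b neg), simp?)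
    have "[:?r, 1:] * [:?r, -1:] * (p * p) = Polynomial.smult (?r\<^sup>2) (p * p) + - (pCons 0 p * pCons 0 p)"
      by (simp add: mult_pCons_left mult_pCons_right power2_eq_square algebra_simps)
    thus "pfun rmom ([:?r, 1:] * [:?r, -1:] * (p * p)) = ?r\<^sup>2 * ip L (pvec p) (pvec p) - ip L (fT (pvec p)) (fT (pvec p))"
      by ((simp only: pfun_add pfun_smult a c neg), simp?)
    show "pfun rmom (p * p) = ip L (pvec p) (pvec p)" by (rule a)
  qed
  have bd: "ip L (fT (pvec p)) (fT (pvec p)) \<le> ?r\<^sup>2 * ip L (pvec p) (pvec p)" 
    "\<bar>ip L (pvec p) (fT (pvec p))\<bar> \<le> ?r * ip L (pvec p) (pvec p)" if L: "L = 2 * degree p + 3" for p L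
  proof -
    have L': "L = Suc (2 * degree p + 2)" using L by simp
    show *: "ip L (fT (pvec p)) (fT (pvec p)) \<le> ?r\<^sup>2 * ip L (pvec p) (pvec p)"
      unfolding L' by (rule ip_fT_bound[OF supp_mono[OF supp_pvec]]) simp
    have "2 * \<bar>ip L (pvec p) (fT (pvec p))\<bar> \<le> ?r * ip L (pvec p) (pvec p) + ip L (fT (pvec p)) (fT (pvec p)) / ?r"
      by (rule ip_am_gm[OF Rad_pos])
    also have "ip L (fT (pvec p)) (fT (pvec p)) / ?r \<le> ?r\<^sup>2 * ip L (pvec p) (pvec p) / ?r"
      using Rad_pos by (intro divide_right_mono *) auto
    also have "?r\<^sup>2 * ip L (pvec p) (pvec p) / ?r = ?r * ip L (pvec p) (pvec p)"
      using Rad_pos by (simp add: power2_eq_square)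
    finally show "\<bar>ip L (pvec p) (fT (pvec p))\<bar> \<le> ?r * ip L (pvec p) (pvec p)" by simp
  qed
  have "\<exists>\<rho>. prob_space \<rho> \<and> sets \<rho> = sets borel \<and> (AE x in \<rho>. \<bar>x\<bar> \<le> ?r) \<and> (\<forall>k. (\<integral>x. x ^ k \<partial>\<rho>) = pfun rmom ([:0, 1:] ^ k))"
  proof (rule bounded_moment_measure)
    show "pfun rmom (p + q) = pfun rmom p + pfun rmom q" for p q by (rule pfun_add)
    show "pfun rmom (Polynomial.smult c p) = c * pfun rmom p" for c p by (rule pfun_smult)
    have "rmom 0 = 1" by (simp add: rmom_def fR_def phi_fom)
    thus "pfun rmom 1 = 1" by (simp add: pfun_def)
    fix p :: "real poly"
    define L where "L = 2 * degree p + 3"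
    have L: "2 * degree p + 2 < L" by (simp add: L_def)
    note b = bd[OF L_def]
    show "pfun rmom (p * p) \<ge> 0" unfolding 1[OF L] by (rule ip_nonneg)
    show "pfun rmom ([:?r, 1:] * (p * p)) \<ge> 0" unfolding 1[OF L] using b(2) by linarith
    show "pfun rmom ([:?r, -1:] * (p * p)) \<ge> 0" unfolding 1[OF L] using b(2) by linarith
    show "pfun rmom ([:?r, 1:] * [:?r, -1:] * (p * p)) \<ge> 0" unfolding 1[OF L] using b(1) by linarith
  qed (rule Rad_pos)
  moreover have "of_real (pfun rmom ([:0, 1:] ^ k)) = fR k" for k
  proof -
    have "pfun rmom ([:0, 1:] ^ k) = (\<Sum>j\<le>k. coeff (monom 1 k) j * rmom j)"
      unfolding monom_altdef by (simp add: pfun_bound degree_power_le[of "[:0, 1::real:]" k, simplified])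
    also have "\<dots> = rmom k" by (simp add: if_distrib[of "\<lambda>x. x * _"] cong: if_cong)
    finally show ?thesis by (simp add: fR_real)
  qed
  ultimately show ?thesis by auto
qed

text \<open>The component at index \<open>i\<close> and the empty word carries the weight
  \<open>1 / n\<close> in \<open>ip\<close>, whence the factor \<open>sqrt n\<close>. The geometric
  growth makes the power series in \<open>1 / z\<close> converge.\<close>

lemma fM_bound: "i < n \<Longrightarrow> cmod (fM i k) \<le> sqrt n * Rad ^ k"
proof -
  assume i: "i < n"
  have "ip L ((fT ^^ k) fom) ((fT ^^ k) fom) \<le> Rad ^ (2 * k)" if "k < L" for L k
    using that
  proof (induction k)
    case 0
    have "ip L fom fom = 1" by (simp add: ip_fom phi_fom)
    thus ?case by simp
  next
    case (Suc k)
    obtain L' where L': "L = Suc L'" using Suc.prems by (cases L) auto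
    have "ip L (fT ((fT ^^ k) fom)) (fT ((fT ^^ k) fom)) \<le> Rad\<^sup>2 * ip L ((fT ^^ k) fom) ((fT ^^ k) fom)"
      unfolding L' by (rule ip_fT_bound[OF supp_mono[OF supp_pow]]) (use Suc.prems L' in auto)
    also have "\<dots> \<le> Rad\<^sup>2 * Rad ^ (2 * k)" using Suc by (intro mult_left_mono) auto
    finally show ?case by (simp flip: power_add)
  qed
  from this[of k "Suc k"] have b: "ip (Suc k) ((fT ^^ k) fom) ((fT ^^ k) fom) \<le> (Rad ^ k)\<^sup>2"
    by (simp add: power_mult mult.commute[of 2])
  have "(1 / real n) * (cmod (fM i k))\<^sup>2 \<le> (1 / real n) * (\<Sum>i<n. (cmod ((fT ^^ k) fom i []))\<^sup>2)"
    unfolding fM_def using i by (intro mult_left_mono member_le_sum) auto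
  also have "\<dots> = (\<Sum>w\<in>{[]}. (1 / real n) ^ Suc (length w) * (\<Sum>i<n. (cmod ((fT ^^ k) fom i w))\<^sup>2))" by simp
  also have "\<dots> \<le> ip (Suc k) ((fT ^^ k) fom) ((fT ^^ k) fom)"
    unfolding ip_self by (intro sum_mono2 finite_wds) (auto simp: wds_def intro!: divide_nonneg_nonneg mult_nonneg_nonneg sum_nonneg)
  finally have "(1 / real n) * (cmod (fM i k))\<^sup>2 \<le> (Rad ^ k)\<^sup>2" using b by linarith
  hence "(cmod (fM i k))\<^sup>2 \<le> real n * (Rad ^ k)\<^sup>2"
    using n by (simp only: mult_1 times_divide_eq_left of_nat_0_less_iff pos_divide_le_eq mult.commute)
  also have "real n * (Rad ^ k)\<^sup>2 = (sqrt n * Rad ^ k)\<^sup>2" by (simp only: power_mult_distrib real_sqrt_pow2[OF of_nat_0_le_iff])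
  finally show ?thesis by (rule power2_le_imp_le) (use Rad_pos in simp)
qed

end


section \<open>Moments of the semicircle law\<close>

text \<open>Passes from the two-term recurrence, which integration by parts provides, to the
  convolution recursion, which the Fock model provides. The symmetry of \<open>a\<close> and
  \<open>j - a\<close> evaluates the sum weighted by \<open>a\<close>, and inserting the recurrence
  shows that the convolution obeys the recurrence of the shifted sequence.\<close>

lemma catalan_convolution:
  fixes c :: "nat \<Rightarrow> real"
  assumes c0: "c 0 = 1" and rec: "\<And>j. (real j + 2) * c (Suc j) = 2 * (2 * real j + 1) * c j"
  shows "(\<Sum>a\<le>j. c a * c (j - a)) = c (Suc j)"
proof -
  define S where "S j = (\<Sum>a\<le>j. c a * c (j - a))" for j
  define T where "T j = (\<Sum>a\<le>j. real a * (c a * c (j - a)))" for j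
  have TS: "2 * T j = real j * S j" for j
  proof -
    have "T j = (\<Sum>a\<le>j. real (j - a) * (c a * c (j - a)))"
      unfolding T_def by (rule sum.reindex_bij_witness[of _ "\<lambda>a. j - a" "\<lambda>a. j - a"]) (auto simp: mult.commute)
    hence "2 * T j = (\<Sum>a\<le>j. real a * (c a * c (j - a)) + real (j - a) * (c a * c (j - a)))"
      by (simp add: T_def sum.distrib)
    also have "\<dots> = (\<Sum>a\<le>j. real j * (c a * c (j - a)))"
      by (intro sum.cong refl) (auto simp: of_nat_diff algebra_simps)
    finally show ?thesis by (simp add: S_def sum_distrib_left)
  qed
  have step: "T (Suc j) + S (Suc j) = c (Suc j) + 2 * (real j + 1) * S j" for j
  proof -
    have "T (Suc j) + S (Suc j) = (\<Sum>a\<le>Suc j. (real a + 1) * (c a * c (Suc j - a)))"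
      by (simp only: T_def S_def sum.distrib[symmetric] distrib_right mult_1)
    also have "\<dots> = c (Suc j) + (\<Sum>a\<le>j. (real a + 2) * c (Suc a) * c (j - a))"
      by (subst sum.atMost_Suc_shift) (simp add: c0 algebra_simps)
    also have "(\<Sum>a\<le>j. (real a + 2) * c (Suc a) * c (j - a)) = (\<Sum>a\<le>j. 4 * (real a * (c a * c (j - a))) + 2 * (c a * c (j - a)))"
      unfolding rec by (intro sum.cong refl) (simp add: algebra_simps)
    also have "\<dots> = 2 * (2 * T j) + 2 * S j" by (simp add: sum.distrib T_def S_def sum_distrib_left)
    also have "\<dots> = 2 * (real j + 1) * S j" unfolding TS by (simp add: algebra_simps)
    finally show ?thesis .
  qed
  have "S j = c (Suc j)"
  proof (induction j)
    case 0
    show ?case using rec[of 0] by (simp add: S_def c0)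
  next
    case (Suc j)
    have "(real j + 3) * S (Suc j) = 2 * (T (Suc j) + S (Suc j))" using TS[of "Suc j"] by (simp add: algebra_simps)
    also have "\<dots> = 2 * (2 * real j + 3) * c (Suc j)" unfolding step Suc by (simp add: algebra_simps)
    also have "\<dots> = (real j + 3) * c (Suc (Suc j))" using rec[of "Suc j"] by (simp add: algebra_simps)
    finally show ?case by simp
  qed
  thus ?thesis by (simp add: S_def)
qed

definition sint :: "nat \<Rightarrow> real" where
  "sint k = integral {-2..2} (\<lambda>x. x ^ k * sqrt (4 - x\<^sup>2))"

lemma sint_integrable: "(\<lambda>x. x ^ k * sqrt (4 - x\<^sup>2)) integrable_on {-2..2::real}"
  by (intro integrable_continuous_real continuous_intros)

lemma four_minus_pos: "-2 < x \<Longrightarrow> x < 2 \<Longrightarrow> 4 - x\<^sup>2 > (0::real)"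
  using abs_square_less_1[of "x / 2"] by (simp add: power_divide)

lemma sint_0: "sint 0 = 2 * pi"
proof -
  let ?F = "\<lambda>x. x / 2 * sqrt (4 - x\<^sup>2) + 2 * arcsin (x / 2)"
  have "((\<lambda>x. sqrt (4 - x\<^sup>2)) has_integral (?F 2 - ?F (-2))) {-2..2}"
  proof (rule fundamental_theorem_of_calculus_interior)
    show "continuous_on {-2..2} ?F" by (intro continuous_intros continuous_on_arcsin) auto
    fix x :: real assume x: "x \<in> {-2<..<2}"
    define s where "s = sqrt (4 - x\<^sup>2)"
    have p: "4 - x\<^sup>2 > 0" using x by (intro four_minus_pos) auto
    hence s: "s > 0" "s\<^sup>2 = 4 - x\<^sup>2" by (auto simp: s_def)
    have "sqrt (1 - (x / 2)\<^sup>2) = sqrt ((4 - x\<^sup>2) / 4)" by (simp add: power_divide diff_divide_distrib)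
    hence s2: "sqrt (1 - (x / 2)\<^sup>2) = s / 2" by (simp add: s_def real_sqrt_divide)
    have "(?F has_real_derivative (1/2 * s + x / 2 * (inverse s / 2 * (- 2 * x)) + 2 * (inverse (s / 2) * (1/2)))) (at x)"
      using x p unfolding s_def s2[unfolded s_def, symmetric]
      by (auto intro!: derivative_eq_intros)
    also have "1/2 * s + x / 2 * (inverse s / 2 * (- 2 * x)) + 2 * (inverse (s / 2) * (1/2)) = (s\<^sup>2 - x\<^sup>2 + 4) / (2 * s)"
      using s(1) by (simp add: field_simps power2_eq_square)
    also have "\<dots> = (2 * s\<^sup>2) / (2 * s)" by (simp add: s(2))
    also have "\<dots> = s" using s(1) by (simp add: power2_eq_square)
    finally show "(?F has_vector_derivative sqrt (4 - x\<^sup>2)) (at x)"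
      by (simp add: s_def has_real_derivative_iff_has_vector_derivative)
  qed simp
  hence "integral {-2..2} (\<lambda>x. sqrt (4 - x\<^sup>2)) = ?F 2 - ?F (-2)" by (rule integral_unique)
  thus ?thesis by (simp add: sint_def)
qed

text \<open>The integrand is the derivative of \<open>x^m (4 - x^2)^(3/2)\<close>, which vanishes at
  both endpoints. For \<open>m = 0\<close> the truncated exponent \<open>m - 1\<close> is harmless
  because of the factor \<open>m\<close>.\<close>

lemma sint_FTC: "((\<lambda>x. real m * x ^ (m - 1) * ((4 - x\<^sup>2) * sqrt (4 - x\<^sup>2)) + x ^ m * (- 3 * x * sqrt (4 - x\<^sup>2))) has_integral 0) {-2..2}"
proof -
  let ?F = "\<lambda>x::real. x ^ m * ((4 - x\<^sup>2) * sqrt (4 - x\<^sup>2))"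
  have "((\<lambda>x. real m * x ^ (m - 1) * ((4 - x\<^sup>2) * sqrt (4 - x\<^sup>2)) + x ^ m * (- 3 * x * sqrt (4 - x\<^sup>2))) has_integral (?F 2 - ?F (-2))) {-2..2}"
  proof (rule fundamental_theorem_of_calculus_interior)
    show "continuous_on {-2..2} ?F" by (intro continuous_intros)
    fix x :: real assume x: "x \<in> {-2<..<2}"
    define s where "s = sqrt (4 - x\<^sup>2)"
    have p: "4 - x\<^sup>2 > 0" using x by (intro four_minus_pos) auto
    hence s: "s > 0" "4 - x\<^sup>2 = s * s" by (auto simp: s_def)
    have "((\<lambda>x. (4 - x\<^sup>2) * sqrt (4 - x\<^sup>2)) has_real_derivative (- 2 * x * s + (inverse s / 2 * (- 2 * x)) * (4 - x\<^sup>2))) (at x)"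
      using p unfolding s_def by (auto intro!: derivative_eq_intros)
    also have "- 2 * x * s + (inverse s / 2 * (- 2 * x)) * (4 - x\<^sup>2) = - 3 * x * s"
      using s(1) unfolding s(2) by (simp add: field_simps)
    finally have H: "((\<lambda>x. (4 - x\<^sup>2) * sqrt (4 - x\<^sup>2)) has_real_derivative (- 3 * x * s)) (at x)" .
    have "((\<lambda>x. x ^ m * ((4 - x\<^sup>2) * sqrt (4 - x\<^sup>2))) has_real_derivative
        (real m * x ^ (m - 1) * ((4 - x\<^sup>2) * sqrt (4 - x\<^sup>2)) + (- 3 * x * s) * x ^ m)) (at x)"
      using DERIV_mult[OF DERIV_pow[of m x UNIV] H] by simp
    thus "(?F has_vector_derivative (real m * x ^ (m - 1) * ((4 - x\<^sup>2) * sqrt (4 - x\<^sup>2)) + x ^ m * (- 3 * x * sqrt (4 - x\<^sup>2)))) (at x)"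
      by (simp add: s_def has_real_derivative_iff_has_vector_derivative mult.commute)
  qed simp
  thus ?thesis by simp
qed

lemma sint_1: "sint 1 = 0"
proof -
  have "((\<lambda>x. (-3) * (x ^ 1 * sqrt (4 - x\<^sup>2))) has_integral 0) {-2..2}"
    using sint_FTC[of 0] by (simp add: mult.assoc)
  moreover have "((\<lambda>x. (-3) * (x ^ 1 * sqrt (4 - x\<^sup>2))) has_integral (-3) * sint 1) {-2..2}"
    unfolding sint_def by (intro has_integral_mult_right integrable_integral sint_integrable)
  ultimately have "(-3) * sint 1 = 0" by (rule has_integral_unique[rotated])
  thus ?thesis by simp
qed

lemma sint_rec: "(real k + 4) * sint (Suc (Suc k)) = 4 * (real k + 1) * sint k"
proof -
  have eq: "real (Suc k) * x ^ (Suc k - 1) * ((4 - x\<^sup>2) * sqrt (4 - x\<^sup>2)) + x ^ Suc k * (- 3 * x * sqrt (4 - x\<^sup>2))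
     = 4 * (real k + 1) * (x ^ k * sqrt (4 - x\<^sup>2)) - (real k + 4) * (x ^ Suc (Suc k) * sqrt (4 - x\<^sup>2))" for x :: real
    by (simp add: power2_eq_square algebra_simps)
  have "((\<lambda>x. 4 * (real k + 1) * (x ^ k * sqrt (4 - x\<^sup>2)) - (real k + 4) * (x ^ Suc (Suc k) * sqrt (4 - x\<^sup>2))) has_integral 0) {-2..2}"
    using sint_FTC[of "Suc k"] unfolding eq .
  moreover have "((\<lambda>x. 4 * (real k + 1) * (x ^ k * sqrt (4 - x\<^sup>2)) - (real k + 4) * (x ^ Suc (Suc k) * sqrt (4 - x\<^sup>2)))
     has_integral (4 * (real k + 1) * sint k - (real k + 4) * sint (Suc (Suc k)))) {-2..2}"
    unfolding sint_def by (intro has_integral_diff has_integral_mult_right integrable_integral sint_integrable)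
  ultimately have "4 * (real k + 1) * sint k - (real k + 4) * sint (Suc (Suc k)) = 0" by (rule has_integral_unique[rotated])
  thus ?thesis by simp
qed

definition smom :: "nat \<Rightarrow> real" where "smom k = (\<integral>s. s ^ k \<partial>semicircle)"

lemma smom_sint: "smom k = sint k / (2 * pi)"
proof -
  let ?f = "\<lambda>x. x ^ k * sqrt (4 - x\<^sup>2) :: real"
  have nn: "0 \<le> indicator {-2..2} x * (1 / (2 * pi) * sqrt (4 - x\<^sup>2))" for x :: real
    using abs_square_le_1[of "x / 2"] by (auto simp: indicator_def power_divide)
  have "smom k = (\<integral>x. (indicator {-2..2} x * (1 / (2 * pi) * sqrt (4 - x\<^sup>2))) *\<^sub>R x ^ k \<partial>lborel)"
    unfolding smom_def semicircle_def by (rule integral_density) (use nn in auto)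
  also have "\<dots> = (\<integral>x. (1 / (2 * pi)) * (indicator {-2..2} x *\<^sub>R ?f x) \<partial>lborel)"
    by (intro Bochner_Integration.integral_cong refl) simp
  also have "\<dots> = (1 / (2 * pi)) * (LINT x:{-2..2}|lborel. ?f x)"
    unfolding set_lebesgue_integral_def by simp
  also have "(LINT x:{-2..2}|lborel. ?f x) = integral {-2..2} ?f"
    by (rule set_borel_integral_eq_integral(2))
       (unfold set_integrable_def, intro borel_integrable_atLeastAtMost'[unfolded set_integrable_def] continuous_intros)
  finally show ?thesis by (simp add: sint_def)
qed

text \<open>Odd moments vanish and even ones are Catalan numbers. In the sum of the two parities
  only the products of even moments survive, and \<open>catalan_convolution\<close> evaluates
  them.\<close>

lemma smom_recursion: "smom (Suc k) = (\<Sum>b<k. smom (k - 1 - b) * smom b)"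
proof -
  have r: "(real k + 4) * smom (Suc (Suc k)) = 4 * (real k + 1) * smom k" for k
    using sint_rec[of k] by (simp add: smom_sint field_simps)
  have odd: "smom (Suc (2 * j)) = 0" for j
  proof (induction j)
    case 0
    show ?case using sint_1 by (simp add: smom_sint)
  next
    case (Suc j)
    have "(real (Suc (2 * j)) + 4) * smom (Suc (2 * Suc j)) = 0" using r[of "Suc (2 * j)"] Suc by simp
    moreover have "real (Suc (2 * j)) + 4 \<noteq> 0" by (simp add: add_nonneg_eq_0_iff)
    ultimately show ?case using mult_eq_0_iff by blast
  qed
  define c where "c j = smom (2 * j)" for j
  have conv: "(\<Sum>a\<le>j. c a * c (j - a)) = c (Suc j)" for j
  proof (rule catalan_convolution)
    show "c 0 = 1" by (simp add: c_def smom_sint sint_0)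
    fix j
    have "2 * ((real j + 2) * c (Suc j)) = 2 * (2 * (2 * real j + 1) * c j)"
      using r[of "2 * j"] by (simp add: c_def algebra_simps)
    thus "(real j + 2) * c (Suc j) = 2 * (2 * real j + 1) * c j" by simp
  qed
  show ?thesis
  proof (cases "even k")
    case True
    have z: "smom (k - 1 - b) * smom b = 0" if "b < k" for b
    proof (cases "even b")
      case False
      then obtain m where "b = Suc (2 * m)" by (auto elim: oddE)
      thus ?thesis using odd by simp
    next
      case eb: True
      have "odd (k - 1 - b)" using True eb that by auto
      then obtain m where "k - 1 - b = 2 * m + 1" by (rule oddE)
      thus ?thesis using odd by (simp del: diff_diff_left)
    qed
    obtain j where "k = 2 * j" using True by blast
    hence "smom (Suc k) = 0" using odd by simp
    moreover have "(\<Sum>b<k. smom (k - 1 - b) * smom b) = 0" by (intro sum.neutral ballI z) simp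
    ultimately show ?thesis by simp
  next
    case False
    then obtain j where k: "k = Suc (2 * j)" by (auto elim: oddE)
    have ev: "(\<Sum>b\<le>2 * j. f b) = (\<Sum>a\<le>j. f (2 * a))" if "\<And>a. f (Suc (2 * a)) = 0" for f :: "nat \<Rightarrow> real"
      by (induction j) (auto simp: that)
    have "(\<Sum>b<k. smom (k - 1 - b) * smom b) = (\<Sum>b\<le>2 * j. smom (2 * j - b) * smom b)"
      by (simp add: k lessThan_Suc_atMost)
    also have "\<dots> = (\<Sum>a\<le>j. smom (2 * j - 2 * a) * smom (2 * a))" by (rule ev) (simp add: odd)
    also have "\<dots> = (\<Sum>a\<le>j. c a * c (j - a))"
    proof (intro sum.cong refl)
      fix a
      have "2 * j - 2 * a = 2 * (j - a)" by simp
      thus "smom (2 * j - 2 * a) * smom (2 * a) = c a * c (j - a)" by (simp only: c_def mult.commute)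
    qed
    also have "\<dots> = smom (Suc k)" unfolding conv by (simp add: c_def k)
    finally show ?thesis by simp
  qed
qed

context fock
begin

lemma fc_smom: "fc k 0 = of_real (smom k)"
proof (induction k rule: less_induct)
  case (less k)
  show ?case
  proof (cases k)
    case 0
    thus ?thesis by (simp add: smom_sint sint_0)
  next
    case (Suc m)
    have "fc (Suc m) 0 = (\<Sum>b<m. fc (m - 1 - b) 0 * fc b 0)" by (rule fc_recursion)
    also have "\<dots> = (\<Sum>b<m. of_real (smom (m - 1 - b)) * of_real (smom b))"
      by (intro sum.cong refl) (simp add: less Suc)
    also have "\<dots> = of_real (smom (Suc m))" unfolding smom_recursion[of m] by simp
    finally show ?thesis by (simp only: Suc)
  qed
qed

text \<open>The state \<open>ftau\<close> witnesses the description of the free convolution.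
  Conversely \<open>free_pair_unique\<close> forces any other witness to equal \<open>ftau\<close>,
  so the moments of a competing measure agree, and compact support makes the measures agree.\<close>

lemma free_conv_eq:
  assumes \<rho>: "prob_space \<rho>" "sets \<rho> = sets borel" "AE x in \<rho>. \<bar>x\<bar> \<le> Rad" "\<And>k. of_real (\<integral>x. x ^ k \<partial>\<rho>) = fR k"
    and \<nu>: "\<And>k. of_real (\<integral>s. s ^ k \<partial>\<nu>) = fm k"
  shows "semicircle \<boxplus> \<nu> = \<rho>"
  unfolding free_conv_def
proof (rule the_equality)
  have sx: "ftau (replicate k False) = of_real (\<integral>s. s ^ k \<partial>semicircle)" for k
    by (simp add: ftau_x fc_smom smom_def)
  have sy: "ftau (replicate k True) = of_real (\<integral>s. s ^ k \<partial>\<nu>)" for k by (simp add: ftau_y \<nu>)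
  show "prob_space \<rho> \<and> sets \<rho> = sets borel \<and> (\<exists>r. AE s in \<rho>. \<bar>s\<bar> \<le> r) \<and>
     (\<exists>\<tau>. free_pair \<tau> \<and> (\<forall>k. \<tau> (replicate k False) = of_real (\<integral>s. s ^ k \<partial>semicircle)) \<and>
        (\<forall>k. \<tau> (replicate k True) = of_real (\<integral>s. s ^ k \<partial>\<nu>)) \<and>
        (\<forall>k. of_real (\<integral>s. s ^ k \<partial>\<rho>) = (\<Sum>w | length w = k. \<tau> w)))"
    using \<rho> sx sy ftau_free ftau_sum by (intro conjI exI[of _ Rad] exI[of _ ftau]) auto
  fix \<rho>'
  assume P: "prob_space \<rho>' \<and> sets \<rho>' = sets borel \<and> (\<exists>r. AE s in \<rho>'. \<bar>s\<bar> \<le> r) \<and>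
     (\<exists>\<tau>. free_pair \<tau> \<and> (\<forall>k. \<tau> (replicate k False) = of_real (\<integral>s. s ^ k \<partial>semicircle)) \<and>
        (\<forall>k. \<tau> (replicate k True) = of_real (\<integral>s. s ^ k \<partial>\<nu>)) \<and>
        (\<forall>k. of_real (\<integral>s. s ^ k \<partial>\<rho>') = (\<Sum>w | length w = k. \<tau> w)))"
  then obtain r \<tau> where r: "AE s in \<rho>'. \<bar>s\<bar> \<le> r" and \<tau>: "free_pair \<tau>"
    "\<And>k. \<tau> (replicate k False) = of_real (\<integral>s. s ^ k \<partial>semicircle)"
    "\<And>k. \<tau> (replicate k True) = of_real (\<integral>s. s ^ k \<partial>\<nu>)"
    "\<And>k. of_real (\<integral>s. s ^ k \<partial>\<rho>') = (\<Sum>w | length w = k. \<tau> w)" by blast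
  have "\<tau> = ftau"
  proof (rule free_pair_unique[OF \<tau>(1) ftau_free])
    fix i k show "\<tau> (replicate k i) = ftau (replicate k i)" by (cases i) (simp_all only: \<tau>(2,3) sx sy)
  qed
  hence "complex_of_real (\<integral>x. x ^ k \<partial>\<rho>') = of_real (\<integral>x. x ^ k \<partial>\<rho>)" for k by (simp add: \<tau>(4) ftau_sum \<rho>(4))
  hence m: "(\<integral>x. x ^ k \<partial>\<rho>') = (\<integral>x. x ^ k \<partial>\<rho>)" for k by (simp only: of_real_eq_iff)
  show "\<rho>' = \<rho>"
  proof (rule moments_determine_bounded_measure)
    show "AE x in \<rho>'. \<bar>x\<bar> \<le> max r Rad" using r by eventually_elim auto
    show "AE x in \<rho>. \<bar>x\<bar> \<le> max r Rad" using \<rho>(3) by eventually_elim auto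
  qed (use P \<rho> m in auto)
qed

end

section \<open>Stieltjes transforms of probability measures on the line\<close>

lemma stieltjes_kernel: "Im z \<noteq> 0 \<Longrightarrow> cmod (1 / (of_real x - z)) \<le> 1 / \<bar>Im z\<bar>"
  using abs_Im_le_cmod[of "of_real x - z"] by (auto simp: norm_divide intro!: divide_left_mono mult_pos_pos)

lemma stieltjes_integrable:
  assumes "prob_space \<mu>" "sets \<mu> = sets borel" "Im z \<noteq> 0"
  shows "integrable \<mu> (\<lambda>x. 1 / (of_real x - z))"
proof -
  have "(\<lambda>x. 1 / (of_real x - z)) \<in> borel_measurable \<mu>"
    by (subst measurable_cong_sets[OF assms(2) refl]) measurable
  thus ?thesis
    by (intro finite_measure.integrable_const_bound[OF prob_space.finite_measure[OF assms(1)], where B = "1 / \<bar>Im z\<bar>"])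
       (use stieltjes_kernel[OF assms(3)] in auto)
qed

lemma stieltjes_im:
  assumes "prob_space \<mu>" "sets \<mu> = sets borel" "Im z > 0"
  shows "Im (stieltjes \<mu> z) \<ge> 0"
proof -
  have "Im (stieltjes \<mu> z) = (\<integral>x. Im (1 / (of_real x - z)) \<partial>\<mu>)"
    unfolding stieltjes_def by (rule integral_Im[symmetric, OF stieltjes_integrable]) (use assms in auto)
  also have "\<dots> \<ge> 0"
  proof (rule Bochner_Integration.integral_nonneg)
    fix x show "0 \<le> Im (1 / (of_real x - z))"
      using assms(3) by (simp add: Im_divide)
  qed
  finally show ?thesis .
qed

lemma stieltjes_bound:
  assumes "prob_space \<mu>" "sets \<mu> = sets borel" "Im z > 0"
  shows "cmod (stieltjes \<mu> z) \<le> 1 / Im z"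
proof -
  have "cmod (stieltjes \<mu> z) \<le> (\<integral>x. cmod (1 / (of_real x - z)) \<partial>\<mu>)"
    unfolding stieltjes_def by (rule integral_norm_bound)
  also have "\<dots> \<le> 1 / Im z"
    by (rule prob_space.integral_le_const[OF assms(1)])
       (use stieltjes_integrable[OF assms(1,2), of z] stieltjes_kernel[of z] assms(3) in auto)
  finally show ?thesis .
qed

text \<open>The kernel has the exact second order remainder
  \<open>(w - z)^2 / ((x - w) (x - z)^2)\<close>, which is bounded uniformly in \<open>x\<close> as
  long as \<open>w\<close> stays within half the height of \<open>z\<close>.\<close>

lemma stieltjes_holomorphic:
  assumes \<mu>: "prob_space \<mu>" "sets \<mu> = sets borel"
  shows "stieltjes \<mu> holomorphic_on {z. Im z > 0}"
proof -
  have "\<exists>D. (stieltjes \<mu> has_field_derivative D) (at z)" if z: "Im z > 0" for z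
  proof -
    define D where "D = (\<integral>x. 1 / (of_real x - z)\<^sup>2 \<partial>\<mu>)"
    have int2: "integrable \<mu> (\<lambda>x. 1 / (of_real x - z)\<^sup>2)"
    proof (rule finite_measure.integrable_const_bound[OF prob_space.finite_measure[OF \<mu>(1)], where B = "(1 / Im z)\<^sup>2"])
      show "(\<lambda>x. 1 / (of_real x - z)\<^sup>2) \<in> borel_measurable \<mu>"
        by (subst measurable_cong_sets[OF \<mu>(2) refl]) measurable
      show "AE x in \<mu>. norm (1 / (of_real x - z)\<^sup>2) \<le> (1 / Im z)\<^sup>2"
      proof (rule AE_I2)
        fix x
        have "norm (1 / (of_real x - z)\<^sup>2) = (cmod (1 / (of_real x - z)))\<^sup>2" by (simp add: norm_divide norm_power power_divide)
        also have "\<dots> \<le> (1 / Im z)\<^sup>2" using stieltjes_kernel[of z x] z by (intro power_mono) auto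
        finally show "norm (1 / (of_real x - z)\<^sup>2) \<le> (1 / Im z)\<^sup>2" .
      qed
    qed
    define K where "K = 2 / Im z * (1 / Im z)\<^sup>2"
    have K: "K > 0" using z by (simp add: K_def)
    have est: "cmod (stieltjes \<mu> w - stieltjes \<mu> z - D * (w - z)) \<le> K * (cmod (w - z))\<^sup>2" if w: "cmod (w - z) < Im z / 2" for w
    proof -
      have wi: "Im w > Im z / 2" using w abs_Im_le_cmod[of "w - z"] by simp
      hence w0: "Im w > 0" using z by simp
      have pt: "1 / (of_real x - w) - 1 / (of_real x - z) - 1 / (of_real x - z)\<^sup>2 * (w - z) = (w - z)\<^sup>2 * (1 / (of_real x - w) * (1 / (of_real x - z))\<^sup>2)" for x :: real
      proof -
        have nz: "of_real x - w \<noteq> 0" "of_real x - z \<noteq> 0" using w0 z by (auto simp: complex_eq_iff)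
        have gen: "1 / u - 1 / v - 1 / v\<^sup>2 * (v - u) = (v - u)\<^sup>2 * (1 / u * (1 / v)\<^sup>2)" if "u \<noteq> 0" "v \<noteq> 0" for u v :: complex
          using that by (simp add: field_simps power2_eq_square)
        show ?thesis using gen[OF nz] by simp
      qed
      have eq0: "stieltjes \<mu> w - stieltjes \<mu> z - D * (w - z) = (\<integral>x. 1 / (of_real x - w) - 1 / (of_real x - z) - 1 / (of_real x - z)\<^sup>2 * (w - z) \<partial>\<mu>)"
      proof -
        have gen: "(\<integral>x. f x \<partial>\<mu>) - (\<integral>x. g x \<partial>\<mu>) - (\<integral>x. k x \<partial>\<mu>) * c = (\<integral>x. f x - g x - k x * c \<partial>\<mu>)"
          if "integrable \<mu> f" "integrable \<mu> g" "integrable \<mu> k" for f g k :: "real \<Rightarrow> complex" and c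
          using that by simp
        show ?thesis unfolding stieltjes_def D_def
          by (rule gen) (use stieltjes_integrable[OF \<mu>, of w] stieltjes_integrable[OF \<mu>, of z] int2 w0 z in auto)
      qed
      have "cmod (stieltjes \<mu> w - stieltjes \<mu> z - D * (w - z)) \<le> (\<integral>x. cmod (1 / (of_real x - w) - 1 / (of_real x - z) - 1 / (of_real x - z)\<^sup>2 * (w - z)) \<partial>\<mu>)"
        unfolding eq0 by (rule integral_norm_bound)
      also have "\<dots> \<le> K * (cmod (w - z))\<^sup>2"
      proof (rule prob_space.integral_le_const[OF \<mu>(1)])
        show "integrable \<mu> (\<lambda>x. cmod (1 / (of_real x - w) - 1 / (of_real x - z) - 1 / (of_real x - z)\<^sup>2 * (w - z)))"
          by (intro integrable_norm Bochner_Integration.integrable_diff integrable_mult_left int2 stieltjes_integrable[OF \<mu>])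
            (use w0 z in auto)
        show "AE x in \<mu>. cmod (1 / (of_real x - w) - 1 / (of_real x - z) - 1 / (of_real x - z)\<^sup>2 * (w - z)) \<le> K * (cmod (w - z))\<^sup>2"
        proof (rule AE_I2)
          fix x
          have "cmod (1 / (of_real x - w)) \<le> 1 / Im w" using stieltjes_kernel[of w x] w0 by simp
          also have "\<dots> \<le> 2 / Im z" using wi w0 z by (simp add: field_simps)
          finally have a: "cmod (1 / (of_real x - w)) \<le> 2 / Im z" .
          have b: "cmod (1 / (of_real x - z)) \<le> 1 / Im z" using stieltjes_kernel[of z x] z by simp
          have "cmod (1 / (of_real x - w)) * (cmod (1 / (of_real x - z)))\<^sup>2 \<le> K"
            unfolding K_def by (intro mult_mono power_mono a b) (use z in auto)
          from mult_left_mono[OF this, of "(cmod (w - z))\<^sup>2"]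
          show "cmod (1 / (of_real x - w) - 1 / (of_real x - z) - 1 / (of_real x - z)\<^sup>2 * (w - z)) \<le> K * (cmod (w - z))\<^sup>2"
            unfolding pt norm_mult norm_power mult.commute[of K] by simp
        qed
      qed
      finally show ?thesis .
    qed
    have "(stieltjes \<mu> has_derivative (\<lambda>h. D * h)) (at z)"
      unfolding has_derivative_at_alt
    proof (intro conjI allI impI)
      show "bounded_linear (\<lambda>h. D * h)" by (rule bounded_linear_mult_right)
      fix e :: real assume e: "e > 0"
      show "\<exists>d>0. \<forall>y. norm (y - z) < d \<longrightarrow> norm (stieltjes \<mu> y - stieltjes \<mu> z - D * (y - z)) \<le> e * norm (y - z)"
      proof (intro exI[of _ "min (Im z / 2) (e / K)"] conjI allI impI)
        show "min (Im z / 2) (e / K) > 0" using e K z by simp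
        fix y assume y: "norm (y - z) < min (Im z / 2) (e / K)"
        have "norm (stieltjes \<mu> y - stieltjes \<mu> z - D * (y - z)) \<le> K * norm (y - z) * norm (y - z)"
          using est[of y] y by (simp add: power2_eq_square)
        also have "\<dots> \<le> e * norm (y - z)" using y K by (intro mult_right_mono) (auto simp: field_simps)
        finally show "norm (stieltjes \<mu> y - stieltjes \<mu> z - D * (y - z)) \<le> e * norm (y - z)" .
      qed
    qed
    thus ?thesis by (auto simp: has_field_derivative_def)
  qed
  thus ?thesis
    by (subst holomorphic_on_open) (auto simp: open_halfspace_Im_gt)
qed

text \<open>The geometric expansion of the kernel at infinity, with its exact remainder, which is of
  order \<open>(r / |z|)^K\<close>.\<close>

lemma stieltjes_sums:
  assumes \<mu>: "prob_space \<mu>" "sets \<mu> = sets borel" "AE x in \<mu>. \<bar>x\<bar> \<le> r" and r: "r > 0" and z: "r < cmod z" "Im z > 0"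
  shows "(\<lambda>k. - of_real (\<integral>x. x ^ k \<partial>\<mu>) / z ^ Suc k) sums stieltjes \<mu> z"
proof -
  have z0: "z \<noteq> 0" using z by auto
  have xz: "of_real x - z \<noteq> 0" for x using z by (auto simp: complex_eq_iff)
  note fm = prob_space.finite_measure[OF \<mu>(1)]
  have m: "f \<in> borel_measurable borel \<Longrightarrow> f \<in> borel_measurable \<mu>" for f :: "real \<Rightarrow> 'b::topological_space"
    by (subst measurable_cong_sets[OF \<mu>(2) refl])
  have ip: "integrable \<mu> (\<lambda>x. x ^ k)" for k
  proof (rule finite_measure.integrable_const_bound[OF fm, where B = "r ^ k"])
    show "AE x in \<mu>. norm (x ^ k) \<le> r ^ k" using \<mu>(3) by eventually_elim (auto simp: power_abs intro: power_mono)
  qed (intro m, measurable)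
  have ipc: "integrable \<mu> (\<lambda>x. complex_of_real x ^ k)" for k
    using integrable_of_real[OF ip[of k], where 'a = complex] by simp
  have si: "integrable \<mu> (\<lambda>x. 1 / (of_real x - z))" using stieltjes_integrable[OF \<mu>(1,2)] z by simp
  have pt: "(\<Sum>k<K. - (of_real x ^ k) / z ^ Suc k) - 1 / (of_real x - z) = - ((of_real x / z) ^ K * (1 / (of_real x - z)))" for x :: real and K
  proof (induction K)
    case (Suc K)
    have "(\<Sum>k<Suc K. - (of_real x ^ k) / z ^ Suc k) - 1 / (of_real x - z) = - ((of_real x / z) ^ K * (1 / (of_real x - z))) - of_real x ^ K / z ^ Suc K"
      using Suc by simp
    also have "\<dots> = - ((of_real x / z) ^ Suc K * (1 / (of_real x - z)))"
      using z0 xz[of x] by (simp add: power_divide field_simps)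
    finally show ?case .
  qed simp
  have b: "cmod ((\<Sum>k<K. - of_real (\<integral>x. x ^ k \<partial>\<mu>) / z ^ Suc k) - stieltjes \<mu> z) \<le> (r / cmod z) ^ K * (1 / Im z)" for K
  proof -
    have "(\<Sum>k<K. - of_real (\<integral>x. x ^ k \<partial>\<mu>) / z ^ Suc k) - stieltjes \<mu> z = (\<Sum>k<K. \<integral>x. - (of_real x ^ k) / z ^ Suc k \<partial>\<mu>) - stieltjes \<mu> z"
      by (intro arg_cong2[of _ _ _ _ minus] sum.cong refl) (simp flip: integral_complex_of_real)
    also have "\<dots> = (\<integral>x. (\<Sum>k<K. - (of_real x ^ k) / z ^ Suc k) - 1 / (of_real x - z) \<partial>\<mu>)"
    proof -
      have i: "integrable \<mu> (\<lambda>x. - (of_real x ^ k) / z ^ Suc k)" for k using ipc[of k] by (intro integrable_divide) simp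
      show ?thesis unfolding stieltjes_def using i si by (subst Bochner_Integration.integral_diff) auto
    qed
    finally have eq0: "(\<Sum>k<K. - of_real (\<integral>x. x ^ k \<partial>\<mu>) / z ^ Suc k) - stieltjes \<mu> z
      = (\<integral>x. (\<Sum>k<K. - (of_real x ^ k) / z ^ Suc k) - 1 / (of_real x - z) \<partial>\<mu>)" .
    have "cmod ((\<Sum>k<K. - of_real (\<integral>x. x ^ k \<partial>\<mu>) / z ^ Suc k) - stieltjes \<mu> z) \<le> (\<integral>x. cmod ((\<Sum>k<K. - (of_real x ^ k) / z ^ Suc k) - 1 / (of_real x - z)) \<partial>\<mu>)"
      unfolding eq0 by (rule integral_norm_bound)
    also have "\<dots> \<le> (r / cmod z) ^ K * (1 / Im z)"
    proof (rule prob_space.integral_le_const[OF \<mu>(1)])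
      show "integrable \<mu> (\<lambda>x. cmod ((\<Sum>k<K. - (of_real x ^ k) / z ^ Suc k) - 1 / (of_real x - z)))"
        using ipc si by (intro integrable_norm Bochner_Integration.integrable_diff Bochner_Integration.integrable_sum integrable_divide integrable_minus) auto
      show "AE x in \<mu>. cmod ((\<Sum>k<K. - (of_real x ^ k) / z ^ Suc k) - 1 / (of_real x - z)) \<le> (r / cmod z) ^ K * (1 / Im z)"
        using \<mu>(3)
      proof eventually_elim
        case (elim x)
        have "cmod (1 / (of_real x - z)) \<le> 1 / Im z" using stieltjes_kernel[of z x] z by simp
        thus ?case unfolding pt norm_minus_cancel norm_mult norm_power norm_divide[of "of_real x" z] norm_of_real
          by (intro mult_mono power_mono divide_right_mono) (use elim r z in auto)
      qed
    qed
    finally show ?thesis .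
  qed
  have "(\<lambda>K. (r / cmod z) ^ K) \<longlonglongrightarrow> 0" using z r z0 by (intro LIMSEQ_power_zero) (simp add: pos_divide_less_eq)
  hence "(\<lambda>K. (r / cmod z) ^ K * (1 / Im z)) \<longlonglongrightarrow> 0" by (rule tendsto_mult_left_zero)
  hence "(\<lambda>K. (\<Sum>k<K. - of_real (\<integral>x. x ^ k \<partial>\<mu>) / z ^ Suc k) - stieltjes \<mu> z) \<longlonglongrightarrow> 0"
    by (rule Lim_null_comparison[rotated]) (use b in auto)
  thus ?thesis unfolding sums_def by (simp add: LIM_zero_iff)
qed

context fock
begin

text \<open>For large \<open>|z|\<close> the recursion \<open>fM_Suc\<close> becomes an identity of
  power series in \<open>1 / z\<close>, its convolution a Cauchy product. It says
  \<open>h i * (lam i - z - g) = 1\<close>, and averaging over \<open>i\<close> gives the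
  equation.\<close>

lemma pastur_far:
  assumes \<rho>: "prob_space \<rho>" "sets \<rho> = sets borel" "AE x in \<rho>. \<bar>x\<bar> \<le> Rad" "\<And>k. of_real (\<integral>x. x ^ k \<partial>\<rho>) = fR k"
    and z: "Rad < cmod z" "Im z > 0"
  shows "stieltjes \<rho> z = (\<Sum>i<n. 1 / (of_real (lam i) - z - stieltjes \<rho> z)) / of_nat n"
proof -
  let ?g = "stieltjes \<rho> z"
  have z0: "z \<noteq> 0" using z by auto
  have gs: "(\<lambda>k. - fR k / z ^ Suc k) sums ?g" using stieltjes_sums[OF \<rho>(1-3) Rad_pos z] by (simp add: \<rho>(4))
  define h where "h i = (\<Sum>k. - fM i k / z ^ Suc k)" for i
  have sumb: "summable (\<lambda>k. cmod (- c k / z ^ Suc k))" if c: "\<And>k. cmod (c k) \<le> B * Rad ^ k" for c :: "nat \<Rightarrow> complex" and B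
  proof (rule summable_comparison_test')
    show "summable (\<lambda>k. B / cmod z * (Rad / cmod z) ^ k)"
      by (intro summable_mult summable_geometric) (use z Rad_pos z0 in \<open>simp add: pos_divide_less_eq\<close>)
    show "norm (cmod (- c k / z ^ Suc k)) \<le> B / cmod z * (Rad / cmod z) ^ k" if "k \<ge> 0" for k
    proof -
      have "cmod (- c k / z ^ Suc k) = cmod (c k) / cmod z ^ Suc k" by (simp add: norm_divide norm_mult norm_power)
      also have "\<dots> \<le> B * Rad ^ k / cmod z ^ Suc k" by (intro divide_right_mono c) auto
      finally show ?thesis by (simp add: power_divide)
    qed
  qed
  have hb: "summable (\<lambda>k. cmod (- fM i k / z ^ Suc k))" if "i < n" for i using sumb[OF fM_bound[OF that]] .
  have hs: "(\<lambda>k. - fM i k / z ^ Suc k) sums h i" if "i < n" for i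
    unfolding h_def using summable_norm_cancel[OF hb[OF that]] by (rule summable_sums)
  have gb: "summable (\<lambda>k. cmod (- fR k / z ^ Suc k))"
  proof (rule sumb)
    fix k
    have "cmod (fR k) \<le> (\<Sum>i<n. sqrt n * Rad ^ k) / real n"
      unfolding fR_fM norm_divide norm_of_nat by (intro divide_right_mono sum_norm_le fM_bound) auto
    thus "cmod (fR k) \<le> sqrt n * Rad ^ k" using n by simp
  qed
  have eq: "h i * (of_real (lam i) - z - ?g) = 1" if i: "i < n" for i
  proof -
    have cp: "(\<lambda>k. \<Sum>b\<le>k. (- fR b / z ^ Suc b) * (- fM i (k - b) / z ^ Suc (k - b))) sums (?g * h i)"
      using Cauchy_product_sums[OF gb hb[OF i]] sums_unique[OF gs] by (simp add: h_def)
    have cp2: "(\<Sum>b\<le>k. (- fR b / z ^ Suc b) * (- fM i (k - b) / z ^ Suc (k - b))) = (\<Sum>b<Suc k. fR (k - b) * fM i b) / z ^ Suc (Suc k)" for k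
    proof -
      have "(\<Sum>b\<le>k. (- fR b / z ^ Suc b) * (- fM i (k - b) / z ^ Suc (k - b))) = (\<Sum>b\<le>k. fR b * fM i (k - b) / z ^ Suc (Suc k))"
      proof (intro sum.cong refl)
        fix b assume "b \<in> {..k}"
        hence "z ^ Suc b * z ^ Suc (k - b) = z ^ Suc (Suc k)" by (simp flip: power_add power_Suc)
        thus "(- fR b / z ^ Suc b) * (- fM i (k - b) / z ^ Suc (k - b)) = fR b * fM i (k - b) / z ^ Suc (Suc k)"
          by (simp only: times_divide_times_eq minus_mult_minus minus_divide_left[symmetric] minus_mult_left[symmetric] minus_mult_right[symmetric] minus_minus)
      qed
      also have "\<dots> = (\<Sum>b\<le>k. fR (k - b) * fM i b / z ^ Suc (Suc k))"
        by (rule sum.reindex_bij_witness[of _ "\<lambda>b. k - b" "\<lambda>b. k - b"]) auto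
      finally show ?thesis by (simp add: lessThan_Suc_atMost sum_divide_distrib)
    qed
    have fs: "fM i (Suc (Suc k)) / z ^ Suc (Suc k) = of_real (lam i) * (fM i (Suc k) / z ^ Suc (Suc k))
       + (\<Sum>b\<le>k. (- fR b / z ^ Suc b) * (- fM i (k - b) / z ^ Suc (k - b)))" for k
      unfolding cp2 fM_Suc[of i "Suc k"] by (simp add: add_divide_distrib)
    \<comment> \<open>The convolution in \<open>fM_Suc\<close> is present from the second moment on,
      so two terms are split off. The shifted series is then summed in two ways, once directly and
      once through the recursion.\<close>
    have s1: "(\<lambda>k. - fM i (Suc k) / z ^ Suc (Suc k)) sums (h i - (- fM i 0 / z ^ Suc 0))"
      using hs[OF i] by (subst sums_Suc_iff) simp
    have s2: "(\<lambda>k. - fM i (Suc (Suc k)) / z ^ Suc (Suc (Suc k))) sums (h i - (- fM i 0 / z ^ Suc 0) - (- fM i 1 / z ^ Suc 1))"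
      using s1 by (subst sums_Suc_iff) simp
    have m1: "fM i 1 = of_real (lam i)" using fM_Suc[of i 0] by (simp add: fM_0)
    have A: "(\<lambda>k. fM i (Suc (Suc k)) / z ^ Suc (Suc k)) sums ((- z) * (h i - (- fM i 0 / z ^ Suc 0) - (- fM i 1 / z ^ Suc 1)))"
    proof -
      have "(- z) * (- fM i (Suc (Suc k)) / z ^ Suc (Suc (Suc k))) = fM i (Suc (Suc k)) / z ^ Suc (Suc k)" for k
        using z0 by simp
      with sums_mult[OF s2, of "- z"] show ?thesis by (simp only:)
    qed
    have B: "(\<lambda>k. fM i (Suc (Suc k)) / z ^ Suc (Suc k)) sums ((- of_real (lam i)) * (h i - (- fM i 0 / z ^ Suc 0)) + ?g * h i)"
    proof -
      have "(- of_real (lam i)) * (- fM i (Suc k) / z ^ Suc (Suc k)) + (\<Sum>b\<le>k. (- fR b / z ^ Suc b) * (- fM i (k - b) / z ^ Suc (k - b)))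
        = fM i (Suc (Suc k)) / z ^ Suc (Suc k)" for k
        unfolding fs[of k] by simp
      with sums_add[OF sums_mult[OF s1, of "- of_real (lam i)"] cp] show ?thesis by (simp only:)
    qed
    have E: "(- z) * (h i - (- 1 / z ^ Suc 0) - (- of_real (lam i) / z ^ Suc 1)) = (- of_real (lam i)) * (h i - (- 1 / z ^ Suc 0)) + ?g * h i"
      using sums_unique2[OF A B] unfolding fM_0 m1 .
    have gen: "h' * (l - z - g) = 1" if "(- z) * (h' - (- 1 / z ^ Suc 0) - (- l / z ^ Suc 1)) = (- l) * (h' - (- 1 / z ^ Suc 0)) + g * h'" for h' l g
    proof -
      have "(- z) * (h' - (- 1 / z ^ Suc 0) - (- l / z ^ Suc 1)) = - z * h' - 1 - l / z" using z0 by (simp add: field_simps)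
      moreover have "(- l) * (h' - (- 1 / z ^ Suc 0)) + g * h' = - l * h' - l / z + g * h'" by (simp add: algebra_simps)
      ultimately have "- z * h' - 1 - l / z = - l * h' - l / z + g * h'" using that by (simp only:)
      hence "(- z * h' - 1 - l / z) - (- l * h' - l / z + g * h') + 1 = 1" by simp
      thus ?thesis by (simp add: algebra_simps)
    qed
    show ?thesis by (rule gen[OF E])
  qed
  have "?g = (\<Sum>i<n. h i) / of_nat n"
  proof -
    have "(\<lambda>k. (\<Sum>i<n. - fM i k / z ^ Suc k) / of_nat n) sums ((\<Sum>i<n. h i) / of_nat n)"
      by (intro sums_divide sums_sum hs) auto
    moreover have "(\<Sum>i<n. - fM i k / z ^ Suc k) / of_nat n = - fR k / z ^ Suc k" for k
      by (simp add: fR_fM sum_negf sum_divide_distrib[symmetric])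
    ultimately show ?thesis using gs sums_unique2 by (simp only:)
  qed
  also have "(\<Sum>i<n. h i) = (\<Sum>i<n. 1 / (of_real (lam i) - z - ?g))"
  proof (intro sum.cong refl)
    have gen: "h' = 1 / d" if "h' * d = 1" for h' d :: complex
      using that by (cases "d = 0") (auto simp: eq_divide_eq)
    fix i assume "i \<in> {..<n}"
    thus "h i = 1 / (of_real (lam i) - z - ?g)" by (intro gen eq) auto
  qed
  finally show ?thesis .
qed

text \<open>Both sides are holomorphic in the upper half-plane, as the denominators have negative
  imaginary part, and they agree where \<open>Im z > Rad\<close>; analytic continuation does the
  rest.\<close>

theorem semicircle_free_conv_pastur:
  assumes \<nu>: "\<And>k. of_real (\<integral>s. s ^ k \<partial>\<nu>) = fm k"
  shows "prob_space (semicircle \<boxplus> \<nu>)" "sets (semicircle \<boxplus> \<nu>) = sets borel"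
    "Im z > 0 \<Longrightarrow> stieltjes (semicircle \<boxplus> \<nu>) z = (\<Sum>i<n. 1 / (of_real (lam i) - z - stieltjes (semicircle \<boxplus> \<nu>) z)) / of_nat n"
proof -
  obtain \<rho> where \<rho>: "prob_space \<rho>" "sets \<rho> = sets borel" "AE x in \<rho>. \<bar>x\<bar> \<le> Rad" "\<And>k. of_real (\<integral>x. x ^ k \<partial>\<rho>) = fR k"
    using fock_measure by blast
  have eq: "semicircle \<boxplus> \<nu> = \<rho>" by (rule free_conv_eq[OF \<rho> \<nu>])
  show "prob_space (semicircle \<boxplus> \<nu>)" "sets (semicircle \<boxplus> \<nu>) = sets borel" by (simp_all add: eq \<rho>)
  assume z: "Im z > 0"
  let ?f = "\<lambda>z. (\<Sum>i<n. 1 / (of_real (lam i) - z - stieltjes \<rho> z)) / of_nat n"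
  let ?U = "{z. Im z > 0}" and ?V = "{z. Im z > Rad}"
  have ne: "of_real (lam i) - z - stieltjes \<rho> z \<noteq> 0" if "Im z > 0" for z i
  proof -
    have "Im (of_real (lam i) - z - stieltjes \<rho> z) < 0" using stieltjes_im[OF \<rho>(1,2) that] that by simp
    thus ?thesis by (metis less_irrefl zero_complex.simps(2))
  qed
  have "stieltjes \<rho> z = ?f z"
  proof (rule analytic_continuation_open[of ?V ?U "stieltjes \<rho>" ?f])
    show "open ?V" "open ?U" by (rule open_halfspace_Im_gt)+
    have "Im (Complex 0 (Rad + 1)) > Rad" by simp
    thus "?V \<noteq> {}" by blast
    show "connected ?U" by (intro convex_connected convex_halfspace_Im_gt)
    show "?V \<subseteq> ?U" using Rad_pos by auto
    show "stieltjes \<rho> holomorphic_on ?U" by (rule stieltjes_holomorphic[OF \<rho>(1,2)])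
    show "?f holomorphic_on ?U"
      by (intro holomorphic_intros stieltjes_holomorphic[OF \<rho>(1,2)]) (use ne n in auto)
    show "stieltjes \<rho> w = ?f w" if "w \<in> ?V" for w
      using pastur_far[OF \<rho>, of w] that Rad_pos abs_Im_le_cmod[of w] by auto
  qed (use z in auto)
  thus "stieltjes (semicircle \<boxplus> \<nu>) z = (\<Sum>i<n. 1 / (of_real (lam i) - z - stieltjes (semicircle \<boxplus> \<nu>) z)) / of_nat n"
    by (simp add: eq)
qed

end


section \<open>Spectral measures and resolvents\<close>

lemma integral_pmf_of_mset:
  fixes f :: "'a \<Rightarrow> 'b::{banach, second_countable_topology}"
  assumes "xs \<noteq> []"
  shows "(\<integral>x. f x \<partial>measure_pmf (pmf_of_multiset (mset xs))) = (\<Sum>i<length xs. f (xs ! i)) /\<^sub>R real (length xs)"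
proof -
  have "mset xs = mset (map ((!) xs) [0..<length xs])" by (simp add: map_nth)
  also have "\<dots> = image_mset ((!) xs) (mset_set {..<length xs})" by (simp only: mset_map mset_upt atLeast0LessThan)
  finally have "pmf_of_multiset (mset xs) = map_pmf ((!) xs) (pmf_of_set {..<length xs})"
    using assms by (subst map_pmf_of_set) auto
  hence "(\<integral>x. f x \<partial>measure_pmf (pmf_of_multiset (mset xs))) = (\<integral>i. f (xs ! i) \<partial>measure_pmf (pmf_of_set {..<length xs}))"
    by simp
  also have "\<dots> = (\<Sum>i<length xs. pmf (pmf_of_set {..<length xs}) i *\<^sub>R f (xs ! i))"
    by (intro integral_measure_pmf) (use assms in \<open>auto simp: set_pmf_of_set lessThan_empty_iff\<close>)
  also have "\<dots> = (\<Sum>i<length xs. f (xs ! i)) /\<^sub>R real (length xs)"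
    unfolding scaleR_sum_right using assms by (intro sum.cong refl) (simp add: divide_inverse pmf_of_set lessThan_empty_iff)
  finally show ?thesis .
qed

lemma mat_mult_mm:
  assumes "A \<in> carrier_mat n n" "B \<in> carrier_mat n n" "i < n" "j < n"
  shows "(A * B) $$ (i, j) = mm n (\<lambda>i j. A $$ (i, j)) (\<lambda>i j. B $$ (i, j)) i j"
  using assms by (simp add: mm_def times_mat_def scalar_prod_def atLeast0LessThan)

lemma mm_trace: "(\<Sum>i<n. mm n A B i i) = (\<Sum>i<n. mm n B A i i)"
  unfolding mm_def by (subst sum.swap) (simp add: mult.commute)

lemma mm_shift_left: "i < n \<Longrightarrow> j < n \<Longrightarrow> mm n (shift H z) P i j = mm n H P i j - z * P i j"
  using mv_shift[of i n H z "\<lambda>k. P k j"] by (simp add: mm_def mv_def)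

lemma mm_shift_right: "i < n \<Longrightarrow> j < n \<Longrightarrow> mm n P (shift B z) i j = mm n P B i j - z * P i j"
proof -
  assume ij: "i < n" "j < n"
  have "mm n P (shift B z) i j = (\<Sum>k<n. P i k * B k j - (if k = j then z * P i k else 0))"
    unfolding mm_def shift_def by (intro sum.cong refl) (auto simp: algebra_simps)
  thus ?thesis using ij by (simp add: sum_subtractf mm_def)
qed

text \<open>Schur's triangular form suffices: its diagonal carries the roots of the characteristic
  polynomial, the trace of the resolvent is invariant under similarity, and the inverse of a
  triangular matrix has the reciprocals on its diagonal. Both identities hold for one and the same
  \<open>lam\<close>.\<close>

lemma spectral_representation:
  assumes H: "herm n H" and n: "n > 0"
  obtains lam :: "nat \<Rightarrow> real" where
    "\<And>f :: real \<Rightarrow> complex. f \<in> borel_measurable borel \<Longrightarrow>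
       (\<integral>x. f x \<partial>spectral_measure (Matrix.mat n n (\<lambda>(i, j). H i j))) = (\<Sum>i<n. f (lam i)) / of_nat n"
    "\<And>z. Im z \<noteq> 0 \<Longrightarrow> gres n H z = (\<Sum>i<n. 1 / (of_real (lam i) - z)) / of_nat n"
proof -
  let ?A = "Matrix.mat n n (\<lambda>(i, j). H i j)"
  have A: "?A \<in> carrier_mat n n" by simp
  obtain es where es: "char_poly ?A = (\<Prod>a\<leftarrow>es. [:- a, 1:])" using char_poly_factorized[OF A] by blast
  obtain B where B: "B \<in> carrier_mat n n" "upper_triangular B" "similar_mat ?A B"
    using schur_decomposition_exists[OF A es] by blast
  from similar_matD[OF B(3)] obtain n' P Q where PQ': "{?A, B, P, Q} \<subseteq> carrier_mat n' n'" "P * Q = 1\<^sub>m n'" "Q * P = 1\<^sub>m n'" "?A = P * B * Q"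
    by blast
  have "n' = n" using PQ'(1) by auto
  hence PQ: "P \<in> carrier_mat n n" "Q \<in> carrier_mat n n" "P * Q = 1\<^sub>m n" "Q * P = 1\<^sub>m n" "?A = P * B * Q" using PQ' by auto
  define b where "b i = B $$ (i, i)" for i
  \<comment> \<open>An eigenvector satisfies \<open>herm_vn_bound\<close> with \<open>v = 0\<close>
    and the eigenvalue in place of \<open>z\<close>.\<close>
  have real: "Im (b i) = 0" if i: "i < n" for i
  proof -
    have "poly (char_poly ?A) (b i) = 0"
    proof -
      have "char_poly ?A = (\<Prod>a\<leftarrow>diag_mat B. [:- a, 1:])"
        unfolding char_poly_similar[OF B(3)] by (rule char_poly_upper_triangular[OF B(1,2)])
      moreover have "b i \<in> set (diag_mat B)" using i B(1) by (auto simp: diag_mat_def b_def)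
      ultimately show ?thesis by (auto simp: poly_prod_list prod_list_zero_iff image_iff)
    qed
    hence "eigenvalue ?A (b i)" by (simp add: eigenvalue_root_char_poly[OF A])
    then obtain v where v: "v \<in> carrier_vec n" "v \<noteq> 0\<^sub>v n" "?A *\<^sub>v v = b i \<cdot>\<^sub>v v"
      unfolding eigenvalue_def eigenvector_def by auto
    have "mv n H (vec_index v) k - b i * vec_index v k = 0" if k: "k < n" for k
    proof -
      have "mv n H (vec_index v) k = vec_index (?A *\<^sub>v v) k"
        using k v(1) by (simp add: scalar_prod_def mv_def atLeast0LessThan)
      also have "\<dots> = b i * vec_index v k" unfolding v(3) using k v(1) by simp
      finally show ?thesis by simp
    qed
    hence "\<bar>Im (b i)\<bar> * vn n (vec_index v) \<le> vn n (\<lambda>i. 0)" by (intro herm_vn_bound[OF H]) auto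
    hence le: "\<bar>Im (b i)\<bar> * vn n (vec_index v) \<le> 0" by (simp add: L2_set_def)
    have "vn n (vec_index v) \<noteq> 0"
    proof
      assume "vn n (vec_index v) = 0"
      hence "\<forall>i<n. vec_index v i = 0" by (auto simp: L2_set_eq_0_iff)
      hence "v = 0\<^sub>v n" using v(1) by (intro eq_vecI) auto
      with v(2) show False by simp
    qed
    hence "vn n (vec_index v) > 0" using L2_set_nonneg[of "\<lambda>k. cmod (vec_index v k)" "{..<n}"] by linarith
    thus ?thesis using le by (simp add: mult_le_0_iff)
  qed
  define lam where "lam i = Re (b i)" for i
  have blam: "b i = of_real (lam i)" if "i < n" for i using real[OF that] by (simp add: lam_def complex_eq_iff)
  have pr: "proots (char_poly ?A) = mset (map b [0..<n])"
  proof -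
    have "char_poly ?A = (\<Prod>a\<leftarrow>diag_mat B. [:- a, 1:])"
      unfolding char_poly_similar[OF B(3)] by (rule char_poly_upper_triangular[OF B(1,2)])
    moreover have "diag_mat B = map b [0..<n]" using B(1) by (simp add: diag_mat_def b_def)
    moreover have "proots (\<Prod>a\<leftarrow>xs. [:- a, 1:]) = mset xs" for xs :: "complex list"
    proof (induction xs)
      case (Cons a xs)
      have "(\<Prod>a\<leftarrow>xs. [:- a, 1:]) \<noteq> 0" by (auto simp: prod_list_zero_iff)
      hence "proots ([:- a, 1:] * (\<Prod>a\<leftarrow>xs. [:- a, 1:])) = proots [:- a, 1:] + proots (\<Prod>a\<leftarrow>xs. [:- a, 1:])"
        by (intro proots_mult) auto
      thus ?case using Cons by simp
    qed simp
    ultimately show ?thesis by (simp only:)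
  qed
  show ?thesis
  proof (rule that[of lam])
    fix f :: "real \<Rightarrow> complex" assume f: "f \<in> borel_measurable borel"
    have "(\<integral>x. f x \<partial>spectral_measure ?A) = (\<integral>y. f (Re y) \<partial>measure_pmf (pmf_of_multiset (mset (map b [0..<n]))))"
      unfolding spectral_measure_def pr by (rule integral_distr) (use f in auto)
    also have "\<dots> = (\<Sum>i<n. f (Re (map b [0..<n] ! i))) /\<^sub>R real n"
      using integral_pmf_of_mset[of "map b [0..<n]" "\<lambda>y. f (Re y)"] n by simp
    also have "\<dots> = (\<Sum>i<n. f (lam i)) / of_nat n"
      by (simp add: lam_def scaleR_conv_of_real divide_inverse mult.commute)
    finally show "(\<integral>x. f x \<partial>spectral_measure ?A) = (\<Sum>i<n. f (lam i)) / of_nat n" .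
  next
    fix z :: complex assume z: "Im z \<noteq> 0"
    let ?P = "\<lambda>i j. P $$ (i, j)" and ?Q = "\<lambda>i j. Q $$ (i, j)" and ?B = "\<lambda>i j. B $$ (i, j)" and ?G = "res n H z"
    define N where "N = mm n ?Q (mm n ?G ?P)"
    have QP: "mm n ?Q ?P i j = (if i = j then 1 else 0)" "mm n ?P ?Q i j = (if i = j then 1 else 0)" if "i < n" "j < n" for i j
      using that mat_mult_mm[OF PQ(2,1) that] mat_mult_mm[OF PQ(1,2) that] PQ(3,4) by auto
    have HP: "mm n H ?P i j = mm n ?P ?B i j" if ij: "i < n" "j < n" for i j
    proof -
      have "?A * P = P * B * (Q * P)" unfolding PQ(5) using PQ(1,2) B(1) by (simp add: assoc_mult_mat[of _ n n _ n _ n])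
      hence "?A * P = P * B" using PQ(1,4) B(1) by simp
      hence "(?A * P) $$ (i, j) = (P * B) $$ (i, j)" by simp
      hence "mm n (\<lambda>i j. ?A $$ (i, j)) ?P i j = mm n ?P ?B i j" using mat_mult_mm[OF A PQ(1) ij] mat_mult_mm[OF PQ(1) B(1) ij] by simp
      moreover have "mm n (\<lambda>i j. ?A $$ (i, j)) ?P i j = mm n H ?P i j" unfolding mm_def using ij by (intro sum.cong) auto
      ultimately show ?thesis by simp
    qed
    have NB: "mm n N (shift ?B z) i j = (if i = j then 1 else 0)" if ij: "i < n" "j < n" for i j
    proof -
      have "mm n N (shift ?B z) i j = mm n ?Q (mm n ?G (mm n ?P (shift ?B z))) i j"
        unfolding N_def mm_assoc ..
      also have "\<dots> = mm n ?Q (mm n (mm n ?G (shift H z)) ?P) i j"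
      proof (rule mm_cong[OF refl])
        fix k assume k: "k < n"
        have "mm n ?G (mm n ?P (shift ?B z)) k j = mm n ?G (mm n (shift H z) ?P) k j"
          by (rule mm_cong[OF refl]) (use ij HP in \<open>simp add: mm_shift_left mm_shift_right\<close>)
        thus "mm n ?G (mm n ?P (shift ?B z)) k j = mm n (mm n ?G (shift H z)) ?P k j" by (simp add: mm_assoc)
      qed
      also have "\<dots> = mm n ?Q ?P i j"
        by (rule mm_cong[OF refl], rule mm_id_left) (use H z in \<open>auto simp: res_left_inverse\<close>)
      finally show ?thesis using QP ij by simp
    qed
    have nz: "b j - z \<noteq> 0" if "j < n" for j using real[OF that] z by (auto simp: complex_eq_iff)
    \<comment> \<open>Column by column: the product of \<open>N\<close> with the triangular matrix
      is the identity, and on and below the diagonal the earlier columns contribute nothing.\<close>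
    have tri: "\<forall>i<n. i \<ge> j \<longrightarrow> N i j = (if i = j then 1 / (b j - z) else 0)" if "j < n" for j
      using that
    proof (induction j rule: less_induct)
      case (less j)
      show ?case
      proof (intro allI impI)
        fix i assume i: "i < n" "j \<le> i"
        have "mm n N (shift ?B z) i j = (\<Sum>k<n. if k = j then N i j * (b j - z) else 0)"
          unfolding mm_def
        proof (intro sum.cong refl)
          fix k assume "k \<in> {..<n}"
          hence k: "k < n" by simp
          consider "k < j" | "k = j" | "k > j" by linarith
          thus "N i k * shift ?B z k j = (if k = j then N i j * (b j - z) else 0)"
          proof cases
            case 1
            thus ?thesis using less.IH[of k] k i by auto
          next
            case 3
            hence "B $$ (k, j) = 0" using B(1,2) k by (auto simp: upper_triangular_def)
            thus ?thesis using 3 by (simp add: shift_def)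
          qed (simp add: shift_def b_def)
        qed
        hence "N i j * (b j - z) = (if i = j then 1 else 0)" using NB[of i j] i less.prems by simp
        thus "N i j = (if i = j then 1 / (b j - z) else 0)" using nz[OF less.prems] by (auto simp: eq_divide_eq split: if_splits)
      qed
    qed
    have "(\<Sum>i<n. N i i) = (\<Sum>i<n. mm n (mm n ?G ?P) ?Q i i)" unfolding N_def by (rule mm_trace)
    also have "\<dots> = (\<Sum>i<n. ?G i i)"
    proof (intro sum.cong refl)
      fix i assume i: "i \<in> {..<n}"
      have "mm n (mm n ?G ?P) ?Q i i = mm n ?G (mm n ?P ?Q) i i" by (rule mm_assoc)
      also have "\<dots> = ?G i i" by (rule mm_id_right) (use QP i in auto)
      finally show "mm n (mm n ?G ?P) ?Q i i = ?G i i" .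
    qed
    finally have "(\<Sum>i<n. ?G i i) = (\<Sum>i<n. N i i)" by simp
    also have "\<dots> = (\<Sum>i<n. 1 / (of_real (lam i) - z))"
      by (intro sum.cong refl) (use tri blam in auto)
    finally show "gres n H z = (\<Sum>i<n. 1 / (of_real (lam i) - z)) / of_nat n" by (simp add: gres_def)
  qed
qed

lemma stieltjes_spectral_measure:
  assumes "herm n H" "n > 0" "Im z \<noteq> 0"
  shows "stieltjes (spectral_measure (Matrix.mat n n (\<lambda>(i, j). H i j))) z = gres n H z"
proof -
  obtain lam where lam: "\<And>f :: real \<Rightarrow> complex. f \<in> borel_measurable borel \<Longrightarrow>
       (\<integral>x. f x \<partial>spectral_measure (Matrix.mat n n (\<lambda>(i, j). H i j))) = (\<Sum>i<n. f (lam i)) / of_nat n"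
    "\<And>z. Im z \<noteq> 0 \<Longrightarrow> gres n H z = (\<Sum>i<n. 1 / (of_real (lam i) - z)) / of_nat n"
    using spectral_representation[OF assms(1,2)] by blast
  have m: "(\<lambda>x. 1 / (complex_of_real x - z)) \<in> borel_measurable borel" by measurable
  show ?thesis unfolding stieltjes_def lam(1)[OF m] lam(2)[OF assms(3)] ..
qed

text \<open>The spectral measure has the moments \<open>fm\<close> of the Fock model for its
  eigenvalues, and the sum in Pastur's equation is the resolvent trace at the shifted point.\<close>

lemma semicircle_free_conv_spectral:
  assumes "herm n H" "n > 0"
  defines "\<rho> \<equiv> semicircle \<boxplus> spectral_measure (Matrix.mat n n (\<lambda>(i, j). H i j))"
  shows "prob_space \<rho>" "sets \<rho> = sets borel"
    "Im z > 0 \<Longrightarrow> stieltjes \<rho> z = gres n H (z + stieltjes \<rho> z)"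
proof -
  let ?A = "Matrix.mat n n (\<lambda>(i, j). H i j)"
  obtain lam where lam: "\<And>f :: real \<Rightarrow> complex. f \<in> borel_measurable borel \<Longrightarrow>
       (\<integral>x. f x \<partial>spectral_measure ?A) = (\<Sum>i<n. f (lam i)) / of_nat n"
    "\<And>z. Im z \<noteq> 0 \<Longrightarrow> gres n H z = (\<Sum>i<n. 1 / (of_real (lam i) - z)) / of_nat n"
    using spectral_representation[OF assms(1,2)] by blast
  interpret fock n lam by unfold_locales (rule assms(2))
  have m: "of_real (\<integral>s. s ^ k \<partial>spectral_measure ?A) = fm k" for k
  proof -
    have "(\<lambda>x. complex_of_real (x ^ k)) \<in> borel_measurable borel" by measurable
    from lam(1)[OF this] show ?thesis by (simp add: fm_def del: of_real_power) simp
  qed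
  show "prob_space \<rho>" "sets \<rho> = sets borel" unfolding \<rho>_def by (rule semicircle_free_conv_pastur[OF m])+
  assume z: "Im z > 0"
  have "Im (z + stieltjes \<rho> z) > 0"
    using stieltjes_im[OF \<open>prob_space \<rho>\<close> \<open>sets \<rho> = sets borel\<close> z] z by simp
  hence "gres n H (z + stieltjes \<rho> z) = (\<Sum>i<n. 1 / (of_real (lam i) - (z + stieltjes \<rho> z))) / of_nat n" by (intro lam(2)) auto
  also have "\<dots> = stieltjes \<rho> z"
    using semicircle_free_conv_pastur(3)[OF m z] unfolding \<rho>_def[symmetric] by (simp only: diff_diff_eq)
  finally show "stieltjes \<rho> z = gres n H (z + stieltjes \<rho> z)" by simp
qed

section \<open>Deterministic comparison\<close>

text \<open>Up to the defect, \<open>g\<close> solves the same fixed point equation as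
  \<open>s\<close>, of a map with Lipschitz constant \<open>1/4\<close>; the factor
  \<open>4/3\<close> is \<open>1 / (1 - 1/4)\<close>.\<close>

lemma defect_controls_distance:
  assumes A: "herm n A" and C: "herm n C" and z: "Im z \<ge> 2" and s: "Im s \<ge> 0" "s = gres n C (z + s)"
  shows "cmod (gres n (hadd A C) z - s) \<le> 4 / 3 * cmod (perr n A C z)"
proof -
  let ?g = "gres n (hadd A C) z"
  have "?g - s = (gres n C (z + ?g) - gres n C (z + s)) - perr n A C z" using s(2) by (simp add: perr_def)
  hence "cmod (?g - s) \<le> cmod (gres n C (z + ?g) - gres n C (z + s)) + cmod (perr n A C z)"
    by (metis norm_triangle_ineq4)
  also have "cmod (gres n C (z + ?g) - gres n C (z + s)) \<le> cmod ((z + ?g) - (z + s)) / 4"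
    by (rule gres_lipschitz[OF C shifted_im[OF A C z]]) (use z s(1) in simp)
  finally show ?thesis by simp
qed

lemma perr_lipschitz:
  assumes A: "herm n A" and C: "herm n C" and z: "Im z \<ge> 2" "Im w \<ge> 2"
  shows "cmod (perr n A C z - perr n A C w) \<le> cmod (z - w)"
proof -
  let ?g = "\<lambda>z. gres n (hadd A C) z"
  have g: "cmod (?g z - ?g w) \<le> cmod (z - w) / 4" by (rule gres_lipschitz[OF herm_hadd[OF A C] z])
  have "cmod (gres n C (z + ?g z) - gres n C (w + ?g w)) \<le> cmod ((z + ?g z) - (w + ?g w)) / 4"
    by (rule gres_lipschitz[OF C shifted_im[OF A C z(1)] shifted_im[OF A C z(2)]])
  also have "\<dots> \<le> (cmod (z - w) + cmod (?g z - ?g w)) / 4"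
    using norm_triangle_ineq[of "z - w" "?g z - ?g w"] by (simp add: algebra_simps)
  finally have h: "cmod (gres n C (z + ?g z) - gres n C (w + ?g w)) \<le> (cmod (z - w) + cmod (?g z - ?g w)) / 4" .
  have "perr n A C z - perr n A C w = (gres n C (z + ?g z) - gres n C (w + ?g w)) - (?g z - ?g w)" by (simp add: perr_def)
  hence "cmod (perr n A C z - perr n A C w) \<le> cmod (gres n C (z + ?g z) - gres n C (w + ?g w)) + cmod (?g z - ?g w)"
    by (metis norm_triangle_ineq4)
  also have "\<dots> \<le> cmod (z - w)"
  proof -
    have "P + Y \<le> X" if "Y \<le> X / 4" "P \<le> (X + Y) / 4" "X \<ge> 0" for P X Y :: real using that by (simp add: field_simps)
    from this[OF g h] show ?thesis by simp
  qed
  finally show ?thesis .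
qed

text \<open>The trace of \<open>(H - z) G = 1\<close>. It makes the transforms small for large
  \<open>|z|\<close>, out of the reach of a finite net.\<close>

lemma gres_far:
  assumes H: "herm n H" and z: "Im z \<ge> 2" and n: "n > 0" and B: "\<And>i j. i < n \<Longrightarrow> j < n \<Longrightarrow> cmod (H i j) \<le> B" "B \<ge> 0"
  shows "cmod z * cmod (gres n H z) \<le> 1 + n * B"
proof -
  let ?G = "res n H z"
  have "(\<Sum>i<n. mm n H ?G i i - z * ?G i i) = (\<Sum>i<n. 1)"
  proof (intro sum.cong refl)
    fix i assume "i \<in> {..<n}"
    thus "mm n H ?G i i - z * ?G i i = 1"
      using res_right_inverse[OF H, of z i i] mm_shift_left[of i n i H z ?G] z by simp
  qed
  hence "z * (\<Sum>i<n. ?G i i) = (\<Sum>i<n. mm n H ?G i i) - of_nat n"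
    by (simp add: sum_subtractf sum_distrib_left algebra_simps)
  hence "cmod z * cmod (\<Sum>i<n. ?G i i) = cmod ((\<Sum>i<n. mm n H ?G i i) - of_nat n)" by (metis norm_mult)
  also have "\<dots> \<le> cmod (\<Sum>i<n. mm n H ?G i i) + real n"
    using norm_triangle_ineq4[of "\<Sum>i<n. mm n H ?G i i" "of_nat n"] by simp
  also have "cmod (\<Sum>i<n. mm n H ?G i i) \<le> (\<Sum>i<n. \<Sum>k<n. B * (1/2))"
    unfolding mm_def
    by (intro sum_norm_le, unfold norm_mult, intro mult_mono B opb_entry[OF opb_res[OF H]]) (use z in auto)
  also have "\<dots> \<le> real n * (real n * B)" using B(2) by (simp add: mult_left_mono)
  finally have "cmod z * cmod (\<Sum>i<n. ?G i i) \<le> real n * (1 + real n * B)" by (simp add: algebra_simps)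
  thus ?thesis using n by (simp add: gres_def norm_divide field_simps)
qed

text \<open>For a complex \<open>c\<close> the mean matrix is not of small rank, and for
  \<open>c\<close> of order \<open>n^(-1/2)\<close> its Hilbert-Schmidt norm is too large for
  \<open>gres_hs\<close>. But its two triangles are tested against a matrix of bounded operator
  norm, which \<open>upper_triangle_sum\<close> exploits.\<close>

lemma remove_mean:
  assumes H: "herm n H" and H': "herm n H'" and z: "Im z \<ge> 2" and n: "n > 0" and q: "q > 0"
    and d: "\<And>i j. i < n \<Longrightarrow> j < n \<Longrightarrow> H i j - H' i j = (if i < j then c else if j < i then cnj c else 0)"
  shows "cmod (gres n H z - gres n H' z) \<le> cmod c / 2 * (sqrt q + (1 / q + 1 / n) * sqrt (real q * real n))"
proof -
  let ?N = "mm n (res n H' z) (res n H z)" and ?b = "1/4 * (real n * sqrt q + (real n / q + 1) * sqrt (real q * real n))"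
  have op: "opb n (1/4) ?N"
    using opb_mm[OF opb_res[OF H', of 2 z] opb_res[OF H, of 2 z]] z by simp
  have "(\<Sum>i<n. res n H z i i) - (\<Sum>i<n. res n H' z i i) = (\<Sum>k<n. \<Sum>l<n. (shift H' z k l - shift H z k l) * ?N l k)"
    by (rule res_trace_diff) (use H H' z in auto)
  also have "\<dots> = (\<Sum>k<n. \<Sum>l<n. (- c) * (if k < l then ?N l k else 0) + (- cnj c) * (if l < k then ?N l k else 0))"
  proof (intro sum.cong refl)
    fix k l assume kl: "k \<in> {..<n}" "l \<in> {..<n}"
    have S: "shift H' z k l - shift H z k l = - (H k l - H' k l)" by (simp add: shift_def)
    thus "(shift H' z k l - shift H z k l) * ?N l k = (- c) * (if k < l then ?N l k else 0) + (- cnj c) * (if l < k then ?N l k else 0)"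
      unfolding S using kl by (subst d) auto
  qed
  also have "\<dots> = (- c) * (\<Sum>k<n. \<Sum>l<n. if k < l then ?N l k else 0) + (- cnj c) * (\<Sum>k<n. \<Sum>l<n. if l < k then ?N l k else 0)"
    by (simp only: sum.distrib sum_distrib_left)
  also have "(\<Sum>k<n. \<Sum>l<n. if l < k then ?N l k else 0) = (\<Sum>l<n. \<Sum>k<n. if l < k then ?N l k else 0)" by (rule sum.swap)
  finally have eq: "(\<Sum>i<n. res n H z i i) - (\<Sum>i<n. res n H' z i i)
    = (- c) * (\<Sum>k<n. \<Sum>l<n. if k < l then ?N l k else 0) + (- cnj c) * (\<Sum>l<n. \<Sum>k<n. if l < k then ?N l k else 0)" .
  have b1: "cmod (\<Sum>k<n. \<Sum>l<n. if k < l then ?N l k else 0) \<le> ?b"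
    using upper_triangle_sum[OF opb_transpose[OF op] _ q n] by simp
  have b2: "cmod (\<Sum>l<n. \<Sum>k<n. if l < k then ?N l k else 0) \<le> ?b"
    using upper_triangle_sum[OF op _ q n] by simp
  have "cmod ((\<Sum>i<n. res n H z i i) - (\<Sum>i<n. res n H' z i i)) \<le> cmod c * ?b + cmod c * ?b"
    unfolding eq using b1 b2
    by (intro order_trans[OF norm_triangle_ineq] add_mono; unfold norm_mult norm_minus_cancel complex_mod_cnj; intro mult_left_mono) auto
  also have "\<dots> = real n * (cmod c / 2 * (sqrt q + (1 / q + 1 / n) * sqrt (real q * real n)))"
    using n q by (simp add: field_simps)
  finally show ?thesis using n
    by (simp only: gres_def diff_divide_distrib[symmetric] norm_divide norm_of_nat pos_divide_le_eq of_nat_0_less_iff mult.commute)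
qed


text \<open>Two matrices are interposed. \<open>H1\<close> drops the at most
  \<open>W / t^\<alpha>\<close> entries of modulus at least \<open>t\<close>, a change of small
  rank. \<open>H2\<close> adds the mean back to \<open>A + C\<close>, so that off the diagonal it
  agrees with \<open>H1\<close> wherever the modulus is at most \<open>K\<close>; the rest is small
  in Hilbert-Schmidt norm. The mean is then removed by \<open>remove_mean\<close>.\<close>

lemma truncation_comparison:
  fixes u :: "nat \<Rightarrow> nat \<Rightarrow> complex"
  assumes n: "n > 0" and z: "Im z \<ge> 2" and herms: "herm n H" "herm n A" "herm n C" and q: "q > 0"
    and off: "\<And>i j. i < j \<Longrightarrow> j < n \<Longrightarrow> H i j = u i j / sqrt n"
      "\<And>i j. i < j \<Longrightarrow> j < n \<Longrightarrow> A i j = (if cmod (u i j) \<le> K then (u i j - m) / sqrt n else 0)"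
      "\<And>i j. i < j \<Longrightarrow> j < n \<Longrightarrow> C i j = (if L < cmod (u i j) \<and> cmod (u i j) < t then u i j / sqrt n else 0)"
    and diag: "\<And>i. i < n \<Longrightarrow> H i i = u i i / sqrt n" "\<And>i. i < n \<Longrightarrow> A i i = 0"
      "\<And>i. i < n \<Longrightarrow> C i i = (if L < cmod (u i i) \<and> cmod (u i i) < t then u i i / sqrt n else 0)"
    and K: "1 \<le> K" "K \<le> L" "L < t" and \<alpha>: "0 < \<alpha>" "\<alpha> < 2"
    and W: "(\<Sum>(i, j)\<in>edges n. if cmod (u i j) > K then cmod (u i j) powr \<alpha> else 0) \<le> W"
  shows "cmod (gres n H z - gres n (hadd A C) z) \<le> W / t powr \<alpha> / n
    + sqrt ((4 * (L powr (2 - \<alpha>) + (cmod m)\<^sup>2) * W + n * K\<^sup>2) / n\<^sup>2) / 4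
    + cmod m / (2 * sqrt n) * (sqrt q + (1 / q + 1 / n) * sqrt (real q * real n))"
proof -
  define y where "y i j = (if cmod (u i j) > K then cmod (u i j) powr \<alpha> else 0)" for i j
  have y0: "y i j \<ge> 0" for i j by (simp add: y_def)
  have W': "(\<Sum>(i, j)\<in>edges n. y i j) \<le> W" using W by (simp add: y_def)
  have sn: "sqrt (real n) > 0" "(sqrt (real n))\<^sup>2 = real n" using n by auto
  define H1 where "H1 i j = (if (if i \<le> j then cmod (u i j) < t else cmod (u j i) < t) then H i j else 0)" for i j
  define H2 where "H2 i j = hadd A C i j + (if i < j then m / sqrt n else if j < i then cnj (m / sqrt n) else 0)" for i j
  define P where "P = {(i, j). i \<le> j \<and> j < n \<and> cmod (u i j) \<ge> t}"
  have hAC: "herm n (hadd A C)" by (rule herm_hadd[OF herms(2,3)])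
  have h1: "herm n H1"
  proof (rule hermI)
    fix i j assume "i < n" "j < n"
    thus "H1 j i = cnj (H1 i j)" using hermD[OF herms(1), of i j] by (cases i j rule: linorder_cases) (auto simp: H1_def)
  qed
  have h2: "herm n H2"
    by (rule hermI) (auto simp: H2_def hermD[OF hAC])
  have PE: "P \<subseteq> edges n" by (auto simp: P_def edges_def)
  hence fP: "finite P" using finite_subset finite_edges by blast
  have cP: "real (card P) * t powr \<alpha> \<le> W"
  proof -
    have "real (card P) * t powr \<alpha> = (\<Sum>(i, j)\<in>P. t powr \<alpha>)" by (simp add: case_prod_beta')
    also have "\<dots> \<le> (\<Sum>(i, j)\<in>P. y i j)"
      using K \<alpha> by (intro sum_mono) (auto simp: P_def y_def intro!: powr_mono2)
    also have "\<dots> \<le> (\<Sum>(i, j)\<in>edges n. y i j)" by (intro sum_mono2 PE) (auto simp: y0)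
    finally show ?thesis using W' by linarith
  qed
  have 1: "cmod (gres n H z - gres n H1 z) \<le> W / t powr \<alpha> / n"
  proof -
    have "cmod ((\<Sum>k<n. res n H z k k) - (\<Sum>k<n. res n H1 z k k)) \<le> real (card P) * (2 / Im z)"
      by (rule entries_change_trace[OF fP _ herms(1) h1]) (use PE z in \<open>auto simp: edges_def H1_def P_def\<close>)
    also have "\<dots> \<le> real (card P) * 1" using z by (intro mult_left_mono) auto
    also have "\<dots> \<le> W / t powr \<alpha>" using cP K by (simp add: pos_le_divide_eq)
    finally have "cmod ((\<Sum>k<n. res n H z k k) - (\<Sum>k<n. res n H1 z k k)) / n \<le> W / t powr \<alpha> / n"
      by (rule divide_right_mono) simp
    thus ?thesis by (simp add: gres_def diff_divide_distrib[symmetric] norm_divide)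
  qed
  \<comment> \<open>In the middle range a square costs \<open>L powr (2 - \<alpha>)\<close> per unit
    of the \<alpha>-th powers, whose sum is at most \<open>W\<close>.\<close>
  have sq: "(cmod (u i j))\<^sup>2 \<le> L powr (2 - \<alpha>) * y i j" if "K < cmod (u i j)" "cmod (u i j) \<le> L" for i j
  proof -
    have p: "cmod (u i j) > 0" using that K by linarith
    have "(cmod (u i j))\<^sup>2 = cmod (u i j) powr (2 - \<alpha>) * cmod (u i j) powr \<alpha>"
      using p by (simp flip: powr_add add: powr_numeral)
    also have "\<dots> \<le> L powr (2 - \<alpha>) * cmod (u i j) powr \<alpha>"
      using that \<alpha> by (intro mult_right_mono powr_mono2) auto
    finally show ?thesis using that by (simp add: y_def)
  qed
  have y1: "1 \<le> y i j" if "K < cmod (u i j)" for i j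
    using that K \<alpha> by (simp add: y_def ge_one_powr_ge_zero)
  define b where "b = L powr (2 - \<alpha>) + (cmod m)\<^sup>2"
  have b0: "b \<ge> 0" "L powr (2 - \<alpha>) \<ge> 0" "(cmod m)\<^sup>2 \<ge> 0" by (auto simp: b_def)
  have bym: "L powr (2 - \<alpha>) * y i j \<le> b * y i j" "(cmod m)\<^sup>2 * y i j \<le> b * y i j" for i j
    unfolding b_def by (intro mult_right_mono y0; simp)+
  have cdiv: "(cmod (x / complex_of_real (sqrt (real n))))\<^sup>2 = (cmod x)\<^sup>2 / n" for x
    by (simp add: norm_divide power_divide)
  \<comment> \<open>Where the modulus exceeds \<open>K\<close>, \<open>A\<close> is 0 but the mean
    has been added to \<open>H2\<close>. As \<open>y i j \<ge> 1\<close> there, the number of such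
    entries is controlled by \<open>W\<close> as well.\<close>
  have Doff: "2 * (cmod (H1 i j - H2 i j))\<^sup>2 \<le> 4 / n * b * y i j" if ij: "i < j" "j < n" for i j
  proof -
    let ?x = "u i j"
    consider "cmod ?x \<le> K" | "K < cmod ?x" "cmod ?x \<le> L" | "L < cmod ?x" by linarith
    thus ?thesis
    proof cases
      case 1
      hence "H1 i j - H2 i j = 0" using ij K off[OF ij] by (auto simp: H1_def H2_def hadd_def diff_divide_distrib)
      thus ?thesis using b0 y0 by simp
    next
      case 2
      hence "H1 i j - H2 i j = (?x - m) / complex_of_real (sqrt n)"
        using ij K off[OF ij] by (auto simp: H1_def H2_def hadd_def diff_divide_distrib)
      hence "(cmod (H1 i j - H2 i j))\<^sup>2 = (cmod (?x - m))\<^sup>2 / n" by (simp only: cdiv)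
      also have "\<dots> \<le> (2 * ((cmod ?x)\<^sup>2 + (cmod m)\<^sup>2)) / n"
      proof (intro divide_right_mono)
        have "(cmod (?x - m))\<^sup>2 \<le> (cmod ?x + cmod m)\<^sup>2" by (intro power_mono norm_triangle_ineq4) auto
        also have "\<dots> \<le> 2 * ((cmod ?x)\<^sup>2 + (cmod m)\<^sup>2)"
          using sum_squares_bound[of "cmod ?x" "cmod m"] by (simp add: power2_sum)
        finally show "(cmod (?x - m))\<^sup>2 \<le> 2 * ((cmod ?x)\<^sup>2 + (cmod m)\<^sup>2)" .
      qed simp
      also have "\<dots> \<le> (2 * (L powr (2 - \<alpha>) * y i j + (cmod m)\<^sup>2 * y i j)) / n"
        using sq[OF 2] mult_left_mono[OF y1[OF 2(1)] b0(3)] by (intro divide_right_mono mult_left_mono add_mono) auto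
      also have "\<dots> = 2 / n * b * y i j" by (simp add: b_def algebra_simps add_divide_distrib)
      finally show ?thesis by simp
    next
      case 3
      hence "H1 i j - H2 i j = (- m) / complex_of_real (sqrt n)"
        using ij K off[OF ij] by (auto simp: H1_def H2_def hadd_def diff_divide_distrib)
      hence "(cmod (H1 i j - H2 i j))\<^sup>2 = (cmod m)\<^sup>2 / n" by (simp only: cdiv norm_minus_cancel)
      also have "\<dots> \<le> (cmod m)\<^sup>2 * y i j / n"
        using mult_left_mono[OF y1[of i j] b0(3)] 3 K by (intro divide_right_mono) auto
      also have "\<dots> \<le> b * y i j / n" by (intro divide_right_mono bym) auto
      finally have "2 * (cmod (H1 i j - H2 i j))\<^sup>2 \<le> 2 * (b * y i j / n)" by simp
      also have "\<dots> \<le> 4 / n * b * y i j" using b0 y0[of i j] n by (simp add: field_simps)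
      finally show ?thesis .
    qed
  qed
  \<comment> \<open>The diagonal of \<open>A\<close> is 0, so diagonal entries of modulus up to
    \<open>K\<close> are charged here, with \<open>K^2 / n\<close> each.\<close>
  have Ddiag: "(cmod (H1 i i - H2 i i))\<^sup>2 \<le> 4 / n * b * y i i + K\<^sup>2 / n" if i: "i < n" for i
  proof -
    let ?x = "u i i"
    have by0: "0 \<le> 4 / n * b * y i i" using b0 y0 by simp
    consider "cmod ?x \<le> K" | "K < cmod ?x" "cmod ?x \<le> L" | "L < cmod ?x" by linarith
    thus ?thesis
    proof cases
      case 1
      hence "H1 i i - H2 i i = ?x / complex_of_real (sqrt n)" using i K diag[OF i] by (auto simp: H1_def H2_def hadd_def)
      hence "(cmod (H1 i i - H2 i i))\<^sup>2 = (cmod ?x)\<^sup>2 / n" by (simp only: cdiv)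
      also have "\<dots> \<le> K\<^sup>2 / n" using 1 by (intro divide_right_mono power_mono) auto
      finally show ?thesis using by0 by linarith
    next
      case 2
      hence "H1 i i - H2 i i = ?x / complex_of_real (sqrt n)" using i K diag[OF i] by (auto simp: H1_def H2_def hadd_def)
      hence "(cmod (H1 i i - H2 i i))\<^sup>2 = (cmod ?x)\<^sup>2 / n" by (simp only: cdiv)
      also have "\<dots> \<le> b * y i i / n" using order_trans[OF sq[OF 2] bym(1)] by (intro divide_right_mono) auto
      also have "\<dots> \<le> 4 / n * b * y i i" using b0 y0[of i i] n by (simp add: field_simps)
      also have "\<dots> \<le> 4 / n * b * y i i + K\<^sup>2 / n" by simp
      finally show ?thesis .
    next
      case 3
      hence "H1 i i - H2 i i = 0" using i K diag[OF i] by (auto simp: H1_def H2_def hadd_def)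
      thus ?thesis using by0 by simp
    qed
  qed
  have S: "(\<Sum>i<n. \<Sum>j<n. (cmod (H1 i j - H2 i j))\<^sup>2) \<le> 4 / n * b * W + K\<^sup>2"
  proof -
    have "(\<Sum>i<n. \<Sum>j<n. (cmod (H1 i j - H2 i j))\<^sup>2)
       = (\<Sum>(i, j)\<in>edges n. if i < j then (cmod (H1 i j - H2 i j))\<^sup>2 + (cmod (H1 j i - H2 j i))\<^sup>2 else (cmod (H1 i j - H2 i j))\<^sup>2)"
      by (rule sum_edges)
    also have "\<dots> \<le> (\<Sum>(i, j)\<in>edges n. 4 / n * b * y i j + (if i < j then 0 + 0 else if i = j then K\<^sup>2 / n else 0))"
    proof (rule sum_mono)
      fix e assume "e \<in> edges n"
      then obtain i j where e: "e = (i, j)" "i \<le> j" "j < n" by (auto simp: edges_def)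
      have sym: "cmod (H1 j i - H2 j i) = cmod (H1 i j - H2 i j)"
      proof -
        have "H1 j i - H2 j i = cnj (H1 i j - H2 i j)" using hermD[OF h1, of i j] hermD[OF h2, of i j] e by simp
        thus ?thesis by (simp only: complex_mod_cnj)
      qed
      show "(case e of (i, j) \<Rightarrow> if i < j then (cmod (H1 i j - H2 i j))\<^sup>2 + (cmod (H1 j i - H2 j i))\<^sup>2 else (cmod (H1 i j - H2 i j))\<^sup>2)
        \<le> (case e of (i, j) \<Rightarrow> 4 / n * b * y i j + (if i < j then 0 + 0 else if i = j then K\<^sup>2 / n else 0))"
      proof (cases "i < j")
        case True
        thus ?thesis using Doff[OF True e(3)] by (simp add: e(1) sym)
      next
        case False
        hence "i = j" using e by simp
        thus ?thesis using Ddiag[of i] e by simp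
      qed
    qed
    also have "\<dots> = 4 / n * b * (\<Sum>(i, j)\<in>edges n. y i j) + (\<Sum>(i, j)\<in>edges n. if i < j then 0 + 0 else if i = j then K\<^sup>2 / n else 0)"
      by (simp add: case_prod_beta' sum.distrib sum_distrib_left)
    also have "(\<Sum>(i, j)\<in>edges n. if i < j then 0 + 0 else if i = j then K\<^sup>2 / n else 0) = (\<Sum>i<n. \<Sum>j<n. if i = j then K\<^sup>2 / n else 0)"
      unfolding sum_edges by (intro sum.cong refl) auto
    also have "\<dots> = K\<^sup>2" using n by simp
    finally show ?thesis using mult_left_mono[OF W', of "4 / n * b"] b0 by simp
  qed
  have "cmod (gres n H1 z - gres n H2 z) \<le> sqrt ((\<Sum>i<n. \<Sum>j<n. (cmod (H1 i j - H2 i j))\<^sup>2) / n) / 4"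
    by (rule gres_hs[OF h1 h2 z n])
  also have "\<dots> \<le> sqrt ((4 * b * W + n * K\<^sup>2) / n\<^sup>2) / 4"
  proof (intro divide_right_mono real_sqrt_le_mono)
    have "(\<Sum>i<n. \<Sum>j<n. (cmod (H1 i j - H2 i j))\<^sup>2) / n \<le> (4 / n * b * W + K\<^sup>2) / n" by (intro divide_right_mono S) simp
    also have "\<dots> = (4 * b * W + n * K\<^sup>2) / n\<^sup>2" using n by (simp add: power2_eq_square add_divide_distrib)
    finally show "(\<Sum>i<n. \<Sum>j<n. (cmod (H1 i j - H2 i j))\<^sup>2) / n \<le> (4 * b * W + n * K\<^sup>2) / n\<^sup>2" .
  qed simp
  finally have 2: "cmod (gres n H1 z - gres n H2 z) \<le> sqrt ((4 * b * W + n * K\<^sup>2) / n\<^sup>2) / 4" .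
  have 3: "cmod (gres n H2 z - gres n (hadd A C) z) \<le> cmod (m / complex_of_real (sqrt n)) / 2 * (sqrt q + (1 / q + 1 / n) * sqrt (real q * real n))"
    by (rule remove_mean[OF h2 hAC z n q]) (auto simp: H2_def)
  have "cmod (gres n H z - gres n (hadd A C) z) \<le> cmod (gres n H z - gres n H1 z) + cmod (gres n H1 z - gres n H2 z) + cmod (gres n H2 z - gres n (hadd A C) z)"
    using norm_triangle_ineq[of "(gres n H z - gres n H1 z) + (gres n H1 z - gres n H2 z)" "gres n H2 z - gres n (hadd A C) z"]
      norm_triangle_ineq[of "gres n H z - gres n H1 z" "gres n H1 z - gres n H2 z"] by simp
  moreover have cm: "cmod (m / complex_of_real (sqrt (real n))) / 2 = cmod m / (2 * sqrt (real n))" by (simp add: norm_divide)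
  ultimately show ?thesis using 1 2[unfolded b_def of_nat_power] 3[unfolded cm] by linarith
qed

section \<open>Tails\<close>

lemma (in resample) chernoff:
  fixes g :: "'a \<Rightarrow> real" and c w r :: real
  assumes g: "\<And>e. e \<in> E \<Longrightarrow> g \<in> borel_measurable (\<mu> e)" and int: "\<And>e. e \<in> E \<Longrightarrow> integrable (\<mu> e) (\<lambda>u. exp (c * g u))"
    and le: "\<And>e. e \<in> E \<Longrightarrow> (\<integral>u. exp (c * g u) \<partial>\<mu> e) \<le> exp r" and c: "c > 0"
  shows "measure N {x \<in> space N. (\<Sum>e\<in>E. g (x e)) \<ge> w} \<le> exp (card E * r - c * w)"
proof -
  let ?A = "{x \<in> space N. (\<Sum>e\<in>E. g (x e)) \<ge> w}"
  have [measurable]: "(\<lambda>x. g (x e)) \<in> borel_measurable N" if "e \<in> E" for e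
    by (rule measurable_compose[OF measurable_component_singleton[OF that]]) (rule g[OF that])
  have A: "?A \<in> sets N" by measurable
  have eq: "exp (c * (\<Sum>e\<in>E. g (x e))) = (\<Prod>e\<in>E. exp (c * g (x e)))" for x
    using finE by (simp add: exp_sum sum_distrib_left)
  have I: "integrable N (\<lambda>x. \<Prod>e\<in>E. exp (c * g (x e)))"
    by (rule product_integrable_prod[OF finE]) (rule int)
  have iA: "integrable N (indicator ?A :: _ \<Rightarrow> real)"
    using A by (intro integrable_real_indicator) (auto simp: P.emeasure_eq_measure)
  have "exp (c * w) * measure N ?A = (\<integral>x. exp (c * w) * indicator ?A x \<partial>N)" using A by simp
  also have "\<dots> \<le> (\<integral>x. (\<Prod>e\<in>E. exp (c * g (x e))) \<partial>N)"
  proof (rule integral_mono)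
    fix x
    have "exp (c * w) * indicator ?A x \<le> exp (c * (\<Sum>e\<in>E. g (x e)))" using c by (auto simp: indicator_def)
    thus "exp (c * w) * indicator ?A x \<le> (\<Prod>e\<in>E. exp (c * g (x e)))" by (simp only: eq)
  qed (use I iA in auto)
  also have "\<dots> = (\<Prod>e\<in>E. \<integral>u. exp (c * g u) \<partial>\<mu> e)" by (rule product_integral_prod[OF finE]) (rule int)
  also have "\<dots> \<le> (\<Prod>e\<in>E. exp r)" by (intro prod_mono conjI le Bochner_Integration.integral_nonneg) auto
  also have "\<dots> = exp (card E * r)" by (simp add: exp_of_nat_mult)
  finally have "measure N ?A \<le> exp (card E * r) / exp (c * w)" by (simp add: field_simps)
  thus ?thesis by (simp add: exp_diff)
qed

text \<open>For a real \<open>b\<close> strictly between 0 and \<open>a\<close>, which exists also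
  for \<open>a = \<infinity>\<close>, the tail is eventually below
  \<open>exp(- b t^\<alpha>)\<close>. At half that rate the layers between consecutive integers of
  \<open>|Y|^\<alpha>\<close> are dominated by a geometric series.\<close>

lemma tail_class_exp_moment:
  assumes "prob_space M" and \<alpha>: "0 < \<alpha>" and a: "0 < a" and tc: "tail_class M \<alpha> a Y"
  shows "\<exists>c>0. integrable M (\<lambda>\<omega>. exp (c * cmod (Y \<omega>) powr \<alpha>))"
proof -
  interpret prob_space M by fact
  have Y[measurable]: "Y \<in> borel_measurable M"
    and lim: "((\<lambda>t. - ereal (t powr (- \<alpha>)) * elog (measure M {\<omega> \<in> space M. t \<le> cmod (Y \<omega>)})) \<longlongrightarrow> a) at_top"
    using tc by (auto simp: tail_class_def)
  obtain b where b: "ereal 0 < ereal b" "ereal b < a" using ereal_dense2[of "ereal 0" a] a by (auto simp: zero_ereal_def)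
  have b0: "b > 0" using b by simp
  let ?p = "\<lambda>t. measure M {\<omega> \<in> space M. t \<le> cmod (Y \<omega>)}"
  have "eventually (\<lambda>t. ereal b < - ereal (t powr (- \<alpha>)) * elog (?p t)) at_top"
    using order_tendstoD(1)[OF lim b(2)] .
  hence "eventually (\<lambda>t. ?p t \<le> exp (- b * t powr \<alpha>)) at_top"
    using eventually_gt_at_top[of 0]
  proof eventually_elim
    case (elim t)
    show ?case
    proof (cases "?p t = 0")
      case False
      hence p: "?p t > 0" by (simp add: zero_less_measure_iff less_le)
      have "b < - (t powr (- \<alpha>)) * ln (?p t)" using elim(1) False by (simp add: elog_def)
      hence "b * t powr \<alpha> < (- (t powr (- \<alpha>)) * ln (?p t)) * t powr \<alpha>" using elim(2) by (intro mult_strict_right_mono) auto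
      also have "\<dots> = - ln (?p t)" using elim(2) by (simp add: powr_minus field_simps)
      finally have "ln (?p t) < - b * t powr \<alpha>" by simp
      thus ?thesis using p by (metis exp_le_cancel_iff exp_ln less_imp_le)
    qed simp
  qed
  then obtain t0 where t0: "\<And>t. t \<ge> t0 \<Longrightarrow> ?p t \<le> exp (- b * t powr \<alpha>)" by (auto simp: eventually_at_top_linorder)
  define T where "T = max t0 1"
  \<comment> \<open>Makes the tail bound trivially true below \<open>T\<close>, where only the bound
    1 for a probability is available.\<close>
  define C where "C = exp (b * T powr \<alpha>)"
  define Z where "Z \<omega> = cmod (Y \<omega>) powr \<alpha>" for \<omega>
  have Zm[measurable]: "Z \<in> borel_measurable M" unfolding Z_def by measurable
  have Z0: "Z \<omega> \<ge> 0" for \<omega> by (simp add: Z_def)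
  have PZ: "measure M {\<omega> \<in> space M. real k \<le> Z \<omega>} \<le> C * exp (- b * k)" for k :: nat
  proof (cases "real k \<ge> T powr \<alpha>")
    case False
    have "1 \<le> C * exp (- b * k)" unfolding C_def exp_add[symmetric] using False b0 by simp
    thus ?thesis by (rule order_trans[OF prob_le_1])
  next
    case True
    have T1: "T powr \<alpha> \<ge> 1" using \<alpha> by (simp add: T_def ge_one_powr_ge_zero)
    hence k0: "real k > 0" using True by linarith
    define s where "s = real k powr (1 / \<alpha>)"
    have s\<alpha>: "s powr \<alpha> = real k" using \<alpha> k0 by (simp add: s_def powr_powr)
    have "s \<ge> T"
    proof (rule ccontr)
      assume "\<not> s \<ge> T"
      hence "s powr \<alpha> < T powr \<alpha>" using \<alpha> by (intro powr_less_mono2) (auto simp: s_def)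
      thus False using s\<alpha> True by simp
    qed
    have "measure M {\<omega> \<in> space M. real k \<le> Z \<omega>} \<le> ?p s"
    proof (rule finite_measure_mono)
      show "{\<omega> \<in> space M. real k \<le> Z \<omega>} \<subseteq> {\<omega> \<in> space M. s \<le> cmod (Y \<omega>)}"
      proof safe
        fix \<omega> assume "real k \<le> Z \<omega>"
        show "s \<le> cmod (Y \<omega>)"
        proof (rule ccontr)
          assume "\<not> s \<le> cmod (Y \<omega>)"
          hence "Z \<omega> < s powr \<alpha>" unfolding Z_def using \<alpha> by (intro powr_less_mono2) auto
          thus False using \<open>real k \<le> Z \<omega>\<close> s\<alpha> by simp
        qed
      qed
    qed measurable
    also have "\<dots> \<le> exp (- b * s powr \<alpha>)" using \<open>s \<ge> T\<close> by (intro t0) (simp add: T_def)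
    also have "\<dots> \<le> C * exp (- b * k)" using b0 by (simp add: s\<alpha> C_def)
    finally show ?thesis .
  qed
  define c where "c = b / 2"
  have c0: "c > 0" using b0 by (simp add: c_def)
  have bc: "b = 2 * c" by (simp add: c_def)
  define F where "F k \<omega> = ennreal (exp (c * (real k + 1))) * indicator {\<omega> \<in> space M. real k \<le> Z \<omega>} \<omega>" for k \<omega>
  have Fm: "F k \<in> borel_measurable M" for k unfolding F_def by measurable
  have pt: "ennreal (exp (c * Z \<omega>)) \<le> (\<Sum>k. F k \<omega>)" if "\<omega> \<in> space M" for \<omega>
  proof -
    define k where "k = nat \<lfloor>Z \<omega>\<rfloor>"
    have k: "real k \<le> Z \<omega>" "Z \<omega> \<le> real k + 1" using Z0[of \<omega>] unfolding k_def by linarith+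
    have "ennreal (exp (c * Z \<omega>)) \<le> F k \<omega>"
      using k that c0 by (auto simp: F_def intro!: ennreal_leI)
    also have "\<dots> = sum (\<lambda>k. F k \<omega>) {k}" by simp
    also have "\<dots> \<le> (\<Sum>k. F k \<omega>)" by (rule sum_le_suminf) auto
    finally show ?thesis .
  qed
  have "(\<integral>\<^sup>+\<omega>. ennreal (exp (c * Z \<omega>)) \<partial>M) \<le> (\<integral>\<^sup>+\<omega>. (\<Sum>k. F k \<omega>) \<partial>M)" by (intro nn_integral_mono pt)
  also have "\<dots> = (\<Sum>k. \<integral>\<^sup>+\<omega>. F k \<omega> \<partial>M)" by (rule nn_integral_suminf[OF Fm])
  also have "\<dots> \<le> (\<Sum>k. ennreal (C * exp c * exp (- c) ^ k))"
  proof (rule suminf_le)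
    fix k
    have "(\<integral>\<^sup>+\<omega>. F k \<omega> \<partial>M) = ennreal (exp (c * (real k + 1))) * emeasure M {\<omega> \<in> space M. real k \<le> Z \<omega>}"
      unfolding F_def by (rule nn_integral_cmult_indicator) measurable
    also have "\<dots> = ennreal (exp (c * (real k + 1)) * measure M {\<omega> \<in> space M. real k \<le> Z \<omega>})"
      by (simp add: emeasure_eq_measure ennreal_mult)
    also have "\<dots> \<le> ennreal (exp (c * (real k + 1)) * (C * exp (- b * k)))"
      by (intro ennreal_leI mult_left_mono PZ) auto
    also have "exp (c * (real k + 1)) * (C * exp (- b * k)) = C * exp c * exp (- c) ^ k"
    proof -
      have "exp (c * (real k + 1)) * exp (- b * k) = exp c * exp (real k * (- c))"
        unfolding exp_add[symmetric] by (simp add: bc algebra_simps)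
      hence e: "exp (c * (real k + 1)) * exp (- b * k) = exp c * exp (- c) ^ k" by (simp only: exp_of_nat_mult)
      have "exp (c * (real k + 1)) * (C * exp (- b * k)) = C * (exp (c * (real k + 1)) * exp (- b * k))"
        by (simp only: mult_ac)
      also have "\<dots> = C * (exp c * exp (- c) ^ k)" by (simp only: e)
      finally show ?thesis by (simp only: mult_ac)
    qed
    finally show "(\<integral>\<^sup>+\<omega>. F k \<omega> \<partial>M) \<le> ennreal (C * exp c * exp (- c) ^ k)" .
  qed auto
  also have "\<dots> = ennreal (\<Sum>k. C * exp c * exp (- c) ^ k)"
    by (rule suminf_ennreal2) (use c0 in \<open>auto simp: C_def intro!: summable_mult summable_geometric\<close>)
  also have "\<dots> < \<infinity>" by simp
  finally have "integrable M (\<lambda>\<omega>. exp (c * Z \<omega>))" by (intro integrableI_bounded) auto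
  thus ?thesis using c0 unfolding Z_def by blast
qed


section \<open>Asymptotics of the parameters\<close>

text \<open>For \<open>\<kappa> = 2 K / sqrt n\<close> these are \<theta> times the bound of
  \<open>BE_sum\<close>, apart from \<open>p\<close>, and the error of \<open>perr_plin\<close>. The
  first is \<open>n^(\<alpha>/2 - 1)\<close> up to logarithms, so \<alpha> < 2 is decisive.\<close>

lemma asymp_variance_terms:
  fixes \<alpha> :: real
  assumes "0 < \<alpha>" "\<alpha> < 2"
  shows "(\<lambda>n. real n powr (1 + \<alpha> / 2) * ln (real n) * (60 * (ln (real n) powr (2 / \<alpha>))\<^sup>2 / real n * (1 / real n + 16 * (ln (real n) powr (2 / \<alpha>))\<^sup>2 / real n))) \<longlonglongrightarrow> 0"
    "(\<lambda>n. (2 * ln (real n) powr (2 / \<alpha>) / sqrt (real n)) ^ 3 * real n + (2 * ln (real n) powr (2 / \<alpha>) / sqrt (real n))\<^sup>2 * sqrt (real n)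
       + (2 * ln (real n) powr (2 / \<alpha>) / sqrt (real n))\<^sup>2 + 1 / real n) \<longlonglongrightarrow> 0"
  using assms by real_asymp+

text \<open>The rank, Hilbert-Schmidt and mean terms of \<open>truncation_comparison\<close>. The
  first equals \<open>(log n)^(\<beta> - \<alpha>)\<close>, and the leading part under the root in
  the second is \<open>(log n)^(\<alpha> - 2 + \<beta>)\<close>, whence the two upper bounds on
  \<beta>. In the third, \<open>q\<close> is about \<open>sqrt n\<close>.\<close>

lemma asymp_comparison:
  fixes \<alpha> \<beta> D :: real
  assumes "0 < \<alpha>" "\<alpha> < 2" "0 < \<beta>" "\<beta> < \<alpha>" "\<beta> < 2 - \<alpha>" "D > 0"
  shows "(\<lambda>n. (real n powr (1 + \<alpha> / 2) * ln (real n) powr \<beta>) / (sqrt (real n) * ln (real n)) powr \<alpha> / real n) \<longlonglongrightarrow> 0"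
   "(\<lambda>n. sqrt ((4 * ((sqrt (real n) / ln (real n)) powr (2 - \<alpha>) + D\<^sup>2) * (real n powr (1 + \<alpha> / 2) * ln (real n) powr \<beta>)
        + real n * (ln (real n) powr (2 / \<alpha>))\<^sup>2) / (real n)\<^sup>2) / 4) \<longlonglongrightarrow> 0"
   "(\<lambda>n. D / (2 * sqrt (real n)) * (sqrt (sqrt (real n) + 1) + (1 / sqrt (real n) + 1 / real n) * sqrt ((sqrt (real n) + 1) * real n))) \<longlonglongrightarrow> 0"
proof -
  show "(\<lambda>n. (real n powr (1 + \<alpha> / 2) * ln (real n) powr \<beta>) / (sqrt (real n) * ln (real n)) powr \<alpha> / real n) \<longlonglongrightarrow> 0"
    "(\<lambda>n. D / (2 * sqrt (real n)) * (sqrt (sqrt (real n) + 1) + (1 / sqrt (real n) + 1 / real n) * sqrt ((sqrt (real n) + 1) * real n))) \<longlonglongrightarrow> 0"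
    using assms by real_asymp+
  define \<gamma> where "\<gamma> = \<alpha> - 2 + \<beta>"
  have \<gamma>: "\<gamma> < 0" using assms by (simp add: \<gamma>_def)
  have "(\<lambda>n. sqrt (4 * ln (real n) powr \<gamma> + 4 * D\<^sup>2 * (real n powr (\<alpha> / 2 - 1) * ln (real n) powr \<beta>)
        + (ln (real n) powr (2 / \<alpha>))\<^sup>2 / real n) / 4) \<longlonglongrightarrow> 0"
    using assms \<gamma> by real_asymp
  moreover have "eventually (\<lambda>n. sqrt (4 * ln (real n) powr \<gamma> + 4 * D\<^sup>2 * (real n powr (\<alpha> / 2 - 1) * ln (real n) powr \<beta>)
        + (ln (real n) powr (2 / \<alpha>))\<^sup>2 / real n) / 4 = sqrt ((4 * ((sqrt (real n) / ln (real n)) powr (2 - \<alpha>) + D\<^sup>2) * (real n powr (1 + \<alpha> / 2) * ln (real n) powr \<beta>)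
        + real n * (ln (real n) powr (2 / \<alpha>))\<^sup>2) / (real n)\<^sup>2) / 4) sequentially"
    using eventually_gt_at_top[of 2]
  proof eventually_elim
    case (elim n)
    define N l where "N = real n" and "l = ln (real n)"
    have N: "N > 0" "l > 0" "sqrt N = N powr (1 / 2)" using elim by (auto simp: N_def l_def powr_half_sqrt)
    \<comment> \<open>The powers of \<open>n\<close> cancel exactly in the leading part; only a
      negative power of the logarithm is left.\<close>
    have e1: "(sqrt N / l) powr (2 - \<alpha>) * (N powr (1 + \<alpha> / 2) * l powr \<beta>) = l powr \<gamma> * N\<^sup>2"
    proof -
      have "(N powr (1 / 2)) powr (2 - \<alpha>) = N powr (1 - \<alpha> / 2)" by (simp add: powr_powr diff_divide_distrib)
      moreover have "inverse (l powr (2 - \<alpha>)) = l powr (\<alpha> - 2)" by (simp flip: powr_minus)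
      ultimately have "(sqrt N / l) powr (2 - \<alpha>) = N powr (1 - \<alpha> / 2) * l powr (\<alpha> - 2)"
        using powr_divide[of "N powr (1 / 2)" l "2 - \<alpha>"] N(2) unfolding N(3) divide_inverse by simp
      moreover have "N powr (1 - \<alpha> / 2) * N powr (1 + \<alpha> / 2) = N\<^sup>2" using N(1) by (simp flip: powr_add add: powr_numeral)
      moreover have "l powr (\<alpha> - 2) * l powr \<beta> = l powr \<gamma>" by (simp add: \<gamma>_def flip: powr_add)
      moreover have "x * (c * d) = g * s" if "x = a * b" "a * c = s" "b * d = g" for x a b c d g s :: real
        using that(1) unfolding that(2,3)[symmetric] by (simp only: mult_ac)
      ultimately show ?thesis by blast
    qed
    have e2: "N powr (1 + \<alpha> / 2) = N powr (\<alpha> / 2 - 1) * N\<^sup>2"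
      using N(1) by (simp flip: powr_numeral powr_add)
    have "(4 * ((sqrt N / l) powr (2 - \<alpha>) + D\<^sup>2) * (N powr (1 + \<alpha> / 2) * l powr \<beta>) + N * (l powr (2 / \<alpha>))\<^sup>2) / N\<^sup>2
      = (4 * ((sqrt N / l) powr (2 - \<alpha>) * (N powr (1 + \<alpha> / 2) * l powr \<beta>)) + 4 * D\<^sup>2 * (N powr (1 + \<alpha> / 2) * l powr \<beta>) + N * (l powr (2 / \<alpha>))\<^sup>2) / N\<^sup>2"
      by (simp only: ring_distribs mult.assoc)
    also have "\<dots> = (4 * (l powr \<gamma> * N\<^sup>2) + 4 * D\<^sup>2 * ((N powr (\<alpha> / 2 - 1) * N\<^sup>2) * l powr \<beta>) + N * (l powr (2 / \<alpha>))\<^sup>2) / N\<^sup>2"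
      by (subst e1, subst e2, rule refl)
    also have "\<dots> = 4 * l powr \<gamma> + 4 * D\<^sup>2 * (N powr (\<alpha> / 2 - 1) * l powr \<beta>) + (l powr (2 / \<alpha>))\<^sup>2 / N"
      using N(1) by (simp add: add_divide_distrib power2_eq_square)
    finally show ?case unfolding N_def l_def by (simp only:)
  qed
  ultimately show "(\<lambda>n. sqrt ((4 * ((sqrt (real n) / ln (real n)) powr (2 - \<alpha>) + D\<^sup>2) * (real n powr (1 + \<alpha> / 2) * ln (real n) powr \<beta>)
        + real n * (ln (real n) powr (2 / \<alpha>))\<^sup>2) / (real n)\<^sup>2) / 4) \<longlonglongrightarrow> 0"
    by (rule Lim_transform_eventually)
qed

lemma asymp_far:
  fixes \<alpha> :: real
  assumes "0 < \<alpha>"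
  shows "(\<lambda>n. 3 * (1 + 2 * real n * (2 * ln (real n) powr (2 / \<alpha>) + ln (real n))) / real n ^ 3) \<longlonglongrightarrow> 0"
  using assms by real_asymp

lemma asymp_params:
  fixes \<alpha> :: real
  assumes "0 < \<alpha>"
  shows "eventually (\<lambda>n. 1 \<le> ln (real n) powr (2 / \<alpha>) \<and> ln (real n) powr (2 / \<alpha>) \<le> sqrt (real n) / ln (real n)
    \<and> sqrt (real n) / ln (real n) < sqrt (real n) * ln (real n) \<and> ln (real n) > 1) sequentially"
  using assms by (intro eventually_conj) real_asymp+

text \<open>The first summand of the Chernoff exponent is negligible because
  \<open>exp(- c (log n)^2)\<close> beats \<open>n^2\<close>; the factor
  \<open>(log n)^\<beta>\<close> in the second beats any multiple \<open>R\<close> of the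
  speed.\<close>

lemma asymp_chernoff:
  fixes \<alpha> \<beta> D c R :: real
  assumes "0 < \<alpha>" "\<alpha> < 2" "0 < \<beta>" "D > 0" "c > 0"
  shows "(\<lambda>n. exp (R * real n powr (1 + \<alpha> / 2)) * exp ((real n)\<^sup>2 * (D * exp (- c * (ln (real n))\<^sup>2)) - c * (real n powr (1 + \<alpha> / 2) * ln (real n) powr \<beta>))) \<longlonglongrightarrow> 0"
proof -
  have "filterlim (\<lambda>n. R * real n powr (1 + \<alpha> / 2) + ((real n)\<^sup>2 * (D * exp (- c * (ln (real n))\<^sup>2)) - c * (real n powr (1 + \<alpha> / 2) * ln (real n) powr \<beta>))) at_bot sequentially"
    using assms by real_asymp
  thus ?thesis unfolding exp_add[symmetric] by (rule filterlim_compose[OF exp_at_bot])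
qed

text \<open>The polynomial factor counts the points of a net of mesh \<open>h\<close> up to distance
  \<open>n^3\<close>. The extra logarithm in \<theta> beats it together with the multiple
  \<open>R\<close> of the speed.\<close>

lemma asymp_tail1:
  fixes \<alpha> h t R :: real
  assumes "0 < \<alpha>" "\<alpha> < 2" "0 < h" "t > 0" "R > 0"
  shows "(\<lambda>n. exp (R * real n powr (1 + \<alpha> / 2)) * ((2 * (real n ^ 3 / h + 1) + 1) * ((real n ^ 3 / h + 1) + 1) * (4 *
    (exp (- (real n powr (1 + \<alpha> / 2) * ln (real n)) * t) / ((real n powr (1 + \<alpha> / 2) * ln (real n)) * t))))) \<longlonglongrightarrow> 0"
  using assms by real_asymp

text \<open>The contribution of the bad event: its exponent, \<open>n^2\<close> over a power of
  \<open>log n\<close>, beats \<theta>, which is \<open>n^(1 + \<alpha>/2) log n\<close>.\<close>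

lemma asymp_tail2:
  fixes \<alpha> h t \<eta> R :: real
  assumes "0 < \<alpha>" "\<alpha> < 2" "0 < h" "t > 0" "R > 0" "\<eta> > 0"
  shows "(\<lambda>n. exp (R * real n powr (1 + \<alpha> / 2)) * ((2 * (real n ^ 3 / h + 1) + 1) * ((real n ^ 3 / h + 1) + 1) * (4 *
    ((1 + real n * (2 * ln (real n) powr (2 / \<alpha>) / sqrt (real n))) * exp ((real n powr (1 + \<alpha> / 2) * ln (real n)) * 1) / t
      * (4 ^ n * exp (- \<eta>\<^sup>2 / (8 * (2 * ln (real n) powr (2 / \<alpha>) / sqrt (real n)) ^ 4))))))) \<longlonglongrightarrow> 0"
proof -
  \<comment> \<open>The term \<open>9 * ln (real n)\<close> is a reserve for the polynomial
    prefactor, which is divided by \<open>n^9\<close> in return.\<close>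
  have ev: "filterlim (\<lambda>n. R * real n powr (1 + \<alpha> / 2) + real n powr (1 + \<alpha> / 2) * ln (real n) + real n * ln 4
     + (- \<eta>\<^sup>2 / 128 * (real n)\<^sup>2 / (ln (real n) powr (2 / \<alpha>)) ^ 4) + 9 * ln (real n)) at_bot sequentially"
    using assms by real_asymp
  have 1: "(\<lambda>n. exp (R * real n powr (1 + \<alpha> / 2) + real n powr (1 + \<alpha> / 2) * ln (real n) + real n * ln 4
     + (- \<eta>\<^sup>2 / 128 * (real n)\<^sup>2 / (ln (real n) powr (2 / \<alpha>)) ^ 4) + 9 * ln (real n))) \<longlonglongrightarrow> 0"
    by (rule filterlim_compose[OF exp_at_bot ev])
  have 2: "(\<lambda>n. (2 * (real n ^ 3 / h + 1) + 1) * ((real n ^ 3 / h + 1) + 1) * 4 * (1 + real n * (2 * ln (real n) powr (2 / \<alpha>) / sqrt (real n))) / t / real n ^ 9) \<longlonglongrightarrow> 0"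
    using assms by real_asymp
  have "(\<lambda>n. exp (R * real n powr (1 + \<alpha> / 2) + real n powr (1 + \<alpha> / 2) * ln (real n) + real n * ln 4
     + (- \<eta>\<^sup>2 / 128 * (real n)\<^sup>2 / (ln (real n) powr (2 / \<alpha>)) ^ 4) + 9 * ln (real n))
     * ((2 * (real n ^ 3 / h + 1) + 1) * ((real n ^ 3 / h + 1) + 1) * 4 * (1 + real n * (2 * ln (real n) powr (2 / \<alpha>) / sqrt (real n))) / t / real n ^ 9)) \<longlonglongrightarrow> 0"
    using tendsto_mult[OF 1 2] by simp
  thus ?thesis
  proof (rule Lim_transform_eventually)
    show "eventually (\<lambda>n. exp (R * real n powr (1 + \<alpha> / 2) + real n powr (1 + \<alpha> / 2) * ln (real n) + real n * ln 4
     + (- \<eta>\<^sup>2 / 128 * (real n)\<^sup>2 / (ln (real n) powr (2 / \<alpha>)) ^ 4) + 9 * ln (real n))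
     * ((2 * (real n ^ 3 / h + 1) + 1) * ((real n ^ 3 / h + 1) + 1) * 4 * (1 + real n * (2 * ln (real n) powr (2 / \<alpha>) / sqrt (real n))) / t / real n ^ 9)
     = exp (R * real n powr (1 + \<alpha> / 2)) * ((2 * (real n ^ 3 / h + 1) + 1) * ((real n ^ 3 / h + 1) + 1) * (4 *
    ((1 + real n * (2 * ln (real n) powr (2 / \<alpha>) / sqrt (real n))) * exp ((real n powr (1 + \<alpha> / 2) * ln (real n)) * 1) / t
      * (4 ^ n * exp (- \<eta>\<^sup>2 / (8 * (2 * ln (real n) powr (2 / \<alpha>) / sqrt (real n)) ^ 4))))))) sequentially"
      using eventually_gt_at_top[of 2]
    proof eventually_elim
      case (elim n)
      have e1: "exp (real n * ln 4) = 4 ^ n" by (simp add: exp_of_nat_mult)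
      have "exp (9 * ln (real n)) = exp (ln (real n ^ 9))" using elim by (subst ln_realpow) auto
      hence e2: "exp (9 * ln (real n)) = real n ^ 9" using elim by simp
      have "(sqrt (real n)) ^ 4 = ((sqrt (real n))\<^sup>2)\<^sup>2" by (simp only: power_mult[symmetric]) simp
      hence "sqrt (real n) ^ 4 = (real n)\<^sup>2" by simp
      hence e3: "- \<eta>\<^sup>2 / (8 * (2 * ln (real n) powr (2 / \<alpha>) / sqrt (real n)) ^ 4) = - \<eta>\<^sup>2 / 128 * (real n)\<^sup>2 / (ln (real n) powr (2 / \<alpha>)) ^ 4"
        by (simp add: power_divide power_mult_distrib)
      have alg: "a1 * a2 * a3 * a4 * b9 * (P1 * P2 * 4 * Q / t / b9) = a1 * (P1 * P2 * (4 * (Q * a2 / t * (a3 * a4))))"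
        if "b9 \<noteq> 0" for a1 a2 a3 a4 b9 P1 P2 Q :: real using that by (simp add: field_simps)
      have "real n ^ 9 \<noteq> 0" using elim by simp
      thus ?case unfolding exp_add e1 e2 e3 mult_1_right by (rule alg)
    qed
  qed
qed


text \<open>For \<open>|z| \<le> R\<close>, rounding down to the net moves \<open>z\<close> by at
  most \<open>2 h\<close>, and the defect is Lipschitz. For larger \<open>|z|\<close> both
  transforms are themselves of order \<open>(1 + n B) / R\<close>.\<close>

lemma net_comparison:
  assumes n: "n > 0" and herms: "herm n A" "herm n C"
    and B: "\<And>i j. i < n \<Longrightarrow> j < n \<Longrightarrow> cmod (A i j) \<le> B" "\<And>i j. i < n \<Longrightarrow> j < n \<Longrightarrow> cmod (C i j) \<le> B" "B \<ge> 0"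
    and h: "0 < h" and R: "1 \<le> R" "R \<le> real m * h"
    and grid: "\<And>k l. k \<in> {- int m..int m} \<Longrightarrow> l \<in> {..m} \<Longrightarrow> cmod (perr n A C (Complex (h * of_int k) (2 + h * real l))) \<le> e"
    and z: "Im z \<ge> 2" and s: "Im s \<ge> 0" "cmod s \<le> 1 / 2" "s = gres n C (z + s)"
  shows "cmod (gres n (hadd A C) z - s) \<le> 4 / 3 * (e + 2 * h) + 3 * (1 + 2 * real n * B) / R"
proof -
  have e0: "0 \<le> e" by (rule order_trans[OF norm_ge_zero grid[of 0 0]]) auto
  have nB: "0 \<le> real n * B" using B by simp
  show ?thesis
  proof (cases "cmod z \<le> R")
    case True
    define x y where "x = Re z / h" and "y = (Im z - 2) / h"
    have zx: "Re z = h * x" "Im z = 2 + h * y" using h by (auto simp: x_def y_def)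
    have "\<bar>Re z\<bar> \<le> real m * h" "Im z - 2 \<le> real m * h"
      using abs_Re_le_cmod[of z] abs_Im_le_cmod[of z] True R by linarith+
    hence x: "\<bar>x\<bar> \<le> real m" and y: "0 \<le> y" "y \<le> real m"
      using h z by (auto simp: x_def y_def abs_divide pos_divide_le_eq)
    define k l where "k = \<lfloor>x\<rfloor>" and "l = nat \<lfloor>y\<rfloor>"
    have k: "k \<in> {- int m..int m}" using x unfolding k_def by (auto simp: le_floor_iff floor_le_iff)
    have l: "l \<in> {..m}" using y unfolding l_def by (auto simp: nat_le_iff floor_le_iff)
    have kx: "\<bar>x - of_int k\<bar> \<le> 1" unfolding k_def by linarith
    have ly: "\<bar>y - real l\<bar> \<le> 1" using y unfolding l_def by linarith
    let ?w = "Complex (h * of_int k) (2 + h * real l)"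
    have "cmod (z - ?w) \<le> \<bar>Re (z - ?w)\<bar> + \<bar>Im (z - ?w)\<bar>" by (rule cmod_le)
    also have "\<dots> = h * \<bar>x - of_int k\<bar> + h * \<bar>y - real l\<bar>"
      using h by (simp add: zx right_diff_distrib[symmetric] abs_mult)
    also have "\<dots> \<le> h * 1 + h * 1" using kx ly h by (intro add_mono mult_left_mono) auto
    finally have zw: "cmod (z - ?w) \<le> 2 * h" by simp
    have "cmod (perr n A C z - perr n A C ?w) \<le> cmod (z - ?w)"
      using h by (intro perr_lipschitz[OF herms z]) simp
    hence "cmod (perr n A C z) \<le> e + 2 * h"
      using grid[OF k l] zw norm_triangle_sub[of "perr n A C z" "perr n A C ?w"] by linarith
    moreover have "cmod (gres n (hadd A C) z - s) \<le> 4 / 3 * cmod (perr n A C z)"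
      by (rule defect_controls_distance[OF herms z s(1,3)])
    moreover have "0 \<le> 3 * (1 + 2 * real n * B) / R" using nB R by simp
    moreover have "v \<le> 4 / 3 * y + w" if "x \<le> y" "v \<le> 4 / 3 * x" "0 \<le> w" for v w x y :: real using that by linarith
    ultimately show ?thesis by blast
  next
    case False
    hence zR: "R \<le> cmod z" by simp
    let ?g = "gres n (hadd A C) z"
    have g: "cmod z * cmod ?g \<le> 1 + n * (2 * B)"
    proof (rule gres_far[OF herm_hadd[OF herms] z n])
      fix i j assume "i < n" "j < n"
      thus "cmod (hadd A C i j) \<le> 2 * B"
        using norm_triangle_ineq[of "A i j" "C i j"] B(1,2)[of i j] by (simp add: hadd_def)
    qed (use B in simp)
    have "R * cmod ?g \<le> cmod z * cmod ?g" using zR by (intro mult_right_mono) auto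
    hence gR: "cmod ?g \<le> (1 + 2 * real n * B) / R" using g R by (simp add: pos_le_divide_eq mult_ac)
    \<comment> \<open>Uses \<open>R \<ge> 1\<close> together with
      \<open>|s| \<le> 1/2\<close>.\<close>
    have "R / 2 \<le> cmod (z + s)" using norm_diff_ineq[of z s] zR R s(2) by linarith
    hence "R / 2 * cmod s \<le> cmod (z + s) * cmod s" by (rule mult_right_mono) simp
    hence "R / 2 * cmod s \<le> cmod (z + s) * cmod (gres n C (z + s))" by (simp only: s(3)[symmetric])
    also have "\<dots> \<le> 1 + n * B" by (rule gres_far[OF herms(2) _ n B(2,3)]) (use z s in simp)
    also have "\<dots> \<le> 1 + 2 * real n * B" using nB by linarith
    finally have sR: "cmod s \<le> 2 * ((1 + 2 * real n * B) / R)" using R by (simp add: field_simps)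
    have "cmod (?g - s) \<le> cmod ?g + cmod s" by (rule norm_triangle_ineq4)
    also have "\<dots> \<le> 3 * ((1 + 2 * real n * B) / R)"
    proof -
      have "x + y \<le> 3 * w" if "x \<le> w" "y \<le> 2 * w" for x y w :: real using that by linarith
      from this[OF gR sR] show ?thesis .
    qed
    also have "\<dots> \<le> 4 / 3 * (e + 2 * h) + 3 * (1 + 2 * real n * B) / R" using e0 h by simp
    finally show ?thesis .
  qed
qed

lemma (in trunc_law) fX_tail_finite:
  assumes G: "finite G" "\<And>z. z \<in> G \<Longrightarrow> Im z \<ge> 2" and \<theta>: "\<theta> > 0" and t: "t > 0" and \<eta>: "\<eta> > 0"
    and s: "s \<ge> \<theta> * (15 * \<kappa>\<^sup>2 / p * (1 / n + 4 * \<kappa>\<^sup>2)) + (\<kappa> ^ 3 * n + \<kappa>\<^sup>2 * sqrt n + \<kappa>\<^sup>2 + 1 / n + \<epsilon> + \<eta>)"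
    and r: "\<epsilon> \<ge> 0"
  shows "measure N (\<Union>z\<in>G. {x \<in> space N. cmod (fX z x) \<ge> 2 * (s + t)}) \<le> card G *
    (4 * (exp (- \<theta> * t) / (\<theta> * t) + (1 + n * \<kappa>) * exp (\<theta> * 1) / t * (4 ^ n * exp (- \<eta>\<^sup>2 / (8 * \<kappa> ^ 4)))))"
proof -
  have D: "{x \<in> space N. cmod (fX z x) \<ge> 2 * (s + t)} \<in> sets N" for z using fX_measurable by measurable
  have "measure N (\<Union>z\<in>G. {x \<in> space N. cmod (fX z x) \<ge> 2 * (s + t)})
    \<le> (\<Sum>z\<in>G. measure N {x \<in> space N. cmod (fX z x) \<ge> 2 * (s + t)})"
    by (rule P.finite_measure_subadditive_finite[OF G(1)]) (use D in auto)
  also have "\<dots> \<le> of_nat (card G) * (4 * (exp (- \<theta> * t) / (\<theta> * t) + (1 + n * \<kappa>) * exp (\<theta> * 1) / t * (4 ^ n * exp (- \<eta>\<^sup>2 / (8 * \<kappa> ^ 4)))))"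
    by (rule sum_bounded_above) (rule fX_tail[OF G(2) \<theta> t \<eta> s r])
  finally show ?thesis by simp
qed

section \<open>Truncated moments of an entry\<close>

context prob_space
begin

definition trunc_prob :: "('a \<Rightarrow> complex) \<Rightarrow> real \<Rightarrow> real" where
  "trunc_prob Y K = expectation (\<lambda>\<omega>. if cmod (Y \<omega>) \<le> K then 1 else 0)"

text \<open>The conditional mean under the truncation, so that the truncated entry minus this mean,
  set to 0 outside the truncation, is exactly centred.\<close>

definition trunc_mean :: "('a \<Rightarrow> complex) \<Rightarrow> real \<Rightarrow> complex" where
  "trunc_mean Y K = expectation (\<lambda>\<omega>. if cmod (Y \<omega>) \<le> K then Y \<omega> else 0) / of_real (trunc_prob Y K)"

text \<open>Not divided by \<open>trunc_prob\<close>: up to the factor \<open>n\<close> this is the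
  second moment of an entry of \<open>A\<close>, which is 0 outside the truncation.\<close>

definition trunc_var :: "('a \<Rightarrow> complex) \<Rightarrow> real \<Rightarrow> real" where
  "trunc_var Y K = expectation (\<lambda>\<omega>. if cmod (Y \<omega>) \<le> K then (cmod (Y \<omega> - trunc_mean Y K))\<^sup>2 else 0)"

lemma trunc_mean_bound:
  assumes [measurable]: "random_variable borel Y" and K: "K \<ge> 0"
  shows "cmod (trunc_mean Y K) \<le> K"
proof -
  let ?J = "\<lambda>\<omega>. if cmod (Y \<omega>) \<le> K then Y \<omega> else 0"
  have "cmod (expectation ?J) \<le> expectation (\<lambda>\<omega>. cmod (?J \<omega>))" by (rule integral_norm_bound)
  also have "\<dots> \<le> expectation (\<lambda>\<omega>. K * (if cmod (Y \<omega>) \<le> K then 1 else 0))"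
  proof (rule integral_mono)
    show "integrable M (\<lambda>\<omega>. cmod (?J \<omega>))" by (rule integrable_const_bound[of _ K]) (use K in auto)
    show "integrable M (\<lambda>\<omega>. K * (if cmod (Y \<omega>) \<le> K then 1 else 0))" by (rule integrable_const_bound[of _ K]) (use K in auto)
  qed auto
  also have "\<dots> = K * trunc_prob Y K" by (simp add: trunc_prob_def)
  finally have le: "cmod (expectation ?J) \<le> K * trunc_prob Y K" .
  have p0: "trunc_prob Y K \<ge> 0" unfolding trunc_prob_def by (rule Bochner_Integration.integral_nonneg) auto
  show ?thesis
  proof (cases "trunc_prob Y K = 0")
    case False
    thus ?thesis using le p0 by (simp add: trunc_mean_def norm_divide pos_divide_le_eq)
  qed (use K in \<open>simp add: trunc_mean_def\<close>)
qed

lemma trunc_limits: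
  assumes Y[measurable]: "random_variable borel Y" and v: "expectation (\<lambda>\<omega>. (cmod (Y \<omega> - expectation Y))\<^sup>2) = 1"
  shows "(trunc_prob Y \<longlongrightarrow> 1) at_top" "(trunc_mean Y \<longlongrightarrow> expectation Y) at_top" "(trunc_var Y \<longlongrightarrow> 1) at_top"
proof -
  let ?D = "\<lambda>\<omega>. Y \<omega> - expectation Y"
  \<comment> \<open>A non-integrable function would have integral 0 and not 1.\<close>
  have i2: "integrable M (\<lambda>\<omega>. (cmod (?D \<omega>))\<^sup>2)" using v not_integrable_integral_eq by fastforce
  \<comment> \<open>Integrability of \<open>Y\<close> is deduced from that of the centred variable,
    so the argument is valid whatever default value \<open>expectation Y\<close> might have
    had.\<close>
  have "integrable M ?D"
  proof (rule Bochner_Integration.integrable_bound)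
    show "integrable M (\<lambda>\<omega>. 1 + (cmod (?D \<omega>))\<^sup>2)" using i2 by simp
    show "AE \<omega> in M. cmod (?D \<omega>) \<le> norm (1 + (cmod (?D \<omega>))\<^sup>2)"
    proof (rule AE_I2)
      fix \<omega>
      have "c \<le> norm (1 + c\<^sup>2)" if "0 \<le> c" for c :: real
      proof -
        have "0 \<le> (c - 1)\<^sup>2" by simp
        also have "\<dots> = c\<^sup>2 + 1 - 2 * c" by (simp add: power2_diff)
        finally show ?thesis using that by simp
      qed
      thus "cmod (?D \<omega>) \<le> norm (1 + (cmod (?D \<omega>))\<^sup>2)" by simp
    qed
  qed simp
  hence "integrable M (\<lambda>\<omega>. ?D \<omega> + expectation Y)" by (intro Bochner_Integration.integrable_add) auto
  hence iY: "integrable M Y" by simp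
  have ev: "eventually (\<lambda>K. cmod (Y \<omega>) \<le> K) at_top" for \<omega> by (rule eventually_ge_at_top)
  have "((\<lambda>K. expectation (\<lambda>\<omega>. if cmod (Y \<omega>) \<le> K then 1 else (0::real))) \<longlongrightarrow> expectation (\<lambda>_. 1)) at_top"
  proof (rule integral_dominated_convergence_at_top[where w = "\<lambda>_. 1"])
    show "AE \<omega> in M. ((\<lambda>K. if cmod (Y \<omega>) \<le> K then 1 else (0::real)) \<longlongrightarrow> 1) at_top"
      by (intro AE_I2 tendsto_eventually eventually_mono[OF ev]) simp
  qed (auto intro!: always_eventually)
  thus p: "(trunc_prob Y \<longlongrightarrow> 1) at_top" unfolding trunc_prob_def by (simp add: prob_space)
  have J: "((\<lambda>K. expectation (\<lambda>\<omega>. if cmod (Y \<omega>) \<le> K then Y \<omega> else 0)) \<longlongrightarrow> expectation Y) at_top"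
  proof (rule integral_dominated_convergence_at_top[where w = "\<lambda>\<omega>. cmod (Y \<omega>)"])
    show "AE \<omega> in M. ((\<lambda>K. if cmod (Y \<omega>) \<le> K then Y \<omega> else 0) \<longlongrightarrow> Y \<omega>) at_top"
    proof (intro AE_I2 tendsto_eventually)
      fix \<omega> show "eventually (\<lambda>K. (if cmod (Y \<omega>) \<le> K then Y \<omega> else 0) = Y \<omega>) at_top"
        by (rule eventually_mono[OF ev[of \<omega>]]) simp
    qed
  qed (use iY in \<open>auto intro!: always_eventually\<close>)
  have "((\<lambda>K. expectation (\<lambda>\<omega>. if cmod (Y \<omega>) \<le> K then Y \<omega> else 0) / of_real (trunc_prob Y K)) \<longlongrightarrow> expectation Y / of_real 1) at_top"
    by (intro tendsto_divide J tendsto_of_real p) simp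
  thus m: "(trunc_mean Y \<longlongrightarrow> expectation Y) at_top" unfolding trunc_mean_def by simp
  have "((\<lambda>K. expectation (\<lambda>\<omega>. if cmod (Y \<omega>) \<le> K then (cmod (Y \<omega> - trunc_mean Y K))\<^sup>2 else 0)) \<longlongrightarrow> expectation (\<lambda>\<omega>. (cmod (?D \<omega>))\<^sup>2)) at_top"
  proof (rule integral_dominated_convergence_at_top[where w = "\<lambda>\<omega>. 2 * (cmod (?D \<omega>))\<^sup>2 + 2"])
    show "AE \<omega> in M. ((\<lambda>K. if cmod (Y \<omega>) \<le> K then (cmod (Y \<omega> - trunc_mean Y K))\<^sup>2 else 0) \<longlongrightarrow> (cmod (?D \<omega>))\<^sup>2) at_top"
    proof (intro AE_I2)
      fix \<omega>
      have "((\<lambda>K. (cmod (Y \<omega> - trunc_mean Y K))\<^sup>2) \<longlongrightarrow> (cmod (?D \<omega>))\<^sup>2) at_top" by (intro tendsto_intros m)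
      thus "((\<lambda>K. if cmod (Y \<omega>) \<le> K then (cmod (Y \<omega> - trunc_mean Y K))\<^sup>2 else 0) \<longlongrightarrow> (cmod (?D \<omega>))\<^sup>2) at_top"
        by (rule Lim_transform_eventually) (rule eventually_mono[OF ev[of \<omega>]], simp)
    qed
    have "eventually (\<lambda>K. dist (trunc_mean Y K) (expectation Y) < 1) at_top" by (rule tendstoD[OF m]) simp
    thus "\<forall>\<^sub>F K in at_top. AE \<omega> in M. norm (if cmod (Y \<omega>) \<le> K then (cmod (Y \<omega> - trunc_mean Y K))\<^sup>2 else 0) \<le> 2 * (cmod (?D \<omega>))\<^sup>2 + 2"
    proof eventually_elim
      case (elim K)
      have "(cmod (Y \<omega> - trunc_mean Y K))\<^sup>2 \<le> 2 * (cmod (?D \<omega>))\<^sup>2 + 2" for \<omega>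
      proof -
        have "cmod (Y \<omega> - trunc_mean Y K) \<le> cmod (?D \<omega>) + 1"
          using elim norm_triangle_ineq[of "?D \<omega>" "expectation Y - trunc_mean Y K"] by (simp add: dist_norm norm_minus_commute)
        hence "(cmod (Y \<omega> - trunc_mean Y K))\<^sup>2 \<le> (cmod (?D \<omega>) + 1)\<^sup>2" by (intro power_mono) auto
        also have "\<dots> \<le> 2 * (cmod (?D \<omega>))\<^sup>2 + 2"
          using sum_squares_bound[of "cmod (?D \<omega>)" 1] by (simp add: power2_sum)
        finally show ?thesis .
      qed
      thus ?case by (intro AE_I2) auto
    qed
  qed (use i2 in auto)
  thus "(trunc_var Y \<longlongrightarrow> 1) at_top" unfolding trunc_var_def v .
qed

end

section \<open>The entries as coordinates of a product space\<close>

context wigner_entries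
begin

definition entry :: "nat \<times> nat \<Rightarrow> 'w \<Rightarrow> complex" where
  "entry e = X (Suc (fst e)) (Suc (snd e))"

text \<open>The point mass off the edges makes every \<open>law n e\<close> a probability measure,
  as the locale \<open>resample\<close> demands.\<close>

definition law :: "nat \<Rightarrow> nat \<times> nat \<Rightarrow> complex measure" where
  "law n e = (if e \<in> edges n then distr M borel (entry e) else return borel 0)"

definition sample :: "nat \<Rightarrow> 'w \<Rightarrow> nat \<times> nat \<Rightarrow> complex" where
  "sample n \<omega> = (\<lambda>e\<in>edges n. entry e \<omega>)"

lemma entry_measurable:
  assumes "e \<in> edges n"
  shows "random_variable borel (entry e)"
proof -
  have "\<forall>p\<in>{(i, j). 1 \<le> i \<and> i \<le> j}. random_variable borel ((\<lambda>(i, j). X i j) p)"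
    using indep unfolding indep_vars_def by simp
  from bspec[OF this, of "(Suc (fst e), Suc (snd e))"] show ?thesis
    using assms by (auto simp: entry_def edges_def)
qed

lemma sets_law: "sets (law n e) = sets borel" by (simp add: law_def)

lemma prob_law: "prob_space (law n e)"
  using entry_measurable[of e n] by (simp add: law_def prob_space_distr prob_space_return)

lemma law_cases:
  "i < j \<Longrightarrow> j < n \<Longrightarrow> law n (i, j) = distr M borel (X 1 2)" "i < n \<Longrightarrow> law n (i, i) = distr M borel (X 1 1)"
  using ident_offdiag[of "Suc i" "Suc j"] ident_diag[of "Suc i"] by (auto simp: law_def edges_def entry_def)

lemma sample_measurable: "sample n \<in> M \<rightarrow>\<^sub>M Pi\<^sub>M (edges n) (law n)"
  unfolding sample_def
proof (rule measurable_restrict)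
  fix e assume "e \<in> edges n"
  thus "entry e \<in> M \<rightarrow>\<^sub>M law n e" using entry_measurable[of e n] measurable_cong_sets[OF refl sets_law, of M n e] by simp
qed

text \<open>Independence is equality of the joint law with the product law; the map \<open>f\<close>
  transports it from pairs counted from 1 to edges counted from 0.\<close>

lemma distr_sample:
  assumes n: "n > 0"
  shows "distr M (Pi\<^sub>M (edges n) (law n)) (sample n) = Pi\<^sub>M (edges n) (law n)"
proof -
  define f :: "nat \<times> nat \<Rightarrow> nat \<times> nat" where "f e = (Suc (fst e), Suc (snd e))" for e
  define J where "J = f ` edges n"
  define X' where "X' = (\<lambda>p :: nat \<times> nat. X (fst p) (snd p))"
  have inj: "inj_on f (edges n)" by (auto simp: f_def inj_on_def prod_eq_iff)
  have fJ: "f \<in> edges n \<rightarrow> J" by (simp add: J_def)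
  have ne: "J \<noteq> {}" using n by (auto simp: J_def edges_def)
  have X'f: "X' (f e) = entry e" for e by (simp add: X'_def f_def entry_def)
  have J: "J \<subseteq> {(i, j). 1 \<le> i \<and> i \<le> j}" by (auto simp: J_def f_def edges_def)
  have X'm: "random_variable borel (X' i)" if "i \<in> J" for i
    using that entry_measurable X'f by (auto simp: J_def)
  have "indep_vars (\<lambda>_. borel) X' J"
    using indep_vars_subset[OF indep J] by (simp add: X'_def case_prod_beta')
  hence d: "distr M (\<Pi>\<^sub>M i\<in>J. borel) (\<lambda>x. \<lambda>i\<in>J. X' i x) = (\<Pi>\<^sub>M i\<in>J. distr M borel (X' i))"
    using indep_vars_iff_distr_eq_PiM'[OF ne X'm] by simp
  have s1: "sets (Pi\<^sub>M (edges n) (law n)) = sets (Pi\<^sub>M (edges n) (\<lambda>_. borel))" by (rule sets_PiM_cong) (auto simp: sets_law)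
  have P: "Pi\<^sub>M (edges n) (law n) = (\<Pi>\<^sub>M e\<in>edges n. distr M borel (X' (f e)))"
    by (rule PiM_cong) (auto simp: law_def X'f)
  have "(\<Pi>\<^sub>M e\<in>edges n. distr M borel (X' (f e))) = distr (\<Pi>\<^sub>M i\<in>J. distr M borel (X' i)) (\<Pi>\<^sub>M e\<in>edges n. distr M borel (X' (f e))) (\<lambda>\<omega>. \<lambda>e\<in>edges n. \<omega> (f e))"
    by (rule distr_PiM_reindex[symmetric, OF _ inj fJ]) (auto intro!: prob_space_distr X'm)
  also have "\<dots> = distr (distr M (\<Pi>\<^sub>M i\<in>J. borel) (\<lambda>x. \<lambda>i\<in>J. X' i x)) (Pi\<^sub>M (edges n) (\<lambda>_. borel)) (\<lambda>\<omega>. \<lambda>e\<in>edges n. \<omega> (f e))"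
    unfolding d by (rule distr_cong) (auto intro!: sets_PiM_cong)
  also have "\<dots> = distr M (Pi\<^sub>M (edges n) (\<lambda>_. borel)) ((\<lambda>\<omega>. \<lambda>e\<in>edges n. \<omega> (f e)) \<circ> (\<lambda>x. \<lambda>i\<in>J. X' i x))"
  proof (rule distr_distr)
    show "(\<lambda>\<omega>. \<lambda>e\<in>edges n. \<omega> (f e)) \<in> (\<Pi>\<^sub>M i\<in>J. borel) \<rightarrow>\<^sub>M Pi\<^sub>M (edges n) (\<lambda>_. borel)"
      using fJ by (intro measurable_restrict measurable_component_singleton) auto
    show "(\<lambda>x. \<lambda>i\<in>J. X' i x) \<in> M \<rightarrow>\<^sub>M (\<Pi>\<^sub>M i\<in>J. borel)" by (intro measurable_restrict X'm)
  qed
  also have "(\<lambda>\<omega>. \<lambda>e\<in>edges n. \<omega> (f e)) \<circ> (\<lambda>x. \<lambda>i\<in>J. X' i x) = sample n"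
    using fJ by (auto simp: fun_eq_iff sample_def X'f restrict_def)
  also have "distr M (Pi\<^sub>M (edges n) (\<lambda>_. borel)) (sample n) = distr M (Pi\<^sub>M (edges n) (law n)) (sample n)"
    by (rule distr_cong[OF refl s1[symmetric] refl])
  finally have F: "(\<Pi>\<^sub>M e\<in>edges n. distr M borel (X' (f e))) = distr M (Pi\<^sub>M (edges n) (law n)) (sample n)" .
  show ?thesis by (rule trans[OF F[symmetric] P[symmetric]])
qed

end


text \<open>The parts are \<open>\<delta> / 8\<close>, \<open>\<delta> / 4\<close> and
  \<open>\<delta> / 8\<close>. Ending at half of \<delta> gives a strict inequality for the supremum
  over \<open>z\<close>.\<close>

lemma comparison_budget:
  fixes v x y w \<delta> :: real
  assumes "v \<le> x + y" "x \<le> \<delta> / 8" "y \<le> 4 / 3 * (\<delta> / 8 + 2 * (\<delta> / 32)) + w" "w \<le> \<delta> / 8"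
  shows "v \<le> \<delta> / 2"
proof -
  have "4 / 3 * (\<delta> / 8 + 2 * (\<delta> / 32)) = \<delta> / 4" by (simp add: field_simps)
  thus ?thesis using assms by linarith
qed

section \<open>The exceptional events and their probabilities\<close>

context wigner_entries
begin

text \<open>There are two exceptional events in the product space: \<open>B1\<close>, where the
  entries above \<open>K\<close> are too heavy in total, bounded by Chernoff, and \<open>B2\<close>,
  where the defect is not small at some net point, bounded by \<open>fX_tail_finite\<close>. Outside
  both, the deterministic comparisons keep the distance at most \<open>\<delta> / 2\<close>.\<close>

lemma event_bound:
  fixes n m q :: nat and \<alpha> K \<delta> D c R \<kappa> \<theta> W :: real
  defines "mean \<equiv> trunc_mean (X 1 2) K"
  assumes n: "n > 0" and ln: "ln (real n) > 0" and \<alpha>: "0 < \<alpha>" "\<alpha> < 2" and \<delta>: "\<delta> > 0"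
    and K: "1 \<le> K" "K \<le> sqrt (real n) / ln (real n)" "sqrt (real n) / ln (real n) < sqrt (real n) * ln (real n)"
    and p: "trunc_prob (X 1 2) K > 0" and c: "c > 0"
    and D: "\<And>k. k \<in> {1, 2} \<Longrightarrow> integrable M (\<lambda>\<omega>. exp (2 * c * cmod (X 1 k \<omega>) powr \<alpha>))"
      "\<And>k. k \<in> {1, 2} \<Longrightarrow> expectation (\<lambda>\<omega>. exp (2 * c * cmod (X 1 k \<omega>) powr \<alpha>)) \<le> D"
    and R: "1 \<le> R" "R \<le> real m * (\<delta> / 32)" and \<kappa>: "\<kappa> = 2 * K / sqrt (real n)" and \<theta>: "\<theta> > 0" and q: "q > 0"
    and tail: "\<theta> * (15 * \<kappa>\<^sup>2 / trunc_prob (X 1 2) K * (1 / real n + 4 * \<kappa>\<^sup>2)) + (\<kappa> ^ 3 * real n + \<kappa>\<^sup>2 * sqrt (real n) + \<kappa>\<^sup>2 + 1 / real n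
      + \<bar>trunc_var (X 1 2) K - 1\<bar> + \<delta> / 64) \<le> \<delta> / 32"
    and comp: "W / (sqrt (real n) * ln (real n)) powr \<alpha> / real n
      + sqrt ((4 * ((sqrt (real n) / ln (real n)) powr (2 - \<alpha>) + (cmod mean)\<^sup>2) * W + real n * K\<^sup>2) / (real n)\<^sup>2) / 4
      + cmod mean / (2 * sqrt (real n)) * (sqrt (real q) + (1 / real q + 1 / real n) * sqrt (real q * real n)) \<le> \<delta> / 8"
    and far: "3 * (1 + 2 * real n * (2 * K + ln (real n))) / R \<le> \<delta> / 8"
  shows "prob {\<omega> \<in> space M. \<delta> \<le> stieltjes_dist (spectral_measure (wigner_scaled X n \<omega>))
                   (semicircle \<boxplus> spectral_measure (wigner_C X n \<omega>))}
    \<le> exp ((real n)\<^sup>2 * (D * exp (- c * K powr \<alpha>)) - c * W) + (2 * real m + 1) * (real m + 1) *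
      (4 * (exp (- \<theta> * (\<delta> / 32)) / (\<theta> * (\<delta> / 32)) + (1 + real n * \<kappa>) * exp (\<theta> * 1) / (\<delta> / 32) * (4 ^ n * exp (- (\<delta> / 64)\<^sup>2 / (8 * \<kappa> ^ 4)))))"
    (is "prob ?Ev \<le> _ + _ * ?tail")
proof -
  have sn: "sqrt (real n) > 0" "sqrt (real n) \<ge> 1" using n by auto
  have Ym: "random_variable borel (X 1 1)" "random_variable borel (X 1 2)"
    using entry_measurable[of "(0, 0)" 1] entry_measurable[of "(0, 1)" 2] by (auto simp: entry_def edges_def numeral_2_eq_2)
  note [measurable] = Ym Ym[unfolded One_nat_def]
  note One_nat_def[simp del]
  define S where "S = cball (0::complex) K"
  define a where "a u = (if u \<in> S then (u - mean) / of_real (sqrt (real n)) else 0)" for u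
  define cc where "cc u = (if sqrt (real n) / ln (real n) < cmod u \<and> cmod u < sqrt (real n) * ln (real n) then u / of_real (sqrt (real n)) else 0)" for u
  define g where "g u = (if cmod u > K then cmod u powr \<alpha> else 0)" for u :: complex
  have SK: "u \<in> S \<longleftrightarrow> cmod u \<le> K" for u by (simp add: S_def)
  have Sm[measurable]: "S \<in> sets borel" by (simp add: S_def)
  have am[measurable]: "a \<in> borel_measurable borel" unfolding a_def by measurable
  have ccm[measurable]: "cc \<in> borel_measurable borel" unfolding cc_def by measurable
  have gm[measurable]: "g \<in> borel_measurable borel" unfolding g_def by measurable
  have mean: "cmod mean \<le> K" unfolding mean_def using K by (intro trunc_mean_bound Ym) auto
  have tp: "trunc_prob (X 1 2) K = prob {\<omega> \<in> space M. cmod (X 1 2 \<omega>) \<le> K}"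
  proof -
    have "trunc_prob (X 1 2) K = expectation (indicator {\<omega> \<in> space M. cmod (X 1 2 \<omega>) \<le> K})"
      unfolding trunc_prob_def by (intro Bochner_Integration.integral_cong) (auto simp: indicator_def)
    moreover have "{\<omega> \<in> space M. cmod (X 1 2 \<omega>) \<le> K} \<inter> space M = {\<omega> \<in> space M. cmod (X 1 2 \<omega>) \<le> K}" by auto
    ultimately show ?thesis by simp
  qed
  have tl: "trunc_law n (law n) S a cc \<kappa> (trunc_prob (X 1 2) K) (trunc_var (X 1 2) K / n) \<bar>trunc_var (X 1 2) K - 1\<bar>"
  proof (intro trunc_law.intro resample.intro trunc_law_axioms.intro)
    show "finite (edges n)" by simp
    show "prob_space (law n e)" for e by (rule prob_law)
    show "cmod (a u) \<le> \<kappa>" for u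
    proof (cases "u \<in> S")
      case True
      hence "cmod (u - mean) \<le> 2 * K" using mean norm_triangle_ineq4[of u mean] by (simp add: SK)
      thus ?thesis using True sn by (simp add: a_def \<kappa> norm_divide divide_right_mono)
    qed (use K \<kappa> sn in \<open>simp add: a_def\<close>)
    show "cc u = 0" if "u \<in> S" for u using that K by (auto simp: cc_def SK)
    show "\<kappa> > 0" using K sn by (simp add: \<kappa>)
    fix i j assume ij: "i < j" "j < n"
    show "measure (law n (i, j)) S = trunc_prob (X 1 2) K"
      unfolding law_cases(1)[OF ij] tp by (subst measure_distr) (auto simp: SK intro!: arg_cong[where f = prob])
    have "(\<integral>u. a u \<partial>law n (i, j)) = expectation (\<lambda>\<omega>. a (X 1 2 \<omega>))"
      unfolding law_cases(1)[OF ij] by (rule integral_distr) measurable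
    also have "\<dots> = expectation (\<lambda>\<omega>. ((if cmod (X 1 2 \<omega>) \<le> K then X 1 2 \<omega> else 0) - mean * complex_of_real (if cmod (X 1 2 \<omega>) \<le> K then 1 else 0)) / of_real (sqrt (real n)))"
      by (intro Bochner_Integration.integral_cong) (auto simp: a_def SK)
    also have "\<dots> = (expectation (\<lambda>\<omega>. (if cmod (X 1 2 \<omega>) \<le> K then X 1 2 \<omega> else 0)) - expectation (\<lambda>\<omega>. mean * complex_of_real (if cmod (X 1 2 \<omega>) \<le> K then 1 else 0))) / of_real (sqrt (real n))"
    proof (subst integral_divide_zero, subst Bochner_Integration.integral_diff)
      show "integrable M (\<lambda>\<omega>. (if cmod (X 1 2 \<omega>) \<le> K then X 1 2 \<omega> else 0))"
        by (rule integrable_const_bound[of _ K]) (use K in auto)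
      show "integrable M (\<lambda>\<omega>. mean * complex_of_real (if cmod (X 1 2 \<omega>) \<le> K then 1 else 0))"
        by (rule integrable_const_bound[of _ "cmod mean"]) (auto simp: norm_mult)
    qed simp
    also have "expectation (\<lambda>\<omega>. mean * complex_of_real (if cmod (X 1 2 \<omega>) \<le> K then 1 else 0)) = mean * of_real (trunc_prob (X 1 2) K)"
      unfolding trunc_prob_def integral_mult_right_zero integral_complex_of_real ..
    also have "\<dots> = expectation (\<lambda>\<omega>. (if cmod (X 1 2 \<omega>) \<le> K then X 1 2 \<omega> else 0))"
      using p by (simp add: mean_def trunc_mean_def del: One_nat_def)
    finally show "(\<integral>u. a u \<partial>law n (i, j)) = 0" by simp
    have "(\<integral>u. (cmod (a u))\<^sup>2 \<partial>law n (i, j)) = expectation (\<lambda>\<omega>. (cmod (a (X 1 2 \<omega>)))\<^sup>2)"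
      unfolding law_cases(1)[OF ij] by (rule integral_distr) measurable
    also have "\<dots> = expectation (\<lambda>\<omega>. (if cmod (X 1 2 \<omega>) \<le> K then (cmod (X 1 2 \<omega> - mean))\<^sup>2 else 0) / real n)"
      by (intro Bochner_Integration.integral_cong) (auto simp: a_def SK norm_divide power_divide)
    finally show "(\<integral>u. (cmod (a u))\<^sup>2 \<partial>law n (i, j)) = trunc_var (X 1 2) K / real n"
      unfolding trunc_var_def mean_def integral_divide_zero .
  next
    have "trunc_var (X 1 2) K / real n - 1 / real n = (trunc_var (X 1 2) K - 1) / real n" by (simp add: diff_divide_distrib)
    thus "\<bar>trunc_var (X 1 2) K / real n - 1 / real n\<bar> \<le> \<bar>trunc_var (X 1 2) K - 1\<bar> / real n" by simp
  qed (use n p in \<open>auto simp: sets_law a_def\<close>)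
  then interpret T: trunc_law n "law n" S a cc \<kappa> "trunc_prob (X 1 2) K" "trunc_var (X 1 2) K / n" "\<bar>trunc_var (X 1 2) K - 1\<bar>" .
  let ?N = "Pi\<^sub>M (edges n) (law n)"
  \<comment> \<open>The mesh is \<open>\<delta> / 32\<close>, so rounding costs
    \<open>2 \<delta> / 32\<close> in the defect, next to the \<open>\<delta> / 8\<close> allowed by
    \<open>B2\<close>.\<close>
  define G where "G = (\<lambda>(k, l). Complex (\<delta> / 32 * of_int k) (2 + \<delta> / 32 * real l)) ` ({- int m..int m} \<times> {..m})"
  define B1 where "B1 = {x \<in> space ?N. (\<Sum>e\<in>edges n. g (x e)) \<ge> W}"
  define B2 where "B2 = (\<Union>z\<in>G. {x \<in> space ?N. cmod (T.fX z x) \<ge> 2 * (\<delta> / 32 + \<delta> / 32)})"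
  have fG: "finite G" by (simp add: G_def)
  have "card G \<le> card ({- int m..int m} \<times> {..m})" unfolding G_def by (intro card_image_le) auto
  also have "\<dots> = (2 * m + 1) * (m + 1)" by (simp add: card_cartesian_product nat_add_distrib nat_mult_distrib One_nat_def)
  finally have "real (card G) \<le> real ((2 * m + 1) * (m + 1))" by (rule of_nat_mono)
  hence cG: "real (card G) \<le> (2 * real m + 1) * (real m + 1)" by (simp add: algebra_simps)
  have t0: "?tail \<ge> 0" using \<theta> \<delta> K sn by (simp add: \<kappa>)
  have "measure ?N B2 \<le> card G * ?tail"
    unfolding B2_def
  proof (rule T.fX_tail_finite[OF fG])
    show "Im z \<ge> 2" if "z \<in> G" for z using that \<delta> by (auto simp: G_def)
  qed (use \<theta> \<delta> tail in auto)
  also have "\<dots> \<le> ((2 * real m + 1) * (real m + 1)) * ?tail" using cG t0 by (rule mult_right_mono)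
  finally have PB2: "measure ?N B2 \<le> (2 * real m + 1) * (real m + 1) * ?tail" .
  have PB1: "measure ?N B1 \<le> exp ((real n)\<^sup>2 * (D * exp (- c * K powr \<alpha>)) - c * W)"
  proof -
    define r where "r = D * exp (- c * K powr \<alpha>)"
    have mom: "integrable (law n e) (\<lambda>u. exp (c * g u)) \<and> (\<integral>u. exp (c * g u) \<partial>law n e) \<le> exp r" if e: "e \<in> edges n" for e
    proof -
      obtain i j where ij: "e = (i, j)" "i \<le> j" "j < n" using e by (auto simp: edges_def)
      obtain k where k: "k \<in> {1, 2}" "law n e = distr M borel (X 1 k)"
        using law_cases(1)[of i j n] law_cases(2)[of i n] ij by (cases "i = j") force+
      have [measurable]: "random_variable borel (X 1 k)" using k Ym by auto
      \<comment> \<open>Above \<open>K\<close> one factor \<open>exp(- c K^\<alpha>)\<close> is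
        gained by doubling the rate; this is why \<open>D\<close> bounds the moments at
        \<open>2 * c\<close>.\<close>
      let ?b = "\<lambda>\<omega>. 1 + exp (- c * K powr \<alpha>) * exp (2 * c * cmod (X 1 k \<omega>) powr \<alpha>)"
      have le: "exp (c * g (X 1 k \<omega>)) \<le> ?b \<omega>" for \<omega>
      proof (cases "cmod (X 1 k \<omega>) > K")
        case True
        hence "K powr \<alpha> \<le> cmod (X 1 k \<omega>) powr \<alpha>" using K \<alpha> by (intro powr_mono2) auto
        hence "c * K powr \<alpha> \<le> c * cmod (X 1 k \<omega>) powr \<alpha>" using c by (intro mult_left_mono) auto
        hence "exp (c * g (X 1 k \<omega>)) \<le> exp (- c * K powr \<alpha> + 2 * c * cmod (X 1 k \<omega>) powr \<alpha>)"
          using True by (simp add: g_def)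
        thus ?thesis unfolding exp_add by linarith
      next
        case False
        thus ?thesis by (simp add: g_def)
      qed
      have ib: "integrable M ?b" using D(1)[OF k(1)] by simp
      have ig: "integrable M (\<lambda>\<omega>. exp (c * g (X 1 k \<omega>)))"
      proof (rule Bochner_Integration.integrable_bound[OF ib])
        have gX[measurable]: "(\<lambda>\<omega>. g (X 1 k \<omega>)) \<in> borel_measurable M"
          by (rule measurable_compose[OF _ gm]) (use k Ym in auto)
        show "(\<lambda>\<omega>. exp (c * g (X 1 k \<omega>))) \<in> borel_measurable M" by measurable
        show "AE \<omega> in M. norm (exp (c * g (X 1 k \<omega>))) \<le> norm (?b \<omega>)"
        proof (rule AE_I2)
          fix \<omega>
          have "norm (exp (c * g (X 1 k \<omega>))) \<le> ?b \<omega>" using le[of \<omega>] by simp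
          also have "\<dots> \<le> norm (?b \<omega>)" unfolding real_norm_def by (rule abs_ge_self)
          finally show "norm (exp (c * g (X 1 k \<omega>))) \<le> norm (?b \<omega>)" .
        qed
      qed
      have "expectation (\<lambda>\<omega>. exp (c * g (X 1 k \<omega>))) \<le> expectation ?b" by (intro integral_mono ig ib le)
      also have "\<dots> = 1 + exp (- c * K powr \<alpha>) * expectation (\<lambda>\<omega>. exp (2 * c * cmod (X 1 k \<omega>) powr \<alpha>))"
        using D(1)[OF k(1)] by (simp add: prob_space)
      also have "\<dots> \<le> 1 + exp (- c * K powr \<alpha>) * D" using D(2)[OF k(1)] by (intro add_left_mono mult_left_mono) auto
      also have "\<dots> \<le> exp r" using exp_ge_add_one_self[of r] by (simp add: r_def mult.commute)
      finally have "expectation (\<lambda>\<omega>. exp (c * g (X 1 k \<omega>))) \<le> exp r" .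
      thus ?thesis using ig unfolding k(2) by (subst integrable_distr_eq) (auto simp: integral_distr)
    qed
    have "measure ?N B1 \<le> exp (card (edges n) * r - c * W)"
      unfolding B1_def by (rule T.chernoff) (use mom c gm in \<open>auto simp: T.measurable_mu\<close>)
    also have "\<dots> \<le> exp ((real n)\<^sup>2 * r - c * W)"
    proof -
      have "0 \<le> expectation (\<lambda>\<omega>. exp (2 * c * cmod (X 1 1 \<omega>) powr \<alpha>))" by (rule Bochner_Integration.integral_nonneg) simp
      hence "D \<ge> 0" by (rule order_trans) (rule D(2), simp)
      hence r: "r \<ge> 0" by (simp add: r_def)
      have "real (card (edges n)) \<le> real (n * n)" using card_edges by (rule of_nat_mono)
      hence "real (card (edges n)) * r \<le> (real n)\<^sup>2 * r" using r by (intro mult_right_mono) (auto simp: power2_eq_square)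
      thus ?thesis by simp
    qed
    finally show ?thesis by (simp add: r_def)
  qed
  have key: "stieltjes_dist (spectral_measure (wigner_scaled X n \<omega>)) (semicircle \<boxplus> spectral_measure (wigner_C X n \<omega>)) \<le> \<delta> / 2"
    if \<omega>: "\<omega> \<in> space M" and nB: "sample n \<omega> \<notin> B1 \<union> B2" for \<omega>
  proof -
    define x where "x = sample n \<omega>"
    define u where "u i j = X (Suc i) (Suc j) \<omega>" for i j
    define H where "H i j = u i j / complex_of_real (sqrt (real n))" for i j
    have xN: "x \<in> space ?N" unfolding x_def by (rule measurable_space[OF sample_measurable \<omega>])
    have xu: "x (i, j) = u i j" if "i \<le> j" "j < n" for i j
      using that by (simp add: x_def sample_def edges_def entry_def u_def)
    have uc: "u j i = cnj (u i j)" if "i < j" for i j using that \<omega> hermitian[of "Suc i" "Suc j" \<omega>] by (simp add: u_def)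
    have ur: "cnj (u i i) = u i i" for i using real_diag[of "Suc i" \<omega>] \<omega> by (simp add: u_def Reals_cnj_iff)
    have hH: "herm n H"
    proof (rule hermI)
      fix i j assume "i < n" "j < n"
      show "H j i = cnj (H i j)" using uc[of i j] uc[of j i] ur[of i] by (cases i j rule: linorder_cases) (auto simp: H_def)
    qed
    have WS: "wigner_scaled X n \<omega> = Matrix.mat n n (\<lambda>(i, j). H i j)" by (simp add: wigner_scaled_def H_def u_def)
    have ccu: "(if eps n * sqrt (real n) < cmod v \<and> cmod v < inverse (eps n) * sqrt (real n) then v / complex_of_real (sqrt (real n)) else 0) = cc v" for v
      by (simp add: cc_def eps_def mult.commute)
    have ccc: "cnj (cc v) = cc (cnj v)" for v by (simp add: cc_def)
    \<comment> \<open>The diagonal entries are real, so the \<open>Re\<close> in \<open>Cmat\<close>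
      has no effect on them.\<close>
    have Cu: "T.Cmat x i j = cc (u i j)" if "i < n" "j < n" for i j
    proof (cases i j rule: linorder_cases)
      case equal
      have "cnj (cc (u i i)) = cc (u i i)" by (simp add: ccc ur)
      hence "complex_of_real (Re (cc (u i i))) = cc (u i i)" by (simp add: complex_eq_iff)
      thus ?thesis using equal that by (simp add: T.Cmat_def xu)
    qed (use that uc[of j i] xu in \<open>auto simp: T.Cmat_def ccc\<close>)
    have WC: "wigner_C X n \<omega> = Matrix.mat n n (\<lambda>(i, j). T.Cmat x i j)"
      unfolding wigner_C_def Let_def ccu by (rule eq_matI) (auto simp: Cu u_def)
    let ?\<rho> = "semicircle \<boxplus> spectral_measure (Matrix.mat n n (\<lambda>(i, j). T.Cmat x i j))"
    note \<rho> = semicircle_free_conv_spectral[OF T.herm_Cmat[of x] n]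
    have "cmod (stieltjes (spectral_measure (Matrix.mat n n (\<lambda>(i, j). H i j))) z - stieltjes ?\<rho> z) \<le> \<delta> / 2" if z: "2 \<le> Im z" for z
    proof -
      let ?s = "stieltjes ?\<rho> z"
      have zp: "Im z > 0" using z by simp
      have s0: "Im ?s \<ge> 0" by (rule stieltjes_im[OF \<rho>(1,2) zp])
      have "1 / Im z \<le> 1 / 2" using z by (intro divide_left_mono) auto
      hence s1: "cmod ?s \<le> 1 / 2" using stieltjes_bound[OF \<rho>(1,2) zp] by linarith
      have sW: "(\<Sum>(i, j)\<in>edges n. if cmod (u i j) > K then cmod (u i j) powr \<alpha> else 0) \<le> W"
      proof -
        have "(\<Sum>e\<in>edges n. g (x e)) < W" using nB xN by (auto simp: B1_def x_def not_le)
        moreover have "(\<Sum>(i, j)\<in>edges n. if cmod (u i j) > K then cmod (u i j) powr \<alpha> else 0) = (\<Sum>e\<in>edges n. g (x e))"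
          by (intro sum.cong refl) (auto simp: g_def edges_def xu)
        ultimately show ?thesis by simp
      qed
      have 1: "cmod (gres n H z - gres n (hadd (T.Amat x) (T.Cmat x)) z) \<le> \<delta> / 8"
      proof (rule order_trans[OF _ comp])
        show "cmod (gres n H z - gres n (hadd (T.Amat x) (T.Cmat x)) z) \<le> W / (sqrt (real n) * ln (real n)) powr \<alpha> / real n
      + sqrt ((4 * ((sqrt (real n) / ln (real n)) powr (2 - \<alpha>) + (cmod mean)\<^sup>2) * W + real n * K\<^sup>2) / (real n)\<^sup>2) / 4
      + cmod mean / (2 * sqrt (real n)) * (sqrt (real q) + (1 / real q + 1 / real n) * sqrt (real q * real n))"
        proof (rule truncation_comparison[OF n z hH T.herm_Amat T.herm_Cmat q, where u = u])
          show "T.Amat x i j = (if cmod (u i j) \<le> K then (u i j - mean) / complex_of_real (sqrt (real n)) else 0)" if "i < j" "j < n" for i j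
            using that by (simp add: T.Amat_def xu a_def SK)
          show "T.Amat x i i = 0" for i by (simp add: T.Amat_def)
          show "T.Cmat x i j = (if sqrt (real n) / ln (real n) < cmod (u i j) \<and> cmod (u i j) < sqrt (real n) * ln (real n) then u i j / complex_of_real (sqrt (real n)) else 0)"
            if "i < j" "j < n" for i j using that Cu[of i j] by (simp add: cc_def)
          show "T.Cmat x i i = (if sqrt (real n) / ln (real n) < cmod (u i i) \<and> cmod (u i i) < sqrt (real n) * ln (real n) then u i i / complex_of_real (sqrt (real n)) else 0)"
            if "i < n" for i using that Cu[of i i] by (simp add: cc_def)
        qed (use K \<alpha> sW in \<open>auto simp: H_def\<close>)
      qed
      have 2: "cmod (gres n (hadd (T.Amat x) (T.Cmat x)) z - ?s) \<le> 4 / 3 * (\<delta> / 8 + 2 * (\<delta> / 32)) + 3 * (1 + 2 * real n * (2 * K + ln (real n))) / R"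
      proof (rule net_comparison[OF n T.herm_Amat T.herm_Cmat _ _ _ _ R _ z s0 s1])
        have "\<kappa> \<le> 2 * K" using sn K by (simp add: \<kappa> divide_le_eq mult_le_cancel_left1)
        thus "cmod (T.Amat x i j) \<le> 2 * K + ln (real n)" for i j using T.Amat_bound[of x i j] ln by linarith
        fix i j assume ij: "i < n" "j < n"
        have "cmod (cc v) \<le> ln (real n)" for v
          using ln sn by (auto simp: cc_def norm_divide divide_le_eq mult.commute)
        hence "cmod (T.Cmat x i j) \<le> ln (real n)" by (simp only: Cu[OF ij])
        thus "cmod (T.Cmat x i j) \<le> 2 * K + ln (real n)" using K(1) by linarith
      next
        fix k l assume "k \<in> {- int m..int m}" "l \<in> {..m}"
        hence "Complex (\<delta> / 32 * of_int k) (2 + \<delta> / 32 * real l) \<in> G" by (auto simp: G_def)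
        hence "\<not> 2 * (\<delta> / 32 + \<delta> / 32) \<le> cmod (T.fX (Complex (\<delta> / 32 * of_int k) (2 + \<delta> / 32 * real l)) x)"
          using nB xN unfolding B2_def x_def by blast
        thus "cmod (perr n (T.Amat x) (T.Cmat x) (Complex (\<delta> / 32 * of_int k) (2 + \<delta> / 32 * real l))) \<le> \<delta> / 8"
          by (simp add: T.fX_def)
      next
        show "?s = gres n (T.Cmat x) (z + ?s)" by (rule \<rho>(3)[OF zp])
      qed (use \<delta> K ln in auto)
      have "cmod (gres n H z - ?s) \<le> cmod (gres n H z - gres n (hadd (T.Amat x) (T.Cmat x)) z) + cmod (gres n (hadd (T.Amat x) (T.Cmat x)) z - ?s)"
        using norm_triangle_ineq[of "gres n H z - gres n (hadd (T.Amat x) (T.Cmat x)) z" "gres n (hadd (T.Amat x) (T.Cmat x)) z - ?s"] by simp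
      hence "cmod (gres n H z - ?s) \<le> \<delta> / 2" by (rule comparison_budget[OF _ 1 2 far])
      moreover have "stieltjes (spectral_measure (Matrix.mat n n (\<lambda>(i, j). H i j))) z = gres n H z"
        by (rule stieltjes_spectral_measure[OF hH n]) (use zp in simp)
      ultimately show ?thesis by simp
    qed
    moreover have "Complex 0 2 \<in> {z. 2 \<le> Im z}" by simp
    ultimately show ?thesis unfolding stieltjes_dist_def WS WC by (intro cSUP_least) blast+
  qed
  have B: "B1 \<in> sets ?N" "B2 \<in> sets ?N"
  proof -
    have [measurable]: "(\<lambda>x. g (x e)) \<in> borel_measurable ?N" if "e \<in> edges n" for e
      by (rule measurable_compose[OF T.coordinate_measurable[OF that] gm])
    show "B1 \<in> sets ?N" unfolding B1_def by measurable
    have "{x \<in> space ?N. cmod (T.fX z x) \<ge> 2 * (\<delta> / 32 + \<delta> / 32)} \<in> sets ?N" for z using T.fX_measurable by measurable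
    thus "B2 \<in> sets ?N" unfolding B2_def using fG by blast
  qed
  \<comment> \<open>An inclusion is enough: monotonicity asks for measurability of the larger set
    only, and a non-measurable event would have measure 0.\<close>
  have "prob ?Ev \<le> prob (sample n -` (B1 \<union> B2) \<inter> space M)"
  proof (rule finite_measure_mono)
    show "?Ev \<subseteq> sample n -` (B1 \<union> B2) \<inter> space M"
    proof (rule subsetI, rule ccontr)
      fix \<omega> assume "\<omega> \<in> ?Ev" "\<omega> \<notin> sample n -` (B1 \<union> B2) \<inter> space M"
      hence "\<delta> \<le> \<delta> / 2" using key[of \<omega>] by fastforce
      thus False using \<delta> by simp
    qed
    show "sample n -` (B1 \<union> B2) \<inter> space M \<in> sets M" by (rule measurable_sets[OF sample_measurable]) (use B in auto)
  qed
  also have "\<dots> = measure (distr M ?N (sample n)) (B1 \<union> B2)"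
    by (rule measure_distr[OF sample_measurable, symmetric]) (use B in auto)
  also have "\<dots> = measure ?N (B1 \<union> B2)" by (simp only: distr_sample[OF n])
  also have "\<dots> \<le> measure ?N B1 + measure ?N B2" using B by (rule measure_Un_le)
  finally show ?thesis using PB1 PB2 by linarith
qed

end


context wigner_entries
begin

text \<open>Chooses the parameters of \<open>event_bound\<close>:
  \<open>K = (log n)^(2/\<alpha>)\<close>, \<open>\<theta> = n^(1 + \<alpha>/2) log n\<close>,
  \<open>W = n^(1 + \<alpha>/2) (log n)^\<beta>\<close> and a net up to distance \<open>n^3\<close>.
  The extra logarithmic factors in \<theta> and \<open>W\<close> are what beats every multiple
  \<open>r\<close> of the speed.\<close>

lemma event_decay:
  fixes \<alpha> \<delta> r :: real
  assumes \<alpha>: "0 < \<alpha>" "\<alpha> < 2" and ab: "0 < a" "0 < b"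
    and tc: "tail_class M \<alpha> a (X 1 2)" "tail_class M \<alpha> b (X 1 1)" and \<delta>: "0 < \<delta>" and r: "0 < r"
  shows "eventually (\<lambda>n. prob {\<omega> \<in> space M. \<delta> \<le> stieltjes_dist (spectral_measure (wigner_scaled X n \<omega>))
                   (semicircle \<boxplus> spectral_measure (wigner_C X n \<omega>))} \<le> exp (- r * real n powr (1 + \<alpha> / 2))) sequentially"
proof -
  obtain c1 where c1: "c1 > 0" "integrable M (\<lambda>\<omega>. exp (c1 * cmod (X 1 1 \<omega>) powr \<alpha>))"
    using tail_class_exp_moment[OF prob_space_axioms \<alpha>(1) ab(2) tc(2)] by blast
  obtain c2 where c2: "c2 > 0" "integrable M (\<lambda>\<omega>. exp (c2 * cmod (X 1 2 \<omega>) powr \<alpha>))"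
    using tail_class_exp_moment[OF prob_space_axioms \<alpha>(1) ab(1) tc(1)] by blast
  have Ym: "random_variable borel (X 1 1)" "random_variable borel (X 1 2)" using tc by (auto simp: tail_class_def)
  note [measurable] = Ym Ym[unfolded One_nat_def]
  note One_nat_def[simp del]
  define c where "c = min c1 c2 / 2"
  have c: "c > 0" "2 * c \<le> c1" "2 * c \<le> c2" using c1 c2 by (auto simp: c_def)
  let ?mom = "\<lambda>k. expectation (\<lambda>\<omega>. exp (2 * c * cmod (X 1 k \<omega>) powr \<alpha>))"
  have I: "integrable M (\<lambda>\<omega>. exp (2 * c * cmod (X 1 k \<omega>) powr \<alpha>))" if "k \<in> {1, 2}" for k
  proof -
    have le: "norm (exp (2 * c * y)) \<le> norm (exp (c' * y))" if "2 * c \<le> c'" "0 \<le> y" for y c' :: real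
      using mult_right_mono[OF that] by simp
    have "integrable M (\<lambda>\<omega>. exp (2 * c * cmod (X 1 1 \<omega>) powr \<alpha>))"
      by (rule Bochner_Integration.integrable_bound[OF c1(2)]) (measurable, intro AE_I2 le c powr_ge_zero)
    moreover have "integrable M (\<lambda>\<omega>. exp (2 * c * cmod (X 1 2 \<omega>) powr \<alpha>))"
      by (rule Bochner_Integration.integrable_bound[OF c2(2)]) (measurable, intro AE_I2 le c powr_ge_zero)
    ultimately show ?thesis using that by auto
  qed
  define D where "D = max (max (?mom 1) (?mom 2)) 1"
  have D: "D > 0" "k \<in> {1, 2} \<Longrightarrow> ?mom k \<le> D" for k by (auto simp: D_def)
  define D0 where "D0 = cmod (expectation (X 1 2)) + 1"
  have D0: "D0 > 0" unfolding D0_def using norm_ge_zero[of "expectation (X 1 2)"] by linarith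
  \<comment> \<open>Any exponent strictly between 0 and both \<alpha> and
    \<open>2 - \<alpha>\<close> would do.\<close>
  define \<beta> where "\<beta> = min \<alpha> (2 - \<alpha>) / 2"
  have \<beta>: "0 < \<beta>" "\<beta> < \<alpha>" "\<beta> < 2 - \<alpha>" using \<alpha> by (auto simp: \<beta>_def)
  let ?K = "\<lambda>n. ln (real n) powr (2 / \<alpha>)"
  have Klim: "filterlim ?K at_top sequentially" using \<alpha> by real_asymp
  note lim = trunc_limits[OF Ym(2) variance]
  have v1: "eventually (\<lambda>n. trunc_prob (X 1 2) (?K n) > 1 / 2) sequentially"
    by (rule order_tendstoD(1)[OF filterlim_compose[OF lim(1) Klim]]) simp
  have v2: "eventually (\<lambda>n. dist (trunc_mean (X 1 2) (?K n)) (expectation (X 1 2)) < 1) sequentially"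
    by (rule tendstoD[OF filterlim_compose[OF lim(2) Klim]]) simp
  have v3: "eventually (\<lambda>n. dist (trunc_var (X 1 2) (?K n)) 1 < \<delta> / 256) sequentially"
    by (rule tendstoD[OF filterlim_compose[OF lim(3) Klim]]) (use \<delta> in simp)
  \<comment> \<open>The error budget. Three terms below \<open>\<delta> / 24\<close> make up
    \<open>\<delta> / 8\<close>; \<open>\<delta> / 512\<close> doubles to
    \<open>\<delta> / 256\<close> when \<open>1 / trunc_prob\<close> is replaced by 2; three terms
    below \<open>\<delta> / 256\<close> plus \<open>\<delta> / 64\<close> stay below
    \<open>\<delta> / 32\<close>. The three parts of the probability, multiplied by the exponential
    of the speed, get \<open>1 / 3\<close> each.\<close>
  have d: "0 < \<delta> / 512" "0 < \<delta> / 256" "0 < \<delta> / 24" "0 < \<delta> / 8" "(0::real) < 1 / 3" "0 < \<delta> / 32" "0 < \<delta> / 64" using \<delta> by auto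
  note cmp = asymp_comparison[OF \<alpha> \<beta> D0]
  show ?thesis
    using v1 v2 v3 order_tendstoD(2)[OF asymp_variance_terms(1)[OF \<alpha>] d(1)] order_tendstoD(2)[OF asymp_variance_terms(2)[OF \<alpha>] d(2)]
      order_tendstoD(2)[OF cmp(1) d(3)] order_tendstoD(2)[OF cmp(2) d(3)] order_tendstoD(2)[OF cmp(3) d(3)]
      order_tendstoD(2)[OF asymp_far[OF \<alpha>(1)] d(4)] asymp_params[OF \<alpha>(1)]
      order_tendstoD(2)[OF asymp_chernoff[OF \<alpha> \<beta>(1) D(1) c(1), of r] d(5)]
      order_tendstoD(2)[OF asymp_tail1[OF \<alpha> d(6) d(6) r] d(5)] order_tendstoD(2)[OF asymp_tail2[OF \<alpha> d(6) d(6) r d(7)] d(5)]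
      eventually_gt_at_top[of 2]
  proof eventually_elim
    case (elim n)
    define K l where "K = ?K n" and "l = ln (real n)"
    define P where "P = real n powr (1 + \<alpha> / 2)"
    define \<theta> W where "\<theta> = P * l" and "W = P * l powr \<beta>"
    define \<kappa> where "\<kappa> = 2 * K / sqrt (real n)"
    \<comment> \<open>The block length \<open>sqrt n\<close> balances the two terms
      \<open>sqrt q\<close> and \<open>sqrt (n / q)\<close> of \<open>remove_mean\<close>;
      \<open>m\<close> steps of the mesh reach the distance \<open>n^3\<close>.\<close>
    define q m where "q = nat \<lceil>sqrt (real n)\<rceil>" and "m = nat \<lceil>real n ^ 3 / (\<delta> / 32)\<rceil>"
    define tp mean tv where "tp = trunc_prob (X 1 2) K" and "mean = trunc_mean (X 1 2) K" and "tv = trunc_var (X 1 2) K"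
    note e = elim[folded K_def, folded l_def, folded P_def, folded \<theta>_def, folded W_def, folded \<kappa>_def, folded tp_def, folded mean_def, folded tv_def]
    have n: "n > 0" "real n \<ge> 1" "real n > 0" using e(14) by auto
    have sn: "sqrt (real n) > 0" "sqrt (real n) \<ge> 1" using n by auto
    have l1: "l > 1" using e(10) by blast
    have P0: "P > 0" using n by (simp add: P_def)
    have \<theta>0: "\<theta> > 0" and W0: "W > 0" using P0 l1 by (auto simp: \<theta>_def W_def)
    have K1: "K \<ge> 1" using e(10) by blast
    have qr: "sqrt (real n) \<le> real q" "real q \<le> sqrt (real n) + 1" unfolding q_def using sn by linarith+
    have "0 < real q" using qr(1) sn(1) by linarith
    hence q0: "q > 0" by simp
    have x0: "real n ^ 3 / (\<delta> / 32) \<ge> 0" using \<delta> by simp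
    have mr: "real n ^ 3 / (\<delta> / 32) \<le> real m" "real m \<le> real n ^ 3 / (\<delta> / 32) + 1" unfolding m_def using x0 by linarith+
    have mR: "real n ^ 3 \<le> real m * (\<delta> / 32)" using mr(1) d(6) by (simp only: pos_divide_le_eq)
    have tp: "tp > 1 / 2" using e(1) .
    have mean: "cmod mean \<le> D0"
    proof -
      have "cmod (mean - expectation (X 1 2)) < 1" using e(2) by (simp only: dist_norm)
      thus ?thesis unfolding D0_def using norm_triangle_sub[of mean "expectation (X 1 2)"] by linarith
    qed
    have \<kappa>2: "\<kappa>\<^sup>2 = 4 * K\<^sup>2 / real n" by (simp add: \<kappa>_def power_divide power_mult_distrib)
    have tail: "\<theta> * (15 * \<kappa>\<^sup>2 / tp * (1 / real n + 4 * \<kappa>\<^sup>2)) + (\<kappa> ^ 3 * real n + \<kappa>\<^sup>2 * sqrt (real n) + \<kappa>\<^sup>2 + 1 / real n + \<bar>tv - 1\<bar> + \<delta> / 64) \<le> \<delta> / 32"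
    proof -
      have "15 * \<kappa>\<^sup>2 / tp \<le> 15 * \<kappa>\<^sup>2 / (1 / 2)" using tp by (intro divide_left_mono) auto
      hence "\<theta> * (15 * \<kappa>\<^sup>2 / tp * (1 / real n + 4 * \<kappa>\<^sup>2)) \<le> \<theta> * (15 * \<kappa>\<^sup>2 / (1 / 2) * (1 / real n + 4 * \<kappa>\<^sup>2))"
        using \<theta>0 n by (intro mult_left_mono mult_right_mono) auto
      also have "\<dots> = 2 * (\<theta> * (60 * K\<^sup>2 / real n * (1 / real n + 16 * K\<^sup>2 / real n)))"
      proof -
        have "t * (15 * (4 * x / y) / (1 / 2) * (1 / y + 4 * (4 * x / y))) = 2 * (t * (60 * x / y * (1 / y + 16 * x / y)))" for t x y :: real
          by (simp add: algebra_simps)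
        thus ?thesis unfolding \<kappa>2 .
      qed
      also have "\<dots> \<le> \<delta> / 256" by (rule order_trans[OF mult_left_mono[OF less_imp_le[OF e(4)]]]) auto
      finally have 1: "\<theta> * (15 * \<kappa>\<^sup>2 / tp * (1 / real n + 4 * \<kappa>\<^sup>2)) \<le> \<delta> / 256" .
      have "\<bar>tv - 1\<bar> < \<delta> / 256" using e(3) by (simp only: dist_real_def)
      moreover have "t + (y + v + \<delta> / 64) \<le> \<delta> / 32" if "t \<le> \<delta> / 256" "y < \<delta> / 256" "v < \<delta> / 256" for t y v
        using that \<delta> by linarith
      ultimately show ?thesis using 1 e(5) by blast
    qed
    have comp: "W / (sqrt (real n) * ln (real n)) powr \<alpha> / real n
      + sqrt ((4 * ((sqrt (real n) / ln (real n)) powr (2 - \<alpha>) + (cmod mean)\<^sup>2) * W + real n * K\<^sup>2) / (real n)\<^sup>2) / 4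
      + cmod mean / (2 * sqrt (real n)) * (sqrt (real q) + (1 / real q + 1 / real n) * sqrt (real q * real n)) \<le> \<delta> / 8"
    proof -
      have s2: "sqrt ((4 * ((sqrt (real n) / l) powr (2 - \<alpha>) + (cmod mean)\<^sup>2) * W + real n * K\<^sup>2) / (real n)\<^sup>2) / 4
        \<le> sqrt ((4 * ((sqrt (real n) / l) powr (2 - \<alpha>) + D0\<^sup>2) * W + real n * K\<^sup>2) / (real n)\<^sup>2) / 4"
        using W0 mean by (intro divide_right_mono real_sqrt_le_mono add_right_mono mult_right_mono mult_left_mono add_left_mono power_mono) auto
      have s3: "cmod mean / (2 * sqrt (real n)) * (sqrt (real q) + (1 / real q + 1 / real n) * sqrt (real q * real n))
        \<le> D0 / (2 * sqrt (real n)) * (sqrt (sqrt (real n) + 1) + (1 / sqrt (real n) + 1 / real n) * sqrt ((sqrt (real n) + 1) * real n))"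
      proof (intro mult_mono divide_right_mono add_mono real_sqrt_le_mono order_refl)
        show "1 / real q \<le> 1 / sqrt (real n)" using qr(1) sn q0 by (intro divide_left_mono) auto
      qed (use qr sn mean D0 in auto)
      have gen: "x + y + w \<le> \<delta> / 8" if "x < \<delta> / 24" "y \<le> y'" "y' < \<delta> / 24" "w \<le> w'" "w' < \<delta> / 24" for x y w y' w'
        using that by linarith
      show ?thesis unfolding l_def[symmetric] by (rule gen[OF e(6) s2 e(7) s3 e(8)])
    qed
    \<comment> \<open>The reason for the exponent \<open>2 / \<alpha>\<close> in \<open>K\<close>:
      the gain per entry becomes \<open>exp(- c (log n)^2)\<close>, smaller than any power of
      \<open>n\<close>.\<close>
    have K\<alpha>: "K powr \<alpha> = l\<^sup>2" using \<alpha> l1 unfolding K_def l_def by (simp add: powr_powr powr_numeral)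
    let ?A = "exp ((real n)\<^sup>2 * (D * exp (- c * l\<^sup>2)) - c * W)"
    let ?B1 = "exp (- \<theta> * (\<delta> / 32)) / (\<theta> * (\<delta> / 32))"
    let ?B2 = "(1 + real n * \<kappa>) * exp (\<theta> * 1) / (\<delta> / 32) * (4 ^ n * exp (- (\<delta> / 64)\<^sup>2 / (8 * \<kappa> ^ 4)))"
    let ?Q = "(2 * (real n ^ 3 / (\<delta> / 32) + 1) + 1) * ((real n ^ 3 / (\<delta> / 32) + 1) + 1)"
    have "prob {\<omega> \<in> space M. \<delta> \<le> stieltjes_dist (spectral_measure (wigner_scaled X n \<omega>)) (semicircle \<boxplus> spectral_measure (wigner_C X n \<omega>))}
      \<le> exp ((real n)\<^sup>2 * (D * exp (- c * K powr \<alpha>)) - c * W) + (2 * real m + 1) * (real m + 1) * (4 * (?B1 + ?B2))"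
    proof (rule event_bound[where R = "real n ^ 3" and q = q, OF n(1) _ \<alpha> \<delta> _ _ _ _ c(1) I D(2)])
      show "1 \<le> real n ^ 3" using n by simp
      show "real n ^ 3 \<le> real m * (\<delta> / 32)" by (rule mR)
      show "\<kappa> = 2 * K / sqrt (real n)" by (rule \<kappa>_def)
      show "0 < trunc_prob (X 1 2) K" using tp by (simp add: tp_def)
      show "K \<le> sqrt (real n) / ln (real n)" "sqrt (real n) / ln (real n) < sqrt (real n) * ln (real n)"
        using e(10) unfolding l_def by blast+
      show "0 < ln (real n)" using l1 unfolding l_def by linarith
      show "3 * (1 + 2 * real n * (2 * K + ln (real n))) / real n ^ 3 \<le> \<delta> / 8" using e(9) unfolding l_def by (rule less_imp_le)
      show "1 \<le> K" "0 < \<theta>" "0 < q" by (rule K1 \<theta>0 q0)+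
      show "\<theta> * (15 * \<kappa>\<^sup>2 / trunc_prob (X 1 2) K * (1 / real n + 4 * \<kappa>\<^sup>2)) + (\<kappa> ^ 3 * real n + \<kappa>\<^sup>2 * sqrt (real n) + \<kappa>\<^sup>2 + 1 / real n
        + \<bar>trunc_var (X 1 2) K - 1\<bar> + \<delta> / 64) \<le> \<delta> / 32" by (rule tail[unfolded tp_def tv_def])
      show "W / (sqrt (real n) * ln (real n)) powr \<alpha> / real n
      + sqrt ((4 * ((sqrt (real n) / ln (real n)) powr (2 - \<alpha>) + (cmod (trunc_mean (X 1 2) K))\<^sup>2) * W + real n * K\<^sup>2) / (real n)\<^sup>2) / 4
      + cmod (trunc_mean (X 1 2) K) / (2 * sqrt (real n)) * (sqrt (real q) + (1 / real q + 1 / real n) * sqrt (real q * real n)) \<le> \<delta> / 8"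
        by (rule comp[unfolded mean_def])
    qed
    also have "\<dots> \<le> ?A + ?Q * (4 * (?B1 + ?B2))"
      unfolding K\<alpha>
    proof (intro add_left_mono mult_right_mono)
      show "(2 * real m + 1) * (real m + 1) \<le> ?Q" using mr x0 by (intro mult_mono) (linarith | auto)+
      have "\<kappa> \<ge> 0" using K1 by (simp add: \<kappa>_def)
      thus "0 \<le> 4 * (?B1 + ?B2)" using \<theta>0 \<delta> by simp
    qed
    finally have F: "prob {\<omega> \<in> space M. \<delta> \<le> stieltjes_dist (spectral_measure (wigner_scaled X n \<omega>)) (semicircle \<boxplus> spectral_measure (wigner_C X n \<omega>))}
      \<le> ?A + ?Q * (4 * (?B1 + ?B2))" .
    have "exp (r * P) * (?A + ?Q * (4 * (?B1 + ?B2))) = exp (r * P) * ?A + exp (r * P) * (?Q * (4 * ?B1)) + exp (r * P) * (?Q * (4 * ?B2))"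
    proof -
      have "x * (y + v * (4 * (s + t))) = x * y + x * (v * (4 * s)) + x * (v * (4 * t))" for x y v s t :: real
        by (simp add: algebra_simps)
      thus ?thesis .
    qed
    also have "\<dots> \<le> 1"
    proof -
      have "x + y + v \<le> 1" if "x < 1 / 3" "y < 1 / 3" "v < 1 / 3" for x y v :: real using that by linarith
      from this[OF e(11,12,13)] show ?thesis .
    qed
    finally have G: "exp (r * P) * (?A + ?Q * (4 * (?B1 + ?B2))) \<le> 1" .
    have "y \<le> exp (- r * P)" if "exp (r * P) * y \<le> 1" for y
      using that by (simp add: exp_minus field_simps)
    from order_trans[OF F this[OF G]] show ?case unfolding P_def .
  qed
qed

end

theorem proposition2p1:
  fixes M :: "'w measure" and X :: "nat \<Rightarrow> nat \<Rightarrow> 'w \<Rightarrow> complex"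
    and \<alpha> \<delta> :: real and a b :: ereal
  assumes "0 < \<alpha>" "\<alpha> < 2" and "0 < a" "0 < b"
    and "wigner_entries M X"
    and "tail_class M \<alpha> a (X 1 2)" and "tail_class M \<alpha> b (X 1 1)"
    and "0 < \<delta>"
  shows "limsup (\<lambda>n. ereal (1 / real n powr (1 + \<alpha> / 2)) *
           elog (measure M {\<omega> \<in> space M.
             \<delta> \<le> stieltjes_dist (spectral_measure (wigner_scaled X n \<omega>))
                   (semicircle \<boxplus> spectral_measure (wigner_C X n \<omega>))})) = - \<infinity>"
proof -
  interpret wigner_entries M X by fact
  let ?p = "\<lambda>n. prob {\<omega> \<in> space M. \<delta> \<le> stieltjes_dist (spectral_measure (wigner_scaled X n \<omega>)) (semicircle \<boxplus> spectral_measure (wigner_C X n \<omega>))}"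
  \<comment> \<open>It suffices to bound the upper limit by every real \<open>B\<close>; the rate is
    taken positive and at least \<open>- B\<close>.\<close>
  have "limsup (\<lambda>n. ereal (1 / real n powr (1 + \<alpha> / 2)) * elog (?p n)) \<le> ereal B" for B
  proof (rule Limsup_bounded)
    define r where "r = max 1 (- B)"
    have r: "r > 0" "- r \<le> B" by (auto simp: r_def)
    show "eventually (\<lambda>n. ereal (1 / real n powr (1 + \<alpha> / 2)) * elog (?p n) \<le> ereal B) sequentially"
      using event_decay[OF assms(1-4,6-8) r(1)] eventually_gt_at_top[of 0]
    proof eventually_elim
      case (elim n)
      have P: "real n powr (1 + \<alpha> / 2) > 0" using elim(2) by simp
      show ?case
      \<comment> \<open>A vanishing probability has \<open>elog\<close> equal to minus infinity,
        which is below every bound.\<close>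
      proof (cases "?p n = 0")
        case True
        thus ?thesis using P by (simp add: elog_def)
      next
        case False
        hence p: "?p n > 0" using measure_nonneg[of M] by (simp add: less_le)
        have "ln (?p n) \<le> ln (exp (- r * real n powr (1 + \<alpha> / 2)))" using elim(1) p by (subst ln_le_cancel_iff) auto
        hence "ln (?p n) \<le> - r * real n powr (1 + \<alpha> / 2)" by simp
        hence "ln (?p n) / real n powr (1 + \<alpha> / 2) \<le> - r" using P by (simp add: pos_divide_le_eq)
        thus ?thesis using False r(2) by (simp add: elog_def)
      qed
    qed
  qed
  thus ?thesis by (rule ereal_bot)
qed

end
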